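(* Let $N\ge 1$ be an integer, let $\Omega\subseteq\mathbb{R}^N$ be a bounded open set with smooth boundary, let $T>0$, and let $h\in L^\infty((0,T),L^2(\Omega))$. Let $b,c>0$, let $\lambda,\mu\in\mathbb{R}$, and let $0<\alpha<\beta$. Consider the quasilinear Kirchhoff equation $$u_{tt}-\Delta u-b\left(\int_\Omega|\nabla u|^2\,dx\right)^{\beta/2}\Delta u+c\left(\int_\Omega|u_t|^2\,dx\right)^{\alpha/2}u_t-\lambda u-\mu u_t=h$$ in $(0,T)\times\Omega$, or in $(0,+\infty)\times\Omega$ in statement (2) (where $h\equiv 0$), with homogeneous Dirichlet boundary conditions ($u=0$ on $\partial\Omega$). Then the following hold. (1) There exist two real numbers $\Gamma$ and $\Gamma_*$ (independent of the solution) such that every weak solution $u$ in $(0,T)$ satisfies $$\|u_t(t)\|_{L^2(\Omega)}^2+\|\nabla u(t)\|_{L^2(\Omega)}^{\beta+2}\le\Gamma\,t^{-1/\gamma}+\Gamma_*\qquad\forall t\in(0,T),$$ where $\gamma:=\min\left\{\frac{\alpha}{2},\frac{\beta-\alpha}{(\alpha+1)(\beta+2)}\right\}$. (2) If in addition $\mu=0$, $\lambda<\lambda_1(\Omega)$ (where $\lambda_1(\Omega)$ is the first eigenvalue of the Dirichlet Laplacian in $\Omega$), and $h\equiv 0$, then there exists a real number $D$ (independent of the solution) such that every weak solution $u$ in $(0,+\infty)$ satisfies $$\|u_t(t)\|_{L^2(\Omega)}^2+\|\nabla u(t)\|_{L^2(\Omega)}^2\le D\,t^{-2/\alpha}\qquad\forall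 t\ge 1.$$
   Context: "Smooth boundary" means regular enough to have the classical Sobolev imbeddings and $H^2$ regularity up to the boundary for the Dirichlet Laplacian. Set $V:=H^1_0(\Omega)$ and $H:=L^2(\Omega)$, with $V\subseteq H\subseteq V'=H^{-1}(\Omega)$ the usual Hilbert triple. No existence of solutions is asserted; the statements concern all solutions that exist. For $0<T<+\infty$, a weak solution in $(0,T)$ is a function $u\in C^0([0,T],V)\cap C^1([0,T],H)$ with $u_{tt}\in L^1((0,T),V')$ such that the equation holds in $V'$ for almost every $t\in(0,T)$ and such that the energy $$E_0(t):=\frac12\|u_t(t)\|_H^2+\frac12\|\nabla u(t)\|_{L^2(\Omega)}^2+\frac{b}{\beta+2}\|\nabla u(t)\|_{L^2(\Omega)}^{\beta+2}-\frac{\lambda}{2}\|u(t)\|_{L^2(\Omega)}^2$$ is absolutely continuous on $[0,T]$ and satisfies the energy identity $$E_0'(t)=-c\|u_t(t)\|_H^{\alpha+2}+\mu\|u_t(t)\|_H^2+\int_\Omega h(t,x)u_t(t,x)\,dx$$ for almost every $t\in(0,T)$. This includes all strong solutions, that is, functions $u\in W^{1,\infty}((0,T),V)\cap W^{2,1}((0,T),V')$ for which the equation holds as an equality in $L^1((0,T),V')$. A weak solution in $(0,+\infty)$ is a function whose restriction to $(0,T)$ is a weak solution in $(0,T)$ for every $T>0$. *)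

theory Defs
  imports "HOL-Analysis.Analysis"
begin

text \<open>
  Elements of \<open>L\<^sup>p(\<Omega>)\<close>, \<open>H\<^sup>1(\<Omega>)\<close>, \<open>H\<^sup>1\<^sub>0(\<Omega>)\<close>, ... are represented by functions on the whole
  space, of which only the values on \<open>\<Omega>\<close> matter, and these only up to a null set.  No quotient is
  taken: continuity, differentiability and measurability of maps into these spaces are expressed
  by means of the seminorms below.
\<close>

section \<open>Function spaces on an open set\<close>

definition Lp :: "'a::euclidean_space set \<Rightarrow> real \<Rightarrow> ('a \<Rightarrow> 'b::euclidean_space) set" where
  "Lp \<Omega> p = {f. f \<in> borel_measurable (lebesgue_on \<Omega>) \<and>
                 integrable (lebesgue_on \<Omega>) (\<lambda>x. norm (f x) powr p)}"

definition Lp_norm :: "'a::euclidean_space set \<Rightarrow> real \<Rightarrow> ('a \<Rightarrow> 'b::euclidean_space) \<Rightarrow> real" where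
  "Lp_norm \<Omega> p f = (LINT x|lebesgue_on \<Omega>. norm (f x) powr p) powr (1 / p)"

abbreviation L2_norm_on :: "'a::euclidean_space set \<Rightarrow> ('a \<Rightarrow> 'b::euclidean_space) \<Rightarrow> real" where
  "L2_norm_on \<Omega> f \<equiv> Lp_norm \<Omega> 2 f"

primrec Ck :: "nat \<Rightarrow> ('a::euclidean_space \<Rightarrow> real) \<Rightarrow> bool" where
  "Ck 0 f \<longleftrightarrow> continuous_on UNIV f"
| "Ck (Suc k) f \<longleftrightarrow> (\<forall>x. f differentiable (at x)) \<and>
     (\<forall>i\<in>Basis. Ck k (\<lambda>x. frechet_derivative f (at x) i))"

definition test_function :: "'a::euclidean_space set \<Rightarrow> ('a \<Rightarrow> real) \<Rightarrow> bool" where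
  "test_function \<Omega> \<phi> \<longleftrightarrow> (\<forall>k. Ck k \<phi>) \<and> (\<exists>K. compact K \<and> K \<subseteq> \<Omega> \<and> (\<forall>x. x \<notin> K \<longrightarrow> \<phi> x = 0))"

definition locally_integrable_on ::
    "'a::euclidean_space set \<Rightarrow> ('a \<Rightarrow> 'b::euclidean_space) \<Rightarrow> bool" where
  "locally_integrable_on \<Omega> f \<longleftrightarrow>
     (\<forall>K. compact K \<and> K \<subseteq> \<Omega> \<longrightarrow> integrable (lebesgue_on K) f)"

definition has_weak_gradient ::
    "'a::euclidean_space set \<Rightarrow> ('a \<Rightarrow> real) \<Rightarrow> ('a \<Rightarrow> 'a) \<Rightarrow> bool" where
  "has_weak_gradient \<Omega> w g \<longleftrightarrow> locally_integrable_on \<Omega> w \<and> locally_integrable_on \<Omega> g \<and>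
     (\<forall>\<phi>. test_function \<Omega> \<phi> \<longrightarrow> (\<forall>i\<in>Basis.
        (LINT x|lebesgue_on \<Omega>. w x * frechet_derivative \<phi> (at x) i) =
        - (LINT x|lebesgue_on \<Omega>. (g x \<bullet> i) * \<phi> x)))"

text \<open>The weak gradient is determined only almost everywhere on \<open>\<Omega>\<close>; any version is chosen.\<close>

definition weak_grad :: "'a::euclidean_space set \<Rightarrow> ('a \<Rightarrow> real) \<Rightarrow> 'a \<Rightarrow> 'a" where
  "weak_grad \<Omega> w = (SOME g. has_weak_gradient \<Omega> w g)"

definition W1p :: "'a::euclidean_space set \<Rightarrow> real \<Rightarrow> ('a \<Rightarrow> real) set" where
  "W1p \<Omega> p = {w \<in> Lp \<Omega> p. \<exists>g \<in> Lp \<Omega> p. has_weak_gradient \<Omega> w g}"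

definition W1p_norm :: "'a::euclidean_space set \<Rightarrow> real \<Rightarrow> ('a \<Rightarrow> real) \<Rightarrow> real" where
  "W1p_norm \<Omega> p w =
     (Lp_norm \<Omega> p w powr p + Lp_norm \<Omega> p (weak_grad \<Omega> w) powr p) powr (1 / p)"

abbreviation H1 :: "'a::euclidean_space set \<Rightarrow> ('a \<Rightarrow> real) set" where
  "H1 \<Omega> \<equiv> W1p \<Omega> 2"

abbreviation H1_norm :: "'a::euclidean_space set \<Rightarrow> ('a \<Rightarrow> real) \<Rightarrow> real" where
  "H1_norm \<Omega> w \<equiv> W1p_norm \<Omega> 2 w"

definition H2 :: "'a::euclidean_space set \<Rightarrow> ('a \<Rightarrow> real) set" where
  "H2 \<Omega> = {w \<in> H1 \<Omega>. \<forall>i\<in>Basis. (\<lambda>x. weak_grad \<Omega> w x \<bullet> i) \<in> H1 \<Omega>}"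

definition H10 :: "'a::euclidean_space set \<Rightarrow> ('a \<Rightarrow> real) set" where
  "H10 \<Omega> = {w \<in> H1 \<Omega>. \<exists>\<phi>. (\<forall>n::nat. test_function \<Omega> (\<phi> n)) \<and>
                (\<lambda>n. H1_norm \<Omega> (\<lambda>x. \<phi> n x - w x)) \<longlonglongrightarrow> 0}"

section \<open>The dual space and the Dirichlet Laplacian\<close>

text \<open>
  A bounded functional on \<open>H\<^sup>1\<^sub>0(\<Omega>)\<close> automatically takes equal values on functions that agree
  almost everywhere on \<open>\<Omega>\<close>.
\<close>

definition Hm1 :: "'a::euclidean_space set \<Rightarrow> (('a \<Rightarrow> real) \<Rightarrow> real) set" where
  "Hm1 \<Omega> = {l. (\<forall>v\<in>H10 \<Omega>. \<forall>w\<in>H10 \<Omega>. l (\<lambda>x. v x + w x) = l v + l w) \<and>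
               (\<forall>r. \<forall>v\<in>H10 \<Omega>. l (\<lambda>x. r * v x) = r * l v) \<and>
               (\<exists>C. \<forall>v\<in>H10 \<Omega>. \<bar>l v\<bar> \<le> C * H1_norm \<Omega> v)}"

definition Hm1_norm :: "'a::euclidean_space set \<Rightarrow> (('a \<Rightarrow> real) \<Rightarrow> real) \<Rightarrow> real" where
  "Hm1_norm \<Omega> l = (SUP v\<in>{v\<in>H10 \<Omega>. H1_norm \<Omega> v \<le> 1}. \<bar>l v\<bar>)"

text \<open>The embedding of \<open>L\<^sup>2(\<Omega>)\<close> into \<open>H\<^sup>-\<^sup>1(\<Omega>)\<close>, and \<open>-\<Delta>\<close> as a map from \<open>H\<^sup>1\<^sub>0(\<Omega>)\<close> to \<open>H\<^sup>-\<^sup>1(\<Omega>)\<close>.\<close>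

definition L2_pair :: "'a::euclidean_space set \<Rightarrow> ('a \<Rightarrow> real) \<Rightarrow> ('a \<Rightarrow> real) \<Rightarrow> real" where
  "L2_pair \<Omega> f v = (LINT x|lebesgue_on \<Omega>. f x * v x)"

definition neg_laplacian :: "'a::euclidean_space set \<Rightarrow> ('a \<Rightarrow> real) \<Rightarrow> ('a \<Rightarrow> real) \<Rightarrow> real" where
  "neg_laplacian \<Omega> w v = (LINT x|lebesgue_on \<Omega>. weak_grad \<Omega> w x \<bullet> weak_grad \<Omega> v x)"

definition dirichlet_eigenvalue :: "'a::euclidean_space set \<Rightarrow> real \<Rightarrow> bool" where
  "dirichlet_eigenvalue \<Omega> k \<longleftrightarrow>
     (\<exists>w\<in>H10 \<Omega>. \<not> (AE x in lebesgue_on \<Omega>. w x = 0) \<and>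
        (\<forall>v\<in>H10 \<Omega>. neg_laplacian \<Omega> w v = k * L2_pair \<Omega> w v))"

definition first_dirichlet_eigenvalue :: "'a::euclidean_space set \<Rightarrow> real" where
  "first_dirichlet_eigenvalue \<Omega> = (LEAST k. dirichlet_eigenvalue \<Omega> k)"

section \<open>Smooth boundary\<close>

text \<open>
  Here ``smooth boundary'' is not a condition on local charts: it means regular enough for the
  classical Sobolev imbeddings of \<open>W\<^sup>1\<^sup>,\<^sup>p(\<Omega>)\<close> (subcritical and critical exponents, the
  borderline case \<open>p = N\<close>, and \<open>p > N\<close>) and for the \<open>H\<^sup>2\<close> regularity up to the boundary of the
  Dirichlet problem for the Laplacian.
\<close>

definition sobolev_imbeddings :: "'a::euclidean_space set \<Rightarrow> bool" where
  "sobolev_imbeddings \<Omega> \<longleftrightarrow>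
     (let N = real DIM('a) in
       (\<forall>p q. 1 \<le> p \<and> p \<le> q \<and> (p < N \<and> q \<le> N * p / (N - p) \<or> p = N) \<longrightarrow>
          (\<exists>C. \<forall>w\<in>W1p \<Omega> p. w \<in> Lp \<Omega> q \<and> Lp_norm \<Omega> q w \<le> C * W1p_norm \<Omega> p w)) \<and>
       (\<forall>p>N. \<exists>C. \<forall>w\<in>W1p \<Omega> p. \<exists>v. continuous_on \<Omega> v \<and>
          (AE x in lebesgue_on \<Omega>. w x = v x) \<and> (\<forall>x\<in>\<Omega>. \<bar>v x\<bar> \<le> C * W1p_norm \<Omega> p w)))"

definition H2_regularity :: "'a::euclidean_space set \<Rightarrow> bool" where
  "H2_regularity \<Omega> \<longleftrightarrow>
     (\<forall>f\<in>Lp \<Omega> 2. \<forall>w\<in>H10 \<Omega>.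
        (\<forall>v\<in>H10 \<Omega>. neg_laplacian \<Omega> w v = L2_pair \<Omega> f v) \<longrightarrow> w \<in> H2 \<Omega>)"

definition smooth_boundary :: "'a::euclidean_space set \<Rightarrow> bool" where
  "smooth_boundary \<Omega> \<longleftrightarrow> sobolev_imbeddings \<Omega> \<and> H2_regularity \<Omega>"

section \<open>Functions of time with values in a space of functions\<close>

text \<open>
  In the following, a set \<open>X\<close> of real-valued functions and a seminorm \<open>\<nu>\<close> stand for the normed
  space of values.
\<close>

definition continuous_into ::
    "real set \<Rightarrow> ('d \<Rightarrow> real) set \<Rightarrow> (('d \<Rightarrow> real) \<Rightarrow> real) \<Rightarrow> (real \<Rightarrow> 'd \<Rightarrow> real) \<Rightarrow> bool" where
  "continuous_into I X \<nu> f \<longleftrightarrow> (\<forall>t\<in>I. f t \<in> X) \<and>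
     (\<forall>t\<in>I. ((\<lambda>s. \<nu> (\<lambda>x. f s x - f t x)) \<longlongrightarrow> 0) (at t within I))"

definition has_derivative_into ::
    "real set \<Rightarrow> (('d \<Rightarrow> real) \<Rightarrow> real) \<Rightarrow> (real \<Rightarrow> 'd \<Rightarrow> real) \<Rightarrow> (real \<Rightarrow> 'd \<Rightarrow> real) \<Rightarrow> bool" where
  "has_derivative_into I \<nu> f f' \<longleftrightarrow>
     (\<forall>t\<in>I. ((\<lambda>s. \<nu> (\<lambda>x. (f s x - f t x) / (s - t) - f' t x)) \<longlongrightarrow> 0) (at t within I))"

text \<open>Bochner (strong) measurability: almost everywhere limit of simple functions.\<close>

definition bochner_measurable ::
    "real measure \<Rightarrow> ('d \<Rightarrow> real) set \<Rightarrow> (('d \<Rightarrow> real) \<Rightarrow> real) \<Rightarrow> (real \<Rightarrow> 'd \<Rightarrow> real) \<Rightarrow> bool" where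
  "bochner_measurable M X \<nu> f \<longleftrightarrow> (AE t in M. f t \<in> X) \<and>
     (\<exists>s. (\<forall>n::nat. simple_function M (s n) \<and> s n ` space M \<subseteq> X) \<and>
          (AE t in M. (\<lambda>n. \<nu> (\<lambda>x. s n t x - f t x)) \<longlonglongrightarrow> 0))"

definition bochner_L1 ::
    "real measure \<Rightarrow> ('d \<Rightarrow> real) set \<Rightarrow> (('d \<Rightarrow> real) \<Rightarrow> real) \<Rightarrow> (real \<Rightarrow> 'd \<Rightarrow> real) \<Rightarrow> bool" where
  "bochner_L1 M X \<nu> f \<longleftrightarrow> bochner_measurable M X \<nu> f \<and> integrable M (\<lambda>t. \<nu> (f t))"

definition bochner_Linf ::
    "real measure \<Rightarrow> ('d \<Rightarrow> real) set \<Rightarrow> (('d \<Rightarrow> real) \<Rightarrow> real) \<Rightarrow> (real \<Rightarrow> 'd \<Rightarrow> real) \<Rightarrow> bool" where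
  "bochner_Linf M X \<nu> f \<longleftrightarrow> bochner_measurable M X \<nu> f \<and> (\<exists>C. AE t in M. \<nu> (f t) \<le> C)"

text \<open>
  \<open>\<zeta>\<close> is the derivative of \<open>f\<close> in the sense of \<open>H\<^sup>-\<^sup>1(\<Omega>)\<close>-valued distributions on \<open>(0,T)\<close>, where
  \<open>f\<close> takes values in \<open>L\<^sup>2(\<Omega>)\<close>; the identity in \<open>H\<^sup>-\<^sup>1(\<Omega>)\<close> is evaluated at each \<open>v\<close>.
\<close>

definition distributional_derivative_Hm1 ::
    "'a::euclidean_space set \<Rightarrow> real \<Rightarrow> (real \<Rightarrow> 'a \<Rightarrow> real) \<Rightarrow> (real \<Rightarrow> ('a \<Rightarrow> real) \<Rightarrow> real) \<Rightarrow> bool"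
  where
  "distributional_derivative_Hm1 \<Omega> T f \<zeta> \<longleftrightarrow>
     (\<forall>\<phi>. test_function {0<..<T} \<phi> \<longrightarrow> (\<forall>v\<in>H10 \<Omega>.
        (LINT t|lebesgue_on {0<..<T}. deriv \<phi> t * L2_pair \<Omega> (f t) v) =
        - (LINT t|lebesgue_on {0<..<T}. \<phi> t * \<zeta> t v)))"

definition abs_continuous_on_interval :: "real \<Rightarrow> real \<Rightarrow> (real \<Rightarrow> real) \<Rightarrow> bool" where
  "abs_continuous_on_interval a b f \<longleftrightarrow>
     (\<forall>\<epsilon>>0. \<exists>\<delta>>0. \<forall>D. finite D \<and> (\<forall>(x, y)\<in>D. a \<le> x \<and> x \<le> y \<and> y \<le> b) \<and>
        disjoint_family_on (\<lambda>(x, y). {x<..<y}) D \<and> (\<Sum>(x, y)\<in>D. y - x) < \<delta> \<longrightarrow>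
        (\<Sum>(x, y)\<in>D. \<bar>f y - f x\<bar>) < \<epsilon>)"

section \<open>Weak solutions of the Kirchhoff equation\<close>

definition energy0 ::
    "'a::euclidean_space set \<Rightarrow> real \<Rightarrow> real \<Rightarrow> real \<Rightarrow>
     (real \<Rightarrow> 'a \<Rightarrow> real) \<Rightarrow> (real \<Rightarrow> 'a \<Rightarrow> real) \<Rightarrow> real \<Rightarrow> real" where
  "energy0 \<Omega> b \<beta> lam u ut t =
     1 / 2 * L2_norm_on \<Omega> (ut t) ^ 2
     + 1 / 2 * L2_norm_on \<Omega> (weak_grad \<Omega> (u t)) ^ 2
     + b / (\<beta> + 2) * L2_norm_on \<Omega> (weak_grad \<Omega> (u t)) powr (\<beta> + 2)
     - lam / 2 * L2_norm_on \<Omega> (u t) ^ 2"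

text \<open>
  \<open>ut\<close> is the time derivative of \<open>u\<close>, which is determined by \<open>u\<close> up to null sets of \<open>\<Omega>\<close>, and \<open>utt\<close>
  is its distributional time derivative.
\<close>

definition weak_solution ::
    "'a::euclidean_space set \<Rightarrow> real \<Rightarrow> real \<Rightarrow> real \<Rightarrow> real \<Rightarrow> real \<Rightarrow> real \<Rightarrow>
     (real \<Rightarrow> 'a \<Rightarrow> real) \<Rightarrow> real \<Rightarrow> (real \<Rightarrow> 'a \<Rightarrow> real) \<Rightarrow> (real \<Rightarrow> 'a \<Rightarrow> real) \<Rightarrow> bool" where
  "weak_solution \<Omega> b c \<alpha> \<beta> lam mu h T u ut \<longleftrightarrow>
     continuous_into {0..T} (H10 \<Omega>) (H1_norm \<Omega>) u \<and>
     has_derivative_into {0..T} (Lp_norm \<Omega> 2) u ut \<and>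
     continuous_into {0..T} (Lp \<Omega> 2) (Lp_norm \<Omega> 2) ut \<and>
     (\<exists>utt. bochner_L1 (lebesgue_on {0<..<T}) (Hm1 \<Omega>) (Hm1_norm \<Omega>) utt \<and>
        distributional_derivative_Hm1 \<Omega> T ut utt \<and>
        (AE t in lebesgue_on {0<..<T}. \<forall>v\<in>H10 \<Omega>.
           utt t v
           + neg_laplacian \<Omega> (u t) v
           + b * (LINT x|lebesgue_on \<Omega>. norm (weak_grad \<Omega> (u t) x) ^ 2) powr (\<beta> / 2)
               * neg_laplacian \<Omega> (u t) v
           + c * (LINT x|lebesgue_on \<Omega>. \<bar>ut t x\<bar> ^ 2) powr (\<alpha> / 2) * L2_pair \<Omega> (ut t) v
           - lam * L2_pair \<Omega> (u t) v
           - mu * L2_pair \<Omega> (ut t) v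
           = L2_pair \<Omega> (h t) v)) \<and>
     abs_continuous_on_interval 0 T (energy0 \<Omega> b \<beta> lam u ut) \<and>
     (AE t in lebesgue_on {0<..<T}.
        (energy0 \<Omega> b \<beta> lam u ut has_real_derivative
           - c * L2_norm_on \<Omega> (ut t) powr (\<alpha> + 2)
           + mu * L2_norm_on \<Omega> (ut t) ^ 2
           + (LINT x|lebesgue_on \<Omega>. h t x * ut t x)) (at t))"

definition global_weak_solution ::
    "'a::euclidean_space set \<Rightarrow> real \<Rightarrow> real \<Rightarrow> real \<Rightarrow> real \<Rightarrow> real \<Rightarrow> real \<Rightarrow>
     (real \<Rightarrow> 'a \<Rightarrow> real) \<Rightarrow> (real \<Rightarrow> 'a \<Rightarrow> real) \<Rightarrow> (real \<Rightarrow> 'a \<Rightarrow> real) \<Rightarrow> bool" where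
  "global_weak_solution \<Omega> b c \<alpha> \<beta> lam mu h u ut \<longleftrightarrow>
     (\<forall>T>0. weak_solution \<Omega> b c \<alpha> \<beta> lam mu h T u ut)"

end

theory Submission
  imports Defs "HOL-Complex_Analysis.Great_Picard"
begin

text \<open>
  Up to an additive constant the energy \<open>e\<close> bounds \<open>\<parallel>u\<^sub>t\<parallel>\<^sup>2 + \<parallel>\<nabla>u\<parallel>\<^bsup>\<beta>+2\<^esup>\<close>, but it is dissipated only through
  \<open>u\<^sub>t\<close>.  One therefore adds the corrector \<open>\<epsilon> e\<^sup>\<gamma> (u\<^sub>t, u)\<close>, whose derivative contains
  \<open>- \<epsilon> e\<^sup>\<gamma> \<parallel>\<nabla>u\<parallel>\<^bsup>\<beta>+2\<^esup>\<close>.  The two bounds on \<open>\<gamma>\<close> are exactly those for which Young's inequality absorbs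
  the bad terms \<open>e\<^sup>\<gamma> \<parallel>u\<^sub>t\<parallel>\<^sup>2\<close> and \<open>e\<^sup>\<gamma> \<parallel>u\<^sub>t\<parallel>\<^bsup>\<alpha>+1\<^esup> \<parallel>\<nabla>u\<parallel>\<close> into the damping, and the modified energy \<open>\<Phi>\<close>
  satisfies \<open>\<Phi>' \<le> - k \<Phi>\<^bsup>1+\<gamma>\<^esup> + C\<close> almost everywhere.  Comparison with the barrier
  \<open>\<Gamma> t\<^bsup>-1/\<gamma>\<^esup> + \<Gamma>\<^sub>s\<close>, which is infinite at \<open>0\<close>, gives a bound that does not depend on the initial data.
  If \<open>\<mu> = 0\<close>, \<open>h = 0\<close> and \<open>\<lambda>\<close> lies below the first eigenvalue, then the energy is coercive and nonincreasing,
  and bounded from time \<open>1\<close> on by the universal bound; the corrector \<open>\<epsilon> e\<^bsup>\<alpha>/2\<^esup> (u\<^sub>t, u)\<close> then gives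
  \<open>\<Phi>' \<le> - k \<Phi>\<^bsup>1+\<alpha>/2\<^esup>\<close>.  Coercivity needs that the least Dirichlet eigenvalue exists and is the minimum of
  the Rayleigh quotient, which follows from Rellich's compactness theorem.
\<close>

section \<open>Square-integrable functions on a measure space\<close>

text \<open>The two limits on \<gamma> arise as follows, with e bounding V^2 and A^(\<beta>+2),
  where V is the norm of u_t and A that of the gradient of u. Young's inequality turns e^\<gamma>
  V^2 into e^(1+\<gamma>) and V^(2\<gamma>+2), and the latter is at most V^(\<alpha>+2) + 1 if
  2\<gamma> is at most \<alpha>. It turns e^\<gamma> V^(\<alpha>+1) A into V^(\<alpha>+2) and a
  power of e with exponent (\<gamma> + 1/(\<beta>+2))(\<alpha>+2), which is at most 1+\<gamma>
  exactly if \<gamma> (\<alpha>+1)(\<beta>+2) is at most \<beta>-\<alpha>. The obstacle is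
  regularity: u_t takes values only in L2 and u_tt only in the dual space, so no product rule for
  (u_t, u) is at hand, and differential inequalities hold only almost everywhere. Hence (u_t, u) is
  shown to be Lipschitz and is differentiated by hand from the equation tested with fixed functions,
  and the comparison with the barrier is made for absolutely continuous functions. Once this is
  done, a solution enters only through four real functions of time, and the constants are constants
  of inequalities between real numbers.\<close>

definition L2s :: "'a measure \<Rightarrow> ('a \<Rightarrow> 'b::euclidean_space) set" where
  "L2s M = {f. f \<in> borel_measurable M \<and> integrable M (\<lambda>x. norm (f x) ^ 2)}"

text \<open>The measure is a parameter because the same calculus serves over
  \<open>lebesgue_on \<Omega>\<close>, where solutions live, and over \<open>lborel\<close>, where
  test functions can be translated freely. \<open>l2\<close> is a seminorm; no quotient is
  formed.\<close>

definition l2 :: "'a measure \<Rightarrow> ('a \<Rightarrow> 'b::euclidean_space) \<Rightarrow> real" where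
  "l2 M f = sqrt (LINT x|M. norm (f x) ^ 2)"

definition ip :: "'a measure \<Rightarrow> ('a \<Rightarrow> 'b::euclidean_space) \<Rightarrow> ('a \<Rightarrow> 'b) \<Rightarrow> real" where
  "ip M f g = (LINT x|M. f x \<bullet> g x)"

lemma powr_two_eq_square: "0 \<le> x \<Longrightarrow> x powr 2 = x ^ 2" for x :: real
  by (cases "x = 0") (auto simp: powr_numeral)

lemma Lp_2_eq_L2s: "Lp \<Omega> 2 = L2s (lebesgue_on \<Omega>)"
  unfolding Lp_def L2s_def by (simp add: powr_two_eq_square)

lemma Lp_norm_2_eq_l2: "Lp_norm \<Omega> 2 f = l2 (lebesgue_on \<Omega>) f"
  unfolding Lp_norm_def l2_def by (simp add: powr_two_eq_square powr_half_sqrt)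

lemma L2_pair_eq_ip: "L2_pair \<Omega> f g = ip (lebesgue_on \<Omega>) f g"
  unfolding L2_pair_def ip_def by simp

lemma l2_nonneg [simp]: "0 \<le> l2 M f"
  unfolding l2_def by simp

lemma l2_power2: "(l2 M f)\<^sup>2 = (LINT x|M. norm (f x) ^ 2)"
  unfolding l2_def by simp

lemma l2_power2_eq_ip: "(l2 M f)\<^sup>2 = ip M f f"
  by (simp add: l2_power2 ip_def power2_norm_eq_inner)

lemma L2s_measurable: "f \<in> L2s M \<Longrightarrow> f \<in> borel_measurable M"
  by (simp add: L2s_def)

lemma L2s_integrable: "f \<in> L2s M \<Longrightarrow> integrable M (\<lambda>x. norm (f x) ^ 2)"
  by (simp add: L2s_def)

lemma integrable_inner_L2s:
  fixes f g :: "'a \<Rightarrow> 'b::euclidean_space"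
  assumes "f \<in> L2s M" "g \<in> L2s M"
  shows "integrable M (\<lambda>x. f x \<bullet> g x)"
proof (rule Bochner_Integration.integrable_bound)
  show "integrable M (\<lambda>x. norm (f x) ^ 2 + norm (g x) ^ 2)"
    using assms by (auto simp: L2s_def)
  show "(\<lambda>x. f x \<bullet> g x) \<in> borel_measurable M"
    using assms by (auto simp: L2s_def)
  have "\<bar>f x \<bullet> g x\<bar> \<le> (norm (f x))\<^sup>2 + (norm (g x))\<^sup>2" for x
  proof -
    have "\<bar>f x \<bullet> g x\<bar> \<le> norm (f x) * norm (g x)" by (rule Cauchy_Schwarz_ineq2)
    also have "\<dots> \<le> (norm (f x))\<^sup>2 + (norm (g x))\<^sup>2"
      using sum_squares_bound[of "norm (f x)" "norm (g x)"] mult_nonneg_nonneg[OF norm_ge_zero norm_ge_zero, of "f x" "g x"]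
      by linarith
    finally show ?thesis .
  qed
  then show "AE x in M. norm (f x \<bullet> g x) \<le> norm (norm (f x) ^ 2 + norm (g x) ^ 2)"
    by (intro AE_I2) (simp add: order.trans[OF _ abs_ge_self])
qed

lemma L2s_add:
  fixes f g :: "'a \<Rightarrow> 'b::euclidean_space"
  assumes "f \<in> L2s M" "g \<in> L2s M"
  shows "(\<lambda>x. f x + g x) \<in> L2s M"
proof -
  have "(\<lambda>x. norm (f x + g x) ^ 2) = (\<lambda>x. norm (f x) ^ 2 + 2 * (f x \<bullet> g x) + norm (g x) ^ 2)"
    by (rule ext) (simp add: power2_norm_eq_inner inner_add_left inner_add_right inner_commute)
  moreover have "integrable M (\<lambda>x. norm (f x) ^ 2 + 2 * (f x \<bullet> g x) + norm (g x) ^ 2)"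
    using assms integrable_inner_L2s[OF assms] by (intro Bochner_Integration.integrable_add) (auto simp: L2s_def)
  ultimately show ?thesis using assms by (auto simp: L2s_def)
qed

lemma L2s_scaleR: "f \<in> L2s M \<Longrightarrow> (\<lambda>x. r *\<^sub>R f x) \<in> L2s M"
  by (auto simp: L2s_def power_mult_distrib)

lemma L2s_mult: "f \<in> L2s M \<Longrightarrow> (\<lambda>x. r * f x) \<in> L2s M" for f :: "'a \<Rightarrow> real"
  using L2s_scaleR[of f M r] by simp

lemma L2s_divide: "f \<in> L2s M \<Longrightarrow> (\<lambda>x. f x / r) \<in> L2s M" for f :: "'a \<Rightarrow> real"
  using L2s_scaleR[of f M "inverse r"] by (simp add: divide_inverse mult.commute)

lemma L2s_zero: "(\<lambda>x. 0) \<in> L2s M"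
  by (auto simp: L2s_def)

lemma L2s_diff:
  fixes f g :: "'a \<Rightarrow> 'b::euclidean_space"
  assumes "f \<in> L2s M" "g \<in> L2s M"
  shows "(\<lambda>x. f x - g x) \<in> L2s M"
  using L2s_add[OF assms(1) L2s_scaleR[OF assms(2), of "-1"]] by simp

lemma ip_add_left:
  assumes "f \<in> L2s M" "g \<in> L2s M" "k \<in> L2s M"
  shows "ip M (\<lambda>x. f x + g x) k = ip M f k + ip M g k"
  unfolding ip_def using assms by (simp add: inner_add_left integrable_inner_L2s)

lemma ip_diff_left:
  assumes "f \<in> L2s M" "g \<in> L2s M" "k \<in> L2s M"
  shows "ip M (\<lambda>x. f x - g x) k = ip M f k - ip M g k"
  unfolding ip_def using assms by (simp add: inner_diff_left integrable_inner_L2s)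

lemma ip_commute: "ip M f g = ip M g f"
  unfolding ip_def by (simp add: inner_commute)

lemma ip_add_right:
  assumes "f \<in> L2s M" "g \<in> L2s M" "k \<in> L2s M"
  shows "ip M k (\<lambda>x. f x + g x) = ip M k f + ip M k g"
  using ip_add_left[OF assms] by (simp add: ip_commute)

lemma ip_diff_right:
  assumes "f \<in> L2s M" "g \<in> L2s M" "k \<in> L2s M"
  shows "ip M k (\<lambda>x. f x - g x) = ip M k f - ip M k g"
  using ip_diff_left[OF assms] by (simp add: ip_commute)

lemma ip_scaleR_left: "ip M (\<lambda>x. r *\<^sub>R f x) g = r * ip M f g"
  unfolding ip_def by simp

lemma ip_scaleR_right: "ip M f (\<lambda>x. r *\<^sub>R g x) = r * ip M f g"
  unfolding ip_def by simp

lemma ip_mult_right: "ip M f (\<lambda>x. r * g x) = r * ip M f g" for f g :: "'a \<Rightarrow> real"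
  using ip_scaleR_right[of M f r g] by simp

lemma ip_divide_right: "ip M f (\<lambda>x. g x / r) = ip M f g / r" for f g :: "'a \<Rightarrow> real"
  using ip_mult_right[of M f "inverse r" g] by (simp add: divide_inverse mult.commute)

lemma l2_cong_AE:
  assumes "AE x in M. f x = f' x" "f \<in> borel_measurable M" "f' \<in> borel_measurable M"
  shows "l2 M f = l2 M f'"
  unfolding l2_def using assms by (intro arg_cong[where f=sqrt] integral_cong_AE) auto

text \<open>For \<open>G > 0\<close> the value at the vertex \<open>- P / G\<close> is the
  discriminant up to a positive factor; a nonnegative affine function is constant, and a strictly
  concave quadratic cannot stay nonnegative. Serves for Cauchy-Schwarz and, with \<open>F\<close>
  equal to 0, to read the eigenvalue equation off a minimality property.\<close>

lemma quadratic_nonneg_imp_discriminant: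
  fixes F G P :: real
  assumes "\<And>t. 0 \<le> F + 2 * t * P + t\<^sup>2 * G"
  shows "P\<^sup>2 \<le> F * G"
proof (cases "G = 0")
  case True
  have "P = 0"
  proof (rule ccontr)
    assume "P \<noteq> 0"
    with assms[of "- (F + 1) / (2 * P)"] True show False by (simp add: field_simps)
  qed
  with True show ?thesis by simp
next
  case False
  have "G \<ge> 0"
  proof (rule ccontr)
    assume "\<not> 0 \<le> G"
    then have G: "G < 0" by simp
    \<comment> \<open>For \<open>G < 0\<close> this t is so large that the quadratic term outweighs
      the other two; the final \<open>+ 1\<close> ensures t \<ge> 1, so that F is at most t times
      its absolute value.\<close>
    define t where "t = (2 * \<bar>P\<bar> + \<bar>F\<bar> + 1) / (- G) + 1"
    have t1: "t \<ge> 1" and tG: "t * (- G) \<ge> 2 * \<bar>P\<bar> + \<bar>F\<bar> + 1"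
      using G by (auto simp: t_def field_simps intro: add_nonneg_nonneg)
    have "t * (t * (-G)) \<ge> t * (2 * \<bar>P\<bar> + \<bar>F\<bar> + 1)" using t1 tG by (intro mult_left_mono) auto
    moreover have "t * \<bar>F\<bar> \<ge> F" using t1 abs_ge_self[of F] mult_right_mono[of 1 t "\<bar>F\<bar>"] by simp
    moreover have "t * \<bar>P\<bar> \<ge> t * P" using t1 by (intro mult_left_mono) auto
    moreover have "F + 2 * (t * P) \<ge> t * (t * (- G))" using assms[of t] by (simp add: power2_eq_square algebra_simps)
    moreover have "t * (2 * \<bar>P\<bar> + \<bar>F\<bar> + 1) = 2 * (t * \<bar>P\<bar>) + t * \<bar>F\<bar> + t" by (simp add: algebra_simps)
    ultimately show False using t1 by linarith
  qed
  with False have G: "G > 0" by simp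
  have "0 \<le> (F + 2 * (- P / G) * P + (- P / G)\<^sup>2 * G) * G"
    using assms[of "- P / G"] G by (intro mult_nonneg_nonneg) auto
  also have "\<dots> = F * G - P\<^sup>2"
    using G by (simp add: power2_eq_square field_simps)
  finally show ?thesis by simp
qed

lemma l2_add_scaleR_power2:
  fixes f g :: "'a \<Rightarrow> 'b::euclidean_space"
  assumes "f \<in> L2s M" "g \<in> L2s M"
  shows "(l2 M (\<lambda>x. f x + t *\<^sub>R g x))\<^sup>2 = (l2 M f)\<^sup>2 + 2 * t * ip M f g + t\<^sup>2 * (l2 M g)\<^sup>2"
proof -
  have tg: "(\<lambda>x. t *\<^sub>R g x) \<in> L2s M" using assms(2) by (rule L2s_scaleR)
  show ?thesis
    using assms tg
    unfolding l2_power2_eq_ip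
    by (simp add: ip_add_left ip_add_right L2s_add ip_scaleR_left ip_scaleR_right
        ip_commute[of M g f] power2_eq_square algebra_simps)
qed

lemma ip_Cauchy_Schwarz:
  fixes f g :: "'a \<Rightarrow> 'b::euclidean_space"
  assumes "f \<in> L2s M" "g \<in> L2s M"
  shows "\<bar>ip M f g\<bar> \<le> l2 M f * l2 M g"
proof -
  have "(ip M f g)\<^sup>2 \<le> (l2 M f)\<^sup>2 * (l2 M g)\<^sup>2"
  proof (rule quadratic_nonneg_imp_discriminant)
    show "0 \<le> (l2 M f)\<^sup>2 + 2 * t * ip M f g + t\<^sup>2 * (l2 M g)\<^sup>2" for t
      unfolding l2_add_scaleR_power2[OF assms, symmetric] by simp
  qed
  then have "\<bar>ip M f g\<bar>\<^sup>2 \<le> (l2 M f * l2 M g)\<^sup>2" by (simp add: power_mult_distrib)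
  then show ?thesis by (rule power2_le_imp_le) simp
qed

lemma l2_triangle:
  fixes f g :: "'a \<Rightarrow> 'b::euclidean_space"
  assumes "f \<in> L2s M" "g \<in> L2s M"
  shows "l2 M (\<lambda>x. f x + g x) \<le> l2 M f + l2 M g"
proof (rule power2_le_imp_le)
  show "(l2 M (\<lambda>x. f x + g x))\<^sup>2 \<le> (l2 M f + l2 M g)\<^sup>2"
    using l2_add_scaleR_power2[OF assms, of 1] ip_Cauchy_Schwarz[OF assms]
    by (simp add: power2_sum)
qed simp

lemma l2_scaleR: "l2 M (\<lambda>x. r *\<^sub>R f x) = \<bar>r\<bar> * l2 M f"
  unfolding l2_def by (simp add: power_mult_distrib real_sqrt_mult)

lemma l2_mult: "l2 M (\<lambda>x. r * f x) = \<bar>r\<bar> * l2 M f" for f :: "'a \<Rightarrow> real"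
  using l2_scaleR[of M r f] by simp

lemma l2_uminus: "l2 M (\<lambda>x. - f x) = l2 M f"
  unfolding l2_def by simp

lemma l2_minus_commute: "l2 M (\<lambda>x. f x - g x) = l2 M (\<lambda>x. g x - f x)"
  unfolding l2_def by (simp add: norm_minus_commute)

lemma l2_zero [simp]: "l2 M (\<lambda>x. 0) = 0"
  unfolding l2_def by simp

lemma l2_triangle_diff:
  fixes f g k :: "'a \<Rightarrow> 'b::euclidean_space"
  assumes "f \<in> L2s M" "g \<in> L2s M" "k \<in> L2s M"
  shows "l2 M (\<lambda>x. f x - k x) \<le> l2 M (\<lambda>x. f x - g x) + l2 M (\<lambda>x. g x - k x)"
  using l2_triangle[OF L2s_diff[OF assms(1,2)] L2s_diff[OF assms(2,3)]] by simp

lemma l2_diff_abs: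
  fixes f g :: "'a \<Rightarrow> 'b::euclidean_space"
  assumes "f \<in> L2s M" "g \<in> L2s M"
  shows "\<bar>l2 M f - l2 M g\<bar> \<le> l2 M (\<lambda>x. f x - g x)"
  using l2_triangle_diff[OF assms(1,2) L2s_zero] l2_triangle_diff[OF assms(2,1) L2s_zero]
    l2_minus_commute[of M f g] by simp

text \<open>Membership in L2 is required only eventually, because functions of time are controlled
  only on an interval.\<close>

lemma tendsto_l2_eventually:
  fixes f :: "'c \<Rightarrow> 'a \<Rightarrow> 'b::euclidean_space"
  assumes "((\<lambda>s. l2 M (\<lambda>x. f s x - g x)) \<longlongrightarrow> 0) F"
    "\<forall>\<^sub>F s in F. f s \<in> L2s M" "g \<in> L2s M"
  shows "((\<lambda>s. l2 M (f s)) \<longlongrightarrow> l2 M g) F"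
proof (rule LIM_zero_cancel, rule tendsto_0_le[OF assms(1), where K=1])
  show "\<forall>\<^sub>F s in F. norm (l2 M (f s) - l2 M g) \<le> norm (l2 M (\<lambda>x. f s x - g x)) * 1"
    using assms(2) by eventually_elim (use l2_diff_abs[OF _ assms(3)] in simp)
qed

lemmas tendsto_l2 = tendsto_l2_eventually[OF _ always_eventually[OF allI]]

lemma ip_diff_bound:
  fixes f g f' g' :: "'a \<Rightarrow> 'b::euclidean_space"
  assumes "f \<in> L2s M" "g \<in> L2s M" "f' \<in> L2s M" "g' \<in> L2s M"
  shows "\<bar>ip M f g - ip M f' g'\<bar> \<le> l2 M (\<lambda>x. f x - f' x) * l2 M g + l2 M f' * l2 M (\<lambda>x. g x - g' x)"
proof -
  have "ip M f g - ip M f' g' = ip M (\<lambda>x. f x - f' x) g + ip M f' (\<lambda>x. g x - g' x)"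
    using assms by (simp add: ip_diff_left ip_diff_right)
  then show ?thesis
    using ip_Cauchy_Schwarz[OF L2s_diff[OF assms(1,3)] assms(2)]
      ip_Cauchy_Schwarz[OF assms(3) L2s_diff[OF assms(2,4)]] by linarith
qed

lemma tendsto_ip_eventually:
  fixes f g :: "'c \<Rightarrow> 'a \<Rightarrow> 'b::euclidean_space"
  assumes f: "((\<lambda>s. l2 M (\<lambda>x. f s x - f' x)) \<longlongrightarrow> 0) F" "\<forall>\<^sub>F s in F. f s \<in> L2s M" "f' \<in> L2s M"
    and g: "((\<lambda>s. l2 M (\<lambda>x. g s x - g' x)) \<longlongrightarrow> 0) F" "\<forall>\<^sub>F s in F. g s \<in> L2s M" "g' \<in> L2s M"
  shows "((\<lambda>s. ip M (f s) (g s)) \<longlongrightarrow> ip M f' g') F"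
proof (rule LIM_zero_cancel, rule tendsto_0_le[where K=1])
  show "((\<lambda>s. l2 M (\<lambda>x. f s x - f' x) * l2 M (g s) + l2 M f' * l2 M (\<lambda>x. g s x - g' x)) \<longlongrightarrow> 0) F"
    using tendsto_add[OF tendsto_mult[OF f(1) tendsto_l2_eventually[OF g]] tendsto_mult[OF tendsto_const g(1), of "l2 M f'"]]
    by simp
  show "\<forall>\<^sub>F s in F. norm (ip M (f s) (g s) - ip M f' g')
     \<le> norm (l2 M (\<lambda>x. f s x - f' x) * l2 M (g s) + l2 M f' * l2 M (\<lambda>x. g s x - g' x)) * 1"
    using f(2) g(2)
    by eventually_elim (use ip_diff_bound[OF _ _ f(3) g(3)] in \<open>auto intro!: order.trans[OF _ abs_ge_self]\<close>)
qed

lemmas tendsto_ip =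
  tendsto_ip_eventually[OF _ always_eventually[OF allI] _ _ always_eventually[OF allI]]

lemma nn_integral_norm2_eq_l2:
  "f \<in> L2s M \<Longrightarrow> (\<integral>\<^sup>+x. ennreal (norm (f x) ^ 2) \<partial>M) = ennreal ((l2 M f)\<^sup>2)"
  unfolding l2_power2 by (rule nn_integral_eq_integral) (auto simp: L2s_def)

text \<open>Riesz-Fischer. Along a subsequence with increments d_k of norm at most 2^-k the sum of
  2^k |d_k|^2 is integrable, hence finite almost everywhere, which forces pointwise convergence.
  Fatou's lemma then turns the Cauchy property of the whole sequence into convergence in norm to the
  pointwise limit.\<close>

lemma L2s_complete:
  fixes f :: "nat \<Rightarrow> 'a \<Rightarrow> 'b::euclidean_space"
  assumes f: "\<And>n. f n \<in> L2s M"
    and cauchy: "\<And>e. 0 < e \<Longrightarrow> \<exists>N. \<forall>m\<ge>N. \<forall>n\<ge>N. l2 M (\<lambda>x. f m x - f n x) < e"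
  obtains g where "g \<in> L2s M" "(\<lambda>n. l2 M (\<lambda>x. f n x - g x)) \<longlonglongrightarrow> 0"
proof -
  have [measurable]: "f n \<in> borel_measurable M" for n using f by (simp add: L2s_def)
  have "\<exists>N. \<forall>k. \<forall>m\<ge>N k. \<forall>n\<ge>N k. l2 M (\<lambda>x. f m x - f n x) < (1/2)^k"
    using cauchy by (intro choice) auto
  then obtain N where N: "\<And>k m n. m \<ge> N k \<Longrightarrow> n \<ge> N k \<Longrightarrow> l2 M (\<lambda>x. f m x - f n x) < (1/2)^k"
    by auto
  \<comment> \<open>Summing the \<open>N i\<close> and adding k puts \<open>r k\<close> above both
    \<open>N k\<close> and k, and \<open>r (Suc k)\<close> above \<open>N k\<close>.\<close>
  define r where "r k = (\<Sum>i\<le>k. N i) + k" for k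
  have rN: "r k \<ge> N k" for k unfolding r_def by (simp add: member_le_sum trans_le_add1)
  have rS: "r (Suc k) \<ge> N k" for k
    unfolding r_def by (intro trans_le_add1 member_le_sum) auto
  have rk: "r k \<ge> k" for k unfolding r_def by simp
  define d where "d k x = f (r (Suc k)) x - f (r k) x" for k x
  have [measurable]: "d k \<in> borel_measurable M" for k unfolding d_def by measurable
  have dL: "d k \<in> L2s M" for k unfolding d_def by (intro L2s_diff f)
  have dn: "l2 M (d k) \<le> (1/2)^k" for k
    using N[OF rS rN, of k] unfolding d_def by simp
  have "AE x in M. (\<Sum>k. ennreal (2^k * norm (d k x)^2)) \<noteq> \<infinity>"
  proof (rule nn_integral_PInf_AE)
    have "(\<integral>\<^sup>+x. (\<Sum>k. ennreal (2^k * norm (d k x)^2)) \<partial>M) = (\<Sum>k. \<integral>\<^sup>+x. ennreal (2^k * norm (d k x)^2) \<partial>M)"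
      by (rule nn_integral_suminf) measurable
    also have "\<dots> = (\<Sum>k. ennreal (2^k * (l2 M (d k))\<^sup>2))"
      by (simp add: ennreal_mult nn_integral_cmult nn_integral_norm2_eq_l2[OF dL])
    also have "\<dots> \<le> (\<Sum>k. ennreal ((1/2)^k))"
    proof (intro suminf_le ennreal_leI)
      show "2 ^ k * (l2 M (d k))\<^sup>2 \<le> (1/2)^k" for k
      proof -
        have "2 ^ k * (l2 M (d k))\<^sup>2 \<le> 2 ^ k * ((1/2)^k)\<^sup>2"
          using dn by (intro mult_left_mono power_mono) auto
        also have "\<dots> = (1/2)^k" by (simp add: power2_eq_square power_divide field_simps)
        finally show ?thesis .
      qed
    qed auto
    also have "\<dots> = ennreal (\<Sum>k. (1/2)^k)"       by (rule suminf_ennreal2) (simp_all add: summable_geometric)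
    also have "\<dots> < \<infinity>" by simp
    finally show "(\<integral>\<^sup>+x. (\<Sum>k. ennreal (2^k * norm (d k x)^2)) \<partial>M) \<noteq> \<infinity>" by simp
  qed measurable
  then have conv: "AE x in M. convergent (\<lambda>k. f (r k) x)"
  proof (rule AE_mp, intro AE_I2 impI)
    fix x assume "(\<Sum>k. ennreal (2^k * norm (d k x)^2)) \<noteq> \<infinity>"
    then have s: "summable (\<lambda>k. 2^k * norm (d k x)^2)"
      by (intro summable_suminf_not_top) (auto simp: top_ennreal_def)
    have "summable (\<lambda>k. d k x)"
    proof (rule summable_comparison_test)
      show "summable (\<lambda>k. (1/2)^k + 2^k * norm (d k x)^2)"
        using s by (intro summable_add summable_geometric) auto
      \<comment> \<open>With y = 2^n |d_n|, the bound y \<le> 1 + y^2 is divided by 2^n.\<close>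
      show "\<exists>N. \<forall>n\<ge>N. norm (d n x) \<le> (1/2)^n + 2^n * norm (d n x)^2"
      proof (intro exI allI impI)
        fix n
        have "0 \<le> norm (d n x) * 2^n" by simp
        then have "norm (d n x) * 2^n \<le> 1 + (norm (d n x) * 2^n)\<^sup>2"
          using sum_squares_bound[of 1 "norm (d n x) * 2^n"] unfolding power2_eq_square by linarith
        then have "norm (d n x) * 2^n * (1/2)^n \<le> (1 + (norm (d n x) * 2^n)\<^sup>2) * (1/2)^n"
          by (intro mult_right_mono) auto
        then show "norm (d n x) \<le> (1/2)^n + 2^n * norm (d n x)^2"
          by (simp add: power_divide field_simps power2_eq_square)
      qed
    qed
    then have "(\<lambda>n. \<Sum>k<n. d k x) \<longlonglongrightarrow> (\<Sum>k. d k x)" by (rule summable_LIMSEQ)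
    moreover have "(\<Sum>k<n. d k x) = f (r n) x - f (r 0) x" for n
      unfolding d_def by (rule sum_lessThan_telescope)
    ultimately have "(\<lambda>n. f (r n) x - f (r 0) x + f (r 0) x) \<longlonglongrightarrow> (\<Sum>k. d k x) + f (r 0) x"
      by (intro tendsto_add) auto
    then show "convergent (\<lambda>k. f (r k) x)" by (auto simp: convergent_def)
  qed
  define g where "g x = lim (\<lambda>k. f (r k) x)" for x
  have [measurable]: "g \<in> borel_measurable M" unfolding g_def by measurable
  have lim: "AE x in M. (\<lambda>k. f (r k) x) \<longlonglongrightarrow> g x"
    using conv unfolding g_def by (auto simp: convergent_LIMSEQ_iff)
  \<comment> \<open>Fatou along the subsequence: the Cauchy bound on the differences
    \<open>f n - f (r k)\<close> passes to \<open>f n - g\<close>.\<close>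
  have est: "(\<integral>\<^sup>+x. ennreal (norm (f n x - g x) ^ 2) \<partial>M) \<le> ennreal (e\<^sup>2)"
    if "e > 0" and K: "\<And>m. m \<ge> K \<Longrightarrow> l2 M (\<lambda>x. f n x - f m x) < e" for n K e
  proof -
    have "(\<integral>\<^sup>+x. ennreal (norm (f n x - g x) ^ 2) \<partial>M)
        = (\<integral>\<^sup>+x. liminf (\<lambda>k. ennreal (norm (f n x - f (r k) x) ^ 2)) \<partial>M)"
    proof (rule nn_integral_cong_AE, rule AE_mp[OF lim], intro AE_I2 impI)
      fix x assume "(\<lambda>k. f (r k) x) \<longlonglongrightarrow> g x"
      then have "(\<lambda>k. ennreal (norm (f n x - f (r k) x) ^ 2)) \<longlonglongrightarrow> ennreal (norm (f n x - g x) ^ 2)"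
        by (intro tendsto_ennrealI tendsto_intros)
      then show "ennreal (norm (f n x - g x) ^ 2) = liminf (\<lambda>k. ennreal (norm (f n x - f (r k) x) ^ 2))"
        by (rule lim_imp_Liminf[OF trivial_limit_sequentially, symmetric])
    qed
    also have "\<dots> \<le> liminf (\<lambda>k. \<integral>\<^sup>+x. ennreal (norm (f n x - f (r k) x) ^ 2) \<partial>M)"
      by (rule nn_integral_liminf) measurable
    also have "\<dots> = liminf (\<lambda>k. ennreal ((l2 M (\<lambda>x. f n x - f (r k) x))\<^sup>2))"
      by (simp add: nn_integral_norm2_eq_l2[OF L2s_diff[OF f f]])
    also have "\<dots> \<le> liminf (\<lambda>k. ennreal (e\<^sup>2))"
    proof (rule Liminf_mono, rule eventually_sequentiallyI[of K])
      fix k assume "K \<le> k"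
      then have "l2 M (\<lambda>x. f n x - f (r k) x) < e" using K rk le_trans by blast
      then show "ennreal ((l2 M (\<lambda>x. f n x - f (r k) x))\<^sup>2) \<le> ennreal (e\<^sup>2)"
        by (intro ennreal_leI power_mono) auto
    qed
    also have "\<dots> = ennreal (e\<^sup>2)" by (simp add: Liminf_const)
    finally show ?thesis .
  qed
  have dL2: "(\<lambda>x. f n x - g x) \<in> L2s M" if "e > 0" and "\<And>m. m \<ge> K \<Longrightarrow> l2 M (\<lambda>x. f n x - f m x) < e" for n K e
    unfolding L2s_def mem_Collect_eq
  proof (intro conjI integrableI_bounded)
    show "(\<integral>\<^sup>+x. ennreal (norm ((norm (f n x - g x))\<^sup>2)) \<partial>M) < \<infinity>"
      using le_less_trans[OF est[OF that] ennreal_less_top] by simp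
  qed measurable
  have small: "l2 M (\<lambda>x. f n x - g x) \<le> e" if "e > 0" and "\<And>m. m \<ge> K \<Longrightarrow> l2 M (\<lambda>x. f n x - f m x) < e" for n K e
  proof -
    have "ennreal ((l2 M (\<lambda>x. f n x - g x))\<^sup>2) \<le> ennreal (e\<^sup>2)"
      using est[OF that] nn_integral_norm2_eq_l2[OF dL2[OF that]] by simp
    then have "(l2 M (\<lambda>x. f n x - g x))\<^sup>2 \<le> e\<^sup>2" by (simp add: ennreal_le_iff)
    then show ?thesis by (rule power2_le_imp_le) (use that(1) in simp)
  qed
  obtain N1 where "\<forall>m\<ge>N1. \<forall>n\<ge>N1. l2 M (\<lambda>x. f m x - f n x) < 1" using cauchy[of 1] by auto
  then have "(\<lambda>x. f N1 x - (f N1 x - g x)) \<in> L2s M" by (intro L2s_diff[OF f] dL2[of 1 N1]) auto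
  then have gL: "g \<in> L2s M" by simp
  have "(\<lambda>n. l2 M (\<lambda>x. f n x - g x)) \<longlonglongrightarrow> 0"
  proof (rule LIMSEQ_I)
    fix e :: real assume "e > 0"
    then obtain K where K: "\<forall>m\<ge>K. \<forall>n\<ge>K. l2 M (\<lambda>x. f m x - f n x) < e / 2" using cauchy[of "e/2"] by auto
    have "l2 M (\<lambda>x. f n x - g x) < e" if "n \<ge> K" for n
      using small[of "e/2" K n] K that \<open>e > 0\<close> by fastforce
    then show "\<exists>no. \<forall>n\<ge>no. norm (l2 M (\<lambda>x. f n x - g x) - 0) < e" by auto
  qed
  with gL that show thesis by blast
qed

lemma l2_eq_0_iff_AE:
  "f \<in> L2s M \<Longrightarrow> l2 M f = 0 \<longleftrightarrow> (AE x in M. f x = 0)"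
  unfolding l2_def by (simp add: integral_nonneg_eq_0_iff_AE L2s_def)

section \<open>Smooth functions of compact support\<close>

text \<open>\<open>Ck\<close> refers to \<open>frechet_derivative\<close>; uniqueness of the
  derivative allows any explicit formula in its place.\<close>

lemma Ck_SucI:
  assumes "\<And>x. (f has_derivative f' x) (at x)" "\<And>i. i \<in> Basis \<Longrightarrow> Ck k (\<lambda>x. f' x i)"
  shows "Ck (Suc k) f"
proof -
  have "frechet_derivative f (at x) = f' x" for x
    using frechet_derivative_at[OF assms(1)] by simp
  then show ?thesis using assms by (auto simp: differentiable_def)
qed

lemma Ck_Suc_has_derivative:
  "Ck (Suc k) f \<Longrightarrow> (f has_derivative frechet_derivative f (at x)) (at x)"
  by (simp add: frechet_derivative_works)

lemma Ck_Suc_imp_Ck: "Ck (Suc k) f \<Longrightarrow> Ck k f"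
proof (induction k arbitrary: f)
  case 0
  then show ?case
    by (auto simp: continuous_on_eq_continuous_at intro: differentiable_imp_continuous_within)
next
  case (Suc k)
  show ?case
  proof (rule Ck_SucI)
    show "(f has_derivative frechet_derivative f (at x)) (at x)" for x
      using Suc.prems by (rule Ck_Suc_has_derivative)
    show "Ck k (\<lambda>x. frechet_derivative f (at x) i)" if "i \<in> Basis" for i
      using Suc that by simp
  qed
qed

lemma Ck_const: "Ck k (\<lambda>x. c)"
proof (induction k arbitrary: c)
  case (Suc k)
  show ?case by (rule Ck_SucI[where f'="\<lambda>x h. 0"]) (auto intro: Suc)
qed simp

lemma Ck_add: "Ck k f \<Longrightarrow> Ck k g \<Longrightarrow> Ck k (\<lambda>x. f x + g x)"
proof (induction k arbitrary: f g)
  case (Suc k)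
  show ?case
  proof (rule Ck_SucI)
    show "((\<lambda>x. f x + g x) has_derivative (\<lambda>h. frechet_derivative f (at x) h + frechet_derivative g (at x) h)) (at x)" for x
      using Suc.prems by (intro has_derivative_add Ck_Suc_has_derivative)
  qed (use Suc in auto)
qed (auto intro: continuous_intros)

lemma Ck_mult: "Ck k f \<Longrightarrow> Ck k g \<Longrightarrow> Ck k (\<lambda>x. f x * g x)"
proof (induction k arbitrary: f g)
  case (Suc k)
  show ?case
  proof (rule Ck_SucI)
    show "((\<lambda>x. f x * g x) has_derivative (\<lambda>h. f x * frechet_derivative g (at x) h + frechet_derivative f (at x) h * g x)) (at x)" for x
      using Suc.prems by (intro has_derivative_mult Ck_Suc_has_derivative)
    show "Ck k (\<lambda>x. f x * frechet_derivative g (at x) i + frechet_derivative f (at x) i * g x)" if "i \<in> Basis" for i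
      using Suc.prems that Suc.prems[THEN Ck_Suc_imp_Ck] by (intro Ck_add Suc.IH) auto
  qed
qed (auto intro: continuous_intros)

lemma Ck_cmult: "Ck k f \<Longrightarrow> Ck k (\<lambda>x. c * f x)"
  by (rule Ck_mult[OF Ck_const])

lemma Ck_diff:
  assumes "Ck k f" "Ck k g"
  shows "Ck k (\<lambda>x. f x - g x)"
  using Ck_add[OF assms(1) Ck_cmult[OF assms(2), of "-1"]] by simp

lemma Ck_prod: "(\<And>i. i \<in> I \<Longrightarrow> Ck k (f i)) \<Longrightarrow> Ck k (\<lambda>x. \<Prod>i\<in>I. f i x)"
proof (induction I rule: infinite_finite_induct)
  case (insert i I)
  then show ?case by (simp add: Ck_mult)
qed (auto intro: Ck_const)

text \<open>The classical smooth function exp(-\<epsilon>/x), zero for x \<le> 0, divided by x^m.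
  The extra division makes the family closed under differentiation, so that smoothness is one
  induction for all m. As \<epsilon> tends to 0, \<open>flat 0 \<epsilon>\<close> approaches the
  indicator of the positive reals.\<close>

definition flat :: "nat \<Rightarrow> real \<Rightarrow> real \<Rightarrow> real" where
  "flat m \<epsilon> x = (if x \<le> 0 then 0 else exp (- \<epsilon> / x) / x ^ m)"

lemma power_div_fact_le_exp:
  assumes "0 \<le> (x::real)" shows "x ^ n / fact n \<le> exp x"
proof -
  have "(\<Sum>k\<in>{n}. x ^ k /\<^sub>R fact k) \<le> (\<Sum>k. x ^ k /\<^sub>R fact k)"
    using assms by (intro sum_le_suminf summable_exp_generic) auto
  then show ?thesis by (simp add: exp_def field_simps)
qed

text \<open>The term of order m + 2 of the exponential series compensates the division by h^m and
  leaves a factor \<open>h\<^sup>2\<close>, which makes the derivative at 0 vanish.\<close>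

lemma flat_bound:
  assumes "\<epsilon> > 0" shows "\<bar>flat m \<epsilon> h\<bar> \<le> fact (m + 2) / \<epsilon> ^ (m + 2) * h\<^sup>2"
proof (cases "h \<le> 0")
  case False
  then have h: "h > 0" by simp
  have "(\<epsilon> / h) ^ (m + 2) / fact (m + 2) \<le> exp (\<epsilon> / h)"
    using h assms by (intro power_div_fact_le_exp) auto
  then have "inverse (exp (\<epsilon> / h)) \<le> inverse ((\<epsilon> / h) ^ (m + 2) / fact (m + 2))"
    using h assms by (intro le_imp_inverse_le) (auto intro!: divide_pos_pos)
  then have "exp (- \<epsilon> / h) \<le> inverse ((\<epsilon> / h) ^ (m + 2) / fact (m + 2))"
    by (simp only: exp_minus minus_divide_left[symmetric])
  also have "\<dots> = fact (m + 2) * h ^ m * h\<^sup>2 / \<epsilon> ^ (m + 2)"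
    by (simp only: power_divide power_add) (use h in \<open>simp add: field_simps\<close>)
  finally show ?thesis using h by (simp add: flat_def pos_divide_le_eq mult_ac)
qed (use assms in \<open>simp add: flat_def\<close>)

lemma flat_has_derivative:
  assumes e: "\<epsilon> > 0"
  shows "(flat m \<epsilon> has_real_derivative \<epsilon> * flat (m + 2) \<epsilon> x - m * flat (m + 1) \<epsilon> x) (at x)"
proof -
  consider "x < 0" | "x = 0" | "x > 0" by linarith
  then show ?thesis
  proof cases
    case 1
    have "((\<lambda>x. 0) has_real_derivative 0) (at x)" by simp
    then have "(flat m \<epsilon> has_real_derivative 0) (at x)"
      by (rule has_field_derivative_transform_within_open[of _ _ _ "{..<0}"]) (use 1 in \<open>auto simp: flat_def\<close>)
    with 1 show ?thesis by (simp add: flat_def)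
  next
    case 2
    have "(\<lambda>h. (flat m \<epsilon> (0 + h) - flat m \<epsilon> 0) / h) \<midarrow>0\<rightarrow> 0"
    proof (rule tendsto_0_le[where f="\<lambda>h::real. h" and K="fact (m + 2) / \<epsilon> ^ (m + 2)"])
      show "\<forall>\<^sub>F h in at 0. norm ((flat m \<epsilon> (0 + h) - flat m \<epsilon> 0) / h) \<le> norm h * (fact (m + 2) / \<epsilon> ^ (m + 2))"
      proof (intro always_eventually allI)
        fix h :: real
        show "norm ((flat m \<epsilon> (0 + h) - flat m \<epsilon> 0) / h) \<le> norm h * (fact (m + 2) / \<epsilon> ^ (m + 2))"
        proof (cases "h = 0")
          case False
          have "\<bar>flat m \<epsilon> h\<bar> / \<bar>h\<bar> \<le> (fact (m + 2) / \<epsilon> ^ (m + 2) * h\<^sup>2) / \<bar>h\<bar>"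
            using flat_bound[OF e, of m h] by (intro divide_right_mono) auto
          also have "\<dots> = \<bar>h\<bar> * (fact (m + 2) / \<epsilon> ^ (m + 2))"
            using False by (simp add: power2_eq_square abs_if)
          finally show ?thesis by (simp add: flat_def abs_divide)
        qed simp
      qed
    qed (rule tendsto_ident_at)
    then have "(flat m \<epsilon> has_real_derivative 0) (at 0)" by (simp add: DERIV_def)
    with 2 show ?thesis by (simp add: flat_def)
  next
    case 3
    have "((\<lambda>x. exp (- \<epsilon> / x) / x ^ m) has_real_derivative \<epsilon> * flat (m + 2) \<epsilon> x - m * flat (m + 1) \<epsilon> x) (at x)"
      using 3 by (auto intro!: derivative_eq_intros simp: flat_def)
        (cases m; simp add: field_simps power2_eq_square)
    then show ?thesis
      by (rule has_field_derivative_transform_within_open[of _ _ _ "{0<..}"]) (use 3 in \<open>auto simp: flat_def\<close>)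
  qed
qed

text \<open>The index m is generalized because differentiation raises it. The affine argument is the
  one in which each coordinate enters a bump.\<close>

lemma Ck_flat_affine:
  assumes "\<epsilon> > 0"
  shows "Ck k (\<lambda>x::'a::euclidean_space. flat m \<epsilon> (s * (x \<bullet> i) + c))"
proof (induction k arbitrary: m)
  case 0
  have "continuous_on UNIV (flat m \<epsilon>)"
    using flat_has_derivative[OF assms] by (auto intro!: DERIV_continuous_on[where D="\<lambda>x. \<epsilon> * flat (m + 2) \<epsilon> x - m * flat (m + 1) \<epsilon> x"])
  then show ?case
    by (auto intro!: continuous_on_compose2[of UNIV "flat m \<epsilon>"] continuous_intros)
next
  case (Suc k)
  show ?case
  proof (rule Ck_SucI)
    fix x :: 'a
    have "((\<lambda>x. s * (x \<bullet> i) + c) has_derivative (\<lambda>h. s * (h \<bullet> i))) (at x)"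
      by (auto intro!: derivative_eq_intros)
    from has_derivative_compose[OF this flat_has_derivative[OF assms, of m "s * (x \<bullet> i) + c", unfolded has_field_derivative_def]]
    show "((\<lambda>x. flat m \<epsilon> (s * (x \<bullet> i) + c)) has_derivative
        (\<lambda>h. (\<epsilon> * flat (m + 2) \<epsilon> (s * (x \<bullet> i) + c) - m * flat (m + 1) \<epsilon> (s * (x \<bullet> i) + c)) * (s * (h \<bullet> i)))) (at x)" .
  next
    fix j :: 'a
    show "Ck k (\<lambda>x. (\<epsilon> * flat (m + 2) \<epsilon> (s * (x \<bullet> i) + c) - m * flat (m + 1) \<epsilon> (s * (x \<bullet> i) + c)) * (s * (j \<bullet> i)))"
      by (intro Ck_mult Ck_diff Ck_cmult Ck_const Suc.IH)
  qed
qed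

lemma flat_0_bounds: "\<epsilon> > 0 \<Longrightarrow> 0 \<le> flat 0 \<epsilon> x" "\<epsilon> > 0 \<Longrightarrow> flat 0 \<epsilon> x \<le> 1"
  by (auto simp: flat_def)

lemma flat_0_tendsto_1: "x > 0 \<Longrightarrow> (\<lambda>n. flat 0 (1 / real (Suc n)) x) \<longlonglongrightarrow> 1"
proof -
  assume x: "x > 0"
  have "(\<lambda>n. exp (- (1 / real (Suc n)) / x)) \<longlonglongrightarrow> exp (- 0 / x)"
    using LIMSEQ_inverse_real_of_nat
    by (intro tendsto_intros) (use x in \<open>auto simp: divide_inverse\<close>)
  with x show ?thesis by (simp add: flat_def)
qed

text \<open>The factors \<open>1\<close> and \<open>(-1)\<close> bring the arguments into the affine
  form of \<open>Ck_flat_affine\<close>. The parameter \<epsilon> is kept because its limit 0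
  produces the indicator of the open box.\<close>

definition bump :: "real \<Rightarrow> 'a::euclidean_space \<Rightarrow> 'a \<Rightarrow> 'a \<Rightarrow> real" where
  "bump \<epsilon> a b x = (\<Prod>i\<in>Basis. flat 0 \<epsilon> (1 * (x \<bullet> i) + - (a \<bullet> i)) * flat 0 \<epsilon> ((-1) * (x \<bullet> i) + b \<bullet> i))"

lemma Ck_bump: "\<epsilon> > 0 \<Longrightarrow> Ck k (bump \<epsilon> a b)"
  unfolding bump_def by (intro Ck_prod Ck_mult Ck_flat_affine)

lemma bump_outside: "x \<notin> box a b \<Longrightarrow> bump \<epsilon> a b x = 0"
proof -
  assume "x \<notin> box a b"
  then obtain i where i: "i \<in> Basis" "\<not> (a \<bullet> i < x \<bullet> i \<and> x \<bullet> i < b \<bullet> i)"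
    by (auto simp: mem_box)
  then have "flat 0 \<epsilon> (1 * (x \<bullet> i) + - (a \<bullet> i)) * flat 0 \<epsilon> ((-1) * (x \<bullet> i) + b \<bullet> i) = 0"
    by (auto simp: flat_def)
  with i(1) show ?thesis unfolding bump_def by (intro prod_zero) auto
qed

lemma bump_pos: "\<epsilon> > 0 \<Longrightarrow> x \<in> box a b \<Longrightarrow> 0 < bump \<epsilon> a b x"
  unfolding bump_def by (intro prod_pos) (auto simp: mem_box flat_def)

lemma bump_nonneg: "\<epsilon> > 0 \<Longrightarrow> 0 \<le> bump \<epsilon> a b x"
  unfolding bump_def by (intro prod_nonneg mult_nonneg_nonneg flat_0_bounds)

lemma bump_le_1: "\<epsilon> > 0 \<Longrightarrow> bump \<epsilon> a b x \<le> 1"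
  unfolding bump_def
  by (intro prod_le_1 conjI mult_nonneg_nonneg flat_0_bounds mult_le_one)

lemma bump_tendsto:
  fixes a b x :: "'a::euclidean_space"
  shows "(\<lambda>n. bump (1 / real (Suc n)) a b x) \<longlonglongrightarrow> indicator (box a b) x"
proof (cases "x \<in> box a b")
  case True
  have "(\<lambda>n. bump (1 / real (Suc n)) a b x) \<longlonglongrightarrow> (\<Prod>i\<in>(Basis::'a set). 1 * 1)"
    unfolding bump_def using True
    by (intro tendsto_prod tendsto_mult flat_0_tendsto_1) (auto simp: mem_box)
  with True show ?thesis by simp
qed (simp add: bump_outside)

lemma test_function_bump:
  assumes "\<epsilon> > 0" "cbox a b \<subseteq> \<Omega>"
  shows "test_function \<Omega> (bump \<epsilon> a b)"
  unfolding test_function_def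
proof (intro conjI exI[of _ "cbox a b"])
  show "\<forall>x. x \<notin> cbox a b \<longrightarrow> bump \<epsilon> a b x = 0"
    using box_subset_cbox[of a b] by (auto intro!: bump_outside)
qed (use assms in \<open>auto intro: Ck_bump\<close>)

section \<open>Operations on test functions\<close>

lemma test_function_add: "test_function \<Omega> \<phi> \<Longrightarrow> test_function \<Omega> \<psi> \<Longrightarrow> test_function \<Omega> (\<lambda>x. \<phi> x + \<psi> x)"
proof -
  assume a: "test_function \<Omega> \<phi>" "test_function \<Omega> \<psi>"
  then obtain K L where "compact K" "K \<subseteq> \<Omega>" "\<forall>x. x \<notin> K \<longrightarrow> \<phi> x = 0" "compact L" "L \<subseteq> \<Omega>" "\<forall>x. x \<notin> L \<longrightarrow> \<psi> x = 0"
    by (auto simp: test_function_def)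
  with a show ?thesis unfolding test_function_def
    by (intro conjI exI[of _ "K \<union> L"]) (auto intro: Ck_add)
qed

lemma test_function_cmult: "test_function \<Omega> \<phi> \<Longrightarrow> test_function \<Omega> (\<lambda>x. r * \<phi> x)"
  unfolding test_function_def by (auto intro: Ck_cmult)

lemma test_function_diff: "test_function \<Omega> \<phi> \<Longrightarrow> test_function \<Omega> \<psi> \<Longrightarrow> test_function \<Omega> (\<lambda>x. \<phi> x - \<psi> x)"
  using test_function_add[of \<Omega> \<phi> "\<lambda>x. -1 * \<psi> x"] test_function_cmult[of \<Omega> \<psi> "-1"] by simp

lemma test_function_mult: "test_function \<Omega> \<phi> \<Longrightarrow> (\<And>k. Ck k \<psi>) \<Longrightarrow> test_function \<Omega> (\<lambda>x. \<phi> x * \<psi> x)"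
  unfolding test_function_def by (force intro: Ck_mult)

lemma test_function_Ck: "test_function \<Omega> \<phi> \<Longrightarrow> Ck k \<phi>"
  by (simp add: test_function_def)

lemma test_function_continuous: "test_function \<Omega> \<phi> \<Longrightarrow> continuous_on S \<phi>"
  using test_function_Ck[of \<Omega> \<phi> 0] by (auto intro: continuous_on_subset)

lemma test_function_has_derivative:
  "test_function \<Omega> \<phi> \<Longrightarrow> (\<phi> has_derivative frechet_derivative \<phi> (at x)) (at x)"
  using test_function_Ck[of \<Omega> \<phi> "Suc 0"] Ck_Suc_has_derivative by blast

lemma frechet_derivative_zero_outside:
  assumes "compact K" "\<forall>x. x \<notin> K \<longrightarrow> \<phi> x = (0::real)" "x \<notin> K"
  shows "frechet_derivative \<phi> (at x) = (\<lambda>h. 0)"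
proof -
  have "((\<lambda>x. 0) has_derivative (\<lambda>h. 0)) (at x)" by simp
  then have "(\<phi> has_derivative (\<lambda>h. 0)) (at x)"
    by (rule has_derivative_transform_within_open[of _ _ _ _ "- K"])
      (use assms in \<open>auto intro: compact_imp_closed\<close>)
  then show ?thesis by (rule frechet_derivative_at[symmetric])
qed

lemma test_function_partial:
  "test_function \<Omega> \<phi> \<Longrightarrow> i \<in> Basis \<Longrightarrow> test_function \<Omega> (\<lambda>x. frechet_derivative \<phi> (at x) i)"
proof -
  assume a: "test_function \<Omega> \<phi>" and i: "i \<in> Basis"
  then obtain K where K: "compact K" "K \<subseteq> \<Omega>" "\<forall>x. x \<notin> K \<longrightarrow> \<phi> x = 0" by (auto simp: test_function_def)
  have "Ck k (\<lambda>x. frechet_derivative \<phi> (at x) i)" for k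
    using test_function_Ck[OF a, of "Suc k"] i by simp
  with K frechet_derivative_zero_outside[OF K(1,3)] show ?thesis
    unfolding test_function_def by auto
qed

lemma test_function_bounded:
  assumes "test_function \<Omega> \<phi>" obtains B where "\<And>x. \<bar>\<phi> x\<bar> \<le> B" "B > 0"
proof -
  obtain K where K: "compact K" "K \<subseteq> \<Omega>" "\<forall>x. x \<notin> K \<longrightarrow> \<phi> x = 0" using assms by (auto simp: test_function_def)
  have "compact (\<phi> ` K)" using K(1) test_function_continuous[OF assms] by (rule compact_continuous_image[rotated])
  then obtain B where "B > 0" "\<forall>y\<in>\<phi> ` K. norm y \<le> B" using compact_imp_bounded bounded_pos by metis
  with K(3) have "\<bar>\<phi> x\<bar> \<le> B" for x by (cases "x \<in> K") auto
  with \<open>B > 0\<close> that show thesis by blast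
qed

section \<open>Lebesgue integrals over subsets and the fundamental lemma of the calculus of
  variations\<close>

lemma integral_lebesgue_on_superset:
  fixes f :: "'a::euclidean_space \<Rightarrow> 'b::euclidean_space"
  assumes "K \<in> sets lebesgue" "S \<in> sets lebesgue" "K \<subseteq> S" "\<And>x. x \<notin> K \<Longrightarrow> f x = 0"
  shows "integral\<^sup>L (lebesgue_on S) f = integral\<^sup>L (lebesgue_on K) f"
proof -
  have "(\<lambda>x. if x \<in> S then f x else 0) = (\<lambda>x. if x \<in> K then f x else 0)"
    by (rule ext) (use assms(3,4) in auto)
  then show ?thesis
    using Lebesgue_Measure.integral_restrict_UNIV[OF assms(1), of f] Lebesgue_Measure.integral_restrict_UNIV[OF assms(2), of f] by simp
qed

lemma integrable_lebesgue_on_subset: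
  fixes f :: "'a::euclidean_space \<Rightarrow> 'b::euclidean_space"
  assumes "integrable (lebesgue_on S) f" "T \<subseteq> S" "S \<in> sets lebesgue" "T \<in> sets lebesgue"
  shows "integrable (lebesgue_on T) f"
  using assms set_integrable_subset[of lebesgue S f T]
  by (simp add: integrable_restrict_space set_integrable_def)

lemma integrable_lebesgue_on_superset:
  fixes f :: "'a::euclidean_space \<Rightarrow> 'b::euclidean_space"
  assumes "K \<in> sets lebesgue" "S \<in> sets lebesgue" "K \<subseteq> S" "\<And>x. x \<notin> K \<Longrightarrow> f x = 0"
  shows "integrable (lebesgue_on S) f \<longleftrightarrow> integrable (lebesgue_on K) f"
proof -
  have "(\<lambda>x. if x \<in> S then f x else 0) = (\<lambda>x. if x \<in> K then f x else 0)"
    by (rule ext) (use assms(3,4) in auto)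
  then show ?thesis
    using Lebesgue_Measure.integrable_restrict_UNIV[OF assms(1), of f] Lebesgue_Measure.integrable_restrict_UNIV[OF assms(2), of f] by simp
qed

text \<open>The bumps increase to the indicator of a box, so that all integrals over boxes vanish, and
  almost every point is a point of differentiability of the indefinite integral.\<close>

lemma integral_box_eq_0:
  fixes g :: "'a::euclidean_space \<Rightarrow> real"
  assumes "open \<Omega>" "locally_integrable_on \<Omega> g"
    "\<And>\<phi>. test_function \<Omega> \<phi> \<Longrightarrow> (LINT x|lebesgue_on \<Omega>. g x * \<phi> x) = 0"
    "cbox a b \<subseteq> \<Omega>"
  shows "integral (cbox a b) g = 0"
proof -
  have int: "integrable (lebesgue_on (cbox a b)) g"
    using assms(2,4) by (auto simp: locally_integrable_on_def)
  have [measurable]: "bump \<epsilon> a b \<in> borel_measurable (lebesgue_on (cbox a b))" if "\<epsilon> > 0" for \<epsilon>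
    using test_function_continuous[OF test_function_bump[OF that assms(4)]]
    by (intro continuous_imp_measurable_on_sets_lebesgue) auto
  have gm: "g \<in> borel_measurable (lebesgue_on (cbox a b))" using int by auto
  have z: "(LINT x|lebesgue_on (cbox a b). g x * bump (1 / real (Suc n)) a b x) = 0" for n
  proof -
    have "(LINT x|lebesgue_on \<Omega>. g x * bump (1 / real (Suc n)) a b x)
      = (LINT x|lebesgue_on (cbox a b). g x * bump (1 / real (Suc n)) a b x)"
    proof (rule integral_lebesgue_on_superset)
      show "g x * bump (1 / real (Suc n)) a b x = 0" if "x \<notin> cbox a b" for x
        using subsetD[OF box_subset_cbox[of a b]] that by (metis bump_outside mult_zero_right)
    qed (use assms in auto)
    with assms(3)[OF test_function_bump[of "1 / real (Suc n)", OF _ assms(4)]] show ?thesis by simp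
  qed
  have "(\<lambda>n. LINT x|lebesgue_on (cbox a b). g x * bump (1 / real (Suc n)) a b x)
     \<longlonglongrightarrow> (LINT x|lebesgue_on (cbox a b). g x * indicator (box a b) x)"
  proof (rule integral_dominated_convergence[where w="\<lambda>x. \<bar>g x\<bar>"])
    show "AE x in lebesgue_on (cbox a b). (\<lambda>n. g x * bump (1 / real (Suc n)) a b x) \<longlonglongrightarrow> g x * indicator (box a b) x"
      by (intro AE_I2 tendsto_mult tendsto_const bump_tendsto)
    show "AE x in lebesgue_on (cbox a b). norm (g x * bump (1 / real (Suc n)) a b x) \<le> \<bar>g x\<bar>" for n
      using bump_nonneg[of "1 / real (Suc n)" a b] bump_le_1[of "1 / real (Suc n)" a b]
      by (intro AE_I2) (simp add: abs_mult mult_left_le)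
    show "(\<lambda>x. g x * indicator (box a b) x) \<in> borel_measurable (lebesgue_on (cbox a b))"
      using gm box_subset_cbox[of a b]
      by (intro borel_measurable_times borel_measurable_indicator) (auto simp: sets_restrict_space_iff)
  qed (use int gm in auto)
  then have "(LINT x|lebesgue_on (cbox a b). g x * indicator (box a b) x) = 0"
    using z LIMSEQ_unique[OF _ tendsto_const] by auto
  moreover have "(LINT x|lebesgue_on (cbox a b). g x * indicator (box a b) x) = (LINT x|lebesgue_on (box a b). g x)"
    using Lebesgue_Measure.integral_restrict[of "box a b" "cbox a b" g] box_subset_cbox[of a b]
    by (simp add: indicator_def of_bool_def if_distrib[of "\<lambda>y. _ * y"] cong: if_cong)
  moreover have "integrable (lebesgue_on (box a b)) g"
    by (rule integrable_lebesgue_on_subset[OF int]) (auto simp: box_subset_cbox)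
  ultimately have "integral (box a b) g = 0"
    by (simp add: lebesgue_integral_eq_integral)
  then show ?thesis by (simp add: integral_open_interval)
qed


lemma AE_eq_0_on_cbox:
  fixes g :: "'a::euclidean_space \<Rightarrow> real"
  assumes "integrable (lebesgue_on (cbox c d)) g"
    "\<And>a b. cbox a b \<subseteq> cbox c d \<Longrightarrow> integral (cbox a b) g = 0"
  shows "AE x in lebesgue. x \<in> cbox c d \<longrightarrow> g x = 0"
proof -
  define f where "f x = (if x \<in> cbox c d then g x else 0)" for x
  have g_on: "g integrable_on cbox c d"
    using assms(1) by (intro integrable_on_lebesgue_on) auto
  then have "f integrable_on UNIV" unfolding f_def by (simp add: Henstock_Kurzweil_Integration.integrable_restrict_UNIV)
  then have "f integrable_on cbox a b" for a b by (rule integrable_on_subcbox) simp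
  from integrable_ccontinuous_explicit[OF this] obtain N where N: "negligible N"
    "\<And>x e. x \<notin> N \<Longrightarrow> 0 < e \<Longrightarrow> \<exists>r>0. \<forall>h. 0 < h \<and> h < r \<longrightarrow>
        norm (integral (cbox x (x + h *\<^sub>R One)) f /\<^sub>R h ^ DIM('a) - f x) < e" by blast
  have "g x = 0" if x: "x \<in> box c d" "x \<notin> N" for x
  proof (rule ccontr)
    assume "g x \<noteq> 0"
    then obtain r where r: "r > 0" "\<forall>h. 0 < h \<and> h < r \<longrightarrow>
        norm (integral (cbox x (x + h *\<^sub>R One)) f /\<^sub>R h ^ DIM('a) - f x) < \<bar>g x\<bar>"
      using N(2)[OF x(2), of "\<bar>g x\<bar>"] by auto
    \<comment> \<open>The least coordinate distance from x to the upper faces. The differentiation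
      theorem averages over cubes with lower corner x, and those of side at most \<open>D\<close>
      stay in the box.\<close>
    define D where "D = Min ((\<lambda>i. d \<bullet> i - x \<bullet> i) ` Basis)"
    have D: "D > 0" unfolding D_def using x(1) by (subst Min_gr_iff) (auto simp: mem_box)
    have Dle: "D \<le> d \<bullet> i - x \<bullet> i" if "i \<in> Basis" for i
      unfolding D_def using that by (intro Min_le) auto
    define h where "h = min (r / 2) D"
    have h: "0 < h" "h < r" "h \<le> D" using r(1) D by (auto simp: h_def)
    have sub: "cbox x (x + h *\<^sub>R One) \<subseteq> cbox c d"
      using x(1) Dle h(3)
      by (intro subset_box_imp(1)) (force simp: subset_box mem_box inner_add_left intro: less_imp_le)+
    have "integral (cbox x (x + h *\<^sub>R One)) f = integral (cbox x (x + h *\<^sub>R One)) g"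
      using sub by (intro integral_cong) (auto simp: f_def)
    with assms(2)[OF sub] r(2) h have "\<bar>f x\<bar> < \<bar>g x\<bar>" by auto
    moreover have "f x = g x" using x(1) box_subset_cbox[of c d] by (auto simp: f_def)
    ultimately show False by simp
  qed
  then have "{x. \<not> (x \<in> cbox c d \<longrightarrow> g x = 0)} \<subseteq> N \<union> (cbox c d - box c d)" by auto
  moreover have "negligible (N \<union> (cbox c d - box c d))"
    using N(1) negligible_frontier_interval[of c d] by auto
  ultimately show ?thesis
    unfolding negligible_iff_null_sets by (intro AE_I'[of "N \<union> (cbox c d - box c d)"]) auto
qed

text \<open>As g is integrable only on compact subsets, the conclusion is drawn on countably many
  closed boxes that exhaust \<Omega>.\<close>

lemma fundamental_lemma_variations:
  fixes g :: "'a::euclidean_space \<Rightarrow> real"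
  assumes "open \<Omega>" "locally_integrable_on \<Omega> g"
    "\<And>\<phi>. test_function \<Omega> \<phi> \<Longrightarrow> (LINT x|lebesgue_on \<Omega>. g x * \<phi> x) = 0"
  shows "AE x in lebesgue_on \<Omega>. g x = 0"
proof -
  obtain \<D> where D: "countable \<D>" "\<D> \<subseteq> Pow \<Omega>" "\<And>X. X \<in> \<D> \<Longrightarrow> \<exists>a b. X = cbox a b" "\<Union>\<D> = \<Omega>"
    using open_countable_Union_open_cbox[OF assms(1)] by metis
  have "AE x in lebesgue. \<forall>X\<in>\<D>. x \<in> X \<longrightarrow> g x = 0"
  proof (rule AE_ball_countable'[OF _ D(1)])
    fix X assume X: "X \<in> \<D>"
    then obtain a b where ab: "X = cbox a b" using D(3) by blast
    have sub: "cbox a b \<subseteq> \<Omega>" using X D(2) ab by blast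
    show "AE x in lebesgue. x \<in> X \<longrightarrow> g x = 0"
      unfolding ab
    proof (rule AE_eq_0_on_cbox)
      show "integrable (lebesgue_on (cbox a b)) g"
        using assms(2) sub by (auto simp: locally_integrable_on_def)
      show "integral (cbox a' b') g = 0" if "cbox a' b' \<subseteq> cbox a b" for a' b'
        by (rule integral_box_eq_0[OF assms]) (use that sub in auto)
    qed
  qed
  moreover have "\<Omega> \<in> sets lebesgue" using assms(1) by (simp add: sets_completionI_sets)
  ultimately show ?thesis
    by (subst AE_restrict_space_iff) (use D(4) in auto)
qed

section \<open>Weak gradients\<close>

lemma open_sets_lebesgue: "open \<Omega> \<Longrightarrow> \<Omega> \<in> sets lebesgue"
  by (simp add: sets_completionI_sets)

lemma compact_sets_lebesgue: "compact K \<Longrightarrow> K \<in> sets lebesgue"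
  by (simp add: sets_completionI_sets borel_compact)

lemma borel_measurable_imp_lebesgue_on:
  "f \<in> borel_measurable borel \<Longrightarrow> f \<in> borel_measurable (lebesgue_on S)"
  by (intro measurable_restrict_space1 measurable_completion) simp

text \<open>Completeness of Lebesgue measure. It carries measurability over from a given L2 gradient
  to the representative picked by \<open>weak_grad\<close>.\<close>

lemma borel_measurable_lebesgue_on_AE:
  fixes f :: "'a::euclidean_space \<Rightarrow> 'b::euclidean_space"
  assumes "f \<in> borel_measurable (lebesgue_on S)" "AE x in lebesgue_on S. f x = g x" "S \<in> sets lebesgue"
  shows "g \<in> borel_measurable (lebesgue_on S)"
proof -
  have "(\<lambda>x. if x \<in> S then g x else 0) \<in> borel_measurable lebesgue"
  proof (rule borel_measurable_AE)
    show "(\<lambda>x. if x \<in> S then f x else 0) \<in> borel_measurable lebesgue"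
      using assms(1,3) by (simp add: borel_measurable_if)
    show "AE x in lebesgue. (if x \<in> S then f x else 0) = (if x \<in> S then g x else 0)"
      using assms(2,3) by (auto simp: AE_restrict_space_iff)
  qed
  then show ?thesis using assms(3) by (simp add: borel_measurable_if)
qed

lemma integrable_test_mult:
  fixes g :: "'a::euclidean_space \<Rightarrow> real"
  assumes "open \<Omega>" "locally_integrable_on \<Omega> g" "test_function \<Omega> \<phi>"
  shows "integrable (lebesgue_on \<Omega>) (\<lambda>x. g x * \<phi> x)"
proof -
  obtain K where K: "compact K" "K \<subseteq> \<Omega>" "\<forall>x. x \<notin> K \<longrightarrow> \<phi> x = 0" using assms(3) by (auto simp: test_function_def)
  obtain B where B: "\<And>x. \<bar>\<phi> x\<bar> \<le> B" "B > 0" using test_function_bounded[OF assms(3)] by blast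
  have g: "integrable (lebesgue_on K) g" using assms(2) K by (auto simp: locally_integrable_on_def)
  have "integrable (lebesgue_on K) (\<lambda>x. g x * \<phi> x)"
  proof (rule Bochner_Integration.integrable_bound)
    show "integrable (lebesgue_on K) (\<lambda>x. B * \<bar>g x\<bar>)" using g by auto
    have "\<phi> \<in> borel_measurable (lebesgue_on K)"
      using test_function_continuous[OF assms(3)] K(1)
      by (intro continuous_imp_measurable_on_sets_lebesgue compact_sets_lebesgue)
    then show "(\<lambda>x. g x * \<phi> x) \<in> borel_measurable (lebesgue_on K)" using g by auto
    show "AE x in lebesgue_on K. norm (g x * \<phi> x) \<le> norm (B * \<bar>g x\<bar>)"
      using B by (intro AE_I2) (simp add: abs_mult mult.commute mult_right_mono)
  qed
  then show ?thesis
    by (subst integrable_lebesgue_on_superset[OF compact_sets_lebesgue[OF K(1)] open_sets_lebesgue[OF assms(1)] K(2)])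
      (use K(3) in auto)
qed

lemma integrable_square_imp_integrable_on_compact:
  fixes f :: "'a::euclidean_space \<Rightarrow> 'b::euclidean_space"
  assumes f: "f \<in> L2s (lebesgue_on \<Omega>)" and K: "compact K" "K \<subseteq> \<Omega>" and \<Omega>: "\<Omega> \<in> sets lebesgue"
  shows "integrable (lebesgue_on K) f"
proof (rule Bochner_Integration.integrable_bound)
  have "finite_measure (lebesgue_on K)"
    using K(1) by (intro finite_measure_lebesgue_on) (rule lmeasurable_compact)
  then have "integrable (lebesgue_on K) (\<lambda>x. 1::real)" by (simp add: finite_measure.integrable_const)
  moreover have "integrable (lebesgue_on K) (\<lambda>x. norm (f x) ^ 2)"
    by (rule integrable_lebesgue_on_subset[OF L2s_integrable[OF f] K(2) \<Omega> compact_sets_lebesgue[OF K(1)]])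
  ultimately show "integrable (lebesgue_on K) (\<lambda>x. 1 + norm (f x) ^ 2)" by auto
  show "f \<in> borel_measurable (lebesgue_on K)"
    using L2s_measurable[OF f] K(2) by (rule measurable_restrict_mono)
  have "norm (f x) \<le> 1 + norm (f x) ^ 2" for x
    using sum_squares_bound[of 1 "norm (f x)"] norm_ge_zero[of "f x"] unfolding power_one by linarith
  then show "AE x in lebesgue_on K. norm (f x) \<le> norm (1 + norm (f x) ^ 2)" by auto
qed

lemma L2s_locally_integrable:
  "f \<in> L2s (lebesgue_on \<Omega>) \<Longrightarrow> open \<Omega> \<Longrightarrow> locally_integrable_on \<Omega> f"
  unfolding locally_integrable_on_def
  by (auto intro: integrable_square_imp_integrable_on_compact open_sets_lebesgue)

lemma locally_integrable_inner: "locally_integrable_on \<Omega> g \<Longrightarrow> locally_integrable_on \<Omega> (\<lambda>x. g x \<bullet> i)"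
  unfolding locally_integrable_on_def by auto

section \<open>Linearity and uniqueness of weak gradients\<close>

lemma has_weak_gradient_add:
  assumes "open \<Omega>" "has_weak_gradient \<Omega> w g" "has_weak_gradient \<Omega> w' g'"
  shows "has_weak_gradient \<Omega> (\<lambda>x. w x + w' x) (\<lambda>x. g x + g' x)"
  unfolding has_weak_gradient_def
proof (intro conjI allI impI ballI)
  show "locally_integrable_on \<Omega> (\<lambda>x. w x + w' x)" "locally_integrable_on \<Omega> (\<lambda>x. g x + g' x)"
    using assms(2,3) by (auto simp: has_weak_gradient_def locally_integrable_on_def)
  fix \<phi> and i :: 'a assume a: "test_function \<Omega> \<phi>" "i \<in> Basis"
  have i: "integrable (lebesgue_on \<Omega>) (\<lambda>x. w x * frechet_derivative \<phi> (at x) i)" "integrable (lebesgue_on \<Omega>) (\<lambda>x. w' x * frechet_derivative \<phi> (at x) i)"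
    using assms a by (auto intro!: integrable_test_mult test_function_partial simp: has_weak_gradient_def)
  have j: "integrable (lebesgue_on \<Omega>) (\<lambda>x. (g x \<bullet> i) * \<phi> x)" "integrable (lebesgue_on \<Omega>) (\<lambda>x. (g' x \<bullet> i) * \<phi> x)"
    using assms a by (auto intro!: integrable_test_mult locally_integrable_inner simp: has_weak_gradient_def)
  show "(LINT x|lebesgue_on \<Omega>. (w x + w' x) * frechet_derivative \<phi> (at x) i) =
      - (LINT x|lebesgue_on \<Omega>. ((g x + g' x) \<bullet> i) * \<phi> x)"
    using i j assms(2,3) a by (simp add: has_weak_gradient_def distrib_right inner_add_left)
qed

lemma has_weak_gradient_cmult:
  assumes "has_weak_gradient \<Omega> w g"
  shows "has_weak_gradient \<Omega> (\<lambda>x. r * w x) (\<lambda>x. r *\<^sub>R g x)"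
  using assms unfolding has_weak_gradient_def locally_integrable_on_def
  by (auto simp: mult.assoc)

lemma has_weak_gradient_diff:
  assumes "open \<Omega>" "has_weak_gradient \<Omega> w g" "has_weak_gradient \<Omega> w' g'"
  shows "has_weak_gradient \<Omega> (\<lambda>x. w x - w' x) (\<lambda>x. g x - g' x)"
  using has_weak_gradient_add[OF assms(1,2) has_weak_gradient_cmult[OF assms(3), of "-1"]] by simp

text \<open>The difference of two weak gradients of one function is orthogonal to all test
  functions, component by component.\<close>

lemma has_weak_gradient_unique:
  assumes "open \<Omega>" "has_weak_gradient \<Omega> w g" "has_weak_gradient \<Omega> w g'"
  shows "AE x in lebesgue_on \<Omega>. g x = g' x"
proof -
  have d: "has_weak_gradient \<Omega> (\<lambda>x. w x - w x) (\<lambda>x. g x - g' x)"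
    by (rule has_weak_gradient_diff[OF assms])
  have "AE x in lebesgue_on \<Omega>. \<forall>i\<in>Basis. (g x - g' x) \<bullet> i = 0"
  proof (rule AE_finite_allI)
    fix i :: 'a assume i: "i \<in> Basis"
    show "AE x in lebesgue_on \<Omega>. (g x - g' x) \<bullet> i = 0"
    proof (rule fundamental_lemma_variations[OF assms(1)])
      show "locally_integrable_on \<Omega> (\<lambda>x. (g x - g' x) \<bullet> i)"
        using d by (intro locally_integrable_inner) (auto simp: has_weak_gradient_def)
      show "(LINT x|lebesgue_on \<Omega>. ((g x - g' x) \<bullet> i) * \<phi> x) = 0" if "test_function \<Omega> \<phi>" for \<phi>
        using d that i by (force simp: has_weak_gradient_def)
    qed
  qed simp
  then show ?thesis
    by eventually_elim (simp only: euclidean_all_zero_iff right_minus_eq)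
qed

text \<open>\<open>weak_grad\<close> picks any weak gradient, not a priori one in L2; uniqueness
  transfers square integrability from the one that membership in H1 provides.\<close>

lemma W1p_2_D:
  assumes "open \<Omega>" "w \<in> H1 \<Omega>"
  shows "w \<in> L2s (lebesgue_on \<Omega>)" "has_weak_gradient \<Omega> w (weak_grad \<Omega> w)"
    "weak_grad \<Omega> w \<in> L2s (lebesgue_on \<Omega>)"
proof -
  show "w \<in> L2s (lebesgue_on \<Omega>)" using assms(2) by (simp add: W1p_def Lp_2_eq_L2s)
  obtain g where g: "g \<in> L2s (lebesgue_on \<Omega>)" "has_weak_gradient \<Omega> w g"
    using assms(2) by (auto simp: W1p_def Lp_2_eq_L2s)
  then show h: "has_weak_gradient \<Omega> w (weak_grad \<Omega> w)" unfolding weak_grad_def by (metis someI)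
  have ae: "AE x in lebesgue_on \<Omega>. g x = weak_grad \<Omega> w x"
    by (rule has_weak_gradient_unique[OF assms(1) g(2) h])
  then have m: "weak_grad \<Omega> w \<in> borel_measurable (lebesgue_on \<Omega>)"
    by (rule borel_measurable_lebesgue_on_AE[OF L2s_measurable[OF g(1)] _ open_sets_lebesgue[OF assms(1)]])
  have "integrable (lebesgue_on \<Omega>) (\<lambda>x. norm (g x) ^ 2) \<longleftrightarrow> integrable (lebesgue_on \<Omega>) (\<lambda>x. norm (weak_grad \<Omega> w x) ^ 2)"
    using g(1) m ae by (intro integrable_cong_AE) (auto simp: L2s_def)
  then show "weak_grad \<Omega> w \<in> L2s (lebesgue_on \<Omega>)" using g(1) m by (simp add: L2s_def)
qed

lemma W1p_2_I:
  assumes "open \<Omega>" "w \<in> L2s (lebesgue_on \<Omega>)" "g \<in> L2s (lebesgue_on \<Omega>)" "has_weak_gradient \<Omega> w g"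
  shows "w \<in> H1 \<Omega>" "AE x in lebesgue_on \<Omega>. weak_grad \<Omega> w x = g x"
proof -
  show h: "w \<in> H1 \<Omega>" using assms by (auto simp: W1p_def Lp_2_eq_L2s)
  show "AE x in lebesgue_on \<Omega>. weak_grad \<Omega> w x = g x"
    by (rule has_weak_gradient_unique[OF assms(1) W1p_2_D(2)[OF assms(1) h] assms(4)])
qed

lemma H1_norm_power2: "(H1_norm \<Omega> w)\<^sup>2 = (l2 (lebesgue_on \<Omega>) w)\<^sup>2 + (l2 (lebesgue_on \<Omega>) (weak_grad \<Omega> w))\<^sup>2"
  unfolding W1p_norm_def by (simp add: Lp_norm_2_eq_l2 powr_two_eq_square powr_half_sqrt)

lemma H1_norm_nonneg: "0 \<le> H1_norm \<Omega> w"
  unfolding W1p_norm_def by simp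

lemma H1_norm_ge: "l2 (lebesgue_on \<Omega>) w \<le> H1_norm \<Omega> w" "l2 (lebesgue_on \<Omega>) (weak_grad \<Omega> w) \<le> H1_norm \<Omega> w"
  by (rule power2_le_imp_le; simp add: H1_norm_power2 H1_norm_nonneg)+

lemma H1_add:
  assumes "open \<Omega>" "v \<in> H1 \<Omega>" "w \<in> H1 \<Omega>"
  shows "(\<lambda>x. v x + w x) \<in> H1 \<Omega>" "AE x in lebesgue_on \<Omega>. weak_grad \<Omega> (\<lambda>x. v x + w x) x = weak_grad \<Omega> v x + weak_grad \<Omega> w x"
  using W1p_2_I[OF assms(1) L2s_add[OF W1p_2_D(1)[OF assms(1,2)] W1p_2_D(1)[OF assms(1,3)]]
      L2s_add[OF W1p_2_D(3)[OF assms(1,2)] W1p_2_D(3)[OF assms(1,3)]]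
      has_weak_gradient_add[OF assms(1) W1p_2_D(2)[OF assms(1,2)] W1p_2_D(2)[OF assms(1,3)]]] by auto

lemma H1_cmult:
  assumes "open \<Omega>" "v \<in> H1 \<Omega>"
  shows "(\<lambda>x. r * v x) \<in> H1 \<Omega>" "AE x in lebesgue_on \<Omega>. weak_grad \<Omega> (\<lambda>x. r * v x) x = r *\<^sub>R weak_grad \<Omega> v x"
  using W1p_2_I[OF assms(1) L2s_mult[OF W1p_2_D(1)[OF assms]] L2s_scaleR[OF W1p_2_D(3)[OF assms]]
      has_weak_gradient_cmult[OF W1p_2_D(2)[OF assms]]] by auto

lemma H1_diff:
  assumes "open \<Omega>" "v \<in> H1 \<Omega>" "w \<in> H1 \<Omega>"
  shows "(\<lambda>x. v x - w x) \<in> H1 \<Omega>" "AE x in lebesgue_on \<Omega>. weak_grad \<Omega> (\<lambda>x. v x - w x) x = weak_grad \<Omega> v x - weak_grad \<Omega> w x"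
  using W1p_2_I[OF assms(1) L2s_diff[OF W1p_2_D(1)[OF assms(1,2)] W1p_2_D(1)[OF assms(1,3)]]
      L2s_diff[OF W1p_2_D(3)[OF assms(1,2)] W1p_2_D(3)[OF assms(1,3)]]
      has_weak_gradient_diff[OF assms(1) W1p_2_D(2)[OF assms(1,2)] W1p_2_D(2)[OF assms(1,3)]]] by auto

lemma l2_weak_grad_eq:
  assumes "open \<Omega>" "w \<in> H1 \<Omega>" "g \<in> L2s (lebesgue_on \<Omega>)" "AE x in lebesgue_on \<Omega>. weak_grad \<Omega> w x = g x"
  shows "l2 (lebesgue_on \<Omega>) (weak_grad \<Omega> w) = l2 (lebesgue_on \<Omega>) g"
  by (rule l2_cong_AE[OF assms(4)]) (use W1p_2_D(3)[OF assms(1,2)] assms(3) in \<open>auto simp: L2s_def\<close>)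

lemma l2_weak_grad_diff:
  assumes "open \<Omega>" "v \<in> H1 \<Omega>" "w \<in> H1 \<Omega>"
  shows "l2 (lebesgue_on \<Omega>) (weak_grad \<Omega> (\<lambda>x. v x - w x)) = l2 (lebesgue_on \<Omega>) (\<lambda>x. weak_grad \<Omega> v x - weak_grad \<Omega> w x)"
  using assms by (intro l2_weak_grad_eq H1_diff L2s_diff W1p_2_D)

section \<open>Test functions as elements of \<open>H\<^sup>1\<^sub>0\<close>\<close>

text \<open>The gradient of a test function as a continuous function with pointwise rules of
  calculus; \<open>weak_grad\<close> of a test function is known to agree with it only almost
  everywhere.\<close>

definition cgrad :: "('a::euclidean_space \<Rightarrow> real) \<Rightarrow> 'a \<Rightarrow> 'a" where
  "cgrad \<phi> x = (\<Sum>i\<in>Basis. frechet_derivative \<phi> (at x) i *\<^sub>R i)"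

lemma cgrad_inner_Basis: "i \<in> Basis \<Longrightarrow> cgrad \<phi> x \<bullet> i = frechet_derivative \<phi> (at x) i"
  unfolding cgrad_def by (simp add: inner_sum_left inner_Basis if_distrib cong: if_cong)

lemma frechet_derivative_eq_cgrad:
  assumes "test_function \<Omega> \<phi>"
  shows "frechet_derivative \<phi> (at x) h = cgrad \<phi> x \<bullet> h"
proof -
  interpret bounded_linear "frechet_derivative \<phi> (at x)"
    using test_function_has_derivative[OF assms] by (rule has_derivative_bounded_linear)
  have "frechet_derivative \<phi> (at x) h = frechet_derivative \<phi> (at x) (\<Sum>i\<in>Basis. (h \<bullet> i) *\<^sub>R i)"
    by (simp add: euclidean_representation)
  also have "\<dots> = (\<Sum>i\<in>Basis. (h \<bullet> i) * frechet_derivative \<phi> (at x) i)"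
    by (simp add: sum scaleR)
  also have "\<dots> = cgrad \<phi> x \<bullet> h"
    unfolding cgrad_def by (simp add: inner_sum_left inner_commute[of h] mult.commute)
  finally show ?thesis .
qed

lemma continuous_on_cgrad: "test_function \<Omega> \<phi> \<Longrightarrow> continuous_on S (cgrad \<phi>)"
  unfolding cgrad_def
  by (intro continuous_intros test_function_continuous[OF test_function_partial])

lemma borel_measurable_test [measurable]: "test_function \<Omega> \<phi> \<Longrightarrow> \<phi> \<in> borel_measurable borel"
  by (intro borel_measurable_continuous_onI test_function_continuous)

lemma borel_measurable_cgrad [measurable]: "test_function \<Omega> \<phi> \<Longrightarrow> cgrad \<phi> \<in> borel_measurable borel"
  by (intro borel_measurable_continuous_onI continuous_on_cgrad)

lemma cgrad_outside:
  assumes "compact K" "\<forall>x. x \<notin> K \<longrightarrow> \<phi> x = 0" "x \<notin> K"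
  shows "cgrad \<phi> x = 0"
  unfolding cgrad_def by (simp add: frechet_derivative_zero_outside[OF assms])

section \<open>Translation invariance and integration by parts\<close>

lemma integrable_lborel_compact_support:
  fixes f :: "'a::euclidean_space \<Rightarrow> 'b::euclidean_space"
  assumes "continuous_on UNIV f" "compact K" "\<And>x. x \<notin> K \<Longrightarrow> f x = 0"
  shows "integrable lborel f"
proof -
  have "integrable lborel (\<lambda>x. indicator K x *\<^sub>R f x)"
    using assms(1,2) by (intro borel_integrable_compact continuous_on_subset[OF assms(1)]) auto
  moreover have "(\<lambda>x. indicator K x *\<^sub>R f x) = f" using assms(3) by (auto simp: indicator_def fun_eq_iff)
  ultimately show ?thesis by simp
qed

lemma integral_lebesgue_on_eq_lborel:
  fixes f :: "'a::euclidean_space \<Rightarrow> 'b::euclidean_space"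
  assumes "f \<in> borel_measurable borel" "\<Omega> \<in> sets lebesgue" "\<And>x. x \<notin> \<Omega> \<Longrightarrow> f x = 0"
  shows "integral\<^sup>L (lebesgue_on \<Omega>) f = integral\<^sup>L lborel f"
    "integrable (lebesgue_on \<Omega>) f \<longleftrightarrow> integrable lborel f"
proof -
  have "(\<lambda>x. if x \<in> \<Omega> then f x else 0) = f" using assms(3) by auto
  then show "integral\<^sup>L (lebesgue_on \<Omega>) f = integral\<^sup>L lborel f" "integrable (lebesgue_on \<Omega>) f \<longleftrightarrow> integrable lborel f"
    using Lebesgue_Measure.integral_restrict_UNIV[OF assms(2), of f] Lebesgue_Measure.integrable_restrict_UNIV[OF assms(2), of f]
      assms(1) by (simp_all add: integral_completion integrable_completion)
qed

lemma lborel_translate: "distr lborel borel (\<lambda>x. t + x) = (lborel :: 'a::euclidean_space measure)"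
  using lborel_affine[of 1 t] by (simp add: density_1)

lemma lborel_integral_translate:
  fixes f :: "'a::euclidean_space \<Rightarrow> real"
  assumes [measurable]: "f \<in> borel_measurable borel"
  shows "(LINT x|lborel. f (t + x)) = integral\<^sup>L lborel f"
  by (subst (2) lborel_translate[of t, symmetric]) (simp add: integral_distr)

lemma integrable_lborel_translate:
  fixes f :: "'a::euclidean_space \<Rightarrow> real"
  assumes [measurable]: "f \<in> borel_measurable borel" and "integrable lborel f"
  shows "integrable lborel (\<lambda>x. f (t + x))"
  using assms(2) by (subst (asm) lborel_translate[of t, symmetric]) (simp add: integrable_distr_eq)

lemma nn_integral_lborel_translate:
  fixes f :: "'a::euclidean_space \<Rightarrow> ennreal"
  assumes [measurable]: "f \<in> borel_measurable borel"
  shows "(\<integral>\<^sup>+x. f (t + x) \<partial>lborel) = integral\<^sup>N lborel f"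
  by (subst (2) lborel_translate[of t, symmetric]) (simp add: nn_integral_distr)

lemma test_function_has_derivative_line:
  assumes "test_function \<Omega> \<phi>"
  shows "((\<lambda>s. \<phi> (x + s *\<^sub>R h)) has_real_derivative cgrad \<phi> (x + s *\<^sub>R h) \<bullet> h) (at s)"
proof -
  have "((\<lambda>s. x + s *\<^sub>R h) has_derivative (\<lambda>d. d *\<^sub>R h)) (at s)"
    by (auto intro!: derivative_eq_intros)
  from has_derivative_compose[OF this test_function_has_derivative[OF assms]]
  show ?thesis
    unfolding has_field_derivative_def
    by (rule has_derivative_eq_rhs) (auto simp: frechet_derivative_eq_cgrad[OF assms] mult.commute)
qed

text \<open>A difference quotient has integral 0 by translation invariance of Lebesgue measure, and
  dominated convergence passes to the derivative.\<close>

lemma integral_partial_eq_0: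
  assumes \<phi>: "test_function \<Omega> \<phi>" and i: "i \<in> Basis"
  shows "(LINT x|lborel. frechet_derivative \<phi> (at x) i) = 0"
proof -
  obtain K where K: "compact K" "K \<subseteq> \<Omega>" "\<forall>x. x \<notin> K \<longrightarrow> \<phi> x = 0" using \<phi> by (auto simp: test_function_def)
  obtain R where R: "\<And>x. x \<in> K \<Longrightarrow> norm x \<le> R" using compact_imp_bounded[OF K(1)] by (auto simp: bounded_iff)
  obtain B where B: "\<And>x. \<bar>frechet_derivative \<phi> (at x) i\<bar> \<le> B" "B > 0"
    using test_function_bounded[OF test_function_partial[OF \<phi> i]] by blast
  define t where "t n = 1 / real (Suc n)" for n
  have t: "0 < t n" "t n \<le> 1" for n by (auto simp: t_def)
  have t0: "t \<longlonglongrightarrow> 0" unfolding t_def using LIMSEQ_inverse_real_of_nat by (simp add: divide_inverse)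
  define d where "d n x = (\<phi> (t n *\<^sub>R i + x) - \<phi> x) / t n" for n x
  have [measurable]: "\<phi> \<in> borel_measurable borel" using \<phi> by (rule borel_measurable_test)
  have int: "integrable lborel \<phi>"
    using K by (intro integrable_lborel_compact_support[of \<phi> K] test_function_continuous[OF \<phi>]) auto
  have pm [measurable]: "(\<lambda>x. frechet_derivative \<phi> (at x) i) \<in> borel_measurable borel"
    by (rule borel_measurable_test[OF test_function_partial[OF \<phi> i]])
  have d0: "integral\<^sup>L lborel (d n) = 0" for n
    unfolding d_def using int integrable_lborel_translate[of \<phi> "t n *\<^sub>R i"]
    by (simp add: lborel_integral_translate)
  \<comment> \<open>By the mean value theorem the difference quotients are bounded by the supremum
    of the partial derivative, uniformly in n.\<close>
  have lip: "\<bar>d n x\<bar> \<le> B" for n x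
  proof -
    obtain z where "\<phi> (x + t n *\<^sub>R i) - \<phi> (x + 0 *\<^sub>R i) = (t n - 0) * (cgrad \<phi> (x + z *\<^sub>R i) \<bullet> i)"
      using MVT2[of 0 "t n" "\<lambda>s. \<phi> (x + s *\<^sub>R i)" "\<lambda>s. cgrad \<phi> (x + s *\<^sub>R i) \<bullet> i"]
        test_function_has_derivative_line[OF \<phi>] t by blast
    then have "d n x = cgrad \<phi> (x + z *\<^sub>R i) \<bullet> i"
      unfolding d_def using t(1)[of n] by (simp add: add.commute field_simps)
    then show ?thesis using B(1) i by (simp add: cgrad_inner_Basis)
  qed
  have "(\<lambda>n. integral\<^sup>L lborel (d n)) \<longlonglongrightarrow> (LINT x|lborel. frechet_derivative \<phi> (at x) i)"
  \<comment> \<open>Since \<open>t n \<le> 1\<close>, all difference quotients vanish outside the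
    ball of radius \<open>R + 1\<close>.\<close>
  proof (rule integral_dominated_convergence[where w="\<lambda>x. B * indicator (cball 0 (R + 1)) x"])
    show "integrable lborel (\<lambda>x. B * indicator (cball 0 (R + 1)) x)"
      by (intro integrable_mult_right integrable_real_indicator emeasure_bounded_finite) auto
    show "d n \<in> borel_measurable lborel" for n unfolding d_def by measurable
    show "AE x in lborel. (\<lambda>n. d n x) \<longlonglongrightarrow> frechet_derivative \<phi> (at x) i"
    proof (intro AE_I2)
      fix x
      have "((\<lambda>h. (\<phi> (x + (0 + h) *\<^sub>R i) - \<phi> (x + 0 *\<^sub>R i)) / h) \<longlongrightarrow> cgrad \<phi> (x + 0 *\<^sub>R i) \<bullet> i) (at 0)"
        using test_function_has_derivative_line[OF \<phi>, of x i 0] unfolding DERIV_def .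
      moreover have "filterlim t (at 0) sequentially"
        using t0 t(1) by (intro filterlim_atI) (auto intro!: always_eventually simp: less_imp_neq[symmetric])
      ultimately have "((\<lambda>n. (\<phi> (x + (0 + t n) *\<^sub>R i) - \<phi> (x + 0 *\<^sub>R i)) / t n) \<longlongrightarrow> cgrad \<phi> (x + 0 *\<^sub>R i) \<bullet> i) sequentially"
        by (rule filterlim_compose)
      then show "(\<lambda>n. d n x) \<longlonglongrightarrow> frechet_derivative \<phi> (at x) i"
        using i by (simp add: d_def cgrad_inner_Basis add.commute)
    qed
    show "AE x in lborel. norm (d n x) \<le> B * indicator (cball 0 (R + 1)) x" for n
    proof (intro AE_I2)
      fix x
      show "norm (d n x) \<le> B * indicator (cball 0 (R + 1)) x"
      proof (cases "x \<in> cball 0 (R + 1)")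
        case False
        have "norm x \<le> norm (t n *\<^sub>R i + x) + norm (t n *\<^sub>R i)"
          using norm_triangle_ineq4[of "t n *\<^sub>R i + x" "t n *\<^sub>R i"] by simp
        then have "t n *\<^sub>R i + x \<notin> K" "x \<notin> K" using False R[of x] R[of "t n *\<^sub>R i + x"] t(1,2)[of n] i
          by (auto simp: dist_norm)
        then show ?thesis using False K(3) by (simp add: d_def)
      qed (use lip in simp)
    qed
  qed measurable
  then show ?thesis using d0 LIMSEQ_unique[OF _ tendsto_const] by auto
qed

lemma frechet_derivative_mult_test:
  assumes "test_function \<Omega> \<phi>" "test_function \<Omega> \<psi>"
  shows "frechet_derivative (\<lambda>x. \<phi> x * \<psi> x) (at x) i
    = \<phi> x * frechet_derivative \<psi> (at x) i + frechet_derivative \<phi> (at x) i * \<psi> x"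
  using frechet_derivative_at[OF has_derivative_mult[OF test_function_has_derivative[OF assms(1)] test_function_has_derivative[OF assms(2)]], symmetric]
  by simp

lemma test_function_outside: "test_function \<Omega> \<phi> \<Longrightarrow> x \<notin> \<Omega> \<Longrightarrow> \<phi> x = 0"
  unfolding test_function_def by auto

lemma test_function_integrable: "test_function \<Omega> \<phi> \<Longrightarrow> integrable lborel \<phi>"
  using integrable_lborel_compact_support[of \<phi>] test_function_continuous[of \<Omega> \<phi> UNIV]
  unfolding test_function_def by blast

lemma test_function_L2s:
  assumes \<phi>: "test_function \<Omega> \<phi>" and \<Omega>: "open \<Omega>"
  shows "\<phi> \<in> L2s (lebesgue_on \<Omega>)" "cgrad \<phi> \<in> L2s (lebesgue_on \<Omega>)"
    "\<phi> \<in> L2s lborel" "cgrad \<phi> \<in> L2s lborel"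
    "l2 (lebesgue_on \<Omega>) \<phi> = l2 lborel \<phi>" "l2 (lebesgue_on \<Omega>) (cgrad \<phi>) = l2 lborel (cgrad \<phi>)"
proof -
  obtain K where K: "compact K" "K \<subseteq> \<Omega>" "\<forall>x. x \<notin> K \<longrightarrow> \<phi> x = 0" using \<phi> by (auto simp: test_function_def)
  have m [measurable]: "\<phi> \<in> borel_measurable borel" "cgrad \<phi> \<in> borel_measurable borel"
    using \<phi> by (auto intro: borel_measurable_test borel_measurable_cgrad)
  have i: "integrable lborel (\<lambda>x. norm (\<phi> x) ^ 2)" "integrable lborel (\<lambda>x. norm (cgrad \<phi> x) ^ 2)"
    using K cgrad_outside[OF K(1,3)]
    by (auto intro!: integrable_lborel_compact_support[of _ K] continuous_intros test_function_continuous[OF \<phi>] continuous_on_cgrad[OF \<phi>])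
  have o: "\<phi> x = 0" "cgrad \<phi> x = 0" if "x \<notin> \<Omega>" for x using that K cgrad_outside[OF K(1,3)] by auto
  note eq = integral_lebesgue_on_eq_lborel[of "\<lambda>x. norm (\<phi> x) ^ 2" \<Omega>, OF _ open_sets_lebesgue[OF \<Omega>]]
    integral_lebesgue_on_eq_lborel[of "\<lambda>x. norm (cgrad \<phi> x) ^ 2" \<Omega>, OF _ open_sets_lebesgue[OF \<Omega>]]

  show "\<phi> \<in> L2s (lebesgue_on \<Omega>)" "cgrad \<phi> \<in> L2s (lebesgue_on \<Omega>)"
    "\<phi> \<in> L2s lborel" "cgrad \<phi> \<in> L2s lborel"
    using eq i o m by (auto simp: L2s_def borel_measurable_imp_lebesgue_on)
  show "l2 (lebesgue_on \<Omega>) \<phi> = l2 lborel \<phi>" "l2 (lebesgue_on \<Omega>) (cgrad \<phi>) = l2 lborel (cgrad \<phi>)"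
    using eq(1,3) o by (simp_all add: l2_def)
qed

text \<open>Integration by parts: the product of two test functions is again one, so its partial
  derivative has integral 0.\<close>

lemma test_function_has_weak_gradient:
  assumes \<phi>: "test_function \<Omega> \<phi>" and \<Omega>: "open \<Omega>"
  shows "has_weak_gradient \<Omega> \<phi> (cgrad \<phi>)"
  unfolding has_weak_gradient_def
proof (intro conjI allI impI ballI)
  show l: "locally_integrable_on \<Omega> \<phi>" "locally_integrable_on \<Omega> (cgrad \<phi>)"
    using test_function_L2s[OF assms] \<Omega> by (auto intro: L2s_locally_integrable)
  fix \<psi> and i :: 'a assume \<psi>: "test_function \<Omega> \<psi>" and i: "i \<in> Basis"
  have p: "test_function \<Omega> (\<lambda>x. \<phi> x * \<psi> x)" by (rule test_function_mult[OF \<phi> test_function_Ck[OF \<psi>]])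
  have q: "test_function \<Omega> (\<lambda>x. frechet_derivative (\<lambda>x. \<phi> x * \<psi> x) (at x) i)" by (rule test_function_partial[OF p i])
  have "0 = (LINT x|lebesgue_on \<Omega>. frechet_derivative (\<lambda>x. \<phi> x * \<psi> x) (at x) i)"
    using integral_partial_eq_0[OF p i] integral_lebesgue_on_eq_lborel(1)[OF borel_measurable_test[OF q] open_sets_lebesgue[OF \<Omega>] test_function_outside[OF q]]
    by simp
  also have "\<dots> = (LINT x|lebesgue_on \<Omega>. \<phi> x * frechet_derivative \<psi> (at x) i + (cgrad \<phi> x \<bullet> i) * \<psi> x)"
    by (simp add: frechet_derivative_mult_test[OF \<phi> \<psi>] cgrad_inner_Basis[OF i])
  also have "\<dots> = (LINT x|lebesgue_on \<Omega>. \<phi> x * frechet_derivative \<psi> (at x) i) + (LINT x|lebesgue_on \<Omega>. (cgrad \<phi> x \<bullet> i) * \<psi> x)"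
    by (intro Bochner_Integration.integral_add integrable_test_mult[OF \<Omega>] l locally_integrable_inner test_function_partial \<psi> i)
  finally show "(LINT x|lebesgue_on \<Omega>. \<phi> x * frechet_derivative \<psi> (at x) i) = - (LINT x|lebesgue_on \<Omega>. (cgrad \<phi> x \<bullet> i) * \<psi> x)"
    by simp
qed

lemma test_function_H1:
  assumes \<phi>: "test_function \<Omega> \<phi>" and \<Omega>: "open \<Omega>"
  shows "\<phi> \<in> H1 \<Omega>" "AE x in lebesgue_on \<Omega>. weak_grad \<Omega> \<phi> x = cgrad \<phi> x"
  using W1p_2_I[OF \<Omega> test_function_L2s(1,2)[OF assms] test_function_has_weak_gradient[OF assms]] by auto

lemma l2_weak_grad_test_diff:
  assumes "open \<Omega>" "test_function \<Omega> \<phi>" "w \<in> H1 \<Omega>"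
  shows "l2 (lebesgue_on \<Omega>) (weak_grad \<Omega> (\<lambda>x. \<phi> x - w x)) = l2 (lebesgue_on \<Omega>) (\<lambda>x. cgrad \<phi> x - weak_grad \<Omega> w x)"
proof (rule l2_weak_grad_eq)
  note h = test_function_H1[OF assms(2,1)]
  show "(\<lambda>x. \<phi> x - w x) \<in> H1 \<Omega>" by (rule H1_diff[OF assms(1) h(1) assms(3)])
  show "(\<lambda>x. cgrad \<phi> x - weak_grad \<Omega> w x) \<in> L2s (lebesgue_on \<Omega>)"
    by (intro L2s_diff test_function_L2s[OF assms(2,1)] W1p_2_D[OF assms(1,3)])
  show "AE x in lebesgue_on \<Omega>. weak_grad \<Omega> (\<lambda>x. \<phi> x - w x) x = cgrad \<phi> x - weak_grad \<Omega> w x"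
    using H1_diff(2)[OF assms(1) h(1) assms(3)] h(2) by eventually_elim simp
qed (rule assms(1))

text \<open>Separating the two L2 parts of the H1 norm and writing \<open>cgrad\<close> for the
  gradient of the approximants turns the later density arguments into limits in L2.\<close>

lemma H10_iff:
  assumes "open \<Omega>"
  shows "w \<in> H10 \<Omega> \<longleftrightarrow> w \<in> H1 \<Omega> \<and> (\<exists>\<phi>. (\<forall>n::nat. test_function \<Omega> (\<phi> n)) \<and>
     (\<lambda>n. l2 (lebesgue_on \<Omega>) (\<lambda>x. \<phi> n x - w x)) \<longlonglongrightarrow> 0 \<and>
     (\<lambda>n. l2 (lebesgue_on \<Omega>) (\<lambda>x. cgrad (\<phi> n) x - weak_grad \<Omega> w x)) \<longlonglongrightarrow> 0)"
proof -
  have "(\<lambda>n. H1_norm \<Omega> (\<lambda>x. \<phi> n x - w x)) \<longlonglongrightarrow> 0 \<longleftrightarrow>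
     (\<lambda>n. l2 (lebesgue_on \<Omega>) (\<lambda>x. \<phi> n x - w x)) \<longlonglongrightarrow> 0 \<and>
     (\<lambda>n. l2 (lebesgue_on \<Omega>) (\<lambda>x. cgrad (\<phi> n) x - weak_grad \<Omega> w x)) \<longlonglongrightarrow> 0"
    if w: "w \<in> H1 \<Omega>" and \<phi>: "\<And>n. test_function \<Omega> (\<phi> n)" for \<phi>
  proof safe
    assume l: "(\<lambda>n. H1_norm \<Omega> (\<lambda>x. \<phi> n x - w x)) \<longlonglongrightarrow> 0"
    show "(\<lambda>n. l2 (lebesgue_on \<Omega>) (\<lambda>x. \<phi> n x - w x)) \<longlonglongrightarrow> 0"
      by (rule tendsto_0_le[OF l, of _ 1]) (simp add: H1_norm_ge H1_norm_nonneg)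
    show "(\<lambda>n. l2 (lebesgue_on \<Omega>) (\<lambda>x. cgrad (\<phi> n) x - weak_grad \<Omega> w x)) \<longlonglongrightarrow> 0"
      unfolding l2_weak_grad_test_diff[OF assms \<phi> w, symmetric]
      by (rule tendsto_0_le[OF l, of _ 1]) (simp add: H1_norm_ge H1_norm_nonneg)
  next
    assume "(\<lambda>n. l2 (lebesgue_on \<Omega>) (\<lambda>x. \<phi> n x - w x)) \<longlonglongrightarrow> 0"
      "(\<lambda>n. l2 (lebesgue_on \<Omega>) (\<lambda>x. cgrad (\<phi> n) x - weak_grad \<Omega> w x)) \<longlonglongrightarrow> 0"
    from tendsto_real_sqrt[OF tendsto_add[OF tendsto_power[OF this(1), of 2] tendsto_power[OF this(2), of 2]]]
    have "(\<lambda>n. sqrt ((H1_norm \<Omega> (\<lambda>x. \<phi> n x - w x))\<^sup>2)) \<longlonglongrightarrow> 0"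
      unfolding H1_norm_power2 l2_weak_grad_test_diff[OF assms \<phi> w] by simp
    then show "(\<lambda>n. H1_norm \<Omega> (\<lambda>x. \<phi> n x - w x)) \<longlonglongrightarrow> 0"
      by (simp add: H1_norm_nonneg)
  qed
  then show ?thesis unfolding H10_def by blast
qed

section \<open>Linear combinations in the space H10\<close>

lemma cgrad_add:
  assumes "test_function \<Omega> \<phi>" "test_function \<Omega> \<psi>"
  shows "cgrad (\<lambda>x. \<phi> x + \<psi> x) x = cgrad \<phi> x + cgrad \<psi> x"
  using frechet_derivative_at[OF has_derivative_add[OF test_function_has_derivative[OF assms(1)] test_function_has_derivative[OF assms(2)]], symmetric]
  unfolding cgrad_def by (simp add: scaleR_left_distrib sum.distrib)

lemma cgrad_cmult:
  assumes "test_function \<Omega> \<phi>"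
  shows "cgrad (\<lambda>x. r * \<phi> x) x = r *\<^sub>R cgrad \<phi> x"
  using frechet_derivative_at[OF has_derivative_mult_right[OF test_function_has_derivative[OF assms(1)]], symmetric]
  unfolding cgrad_def by (simp add: scaleR_sum_right)

lemma cgrad_diff:
  assumes "test_function \<Omega> \<phi>" "test_function \<Omega> \<psi>"
  shows "cgrad (\<lambda>x. \<phi> x - \<psi> x) x = cgrad \<phi> x - cgrad \<psi> x"
  using cgrad_add[OF assms(1) test_function_cmult[OF assms(2)], of "-1"] cgrad_cmult[OF assms(2), of "-1"] by simp

text \<open>The combination has the form in which a minimizer of the Rayleigh quotient is
  varied.\<close>

lemma H10_add_cmult:
  assumes \<Omega>: "open \<Omega>" and v: "v \<in> H10 \<Omega>" and w: "w \<in> H10 \<Omega>"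
  shows "(\<lambda>x. v x + r * w x) \<in> H10 \<Omega>"
proof -
  have h: "v \<in> H1 \<Omega>" "w \<in> H1 \<Omega>" using v w by (auto simp: H10_def)
  obtain \<phi> where \<phi>: "\<And>n. test_function \<Omega> (\<phi> n)" 
    "(\<lambda>n. l2 (lebesgue_on \<Omega>) (\<lambda>x. \<phi> n x - v x)) \<longlonglongrightarrow> 0"
    "(\<lambda>n. l2 (lebesgue_on \<Omega>) (\<lambda>x. cgrad (\<phi> n) x - weak_grad \<Omega> v x)) \<longlonglongrightarrow> 0"
    using v unfolding H10_iff[OF \<Omega>] by blast
  obtain \<psi> where \<psi>: "\<And>n. test_function \<Omega> (\<psi> n)" 
    "(\<lambda>n. l2 (lebesgue_on \<Omega>) (\<lambda>x. \<psi> n x - w x)) \<longlonglongrightarrow> 0"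
    "(\<lambda>n. l2 (lebesgue_on \<Omega>) (\<lambda>x. cgrad (\<psi> n) x - weak_grad \<Omega> w x)) \<longlonglongrightarrow> 0"
    using w unfolding H10_iff[OF \<Omega>] by blast
  note g = W1p_2_D[OF \<Omega> h(1)] W1p_2_D[OF \<Omega> h(2)]
  note t = test_function_L2s[OF \<phi>(1) \<Omega>] test_function_L2s[OF \<psi>(1) \<Omega>]
  have r: "(\<lambda>x. r * w x) \<in> H1 \<Omega>" by (rule H1_cmult[OF \<Omega> h(2)])
  have s: "(\<lambda>x. v x + r * w x) \<in> H1 \<Omega>" by (rule H1_add[OF \<Omega> h(1) r])
  have ae: "AE x in lebesgue_on \<Omega>. weak_grad \<Omega> (\<lambda>x. v x + r * w x) x = weak_grad \<Omega> v x + r *\<^sub>R weak_grad \<Omega> w x"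
    using H1_add(2)[OF \<Omega> h(1) r] H1_cmult(2)[OF \<Omega> h(2), of r] by eventually_elim simp
  show ?thesis
    unfolding H10_iff[OF \<Omega>]
  proof (intro conjI s exI[of _ "\<lambda>n x. \<phi> n x + r * \<psi> n x"] allI)
    show tt: "test_function \<Omega> (\<lambda>x. \<phi> n x + r * \<psi> n x)" for n
      by (intro test_function_add test_function_cmult \<phi> \<psi>)
    show "(\<lambda>n. l2 (lebesgue_on \<Omega>) (\<lambda>x. \<phi> n x + r * \<psi> n x - (v x + r * w x))) \<longlonglongrightarrow> 0"
    proof (rule tendsto_sandwich[OF _ _ tendsto_const])
      show "(\<lambda>n. l2 (lebesgue_on \<Omega>) (\<lambda>x. \<phi> n x - v x) + \<bar>r\<bar> * l2 (lebesgue_on \<Omega>) (\<lambda>x. \<psi> n x - w x)) \<longlonglongrightarrow> 0"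
        using tendsto_add[OF \<phi>(2) tendsto_mult[OF tendsto_const \<psi>(2)]] by simp
      have "l2 (lebesgue_on \<Omega>) (\<lambda>x. \<phi> n x + r * \<psi> n x - (v x + r * w x))
        \<le> l2 (lebesgue_on \<Omega>) (\<lambda>x. \<phi> n x - v x) + l2 (lebesgue_on \<Omega>) (\<lambda>x. r * (\<psi> n x - w x))" for n
        using l2_triangle[OF L2s_diff[OF t(1) g(1)] L2s_mult[OF L2s_diff[OF t(7) g(4)]], of n r n]
        by (simp add: algebra_simps)
      then show "\<forall>\<^sub>F n in sequentially. l2 (lebesgue_on \<Omega>) (\<lambda>x. \<phi> n x + r * \<psi> n x - (v x + r * w x))
        \<le> l2 (lebesgue_on \<Omega>) (\<lambda>x. \<phi> n x - v x) + \<bar>r\<bar> * l2 (lebesgue_on \<Omega>) (\<lambda>x. \<psi> n x - w x)"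
        by (simp add: l2_mult)
    qed simp
    show "(\<lambda>n. l2 (lebesgue_on \<Omega>) (\<lambda>x. cgrad (\<lambda>x. \<phi> n x + r * \<psi> n x) x - weak_grad \<Omega> (\<lambda>x. v x + r * w x) x)) \<longlonglongrightarrow> 0"
    proof (rule tendsto_sandwich[OF _ _ tendsto_const])
      show "(\<lambda>n. l2 (lebesgue_on \<Omega>) (\<lambda>x. cgrad (\<phi> n) x - weak_grad \<Omega> v x) + \<bar>r\<bar> * l2 (lebesgue_on \<Omega>) (\<lambda>x. cgrad (\<psi> n) x - weak_grad \<Omega> w x)) \<longlonglongrightarrow> 0"
        using tendsto_add[OF \<phi>(3) tendsto_mult[OF tendsto_const \<psi>(3)]] by simp
      have "l2 (lebesgue_on \<Omega>) (\<lambda>x. cgrad (\<lambda>x. \<phi> n x + r * \<psi> n x) x - weak_grad \<Omega> (\<lambda>x. v x + r * w x) x)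
        \<le> l2 (lebesgue_on \<Omega>) (\<lambda>x. cgrad (\<phi> n) x - weak_grad \<Omega> v x) + l2 (lebesgue_on \<Omega>) (\<lambda>x. r *\<^sub>R (cgrad (\<psi> n) x - weak_grad \<Omega> w x))" for n
      proof -
        have "cgrad (\<lambda>x. \<phi> n x + r * \<psi> n x) x = cgrad (\<phi> n) x + r *\<^sub>R cgrad (\<psi> n) x" for x
          by (simp add: cgrad_add[OF \<phi>(1) test_function_cmult[OF \<psi>(1)]] cgrad_cmult[OF \<psi>(1)])
        moreover have "l2 (lebesgue_on \<Omega>) (\<lambda>x. cgrad (\<lambda>x. \<phi> n x + r * \<psi> n x) x - weak_grad \<Omega> (\<lambda>x. v x + r * w x) x)
           = l2 (lebesgue_on \<Omega>) (\<lambda>x. cgrad (\<lambda>x. \<phi> n x + r * \<psi> n x) x - (weak_grad \<Omega> v x + r *\<^sub>R weak_grad \<Omega> w x))"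
          using L2s_measurable[OF test_function_L2s(2)[OF tt \<Omega>]] L2s_measurable[OF W1p_2_D(3)[OF \<Omega> s]] L2s_measurable[OF g(3)] L2s_measurable[OF g(6)]
          by (intro l2_cong_AE borel_measurable_diff borel_measurable_add borel_measurable_scaleR borel_measurable_const) (use ae in auto)
        ultimately show ?thesis
          using l2_triangle[OF L2s_diff[OF t(2) g(3)] L2s_scaleR[OF L2s_diff[OF t(8) g(6)]], of n r n]
          by (simp add: algebra_simps)
      qed
      then show "\<forall>\<^sub>F n in sequentially. l2 (lebesgue_on \<Omega>) (\<lambda>x. cgrad (\<lambda>x. \<phi> n x + r * \<psi> n x) x - weak_grad \<Omega> (\<lambda>x. v x + r * w x) x)
        \<le> l2 (lebesgue_on \<Omega>) (\<lambda>x. cgrad (\<phi> n) x - weak_grad \<Omega> v x) + \<bar>r\<bar> * l2 (lebesgue_on \<Omega>) (\<lambda>x. cgrad (\<psi> n) x - weak_grad \<Omega> w x)"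
        by (simp add: l2_scaleR)
    qed simp
  qed
qed

section \<open>Poincare and Friedrichs inequalities\<close>

text \<open>The variance of f on the unit interval is nonnegative.\<close>

lemma square_integral_le_integral_square:
  fixes f :: "real \<Rightarrow> real"
  assumes "continuous_on {0..1} f"
  shows "(integral {0..1} f)\<^sup>2 \<le> integral {0..1} (\<lambda>t. (f t)\<^sup>2)"
proof -
  define m where "m = integral {0..1} f"
  have i: "f integrable_on {0..1}" "(\<lambda>t. (f t)\<^sup>2) integrable_on {0..1}"
    using assms by (auto intro!: integrable_continuous_real continuous_intros)
  have "0 \<le> integral {0..1} (\<lambda>t. (f t - m)\<^sup>2)"
    by (rule integral_nonneg) (auto intro!: integrable_continuous_real continuous_intros assms)
  also have "integral {0..1} (\<lambda>t. (f t - m)\<^sup>2) = integral {0..1} (\<lambda>t. (f t)\<^sup>2 - 2 * m * f t + m\<^sup>2)"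
    by (intro integral_cong) (simp add: power2_eq_square algebra_simps)
  also have "\<dots> = integral {0..1} (\<lambda>t. (f t)\<^sup>2) - 2 * m * m + m\<^sup>2"
  proof (rule integral_unique)
    have "((\<lambda>t::real. m\<^sup>2) has_integral m\<^sup>2) {0..1}" using has_integral_const_real[of "m\<^sup>2" 0 1] by simp
    then show "((\<lambda>t. (f t)\<^sup>2 - 2 * m * f t + m\<^sup>2) has_integral (integral {0..1} (\<lambda>t. (f t)\<^sup>2) - 2 * m * m + m\<^sup>2)) {0..1}"
      using i[THEN integrable_integral] m_def
      by (intro has_integral_add has_integral_diff has_integral_mult_right) auto
  qed
  finally show ?thesis unfolding m_def by (simp add: power2_eq_square)
qed

text \<open>The fundamental theorem of calculus along the segment from x to x + h, followed by
  Jensen's inequality. The bound is a nonnegative integral over the line so that Tonelli's theorem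
  applies to it next.\<close>

lemma test_function_increment_le:
  assumes \<phi>: "test_function \<Omega> \<phi>"
  shows "ennreal ((\<phi> (x + h) - \<phi> x)\<^sup>2) \<le> (\<integral>\<^sup>+t. ennreal ((cgrad \<phi> (x + t *\<^sub>R h) \<bullet> h)\<^sup>2) * indicator {0..1} t \<partial>lborel)"
proof -
  define f where "f t = cgrad \<phi> (x + t *\<^sub>R h) \<bullet> h" for t
  have c: "continuous_on S f" for S unfolding f_def
    by (intro continuous_intros continuous_on_compose2[OF continuous_on_cgrad[OF \<phi>, of UNIV]]) auto
  have "(f has_integral (\<phi> (x + 1 *\<^sub>R h) - \<phi> (x + 0 *\<^sub>R h))) {0..1}"
    unfolding f_def
    by (intro fundamental_theorem_of_calculus)
      (auto intro!: has_field_derivative_at_within test_function_has_derivative_line[OF \<phi>]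
        simp: has_real_derivative_iff_has_vector_derivative[symmetric])
  then have "\<phi> (x + h) - \<phi> x = integral {0..1} f" by (simp add: integral_unique)
  then have "(\<phi> (x + h) - \<phi> x)\<^sup>2 \<le> integral {0..1} (\<lambda>t. (f t)\<^sup>2)"
    using square_integral_le_integral_square[OF c] by simp
  then have "ennreal ((\<phi> (x + h) - \<phi> x)\<^sup>2) \<le> ennreal (integral {0..1} (\<lambda>t. (f t)\<^sup>2))"
    by (rule ennreal_leI)
  also have "\<dots> = (\<integral>\<^sup>+t. ennreal ((f t)\<^sup>2) * indicator {0..1} t \<partial>lborel)"
    by (rule nn_integral_has_integral_lebesgue'[symmetric])
      (auto intro!: integrable_integral integrable_continuous_real continuous_intros c)
  finally show ?thesis unfolding f_def .
qed

text \<open>By Tonelli's theorem each point t of the segment contributes a translate of the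
  gradient, and all translates have the same norm.\<close>

lemma test_function_translation_estimate:
  fixes \<phi> :: "'a::euclidean_space \<Rightarrow> real"
  assumes \<phi>: "test_function \<Omega> \<phi>" and \<Omega>: "open \<Omega>"
  shows "(\<integral>\<^sup>+x. ennreal ((\<phi> (x + h) - \<phi> x)\<^sup>2) \<partial>lborel) \<le> ennreal ((norm h * l2 lborel (cgrad \<phi>))\<^sup>2)"
proof -
  have [measurable]: "\<phi> \<in> borel_measurable borel" "cgrad \<phi> \<in> borel_measurable borel"
    using \<phi> by (auto intro: borel_measurable_test borel_measurable_cgrad)
  have "(\<integral>\<^sup>+x. ennreal ((\<phi> (x + h) - \<phi> x)\<^sup>2) \<partial>lborel)
    \<le> (\<integral>\<^sup>+x. \<integral>\<^sup>+t. ennreal ((cgrad \<phi> (x + t *\<^sub>R h) \<bullet> h)\<^sup>2) * indicator {0..1} t \<partial>(lborel::real measure) \<partial>lborel)"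
    by (intro nn_integral_mono test_function_increment_le[OF \<phi>])
  also have "\<dots> = (\<integral>\<^sup>+t. \<integral>\<^sup>+x. ennreal ((cgrad \<phi> (x + t *\<^sub>R h) \<bullet> h)\<^sup>2) * indicator {0..1} t \<partial>lborel \<partial>(lborel::real measure))"
    by (rule lborel_pair.Fubini'[symmetric]) measurable
  also have "\<dots> \<le> (\<integral>\<^sup>+t. ennreal ((norm h * l2 lborel (cgrad \<phi>))\<^sup>2) * indicator {0..1} t \<partial>(lborel::real measure))"
  proof (rule nn_integral_mono)
    fix t :: real
    have "(\<integral>\<^sup>+x. ennreal ((cgrad \<phi> (x + t *\<^sub>R h) \<bullet> h)\<^sup>2) \<partial>lborel) = (\<integral>\<^sup>+x. ennreal ((cgrad \<phi> x \<bullet> h)\<^sup>2) \<partial>lborel)"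
      using nn_integral_lborel_translate[of "\<lambda>x. ennreal ((cgrad \<phi> x \<bullet> h)\<^sup>2)" "t *\<^sub>R h"]
      by (simp add: add.commute)
    also have "\<dots> \<le> (\<integral>\<^sup>+x. ennreal ((norm h)\<^sup>2) * ennreal (norm (cgrad \<phi> x) ^ 2) \<partial>lborel)"
    proof (rule nn_integral_mono)
      fix x
      have "\<bar>cgrad \<phi> x \<bullet> h\<bar>\<^sup>2 \<le> (norm (cgrad \<phi> x) * norm h)\<^sup>2"
        by (intro power_mono Cauchy_Schwarz_ineq2) simp
      then show "ennreal ((cgrad \<phi> x \<bullet> h)\<^sup>2) \<le> ennreal ((norm h)\<^sup>2) * ennreal (norm (cgrad \<phi> x) ^ 2)"
        by (simp add: ennreal_mult[symmetric] power_mult_distrib mult.commute)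
    qed
    also have "\<dots> = ennreal ((norm h * l2 lborel (cgrad \<phi>))\<^sup>2)"
      using nn_integral_norm2_eq_l2[OF test_function_L2s(4)[OF \<phi> \<Omega>]]
      by (simp add: nn_integral_cmult ennreal_mult power_mult_distrib)
    finally show "(\<integral>\<^sup>+x. ennreal ((cgrad \<phi> (x + t *\<^sub>R h) \<bullet> h)\<^sup>2) * indicator {0..1} t \<partial>lborel)
      \<le> ennreal ((norm h * l2 lborel (cgrad \<phi>))\<^sup>2) * indicator {0..1} t"
      by (simp add: nn_integral_multc mult_right_mono)
  qed
  also have "\<dots> = ennreal ((norm h * l2 lborel (cgrad \<phi>))\<^sup>2)"
    by (simp add: nn_integral_cmult)
  finally show ?thesis .
qed

text \<open>A translation by more than the diameter of the support separates the two terms of the increment.\<close>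

lemma test_function_Poincare:
  fixes \<phi> :: "'a::euclidean_space \<Rightarrow> real"
  assumes \<phi>: "test_function \<Omega> \<phi>" and \<Omega>: "open \<Omega>" and R: "\<Omega> \<subseteq> ball 0 R" "R > 0"
  shows "l2 lborel \<phi> \<le> 2 * R * l2 lborel (cgrad \<phi>)"
proof -
  obtain e :: 'a where e: "e \<in> Basis" using nonempty_Basis by blast
  define h where "h = (2 * R) *\<^sub>R e"
  have h: "norm h = 2 * R" using e R(2) by (simp add: h_def)
  have [measurable]: "\<phi> \<in> borel_measurable borel"
    using \<phi> by (auto intro: borel_measurable_test)
  have "(\<integral>\<^sup>+x. ennreal ((\<phi> x)\<^sup>2) \<partial>lborel) \<le> (\<integral>\<^sup>+x. ennreal ((\<phi> (x + h) - \<phi> x)\<^sup>2) \<partial>lborel)"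
  proof -
    have *: "ennreal ((\<phi> (x + h) - \<phi> x)\<^sup>2) = ennreal ((\<phi> (h + x))\<^sup>2) + ennreal ((\<phi> x)\<^sup>2)" for x
    proof -
      have "\<phi> (x + h) = 0 \<or> \<phi> x = 0"
      proof (rule ccontr)
        assume "\<not> ?thesis"
        then have "x + h \<in> ball 0 R" "x \<in> ball 0 R" using test_function_outside[OF \<phi>] R by blast+
        then show False using norm_triangle_ineq4[of "x + h" x] h by simp
      qed
      then show ?thesis by (auto simp: ennreal_plus[symmetric] add.commute simp del: ennreal_plus)
    qed
    show ?thesis unfolding * by (intro nn_integral_mono) simp
  qed
  also have "\<dots> \<le> ennreal ((2 * R * l2 lborel (cgrad \<phi>))\<^sup>2)"
    using test_function_translation_estimate[OF \<phi> \<Omega>, of h] h by simp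
  finally have "ennreal ((l2 lborel \<phi>)\<^sup>2) \<le> ennreal ((2 * R * l2 lborel (cgrad \<phi>))\<^sup>2)"
    using nn_integral_norm2_eq_l2[OF test_function_L2s(3)[OF \<phi> \<Omega>]] by simp
  then have "(l2 lborel \<phi>)\<^sup>2 \<le> (2 * R * l2 lborel (cgrad \<phi>))\<^sup>2"
    by (simp add: ennreal_le_iff)
  then show ?thesis by (rule power2_le_imp_le) (use R(2) in simp)
qed

text \<open>Half-open cubes of side \<delta>, indexed by integer coordinates. Restriction to
  \<open>Basis\<close> makes the index extensional, so that the cells meeting a bounded set are
  indexed within a finite \<open>PiE\<close>.\<close>

definition cell :: "real \<Rightarrow> 'a::euclidean_space \<Rightarrow> 'a \<Rightarrow> int" where
  "cell \<delta> x = (\<lambda>i\<in>Basis. \<lfloor>(x \<bullet> i) / \<delta>\<rfloor>)"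

lemma cell_eq_iff:
  assumes "k \<in> extensional Basis"
  shows "cell \<delta> x = k \<longleftrightarrow> (\<forall>i\<in>Basis. \<lfloor>(x \<bullet> i) / \<delta>\<rfloor> = k i)"
  using assms unfolding cell_def by (auto simp: fun_eq_iff restrict_def extensional_def)

lemma cell_vimage_sets [measurable]: "{x. cell \<delta> x = k} \<in> sets (borel :: 'a::euclidean_space measure)"
proof (cases "k \<in> extensional Basis")
  case True
  have "{x::'a. cell \<delta> x = k} = (\<Inter>i\<in>Basis. {x. \<lfloor>(x \<bullet> i) / \<delta>\<rfloor> = k i})"
    by (auto simp: cell_eq_iff[OF True])
  also have "\<dots> \<in> sets borel" by (intro sets.finite_INT) auto
  finally show ?thesis .
next
  case False
  then have "{x::'a. cell \<delta> x = k} = {}" by (auto simp: cell_def)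
  then show ?thesis by simp
qed

text \<open>The half-open cube lies between an open and a closed box of the same volume.\<close>

lemma emeasure_cell:
  assumes "\<delta> > 0" "k \<in> extensional (Basis :: 'a::euclidean_space set)"
  shows "emeasure lborel {x::'a. cell \<delta> x = k} = ennreal (\<delta> ^ DIM('a))"
proof (rule antisym)
  define a where "a = (\<Sum>i\<in>(Basis::'a set). (\<delta> * k i) *\<^sub>R i)"
  define b where "b = (\<Sum>i\<in>(Basis::'a set). (\<delta> * (k i + 1)) *\<^sub>R i)"
  have ab: "a \<bullet> i = \<delta> * k i" "b \<bullet> i = \<delta> * (k i + 1)" if "i \<in> Basis" for i
    using that by (auto simp: a_def b_def)
  have m: "emeasure lborel (cbox a b) = ennreal (\<delta> ^ DIM('a))" "emeasure lborel (box a b) = ennreal (\<delta> ^ DIM('a))"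
    using assms(1) by (simp_all add: ab inner_diff_left algebra_simps emeasure_lborel_cbox_eq emeasure_lborel_box_eq)
  have *: "\<lfloor>y / \<delta>\<rfloor> = j \<longleftrightarrow> \<delta> * j \<le> y \<and> y < \<delta> * (j + 1)" for y :: real and j :: int
    using assms(1) by (auto simp: floor_eq_iff field_simps)
  have "{x. cell \<delta> x = k} \<subseteq> cbox a b"
    unfolding cell_eq_iff[OF assms(2)] * by (auto simp: mem_box ab) (meson less_imp_le)
  then show "emeasure lborel {x. cell \<delta> x = k} \<le> ennreal (\<delta> ^ DIM('a))"
    using emeasure_mono[of _ "cbox a b" lborel] m(1) by simp
  have "box a b \<subseteq> {x. cell \<delta> x = k}"
    unfolding cell_eq_iff[OF assms(2)] * by (auto simp: mem_box ab intro: less_imp_le)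
  then show "ennreal (\<delta> ^ DIM('a)) \<le> emeasure lborel {x. cell \<delta> x = k}"
    using emeasure_mono[of "box a b" _ lborel] m(2) by simp
qed

lemma cell_eq_imp_close:
  fixes x y :: "'a::euclidean_space"
  assumes "\<delta> > 0" "cell \<delta> x = cell \<delta> y" "i \<in> Basis"
  shows "\<bar>(y - x) \<bullet> i\<bar> \<le> \<delta>"
proof -
  have "\<lfloor>(x \<bullet> i) / \<delta>\<rfloor> = \<lfloor>(y \<bullet> i) / \<delta>\<rfloor>"
    using fun_cong[OF assms(2), of i] assms(3) by (simp add: cell_def)
  then have "\<bar>(x \<bullet> i) / \<delta> - (y \<bullet> i) / \<delta>\<bar> \<le> 1" by linarith
  then show ?thesis using assms(1) by (simp add: inner_diff_left diff_divide_distrib[symmetric] abs_minus_commute pos_divide_le_eq)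
qed

text \<open>Cauchy-Schwarz for \<phi> cut off to A against the indicator of A.\<close>

lemma square_integral_indicator_le:
  fixes \<phi> :: "'a::euclidean_space \<Rightarrow> real"
  assumes \<phi>: "\<phi> \<in> L2s lborel" and A: "A \<in> sets borel" "emeasure lborel A = ennreal c" "c \<ge> 0"
  shows "(LINT x|lborel. indicator A x * \<phi> x)\<^sup>2 \<le> c * (LINT x|lborel. indicator A x * (\<phi> x)\<^sup>2)"
proof -
  have [measurable]: "\<phi> \<in> borel_measurable borel" using L2s_measurable[OF \<phi>] by simp
  note [measurable] = A(1)
  have "(\<lambda>x. norm (indicator A x * \<phi> x) ^ 2) = (\<lambda>x. indicator A x *\<^sub>R (\<phi> x)\<^sup>2)"
    by (auto simp: indicator_def)
  then have a: "(\<lambda>x. indicator A x * \<phi> x) \<in> L2s lborel"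
    using integrable_mult_indicator[of A lborel "\<lambda>x. (\<phi> x)\<^sup>2"] L2s_integrable[OF \<phi>] by (simp add: L2s_def)
  have "(\<lambda>x. norm (indicator A x :: real) ^ 2) = indicator A"
    by (auto simp: indicator_def)
  then have b: "(indicator A :: 'a \<Rightarrow> real) \<in> L2s lborel" using A(2) by (simp add: L2s_def)
  have "(ip lborel (\<lambda>x. indicator A x * \<phi> x) (indicator A))\<^sup>2 \<le> (l2 lborel (\<lambda>x. indicator A x * \<phi> x) * l2 lborel (indicator A :: 'a \<Rightarrow> real))\<^sup>2"
    using power_mono[OF ip_Cauchy_Schwarz[OF a b], of 2] by simp
  moreover have "ip lborel (\<lambda>x. indicator A x * \<phi> x) (indicator A) = (LINT x|lborel. indicator A x * \<phi> x)"
    unfolding ip_def by (intro Bochner_Integration.integral_cong) (auto simp: indicator_def)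
  moreover have "(l2 lborel (\<lambda>x. indicator A x * \<phi> x))\<^sup>2 = (LINT x|lborel. indicator A x * (\<phi> x)\<^sup>2)"
    unfolding l2_power2 by (intro Bochner_Integration.integral_cong) (auto simp: indicator_def)
  moreover have "(l2 lborel (indicator A :: 'a \<Rightarrow> real))\<^sup>2 = (LINT x|lborel. indicator A x)"
    unfolding l2_power2 by (intro Bochner_Integration.integral_cong) (auto simp: indicator_def)
  moreover have "(LINT x|lborel. indicator A x) = c"
    using A(2,3) by (simp add: measure_def)
  ultimately show ?thesis by (simp add: power_mult_distrib mult.commute)
qed

text \<open>Both sides are twice the squared volume of A times the variance of \<phi> on A. The
  double integral over pairs is the form in which the substitution y = x + h brings in the
  translation estimate.\<close>

lemma variance_on_cell:
  fixes \<phi> :: "'a::euclidean_space \<Rightarrow> real"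
  assumes m: "\<phi> \<in> borel_measurable borel" "A \<in> sets borel"
    and int: "integrable lborel \<phi>" "integrable lborel (\<lambda>x. (\<phi> x)\<^sup>2)"
    and em: "emeasure lborel A = ennreal c" "c \<ge> 0"
  shows "(\<integral>\<^sup>+x. \<integral>\<^sup>+y. ennreal ((\<phi> x - \<phi> y)\<^sup>2) * (indicator A x * indicator A y) \<partial>lborel \<partial>lborel)
    = ennreal (2 * (c * (LINT x|lborel. indicator A x * (\<phi> x)\<^sup>2) - (LINT x|lborel. indicator A x * \<phi> x)\<^sup>2))"
proof -
  define I where "I = (LINT x|lborel. indicator A x * \<phi> x)"
  define J where "J = (LINT x|lborel. indicator A x * (\<phi> x)\<^sup>2)"
  define D where "D x = c * (\<phi> x)\<^sup>2 - 2 * \<phi> x * I + J" for x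
  note [measurable] = m
  have iA: "integrable lborel (indicator A :: 'a \<Rightarrow> real)" "(LINT x|lborel. indicator A x) = c"
    using em by (auto intro!: integrable_real_indicator simp: measure_def)
  have i1: "integrable lborel (\<lambda>x. indicator A x * \<phi> x)" "integrable lborel (\<lambda>x. indicator A x * (\<phi> x)\<^sup>2)"
    using integrable_mult_indicator[of A lborel \<phi>] integrable_mult_indicator[of A lborel "\<lambda>x. (\<phi> x)\<^sup>2"] int by auto
  have e1: "(\<lambda>y. indicator A y * (\<phi> x - \<phi> y)\<^sup>2) = (\<lambda>y. indicator A y * (\<phi> x)\<^sup>2 - 2 * \<phi> x * (indicator A y * \<phi> y) + indicator A y * (\<phi> y)\<^sup>2)" for x
    by (rule ext) (simp add: power2_eq_square algebra_simps)
  have i2: "integrable lborel (\<lambda>y. indicator A y * (\<phi> x - \<phi> y)\<^sup>2)" for x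
    unfolding e1 using iA i1 by auto
  have l2: "(LINT y|lborel. indicator A y * (\<phi> x - \<phi> y)\<^sup>2) = D x" for x
    unfolding e1 D_def I_def J_def using iA i1 by (simp add: mult.commute[of c])
  have D0: "0 \<le> D x" for x unfolding l2[symmetric] by (intro integral_nonneg_AE) auto
  have inner: "(\<integral>\<^sup>+y. ennreal ((\<phi> x - \<phi> y)\<^sup>2) * (indicator A x * indicator A y) \<partial>lborel) = ennreal (indicator A x * D x)" for x
  proof -
    have "(\<integral>\<^sup>+y. ennreal ((\<phi> x - \<phi> y)\<^sup>2) * (indicator A x * indicator A y) \<partial>lborel)
       = indicator A x * (\<integral>\<^sup>+y. ennreal (indicator A y * (\<phi> x - \<phi> y)\<^sup>2) \<partial>lborel)"
      by (subst nn_integral_cmult[symmetric]) (auto intro!: nn_integral_cong simp: indicator_def)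
    also have "(\<integral>\<^sup>+y. ennreal (indicator A y * (\<phi> x - \<phi> y)\<^sup>2) \<partial>lborel) = ennreal (D x)"
      unfolding l2[symmetric] using i2 by (intro nn_integral_eq_integral) auto
    finally show ?thesis by (auto simp: indicator_def)
  qed
  have e3: "(\<lambda>x. indicator A x * D x) = (\<lambda>x. c * (indicator A x * (\<phi> x)\<^sup>2) - 2 * I * (indicator A x * \<phi> x) + J * indicator A x)"
    unfolding D_def by (rule ext) (simp add: algebra_simps)
  have i3: "integrable lborel (\<lambda>x. indicator A x * D x)" unfolding e3 using iA i1 by auto
  have l3: "(LINT x|lborel. indicator A x * D x) = 2 * (c * J - I\<^sup>2)"
  proof -
    have "(LINT x|lborel. indicator A x * D x) = c * J - 2 * I * I + J * c"
      unfolding e3 using iA i1 by (simp add: I_def[symmetric] J_def[symmetric])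
    then show ?thesis by (simp add: power2_eq_square algebra_simps)
  qed
  show ?thesis
    unfolding inner I_def[symmetric] J_def[symmetric] l3[symmetric]
    using i3 D0 by (intro nn_integral_eq_integral) auto
qed

text \<open>On each cell the square integral splits into the squared integral over the volume and a
  variance term. Two points of a cell differ by a vector h with coordinates at most \<delta> in
  absolute value, so all variances together are bounded by the translation estimate integrated over
  such h. With n the dimension, |h|^2 is at most n \<delta>^2, the cube of all h has volume
  (2\<delta>)^n, and division by the cell volume \<delta>^n leaves 2^n n \<delta>^2.\<close>

lemma Friedrichs_cells:
  fixes \<phi> :: "'a::euclidean_space \<Rightarrow> real"
  assumes \<phi>: "test_function \<Omega> \<phi>" and \<Omega>: "open \<Omega>" and \<delta>: "\<delta> > 0"
    and I: "finite I" "I \<subseteq> extensional Basis" "\<And>x. x \<in> \<Omega> \<Longrightarrow> cell \<delta> x \<in> I"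
  shows "(l2 lborel \<phi>)\<^sup>2 \<le> (\<Sum>k\<in>I. (LINT x|lborel. indicator {x. cell \<delta> x = k} x * \<phi> x)\<^sup>2) / \<delta> ^ DIM('a)
     + 2 ^ DIM('a) * real DIM('a) * \<delta>\<^sup>2 * (l2 lborel (cgrad \<phi>))\<^sup>2"
proof -
  let ?n = "DIM('a)"
  define G where "G = (l2 lborel (cgrad \<phi>))\<^sup>2"
  define C where "C = cbox (- \<delta> *\<^sub>R One) (\<delta> *\<^sub>R One :: 'a)"
  define Q where "Q k = {x::'a. cell \<delta> x = k}" for k
  have m [measurable]: "\<phi> \<in> borel_measurable borel" using \<phi> by (rule borel_measurable_test)
  have [measurable]: "Q k \<in> sets borel" for k unfolding Q_def by (rule cell_vimage_sets)
  have int: "integrable lborel \<phi>" "integrable lborel (\<lambda>x. (\<phi> x)\<^sup>2)"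
    using test_function_integrable[OF \<phi>] L2s_integrable[OF test_function_L2s(3)[OF \<phi> \<Omega>]] by auto
  have em: "emeasure lborel (Q k) = ennreal (\<delta> ^ ?n)" if "k \<in> I" for k
    unfolding Q_def using that I(2) \<delta> by (intro emeasure_cell) auto
  define J where "J k = (LINT x|lborel. indicator (Q k) x * (\<phi> x)\<^sup>2)" for k
  define i where "i k = (LINT x|lborel. indicator (Q k) x * \<phi> x)" for k
  have var: "(\<integral>\<^sup>+x. \<integral>\<^sup>+y. ennreal ((\<phi> x - \<phi> y)\<^sup>2) * (indicator (Q k) x * indicator (Q k) y) \<partial>lborel \<partial>lborel)
      = ennreal (2 * (\<delta> ^ ?n * J k - (i k)\<^sup>2))" if "k \<in> I" for k
    unfolding J_def i_def using \<delta> by (intro variance_on_cell m int em[OF that]) auto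
  have nonneg: "0 \<le> 2 * (\<delta> ^ ?n * J k - (i k)\<^sup>2)" if "k \<in> I" for k
  proof -
    have "(i k)\<^sup>2 \<le> \<delta> ^ ?n * J k"
      unfolding i_def J_def using \<delta>
      by (intro square_integral_indicator_le test_function_L2s(3)[OF \<phi> \<Omega>] em[OF that]) auto
    then show ?thesis by simp
  qed
  have "ennreal (\<Sum>k\<in>I. 2 * (\<delta> ^ ?n * J k - (i k)\<^sup>2)) = (\<Sum>k\<in>I. ennreal (2 * (\<delta> ^ ?n * J k - (i k)\<^sup>2)))"
    using nonneg by (simp add: sum_ennreal)
  also have "\<dots> = (\<Sum>k\<in>I. \<integral>\<^sup>+x. \<integral>\<^sup>+y. ennreal ((\<phi> x - \<phi> y)\<^sup>2) * (indicator (Q k) x * indicator (Q k) y) \<partial>lborel \<partial>lborel)"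
    using var by simp
  also have "\<dots> = (\<integral>\<^sup>+x. \<integral>\<^sup>+y. (\<Sum>k\<in>I. ennreal ((\<phi> x - \<phi> y)\<^sup>2) * (indicator (Q k) x * indicator (Q k) y)) \<partial>lborel \<partial>lborel)"
    by (simp add: nn_integral_sum)
  \<comment> \<open>Pairs in a common cell are replaced by all pairs with difference in
    \<open>C\<close>; x and h = y - x then range independently.\<close>
  also have "\<dots> \<le> (\<integral>\<^sup>+x. \<integral>\<^sup>+y. ennreal ((\<phi> x - \<phi> y)\<^sup>2) * indicator C (y - x) \<partial>lborel \<partial>lborel)"
  proof (intro nn_integral_mono)
    fix x y :: 'a
    have "(\<Sum>k\<in>I. ennreal ((\<phi> x - \<phi> y)\<^sup>2) * (indicator (Q k) x * indicator (Q k) y))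
        = (\<Sum>k\<in>I. if k = cell \<delta> x then (if cell \<delta> x = cell \<delta> y then ennreal ((\<phi> x - \<phi> y)\<^sup>2) else 0) else 0)"
      by (intro sum.cong) (auto simp: Q_def indicator_def)
    also have "\<dots> \<le> (if cell \<delta> x = cell \<delta> y then ennreal ((\<phi> x - \<phi> y)\<^sup>2) else 0)"
      using I(1) by (simp add: sum.delta)
    also have "\<dots> \<le> ennreal ((\<phi> x - \<phi> y)\<^sup>2) * indicator C (y - x)"
    proof (cases "cell \<delta> x = cell \<delta> y")
      case True
      have "y - x \<in> C"
        unfolding C_def mem_box
      proof (intro ballI)
        fix i :: 'a assume i: "i \<in> Basis"
        show "- \<delta> *\<^sub>R One \<bullet> i \<le> (y - x) \<bullet> i \<and> (y - x) \<bullet> i \<le> \<delta> *\<^sub>R One \<bullet> i"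
          using cell_eq_imp_close[OF \<delta> True i] i unfolding abs_le_iff by simp
      qed
      then show ?thesis by simp
    qed simp
    finally show "(\<Sum>k\<in>I. ennreal ((\<phi> x - \<phi> y)\<^sup>2) * (indicator (Q k) x * indicator (Q k) y))
       \<le> ennreal ((\<phi> x - \<phi> y)\<^sup>2) * indicator C (y - x)" .
  qed
  also have "\<dots> = (\<integral>\<^sup>+x. \<integral>\<^sup>+h. ennreal ((\<phi> (x + h) - \<phi> x)\<^sup>2) * indicator C h \<partial>lborel \<partial>lborel)"
  proof (rule nn_integral_cong)
    fix x :: 'a
    have [measurable]: "C \<in> sets borel" by (simp add: C_def)
    show "(\<integral>\<^sup>+y. ennreal ((\<phi> x - \<phi> y)\<^sup>2) * indicator C (y - x) \<partial>lborel) = (\<integral>\<^sup>+h. ennreal ((\<phi> (x + h) - \<phi> x)\<^sup>2) * indicator C h \<partial>lborel)"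
      using nn_integral_lborel_translate[of "\<lambda>y. ennreal ((\<phi> x - \<phi> y)\<^sup>2) * indicator C (y - x)" x]
      by (simp add: power2_commute)
  qed
  also have "\<dots> = (\<integral>\<^sup>+h. \<integral>\<^sup>+x. ennreal ((\<phi> (x + h) - \<phi> x)\<^sup>2) * indicator C h \<partial>lborel \<partial>lborel)"
  proof (rule lborel_pair.Fubini'[symmetric])
    have [measurable]: "C \<in> sets borel" by (simp add: C_def)
    show "(\<lambda>(x, h). ennreal ((\<phi> (x + h) - \<phi> x)\<^sup>2) * indicator C h) \<in> borel_measurable (lborel \<Otimes>\<^sub>M lborel)"
      by measurable
  qed
  also have "\<dots> \<le> (\<integral>\<^sup>+h. ennreal (real ?n * \<delta>\<^sup>2 * G) * indicator C h \<partial>(lborel::'a measure))"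
  proof (rule nn_integral_mono)
    fix h :: 'a
    have [measurable]: "C \<in> sets borel" by (simp add: C_def)
    show "(\<integral>\<^sup>+x. ennreal ((\<phi> (x + h) - \<phi> x)\<^sup>2) * indicator C h \<partial>lborel) \<le> ennreal (real ?n * \<delta>\<^sup>2 * G) * indicator C h"
    proof (cases "h \<in> C")
      case True
      have "(norm h)\<^sup>2 = (\<Sum>i\<in>Basis. (h \<bullet> i)\<^sup>2)"
        unfolding power2_norm_eq_inner by (subst euclidean_inner) (simp add: power2_eq_square)
      also have "\<dots> \<le> (\<Sum>i\<in>(Basis::'a set). \<delta>\<^sup>2)"
        using True by (intro sum_mono) (auto simp: C_def mem_box abs_le_square_iff[symmetric])
      finally have "(norm h * l2 lborel (cgrad \<phi>))\<^sup>2 \<le> real ?n * \<delta>\<^sup>2 * G"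
        by (simp add: G_def power_mult_distrib mult_right_mono)
      then have "ennreal ((norm h * l2 lborel (cgrad \<phi>))\<^sup>2) \<le> ennreal (real ?n * \<delta>\<^sup>2 * G)" by (rule ennreal_leI)
      then show ?thesis using test_function_translation_estimate[OF \<phi> \<Omega>, of h] True by simp
    qed simp
  qed
  also have "\<dots> = ennreal (real ?n * \<delta>\<^sup>2 * G) * ennreal ((2 * \<delta>) ^ ?n)"
    using \<delta> by (simp add: nn_integral_cmult C_def emeasure_lborel_cbox_eq inner_add_left power_mult_distrib)
  also have "\<dots> = ennreal (real ?n * \<delta>\<^sup>2 * G * (2 * \<delta>) ^ ?n)"
    using \<delta> by (simp add: ennreal_mult G_def)
  finally have le: "(\<Sum>k\<in>I. 2 * (\<delta> ^ ?n * J k - (i k)\<^sup>2)) \<le> real ?n * \<delta>\<^sup>2 * G * (2 * \<delta>) ^ ?n"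
    using \<delta> by (subst (asm) ennreal_le_iff) (auto simp: G_def)
  \<comment> \<open>The cells indexed by \<open>I\<close> are disjoint and cover \<Omega>, and
    \<phi> vanishes outside \<Omega>.\<close>
  have sumJ: "(\<Sum>k\<in>I. J k) = (l2 lborel \<phi>)\<^sup>2"
  proof -
    have "(\<Sum>k\<in>I. J k) = (LINT x|lborel. (\<Sum>k\<in>I. indicator (Q k) x * (\<phi> x)\<^sup>2))"
      unfolding J_def using integrable_mult_indicator[of "Q _" lborel "\<lambda>x. (\<phi> x)\<^sup>2"] int
      by (subst Bochner_Integration.integral_sum) auto
    also have "\<dots> = (LINT x|lborel. norm (\<phi> x) ^ 2)"
    proof (intro Bochner_Integration.integral_cong refl)
      fix x
      have "(\<Sum>k\<in>I. indicator (Q k) x * (\<phi> x)\<^sup>2) = (\<Sum>k\<in>I. if k = cell \<delta> x then (\<phi> x)\<^sup>2 else 0)"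
        by (intro sum.cong) (auto simp: Q_def indicator_def)
      also have "\<dots> = (if cell \<delta> x \<in> I then (\<phi> x)\<^sup>2 else 0)" using I(1) by simp
      also have "\<dots> = norm (\<phi> x) ^ 2"
        using I(3)[of x] test_function_outside[OF \<phi>, of x] by auto
      finally show "(\<Sum>k\<in>I. indicator (Q k) x * (\<phi> x)\<^sup>2) = norm (\<phi> x) ^ 2" .
    qed
    finally show ?thesis by (simp add: l2_power2)
  qed
  have "(\<Sum>k\<in>I. 2 * (\<delta> ^ ?n * J k - (i k)\<^sup>2)) = 2 * \<delta> ^ ?n * (l2 lborel \<phi>)\<^sup>2 - 2 * (\<Sum>k\<in>I. (i k)\<^sup>2)"
    unfolding sumJ[symmetric] by (simp add: sum_distrib_left sum_distrib_right sum_subtractf algebra_simps)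
  with le have "\<delta> ^ ?n * (l2 lborel \<phi>)\<^sup>2 \<le> (\<Sum>k\<in>I. (i k)\<^sup>2) + \<delta> ^ ?n * (2 ^ ?n * real ?n * \<delta>\<^sup>2 * G) / 2"
    by (simp add: power_mult_distrib field_simps)
  also have "\<dots> \<le> (\<Sum>k\<in>I. (i k)\<^sup>2) + \<delta> ^ ?n * (2 ^ ?n * real ?n * \<delta>\<^sup>2 * G)"
    using \<delta> by (simp add: G_def)
  finally have "(l2 lborel \<phi>)\<^sup>2 \<le> ((\<Sum>k\<in>I. (i k)\<^sup>2) + \<delta> ^ ?n * (2 ^ ?n * real ?n * \<delta>\<^sup>2 * G)) / \<delta> ^ ?n"
    using \<delta> by (simp add: pos_le_divide_eq mult.commute)
  also have "\<dots> = (\<Sum>k\<in>I. (i k)\<^sup>2) / \<delta> ^ ?n + 2 ^ ?n * real ?n * \<delta>\<^sup>2 * G"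
    using \<delta> by (simp add: add_divide_distrib)
  finally show ?thesis unfolding i_def Q_def G_def .
qed


text \<open>Only what compactness needs is kept of the grid: finitely many bounded functionals,
  compatible with differences, that control the L2 norm up to a small multiple of the
  gradient.\<close>

lemma Friedrichs_functionals:
  assumes \<Omega>: "open (\<Omega> :: 'a::euclidean_space set)" "bounded \<Omega>" and \<epsilon>: "\<epsilon> > (0::real)"
  shows "\<exists>I C L. finite (I :: ('a \<Rightarrow> int) set) \<and> (C::real) \<ge> 0 \<and>
    (\<forall>\<phi>. test_function \<Omega> \<phi> \<longrightarrow> (\<forall>k\<in>I. \<bar>L k \<phi>\<bar> \<le> l2 lborel \<phi>)) \<and>
    (\<forall>\<phi> \<psi>. test_function \<Omega> \<phi> \<longrightarrow> test_function \<Omega> \<psi> \<longrightarrow> (\<forall>k\<in>I. L k (\<lambda>x. \<phi> x - \<psi> x) = L k \<phi> - L k \<psi>)) \<and>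
    (\<forall>\<phi>. test_function \<Omega> \<phi> \<longrightarrow> (l2 lborel \<phi>)\<^sup>2 \<le> C * (\<Sum>k\<in>I. (L k \<phi>)\<^sup>2) + \<epsilon> * (l2 lborel (cgrad \<phi>))\<^sup>2)"
proof -
  let ?n = "DIM('a)"
  \<comment> \<open>The bound \<delta> \<le> 1 serves twice: it gives \<delta>^2 \<le> \<delta>, and
    it makes the cell volume at most 1, so that each functional is bounded by the L2 norm.\<close>
  define \<delta> where "\<delta> = min 1 (\<epsilon> / (2 ^ ?n * real ?n))"
  have \<delta>: "\<delta> > 0" "\<delta> \<le> 1" "\<delta> \<le> \<epsilon> / (2 ^ ?n * real ?n)" using \<epsilon> by (auto simp: \<delta>_def)
  have "\<delta>\<^sup>2 \<le> \<epsilon> / (2 ^ ?n * real ?n)"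
    using \<delta>(3) mult_left_le[OF \<delta>(2), of \<delta>] \<delta>(1) unfolding power2_eq_square by linarith
  then have \<delta>2: "2 ^ ?n * real ?n * \<delta>\<^sup>2 \<le> \<epsilon>" by (simp add: field_simps)
  obtain R where R: "R > 0" "\<And>x. x \<in> \<Omega> \<Longrightarrow> norm x \<le> R" using \<Omega>(2) by (auto simp: bounded_pos)
  \<comment> \<open>The \<open>+ 1\<close> allows for rounding down at negative coordinates.\<close>
  define N where "N = \<lceil>R / \<delta>\<rceil> + 1"
  define I where "I = (PiE Basis (\<lambda>_. {-N..N}) :: ('a \<Rightarrow> int) set)"
  have I: "finite I" "I \<subseteq> extensional Basis" "cell \<delta> x \<in> I" if "x \<in> \<Omega>" for x
  proof -
    show "finite I" unfolding I_def by (intro finite_PiE) auto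
    show "I \<subseteq> extensional Basis" unfolding I_def by (auto simp: PiE_def)
    have "\<lfloor>(x \<bullet> i) / \<delta>\<rfloor> \<in> {-N..N}" if i: "i \<in> Basis" for i
    proof -
      have "\<bar>x \<bullet> i\<bar> \<le> R" using Basis_le_norm[OF i, of x] R(2)[OF \<open>x \<in> \<Omega>\<close>] by linarith
      then have "\<bar>(x \<bullet> i) / \<delta>\<bar> \<le> R / \<delta>" using \<delta>(1) by (simp add: abs_divide divide_right_mono)
      then show ?thesis unfolding N_def atLeastAtMost_iff by linarith
    qed
    then show "cell \<delta> x \<in> I" unfolding I_def cell_def by auto
  qed
  have fin: "finite I" unfolding I_def by (intro finite_PiE) auto
  have ext: "I \<subseteq> extensional Basis" unfolding I_def by (auto simp: PiE_def)
  define Q where "Q k = {x::'a. cell \<delta> x = k}" for k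
  have Qs: "Q k \<in> sets borel" for k unfolding Q_def by (rule cell_vimage_sets)
  define L where "L k \<phi> = (LINT x|lborel. indicator (Q k) x * \<phi> x)" for k and \<phi> :: "'a \<Rightarrow> real"
  show ?thesis
  proof (intro exI conjI allI impI ballI)
    show "finite I" by (rule fin)
    show "0 \<le> inverse (\<delta> ^ ?n)" using \<delta> by simp
    fix \<phi> assume \<phi>: "test_function \<Omega> \<phi>"
    show "(l2 lborel \<phi>)\<^sup>2 \<le> inverse (\<delta> ^ ?n) * (\<Sum>k\<in>I. (L k \<phi>)\<^sup>2) + \<epsilon> * (l2 lborel (cgrad \<phi>))\<^sup>2"
    proof -
      have "(l2 lborel \<phi>)\<^sup>2 \<le> (\<Sum>k\<in>I. (L k \<phi>)\<^sup>2) / \<delta> ^ ?n + 2 ^ ?n * real ?n * \<delta>\<^sup>2 * (l2 lborel (cgrad \<phi>))\<^sup>2"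
        unfolding L_def Q_def by (rule Friedrichs_cells[OF \<phi> \<Omega>(1) \<delta>(1) fin ext]) (rule I(3))
      also have "\<dots> \<le> (\<Sum>k\<in>I. (L k \<phi>)\<^sup>2) / \<delta> ^ ?n + \<epsilon> * (l2 lborel (cgrad \<phi>))\<^sup>2"
        using \<delta>2 by (intro add_left_mono mult_right_mono) auto
      finally show ?thesis by (simp add: divide_inverse mult.commute)
    qed
    fix k assume k: "k \<in> I"
    show "\<bar>L k \<phi>\<bar> \<le> l2 lborel \<phi>"
    proof (rule power2_le_imp_le)
      note p = test_function_L2s(3)[OF \<phi> \<Omega>(1)]
      have "(L k \<phi>)\<^sup>2 \<le> \<delta> ^ ?n * (LINT x|lborel. indicator (Q k) x * (\<phi> x)\<^sup>2)"
        unfolding L_def using \<delta> k ext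
        by (intro square_integral_indicator_le p Qs) (auto simp: Q_def intro!: emeasure_cell)
      also have "\<dots> \<le> 1 * (LINT x|lborel. (\<phi> x)\<^sup>2)"
      proof (intro mult_mono power_le_one Bochner_Integration.integral_mono)
        show "integrable lborel (\<lambda>x. indicator (Q k) x * (\<phi> x)\<^sup>2)"
          using integrable_mult_indicator[of "Q k" lborel "\<lambda>x. (\<phi> x)\<^sup>2"] L2s_integrable[OF p] Qs by simp
        show "integrable lborel (\<lambda>x. (\<phi> x)\<^sup>2)" using L2s_integrable[OF p] by simp
      qed (use \<delta> in \<open>auto simp: indicator_def\<close>)
      finally show "\<bar>L k \<phi>\<bar>\<^sup>2 \<le> (l2 lborel \<phi>)\<^sup>2" by (simp add: l2_power2)
    qed simp
  next
    fix \<phi> \<psi> k assume t: "test_function \<Omega> \<phi>" "test_function \<Omega> \<psi>"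
    show "L k (\<lambda>x. \<phi> x - \<psi> x) = L k \<phi> - L k \<psi>"
      unfolding L_def
      using integrable_mult_indicator[OF _ test_function_integrable[OF t(1)], of "Q k"]
        integrable_mult_indicator[OF _ test_function_integrable[OF t(2)], of "Q k"] Qs[of k]
      by (simp add: right_diff_distrib)
  qed
qed

text \<open>The functionals belonging to the weights 1/(j+1) form a countable family, bounded along
  the sequence, so one diagonal subsequence makes all of them converge. For given e, a large j makes
  the gradient term harmless, and the finitely many functionals of this j are Cauchy.\<close>

lemma Rellich_test_functions:
  fixes \<phi> :: "nat \<Rightarrow> 'a::euclidean_space \<Rightarrow> real"
  assumes \<Omega>: "open \<Omega>" "bounded \<Omega>" and \<phi>: "\<And>n. test_function \<Omega> (\<phi> n)"
    and B: "\<And>n. l2 lborel (\<phi> n) \<le> B" "\<And>n. l2 lborel (cgrad (\<phi> n)) \<le> B"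
  obtains r :: "nat \<Rightarrow> nat" where "strict_mono r"
    "\<And>e. 0 < e \<Longrightarrow> \<exists>N. \<forall>m\<ge>N. \<forall>n\<ge>N. l2 lborel (\<lambda>x. \<phi> (r m) x - \<phi> (r n) x) < e"
proof -
  define P where "P j I C L \<longleftrightarrow> finite (I :: ('a \<Rightarrow> int) set) \<and> (C::real) \<ge> 0 \<and>
    (\<forall>\<phi>. test_function \<Omega> \<phi> \<longrightarrow> (\<forall>k\<in>I. \<bar>L k \<phi>\<bar> \<le> l2 lborel \<phi>)) \<and>
    (\<forall>\<phi> \<psi>. test_function \<Omega> \<phi> \<longrightarrow> test_function \<Omega> \<psi> \<longrightarrow> (\<forall>k\<in>I. L k (\<lambda>x. \<phi> x - \<psi> x) = L k \<phi> - L k \<psi>)) \<and>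
    (\<forall>\<phi>. test_function \<Omega> \<phi> \<longrightarrow> (l2 lborel \<phi>)\<^sup>2 \<le> C * (\<Sum>k\<in>I. (L k \<phi>)\<^sup>2) + (1 / real (Suc j)) * (l2 lborel (cgrad \<phi>))\<^sup>2)"
    for j :: nat and I C L
  have "\<forall>j. \<exists>I C L. P j I C L"
    unfolding P_def by (intro allI Friedrichs_functionals \<Omega>) simp
  then obtain I C L where P: "\<And>j. P j (I j) (C j) (L j)" by metis
  have I: "\<And>j. finite (I j)" and C: "\<And>j. C j \<ge> 0"
    and Lb: "\<And>j \<phi> k. test_function \<Omega> \<phi> \<Longrightarrow> k \<in> I j \<Longrightarrow> \<bar>L j k \<phi>\<bar> \<le> l2 lborel \<phi>"
    and Ld: "\<And>j \<phi> \<psi> k. test_function \<Omega> \<phi> \<Longrightarrow> test_function \<Omega> \<psi> \<Longrightarrow> k \<in> I j \<Longrightarrow> L j k (\<lambda>x. \<phi> x - \<psi> x) = L j k \<phi> - L j k \<psi>"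
    and F: "\<And>j \<phi>. test_function \<Omega> \<phi> \<Longrightarrow> (l2 lborel \<phi>)\<^sup>2 \<le> C j * (\<Sum>k\<in>I j. (L j k \<phi>)\<^sup>2) + (1 / real (Suc j)) * (l2 lborel (cgrad \<phi>))\<^sup>2"
    using P unfolding P_def by blast+
  define S where "S = Sigma UNIV I"
  have "countable S" unfolding S_def by (intro countable_SIGMA) (auto intro: countable_finite I)
  moreover have "norm (L (fst p) (snd p) (\<phi> n)) \<le> B" if "p \<in> S" for n p
  proof -
    have "\<bar>L (fst p) (snd p) (\<phi> n)\<bar> \<le> l2 lborel (\<phi> n)"
      using that by (intro Lb \<phi>) (auto simp: S_def)
    then show ?thesis using B(1)[of n] by simp
  qed
  ultimately have "\<exists>r::nat \<Rightarrow> nat. strict_mono r \<and> (\<forall>p\<in>S. \<exists>l. (\<lambda>n. L (fst p) (snd p) (\<phi> (r n))) \<longlonglongrightarrow> l)"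
    by (rule function_convergent_subsequence[of S "\<lambda>n p. L (fst p) (snd p) (\<phi> n)" B]) blast+
  then obtain r where r: "strict_mono (r :: nat \<Rightarrow> nat)"
    and lim: "\<And>p. p \<in> S \<Longrightarrow> \<exists>l. (\<lambda>n. L (fst p) (snd p) (\<phi> (r n))) \<longlonglongrightarrow> l"
    by blast
  have "\<exists>N. \<forall>m\<ge>N. \<forall>n\<ge>N. l2 lborel (\<lambda>x. \<phi> (r m) x - \<phi> (r n) x) < e" if e: "0 < e" for e
  proof -
    have B0: "B \<ge> 0" using B(1)[of 0] l2_nonneg[of lborel "\<phi> 0"] by linarith
    \<comment> \<open>The difference of two gradients has norm at most 2B; this j makes its
      contribution less than half of \<open>e\<^sup>2\<close>.\<close>
    obtain j :: nat where j: "8 * B\<^sup>2 / e\<^sup>2 < real j" using reals_Archimedean2 by blast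
    then have "8 * B\<^sup>2 / e\<^sup>2 < real (Suc j)" by simp
    then have "8 * B\<^sup>2 < real (Suc j) * e\<^sup>2" using e by (simp add: pos_divide_less_eq)
    then have j2: "1 / real (Suc j) * (2 * B)\<^sup>2 < e\<^sup>2 / 2" by (simp add: field_simps)
    have "\<exists>l. \<forall>k\<in>I j. (\<lambda>n. L j k (\<phi> (r n))) \<longlonglongrightarrow> l k"
      using lim unfolding S_def by (intro bchoice) force
    then obtain l where l: "\<And>k. k \<in> I j \<Longrightarrow> (\<lambda>n. L j k (\<phi> (r n))) \<longlonglongrightarrow> l k" by blast
    \<comment> \<open>The other half of \<open>e\<^sup>2\<close>: the functionals of a difference
      contribute at most \<open>2 * s m + 2 * s n\<close>, and each \<open>s\<close> will be below
      \<open>e\<^sup>2 / 8\<close>.\<close>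
    define s where "s n = C j * (\<Sum>k\<in>I j. (L j k (\<phi> (r n)) - l k)\<^sup>2)" for n
    have "s \<longlonglongrightarrow> C j * (\<Sum>k\<in>I j. (l k - l k)\<^sup>2)" unfolding s_def by (intro tendsto_intros l)
    then have "s \<longlonglongrightarrow> 0" by simp
    then have "\<forall>\<^sub>F n in sequentially. s n < e\<^sup>2 / 8" by (rule order_tendstoD) (use e in simp)
    then obtain N where N: "\<And>n. n \<ge> N \<Longrightarrow> s n < e\<^sup>2 / 8" unfolding eventually_sequentially by blast
    have "l2 lborel (\<lambda>x. \<phi> (r m) x - \<phi> (r n) x) < e" if mn: "m \<ge> N" "n \<ge> N" for m n
    proof (rule power2_less_imp_less)
      have t: "test_function \<Omega> (\<lambda>x. \<phi> (r m) x - \<phi> (r n) x)" by (rule test_function_diff[OF \<phi> \<phi>])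
      have c: "cgrad (\<lambda>x. \<phi> (r m) x - \<phi> (r n) x) = (\<lambda>x. cgrad (\<phi> (r m)) x - cgrad (\<phi> (r n)) x)"
        using cgrad_diff[OF \<phi> \<phi>] by blast
      have "l2 lborel (cgrad (\<lambda>x. \<phi> (r m) x - \<phi> (r n) x)) \<le> l2 lborel (cgrad (\<phi> (r m))) + l2 lborel (cgrad (\<phi> (r n)))"
        unfolding c using l2_triangle_diff[OF test_function_L2s(4)[OF \<phi> \<Omega>(1)] L2s_zero test_function_L2s(4)[OF \<phi> \<Omega>(1)]]
        by (simp add: l2_uminus)
      also have "\<dots> \<le> 2 * B" using B(2)[of "r m"] B(2)[of "r n"] by linarith
      finally have "(l2 lborel (cgrad (\<lambda>x. \<phi> (r m) x - \<phi> (r n) x)))\<^sup>2 \<le> (2 * B)\<^sup>2" by (intro power_mono) auto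
      then have g: "1 / real (Suc j) * (l2 lborel (cgrad (\<lambda>x. \<phi> (r m) x - \<phi> (r n) x)))\<^sup>2 \<le> 1 / real (Suc j) * (2 * B)\<^sup>2"
        by (intro mult_left_mono) auto
      have "(\<Sum>k\<in>I j. (L j k (\<lambda>x. \<phi> (r m) x - \<phi> (r n) x))\<^sup>2)
        \<le> (\<Sum>k\<in>I j. 2 * (L j k (\<phi> (r m)) - l k)\<^sup>2 + 2 * (L j k (\<phi> (r n)) - l k)\<^sup>2)"
      proof (rule sum_mono)
        fix k assume k: "k \<in> I j"
        have "(a - b)\<^sup>2 \<le> 2 * (a - c)\<^sup>2 + 2 * (b - c)\<^sup>2" for a b c :: real
          using zero_le_power2[of "(a - c) + (b - c)"] by (simp add: power2_eq_square algebra_simps)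
        then show "(L j k (\<lambda>x. \<phi> (r m) x - \<phi> (r n) x))\<^sup>2 \<le> 2 * (L j k (\<phi> (r m)) - l k)\<^sup>2 + 2 * (L j k (\<phi> (r n)) - l k)\<^sup>2"
          using Ld[OF \<phi> \<phi> k] by simp
      qed
      then have "C j * (\<Sum>k\<in>I j. (L j k (\<lambda>x. \<phi> (r m) x - \<phi> (r n) x))\<^sup>2)
        \<le> C j * (\<Sum>k\<in>I j. 2 * (L j k (\<phi> (r m)) - l k)\<^sup>2 + 2 * (L j k (\<phi> (r n)) - l k)\<^sup>2)"
        using C by (intro mult_left_mono) auto
      also have "\<dots> = 2 * s m + 2 * s n"
        unfolding s_def by (simp add: sum.distrib sum_distrib_left[symmetric] algebra_simps)
      finally show "(l2 lborel (\<lambda>x. \<phi> (r m) x - \<phi> (r n) x))\<^sup>2 < e\<^sup>2"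
        using F[OF t, of j] g j2 N[OF mn(1)] N[OF mn(2)] by linarith
    qed (use e in simp)
    then show ?thesis by blast
  qed
  with r that show thesis by blast
qed

section \<open>The first Dirichlet eigenvalue\<close>

text \<open>Density: both norms converge along the approximating test functions.\<close>

lemma H10_le_of_test_functions:
  assumes \<Omega>: "open \<Omega>" and v: "v \<in> H10 \<Omega>"
    and le: "\<And>\<phi>. test_function \<Omega> \<phi> \<Longrightarrow> m * (l2 lborel \<phi>)\<^sup>2 \<le> (l2 lborel (cgrad \<phi>))\<^sup>2"
  shows "m * (l2 (lebesgue_on \<Omega>) v)\<^sup>2 \<le> (l2 (lebesgue_on \<Omega>) (weak_grad \<Omega> v))\<^sup>2"
proof -
  let ?M = "lebesgue_on \<Omega>"
  have h: "v \<in> H1 \<Omega>" using v by (simp add: H10_def)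
  obtain \<phi> where \<phi>: "\<And>n. test_function \<Omega> (\<phi> n)" 
    "(\<lambda>n. l2 ?M (\<lambda>x. \<phi> n x - v x)) \<longlonglongrightarrow> 0"
    "(\<lambda>n. l2 ?M (\<lambda>x. cgrad (\<phi> n) x - weak_grad \<Omega> v x)) \<longlonglongrightarrow> 0"
    using v unfolding H10_iff[OF \<Omega>] by blast
  note t = test_function_L2s[OF \<phi>(1) \<Omega>]
  have a: "(\<lambda>n. l2 ?M (\<phi> n)) \<longlonglongrightarrow> l2 ?M v"
    by (rule tendsto_l2[OF \<phi>(2) t(1) W1p_2_D(1)[OF \<Omega> h]])
  have b: "(\<lambda>n. l2 ?M (cgrad (\<phi> n))) \<longlonglongrightarrow> l2 ?M (weak_grad \<Omega> v)"
    by (rule tendsto_l2[OF \<phi>(3) t(2) W1p_2_D(3)[OF \<Omega> h]])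
  show ?thesis
  proof (rule LIMSEQ_le)
    show "(\<lambda>n. m * (l2 ?M (\<phi> n))\<^sup>2) \<longlonglongrightarrow> m * (l2 ?M v)\<^sup>2" by (intro tendsto_intros a)
    show "(\<lambda>n. (l2 ?M (cgrad (\<phi> n)))\<^sup>2) \<longlonglongrightarrow> (l2 ?M (weak_grad \<Omega> v))\<^sup>2" by (intro tendsto_intros b)
    show "\<exists>N. \<forall>n\<ge>N. m * (l2 ?M (\<phi> n))\<^sup>2 \<le> (l2 ?M (cgrad (\<phi> n)))\<^sup>2"
      using le[OF \<phi>(1)] t(5,6) by simp
  qed
qed

lemma Poincare_H10:
  fixes \<Omega> :: "'a::euclidean_space set"
  assumes \<Omega>: "open \<Omega>" "bounded \<Omega>"
  obtains P where "P > 0" "\<And>v. v \<in> H10 \<Omega> \<Longrightarrow> l2 (lebesgue_on \<Omega>) v \<le> P * l2 (lebesgue_on \<Omega>) (weak_grad \<Omega> v)"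
proof -
  obtain R where R: "R > 0" "\<Omega> \<subseteq> ball 0 R" using bounded_subset_ballD[OF \<Omega>(2), of 0] by auto
  have p: "inverse ((2 * R)\<^sup>2) * (l2 lborel \<phi>)\<^sup>2 \<le> (l2 lborel (cgrad \<phi>))\<^sup>2" if "test_function \<Omega> \<phi>" for \<phi>
  proof -
    have "(l2 lborel \<phi>)\<^sup>2 \<le> (2 * R * l2 lborel (cgrad \<phi>))\<^sup>2"
      using test_function_Poincare[OF that \<Omega>(1) R(2,1)] by (intro power_mono) auto
    then show ?thesis using R(1) by (simp add: power_mult_distrib field_simps)
  qed
  have "l2 (lebesgue_on \<Omega>) v \<le> 2 * R * l2 (lebesgue_on \<Omega>) (weak_grad \<Omega> v)" if v: "v \<in> H10 \<Omega>" for v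
  proof (rule power2_le_imp_le)
    show "(l2 (lebesgue_on \<Omega>) v)\<^sup>2 \<le> (2 * R * l2 (lebesgue_on \<Omega>) (weak_grad \<Omega> v))\<^sup>2"
      using H10_le_of_test_functions[OF \<Omega>(1) v p] R(1) by (simp add: power_mult_distrib field_simps)
  qed (use R(1) in simp)
  then show thesis using that[of "2 * R"] R(1) by simp
qed

text \<open>A bump is positive on an open box, which has positive measure. This makes the set of
  Rayleigh quotients nonempty.\<close>

lemma ex_test_function_l2_pos:
  assumes "open \<Omega>" "(\<Omega> :: 'a::euclidean_space set) \<noteq> {}"
  obtains \<phi> where "test_function \<Omega> \<phi>" "l2 lborel \<phi> > 0"
proof -
  obtain x where x: "x \<in> \<Omega>" using assms(2) by blast
  obtain a b where ab: "x \<in> box a b" "cbox a b \<subseteq> \<Omega>"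
    using open_contains_cbox[OF assms(1) x] by metis
  have t: "test_function \<Omega> (bump 1 a b)" by (rule test_function_bump[OF _ ab(2)]) simp
  have "l2 lborel (bump 1 a b) \<noteq> 0"
  proof
    assume "l2 lborel (bump 1 a b) = 0"
    then have "AE x in lborel. bump 1 a b x = 0"
      using l2_eq_0_iff_AE[OF test_function_L2s(3)[OF t assms(1)]] by simp
    then have "AE x in lborel. x \<notin> box a b"
      by eventually_elim (use bump_pos[of 1 _ a b] in force)
    then have "emeasure lborel (box a b) = 0"
      by (subst (asm) AE_iff_measurable[of "box a b"]) auto
    then have "negligible (box a b)"
      by (simp add: negligible_iff_emeasure0)
    with ab(1) show False using open_not_negligible[OF open_box] by blast
  qed
  then show thesis using that[OF t] l2_nonneg[of lborel "bump 1 a b"] by linarith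
qed

lemma l2_parallelogram:
  fixes f g :: "'a \<Rightarrow> 'b::euclidean_space"
  assumes "f \<in> L2s M" "g \<in> L2s M"
  shows "(l2 M (\<lambda>x. f x - g x))\<^sup>2 = 2 * (l2 M f)\<^sup>2 + 2 * (l2 M g)\<^sup>2 - (l2 M (\<lambda>x. f x + g x))\<^sup>2"
  using l2_add_scaleR_power2[OF assms, of 1] l2_add_scaleR_power2[OF assms, of "-1"] by simp

text \<open>A minimizing sequence for the Rayleigh quotient is Cauchy in \<open>L\<^sup>2\<close> by compactness, and then
  in \<open>H\<^sup>1\<close> by the parallelogram law.\<close>

lemma Rayleigh_minimizer:
  fixes \<Omega> :: "'a::euclidean_space set"
  assumes \<Omega>: "open \<Omega>" "bounded \<Omega>" "\<Omega> \<noteq> {}"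
  obtains m w where "w \<in> H10 \<Omega>" "l2 (lebesgue_on \<Omega>) w = 1" "(l2 (lebesgue_on \<Omega>) (weak_grad \<Omega> w))\<^sup>2 = m"
    "\<And>\<phi>. test_function \<Omega> \<phi> \<Longrightarrow> m * (l2 lborel \<phi>)\<^sup>2 \<le> (l2 lborel (cgrad \<phi>))\<^sup>2"
proof -
  let ?M = "lebesgue_on \<Omega>"
  define A where "A = {(l2 lborel (cgrad \<phi>))\<^sup>2 | \<phi>. test_function \<Omega> \<phi> \<and> l2 lborel \<phi> = 1}"
  define m where "m = Inf A"
  have normalize: "(l2 lborel (cgrad \<phi>))\<^sup>2 / (l2 lborel \<phi>)\<^sup>2 \<in> A" if t: "test_function \<Omega> \<phi>" and p: "l2 lborel \<phi> > 0" for \<phi>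
  proof -
    define r where "r = inverse (l2 lborel \<phi>)"
    have "test_function \<Omega> (\<lambda>x. r * \<phi> x)" by (rule test_function_cmult[OF t])
    moreover have "l2 lborel (\<lambda>x. r * \<phi> x) = 1" using p by (simp add: l2_mult r_def)
    moreover have "(l2 lborel (cgrad (\<lambda>x. r * \<phi> x)))\<^sup>2 = (l2 lborel (cgrad \<phi>))\<^sup>2 / (l2 lborel \<phi>)\<^sup>2"
    proof -
      have "cgrad (\<lambda>x. r * \<phi> x) = (\<lambda>x. r *\<^sub>R cgrad \<phi> x)" using cgrad_cmult[OF t] by blast
      then show ?thesis using p by (simp add: l2_scaleR power_mult_distrib r_def field_simps)
    qed
    ultimately show ?thesis unfolding A_def mem_Collect_eq by metis
  qed
  have A: "A \<noteq> {}" "bdd_below A"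
  proof -
    show "A \<noteq> {}" using normalize ex_test_function_l2_pos[OF \<Omega>(1,3)] by (metis empty_iff)
    show "bdd_below A" by (rule bdd_belowI[of _ 0]) (auto simp: A_def)
  qed
  have le: "m * (l2 lborel \<phi>)\<^sup>2 \<le> (l2 lborel (cgrad \<phi>))\<^sup>2" if t: "test_function \<Omega> \<phi>" for \<phi>
  proof (cases "l2 lborel \<phi> = 0")
    case False
    then have p: "l2 lborel \<phi> > 0" using l2_nonneg[of lborel \<phi>] by linarith
    have "m \<le> (l2 lborel (cgrad \<phi>))\<^sup>2 / (l2 lborel \<phi>)\<^sup>2"
      unfolding m_def by (rule cInf_lower[OF normalize[OF t p] A(2)])
    then show ?thesis using p by (simp add: pos_le_divide_eq)
  qed simp
  have m0: "m \<ge> 0" unfolding m_def by (rule cInf_greatest[OF A(1)]) (auto simp: A_def)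
  have "\<exists>\<phi>. test_function \<Omega> \<phi> \<and> l2 lborel \<phi> = 1 \<and> (l2 lborel (cgrad \<phi>))\<^sup>2 < m + 1 / real (Suc n)" for n
  proof -
    have "Inf A < m + 1 / real (Suc n)" unfolding m_def by simp
    from cInf_lessD[OF A(1) this] show ?thesis unfolding A_def by blast
  qed
  then obtain \<phi> where \<phi>: "\<And>n. test_function \<Omega> (\<phi> n)" "\<And>n. l2 lborel (\<phi> n) = 1"
    "\<And>n. (l2 lborel (cgrad (\<phi> n)))\<^sup>2 < m + 1 / real (Suc n)" by metis
  \<comment> \<open>A crude bound that avoids square roots: m + 1 \<le> (m + 2)^2 for m \<ge>
    0.\<close>
  have b2: "l2 lborel (cgrad (\<phi> n)) \<le> m + 2" for n
  proof (rule power2_le_imp_le)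
    have "1 / real (Suc n) \<le> 1" by simp
    moreover have "m + 1 \<le> (m + 2)\<^sup>2" using m0 by (simp add: power2_eq_square algebra_simps)
    ultimately show "(l2 lborel (cgrad (\<phi> n)))\<^sup>2 \<le> (m + 2)\<^sup>2" using \<phi>(3)[of n] by linarith
  qed (use m0 in simp)
  have b1: "l2 lborel (\<phi> n) \<le> m + 2" for n using \<phi>(2) m0 by simp
  have "\<exists>r::nat\<Rightarrow>nat. strict_mono r \<and>
      (\<forall>e>0. \<exists>N. \<forall>a\<ge>N. \<forall>b\<ge>N. l2 lborel (\<lambda>x. \<phi> (r a) x - \<phi> (r b) x) < e)"
    by (rule Rellich_test_functions[of \<Omega> \<phi>, OF \<Omega>(1,2) \<phi>(1) b1 b2]) blast
  then obtain r where r: "strict_mono (r::nat\<Rightarrow>nat)"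
    and cauchy: "\<And>e. 0 < e \<Longrightarrow> \<exists>N. \<forall>a\<ge>N. \<forall>b\<ge>N. l2 lborel (\<lambda>x. \<phi> (r a) x - \<phi> (r b) x) < e"
    by blast
  define \<psi> where "\<psi> n = \<phi> (r n)" for n
  define G where "G n = (l2 lborel (cgrad (\<psi> n)))\<^sup>2" for n
  have \<psi>: "test_function \<Omega> (\<psi> n)" "l2 lborel (\<psi> n) = 1" for n using \<phi> by (auto simp: \<psi>_def)
  have G: "m \<le> G n" "G n < m + 1 / real (Suc n)" for n
  proof -
    show "m \<le> G n" using le[OF \<psi>(1), of n] \<psi>(2) by (simp add: G_def)
    have "1 / real (Suc (r n)) \<le> 1 / real (Suc n)" using seq_suble[OF r, of n] by (intro divide_left_mono) auto
    then show "G n < m + 1 / real (Suc n)" using \<phi>(3)[of "r n"] by (simp add: G_def \<psi>_def)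
  qed
  have Glim: "G \<longlonglongrightarrow> m"
  proof (rule tendsto_sandwich[OF _ _ tendsto_const])
    show "(\<lambda>n. m + 1 / real (Suc n)) \<longlonglongrightarrow> m"
      using tendsto_add[OF tendsto_const[of m] LIMSEQ_inverse_real_of_nat] by (simp add: divide_inverse)
  qed (use G in \<open>auto intro!: always_eventually less_imp_le\<close>)
  note t = test_function_L2s[OF \<psi>(1) \<Omega>(1)]
  \<comment> \<open>The parallelogram law for the gradients, with the lower bound \<open>le\<close>
    applied to the sum of the two functions: closeness in L2 and almost minimal gradients force the
    gradients to be close.\<close>
  have gradc: "(l2 lborel (\<lambda>x. cgrad (\<psi> a) x - cgrad (\<psi> b) x))\<^sup>2
     \<le> 2 * (G a - m) + 2 * (G b - m) + m * (l2 lborel (\<lambda>x. \<psi> a x - \<psi> b x))\<^sup>2" for a b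
  proof -
    have "cgrad (\<lambda>x. \<psi> a x + \<psi> b x) = (\<lambda>x. cgrad (\<psi> a) x + cgrad (\<psi> b) x)"
      using cgrad_add[OF \<psi>(1) \<psi>(1)] by blast
    then have "m * (l2 lborel (\<lambda>x. \<psi> a x + \<psi> b x))\<^sup>2 \<le> (l2 lborel (\<lambda>x. cgrad (\<psi> a) x + cgrad (\<psi> b) x))\<^sup>2"
      using le[OF test_function_add[OF \<psi>(1) \<psi>(1)], of a b] by simp
    moreover have "(l2 lborel (\<lambda>x. \<psi> a x + \<psi> b x))\<^sup>2 = 4 - (l2 lborel (\<lambda>x. \<psi> a x - \<psi> b x))\<^sup>2"
      using l2_parallelogram[OF t(3) t(3), of a b] \<psi>(2) by simp
    ultimately show ?thesis
      using l2_parallelogram[OF t(4) t(4), of a b] unfolding G_def by (simp add: algebra_simps)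
  qed
  have l2eq: "l2 ?M (\<lambda>x. \<psi> a x - \<psi> b x) = l2 lborel (\<lambda>x. \<psi> a x - \<psi> b x)"
    "l2 ?M (\<lambda>x. cgrad (\<psi> a) x - cgrad (\<psi> b) x) = l2 lborel (\<lambda>x. cgrad (\<psi> a) x - cgrad (\<psi> b) x)" for a b
  proof -
    have "cgrad (\<lambda>x. \<psi> a x - \<psi> b x) = (\<lambda>x. cgrad (\<psi> a) x - cgrad (\<psi> b) x)"
      using cgrad_diff[OF \<psi>(1) \<psi>(1)] by blast
    then show "l2 ?M (\<lambda>x. \<psi> a x - \<psi> b x) = l2 lborel (\<lambda>x. \<psi> a x - \<psi> b x)"
      "l2 ?M (\<lambda>x. cgrad (\<psi> a) x - cgrad (\<psi> b) x) = l2 lborel (\<lambda>x. cgrad (\<psi> a) x - cgrad (\<psi> b) x)"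
      using test_function_L2s(5,6)[OF test_function_diff[OF \<psi>(1) \<psi>(1)] \<Omega>(1), of a b] by auto
  qed
  have c1: "\<exists>N. \<forall>a\<ge>N. \<forall>b\<ge>N. l2 ?M (\<lambda>x. \<psi> a x - \<psi> b x) < e" if "e > 0" for e
    using cauchy[OF that] unfolding l2eq unfolding \<psi>_def .
  have c2: "\<exists>N. \<forall>a\<ge>N. \<forall>b\<ge>N. l2 ?M (\<lambda>x. cgrad (\<psi> a) x - cgrad (\<psi> b) x) < e" if e: "e > 0" for e
  proof -
    \<comment> \<open>As 2m \<le> (m + 2)^2, this choice gives m d^2 \<le> e^2/2; the other half of
      e^2 is left for the excesses \<open>G a - m\<close> and \<open>G b - m\<close>.\<close>
    define d where "d = e / (m + 2)"
    have d: "d > 0" using e m0 by (simp add: d_def)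
    obtain N1 where N1: "\<And>a b. a \<ge> N1 \<Longrightarrow> b \<ge> N1 \<Longrightarrow> l2 lborel (\<lambda>x. \<psi> a x - \<psi> b x) < d"
      using c1[OF d] unfolding l2eq by blast
    have "\<forall>\<^sub>F n in sequentially. G n < m + e\<^sup>2 / 8" by (rule order_tendstoD[OF Glim]) (use e in simp)
    then obtain N2 where N2: "\<And>n. n \<ge> N2 \<Longrightarrow> G n < m + e\<^sup>2 / 8" unfolding eventually_sequentially by blast
    have "l2 ?M (\<lambda>x. cgrad (\<psi> a) x - cgrad (\<psi> b) x) < e" if ab: "a \<ge> max N1 N2" "b \<ge> max N1 N2" for a b
    proof (rule power2_less_imp_less)
      have "(l2 lborel (\<lambda>x. \<psi> a x - \<psi> b x))\<^sup>2 \<le> d\<^sup>2"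
        using N1[of a b] ab by (intro power_mono) auto
      then have "m * (l2 lborel (\<lambda>x. \<psi> a x - \<psi> b x))\<^sup>2 \<le> m * d\<^sup>2" using m0 by (rule mult_left_mono)
      also have "m * d\<^sup>2 \<le> e\<^sup>2 / 2"
      proof -
        have "2 * m \<le> (m + 2)\<^sup>2" using m0 by (simp add: power2_eq_square algebra_simps)
        then have "2 * m * e\<^sup>2 \<le> (m + 2)\<^sup>2 * e\<^sup>2" by (intro mult_right_mono) auto
        then show ?thesis using m0 by (simp add: d_def power_divide field_simps)
      qed
      finally show "(l2 ?M (\<lambda>x. cgrad (\<psi> a) x - cgrad (\<psi> b) x))\<^sup>2 < e\<^sup>2"
        using gradc[of a b] N2[of a] N2[of b] ab unfolding l2eq by (simp add: field_simps)
    qed (use e in simp)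
    then show ?thesis by blast
  qed
  obtain w where w: "w \<in> L2s ?M" "(\<lambda>n. l2 ?M (\<lambda>x. \<psi> n x - w x)) \<longlonglongrightarrow> 0"
    using L2s_complete[of \<psi> ?M, OF t(1) c1] by blast
  obtain g where g: "g \<in> L2s ?M" "(\<lambda>n. l2 ?M (\<lambda>x. cgrad (\<psi> n) x - g x)) \<longlonglongrightarrow> 0"
    using L2s_complete[of "\<lambda>n. cgrad (\<psi> n)" ?M, OF t(2) c2] by blast
  \<comment> \<open>The identity defining a weak gradient equates inner products with fixed
    functions, hence survives limits in L2.\<close>
  have wg: "has_weak_gradient \<Omega> w g"
    unfolding has_weak_gradient_def
  proof (intro conjI allI impI ballI)
    show "locally_integrable_on \<Omega> w" "locally_integrable_on \<Omega> g"
      using w g \<Omega>(1) by (auto intro: L2s_locally_integrable)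
    fix \<eta> and i :: 'a assume \<eta>: "test_function \<Omega> \<eta>" and i: "i \<in> Basis"
    note c = test_function_L2s(1)[OF \<eta> \<Omega>(1)]
    note d = test_function_L2s(1)[OF test_function_partial[OF \<eta> i] \<Omega>(1)]
    have l1: "(\<lambda>n. ip ?M (\<psi> n) (\<lambda>x. frechet_derivative \<eta> (at x) i)) \<longlonglongrightarrow> ip ?M w (\<lambda>x. frechet_derivative \<eta> (at x) i)"
      by (rule tendsto_ip[OF w(2) t(1) w(1) _ d d]) simp
    have c': "(\<lambda>x. \<eta> x *\<^sub>R i) \<in> L2s ?M" using c i by (auto simp: L2s_def)
    have l2: "(\<lambda>n. ip ?M (cgrad (\<psi> n)) (\<lambda>x. \<eta> x *\<^sub>R i)) \<longlonglongrightarrow> ip ?M g (\<lambda>x. \<eta> x *\<^sub>R i)"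
      by (rule tendsto_ip[OF g(2) t(2) g(1) _ c' c']) simp
    have e: "ip ?M (\<psi> n) (\<lambda>x. frechet_derivative \<eta> (at x) i) = - ip ?M (cgrad (\<psi> n)) (\<lambda>x. \<eta> x *\<^sub>R i)" for n
      using test_function_has_weak_gradient[OF \<psi>(1) \<Omega>(1), of n] \<eta> i
      by (simp add: has_weak_gradient_def ip_def mult.commute)
    have "ip ?M w (\<lambda>x. frechet_derivative \<eta> (at x) i) = - ip ?M g (\<lambda>x. \<eta> x *\<^sub>R i)"
      using LIMSEQ_unique[OF l1] tendsto_minus[OF l2] unfolding e by blast
    then show "(LINT x|?M. w x * frechet_derivative \<eta> (at x) i) = - (LINT x|?M. (g x \<bullet> i) * \<eta> x)"
      by (simp add: ip_def mult.commute)
  qed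
  note h = W1p_2_I[OF \<Omega>(1) w(1) g(1) wg]
  have "l2 ?M (\<lambda>x. cgrad (\<psi> n) x - weak_grad \<Omega> w x) = l2 ?M (\<lambda>x. cgrad (\<psi> n) x - g x)" for n
    using h(2) L2s_measurable[OF t(2)] L2s_measurable[OF g(1)] L2s_measurable[OF W1p_2_D(3)[OF \<Omega>(1) h(1)]]
    by (intro l2_cong_AE borel_measurable_diff) auto
  then have H: "w \<in> H10 \<Omega>"
    unfolding H10_iff[OF \<Omega>(1)] using h(1) \<psi>(1) w(2) g(2) by (intro conjI exI[of _ \<psi>]) auto
  have "l2 ?M w = 1"
    using LIMSEQ_unique[OF tendsto_l2[OF w(2) t(1) w(1)], of 1] by (simp add: t(5) \<psi>(2))
  moreover have "(l2 ?M (weak_grad \<Omega> w))\<^sup>2 = m"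
  proof -
    have "(\<lambda>n. (l2 ?M (cgrad (\<psi> n)))\<^sup>2) \<longlonglongrightarrow> (l2 ?M g)\<^sup>2"
      by (intro tendsto_power tendsto_l2[OF g(2) t(2) g(1)])
    then have "G \<longlonglongrightarrow> (l2 ?M g)\<^sup>2" by (simp add: G_def[abs_def] t(6))
    then show ?thesis using LIMSEQ_unique[OF Glim] l2_weak_grad_eq[OF \<Omega>(1) h(1) g(1) h(2)] by simp
  qed
  ultimately show thesis using that[OF H _ _ le] by blast
qed

text \<open>\<open>LEAST\<close> says something only once a least eigenvalue is exhibited. The
  minimizer solves the eigenvalue equation because the first variation of a nonnegative quadratic
  vanishes at its zero, and an arbitrary eigenvalue is the Rayleigh quotient of its own
  eigenfunction, hence no smaller.\<close>

lemma first_dirichlet_eigenvalue_le_Rayleigh: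
  fixes \<Omega> :: "'a::euclidean_space set"
  assumes \<Omega>: "open \<Omega>" "bounded \<Omega>" and v: "v \<in> H10 \<Omega>"
  shows "first_dirichlet_eigenvalue \<Omega> * (l2 (lebesgue_on \<Omega>) v)\<^sup>2 \<le> (l2 (lebesgue_on \<Omega>) (weak_grad \<Omega> v))\<^sup>2"
proof (cases "\<Omega> = {}")
  \<comment> \<open>The empty set has no eigenvalue and \<open>LEAST\<close> is unspecified, but
    both integrals vanish.\<close>
  case True
  then show ?thesis by (simp add: l2_def)
next
  case False
  let ?M = "lebesgue_on \<Omega>"
  obtain m w where w: "w \<in> H10 \<Omega>" "l2 ?M w = 1" "(l2 ?M (weak_grad \<Omega> w))\<^sup>2 = m"
    and m: "\<And>\<phi>. test_function \<Omega> \<phi> \<Longrightarrow> m * (l2 lborel \<phi>)\<^sup>2 \<le> (l2 lborel (cgrad \<phi>))\<^sup>2"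
    using Rayleigh_minimizer[OF \<Omega> False] by metis
  have R: "m * (l2 ?M u)\<^sup>2 \<le> (l2 ?M (weak_grad \<Omega> u))\<^sup>2" if "u \<in> H10 \<Omega>" for u
    by (rule H10_le_of_test_functions[OF \<Omega>(1) that m])
  have H1: "u \<in> H1 \<Omega>" if "u \<in> H10 \<Omega>" for u using that by (simp add: H10_def)
  note D = W1p_2_D[OF \<Omega>(1) H1]
  have ev: "neg_laplacian \<Omega> w u = m * L2_pair \<Omega> w u" if u: "u \<in> H10 \<Omega>" for u
  proof -
    have eq: "(l2 ?M (\<lambda>x. w x + s * u x))\<^sup>2 = 1 + 2 * s * ip ?M w u + s\<^sup>2 * (l2 ?M u)\<^sup>2" for s
      using l2_add_scaleR_power2[OF D(1)[OF w(1)] D(1)[OF u], of s] w(2) by simp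
    have eq2: "(l2 ?M (weak_grad \<Omega> (\<lambda>x. w x + s * u x)))\<^sup>2 = m + 2 * s * ip ?M (weak_grad \<Omega> w) (weak_grad \<Omega> u) + s\<^sup>2 * (l2 ?M (weak_grad \<Omega> u))\<^sup>2" for s
    proof -
      have su: "(\<lambda>x. s * u x) \<in> H1 \<Omega>" by (rule H1_cmult[OF \<Omega>(1) H1[OF u]])
      have "AE x in ?M. weak_grad \<Omega> (\<lambda>x. w x + s * u x) x = weak_grad \<Omega> w x + s *\<^sub>R weak_grad \<Omega> u x"
        using H1_add(2)[OF \<Omega>(1) H1[OF w(1)] su] H1_cmult(2)[OF \<Omega>(1) H1[OF u], of s] by eventually_elim simp
      then have "l2 ?M (weak_grad \<Omega> (\<lambda>x. w x + s * u x)) = l2 ?M (\<lambda>x. weak_grad \<Omega> w x + s *\<^sub>R weak_grad \<Omega> u x)"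
        by (intro l2_weak_grad_eq[OF \<Omega>(1)] H1_add(1)[OF \<Omega>(1) H1[OF w(1)] su] L2s_add L2s_scaleR D w(1) u)
      then show ?thesis
        using l2_add_scaleR_power2[OF D(3)[OF w(1)] D(3)[OF u], of s] w(3) by simp
    qed
    \<comment> \<open>Half of the first variation, at w in direction u, of the squared gradient norm
      minus m times the squared norm; \<open>Q\<close> is the quadratic part.\<close>
    define P where "P = ip ?M (weak_grad \<Omega> w) (weak_grad \<Omega> u) - m * ip ?M w u"
    define Q where "Q = (l2 ?M (weak_grad \<Omega> u))\<^sup>2 - m * (l2 ?M u)\<^sup>2"
    have "P\<^sup>2 \<le> 0 * Q"
    proof (rule quadratic_nonneg_imp_discriminant)
      show "0 \<le> 0 + 2 * s * P + s\<^sup>2 * Q" for s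
        using R[OF H10_add_cmult[OF \<Omega>(1) w(1) u, of s]] unfolding eq eq2 P_def Q_def by (simp add: algebra_simps)
    qed
    then have "P = 0" by simp
    then show ?thesis unfolding P_def by (simp add: neg_laplacian_def ip_def L2_pair_eq_ip)
  qed
  have "first_dirichlet_eigenvalue \<Omega> = m"
    unfolding first_dirichlet_eigenvalue_def
  proof (rule Least_equality)
    have "\<not> (AE x in ?M. w x = 0)"
      using l2_eq_0_iff_AE[OF D(1)[OF w(1)]] w(2) by simp
    then show "dirichlet_eigenvalue \<Omega> m"
      unfolding dirichlet_eigenvalue_def using w(1) ev by blast
    fix k assume "dirichlet_eigenvalue \<Omega> k"
    then obtain u where u: "u \<in> H10 \<Omega>" "\<not> (AE x in ?M. u x = 0)" "neg_laplacian \<Omega> u u = k * L2_pair \<Omega> u u"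
      unfolding dirichlet_eigenvalue_def by blast
    have "l2 ?M u \<noteq> 0" using l2_eq_0_iff_AE[OF D(1)[OF u(1)]] u(2) by simp
    then have p: "(l2 ?M u)\<^sup>2 > 0" by simp
    have "(l2 ?M (weak_grad \<Omega> u))\<^sup>2 = k * (l2 ?M u)\<^sup>2"
      using u(3) by (simp add: neg_laplacian_def L2_pair_eq_ip l2_power2_eq_ip) (simp add: ip_def)
    with R[OF u(1)] p show "m \<le> k" by simp
  qed
  then show ?thesis using R[OF v] by simp
qed

section \<open>Absolutely continuous functions\<close>

lemma abs_continuous_subinterval:
  assumes "abs_continuous_on_interval a b f" "a \<le> a'" "b' \<le> b"
  shows "abs_continuous_on_interval a' b' f"
  unfolding abs_continuous_on_interval_def
proof (intro allI impI)
  fix e :: real assume "e > 0"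
  then obtain d where d: "d > 0" "\<And>D. finite D \<and> (\<forall>(x, y)\<in>D. a \<le> x \<and> x \<le> y \<and> y \<le> b) \<and>
        disjoint_family_on (\<lambda>(x, y). {x<..<y}) D \<and> (\<Sum>(x, y)\<in>D. y - x) < d \<Longrightarrow>
        (\<Sum>(x, y)\<in>D. \<bar>f y - f x\<bar>) < e"
    using assms(1) unfolding abs_continuous_on_interval_def by blast
  have "(\<Sum>(x, y)\<in>D. \<bar>f y - f x\<bar>) < e"
    if "finite D \<and> (\<forall>(x, y)\<in>D. a' \<le> x \<and> x \<le> y \<and> y \<le> b') \<and>
        disjoint_family_on (\<lambda>(x, y). {x<..<y}) D \<and> (\<Sum>(x, y)\<in>D. y - x) < d" for D
    by (rule d(2)) (use that assms(2,3) in force)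
  with d(1) show "\<exists>d>0. \<forall>D. finite D \<and> (\<forall>(x, y)\<in>D. a' \<le> x \<and> x \<le> y \<and> y \<le> b') \<and>
        disjoint_family_on (\<lambda>(x, y). {x<..<y}) D \<and> (\<Sum>(x, y)\<in>D. y - x) < d \<longrightarrow>
        (\<Sum>(x, y)\<in>D. \<bar>f y - f x\<bar>) < e" by blast
qed

text \<open>The sums in the definition are dominated term by term. Lipschitz functions, differences
  and the corrector are all instances of this criterion.\<close>

lemma abs_continuous_dominated:
  assumes f: "abs_continuous_on_interval a b f" and g: "abs_continuous_on_interval a b g"
    and L: "L \<ge> 0" "\<And>x y. a \<le> x \<Longrightarrow> x \<le> y \<Longrightarrow> y \<le> b \<Longrightarrow> \<bar>p y - p x\<bar> \<le> L * (\<bar>f y - f x\<bar> + \<bar>g y - g x\<bar> + (y - x))"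
  shows "abs_continuous_on_interval a b p"
  unfolding abs_continuous_on_interval_def
proof (intro allI impI)
  fix e :: real assume e: "e > 0"
  \<comment> \<open>One third for each of the three terms of the bound; \<open>L + 1\<close> in
    place of L covers L = 0 and makes the final inequality strict.\<close>
  define e' where "e' = e / (L + 1) / 3"
  have e': "e' > 0" using e L(1) by (simp add: e'_def)
  obtain d1 where d1: "d1 > 0" "\<And>D. finite D \<and> (\<forall>(x, y)\<in>D. a \<le> x \<and> x \<le> y \<and> y \<le> b) \<and>
        disjoint_family_on (\<lambda>(x, y). {x<..<y}) D \<and> (\<Sum>(x, y)\<in>D. y - x) < d1 \<Longrightarrow>
        (\<Sum>(x, y)\<in>D. \<bar>f y - f x\<bar>) < e'"
    using f e' unfolding abs_continuous_on_interval_def by blast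
  obtain d2 where d2: "d2 > 0" "\<And>D. finite D \<and> (\<forall>(x, y)\<in>D. a \<le> x \<and> x \<le> y \<and> y \<le> b) \<and>
        disjoint_family_on (\<lambda>(x, y). {x<..<y}) D \<and> (\<Sum>(x, y)\<in>D. y - x) < d2 \<Longrightarrow>
        (\<Sum>(x, y)\<in>D. \<bar>g y - g x\<bar>) < e'"
    using g e' unfolding abs_continuous_on_interval_def by blast
  have "(\<Sum>(x, y)\<in>D. \<bar>p y - p x\<bar>) < e"
    if D: "finite D \<and> (\<forall>(x, y)\<in>D. a \<le> x \<and> x \<le> y \<and> y \<le> b) \<and>
        disjoint_family_on (\<lambda>(x, y). {x<..<y}) D \<and> (\<Sum>(x, y)\<in>D. y - x) < min (min d1 d2) e'" for D
  proof -
    have "(\<Sum>(x, y)\<in>D. \<bar>p y - p x\<bar>) \<le> (\<Sum>(x, y)\<in>D. L * (\<bar>f y - f x\<bar> + \<bar>g y - g x\<bar> + (y - x)))"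
      using D L(2) by (intro sum_mono) auto
    also have "\<dots> = L * ((\<Sum>(x, y)\<in>D. \<bar>f y - f x\<bar>) + (\<Sum>(x, y)\<in>D. \<bar>g y - g x\<bar>) + (\<Sum>(x, y)\<in>D. y - x))"
      by (simp add: sum_distrib_left sum.distrib[symmetric] case_prod_beta')
    also have "\<dots> \<le> L * (e' + e' + e')"
    proof (rule mult_left_mono[OF _ L(1)])
      have "(\<Sum>(x, y)\<in>D. \<bar>f y - f x\<bar>) < e'" by (rule d1(2)) (use D in simp)
      moreover have "(\<Sum>(x, y)\<in>D. \<bar>g y - g x\<bar>) < e'" by (rule d2(2)) (use D in simp)
      moreover have "(\<Sum>(x, y)\<in>D. y - x) < e'" using D by simp
      ultimately show "(\<Sum>(x, y)\<in>D. \<bar>f y - f x\<bar>) + (\<Sum>(x, y)\<in>D. \<bar>g y - g x\<bar>) + (\<Sum>(x, y)\<in>D. y - x) \<le> e' + e' + e'"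
        by linarith
    qed
    also have "\<dots> = e * (L / (L + 1))"
    proof -
      have "t / 3 + t / 3 + t / 3 = t" for t :: real by simp
      then have "e' + e' + e' = e / (L + 1)" unfolding e'_def by blast
      then show ?thesis by simp
    qed
    also have "\<dots> < e * 1"
      using e L(1) by (intro mult_strict_left_mono) auto
    finally show ?thesis by simp
  qed
  moreover have "min (min d1 d2) e' > 0" using d1(1) d2(1) e' by simp
  ultimately show "\<exists>d>0. \<forall>D. finite D \<and> (\<forall>(x, y)\<in>D. a \<le> x \<and> x \<le> y \<and> y \<le> b) \<and>
        disjoint_family_on (\<lambda>(x, y). {x<..<y}) D \<and> (\<Sum>(x, y)\<in>D. y - x) < d \<longrightarrow>
        (\<Sum>(x, y)\<in>D. \<bar>p y - p x\<bar>) < e" by blast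
qed

lemma abs_continuous_const: "abs_continuous_on_interval a b (\<lambda>x. c)"
  unfolding abs_continuous_on_interval_def by (auto intro!: exI[of _ 1] simp: case_prod_beta')

lemma abs_continuous_Lipschitz:
  assumes "L \<ge> 0" "\<And>x y. a \<le> x \<Longrightarrow> x \<le> y \<Longrightarrow> y \<le> b \<Longrightarrow> \<bar>p y - p x\<bar> \<le> L * (y - x)"
  shows "abs_continuous_on_interval a b p"
  by (rule abs_continuous_dominated[OF abs_continuous_const abs_continuous_const assms(1)]) (use assms(2) in simp)

lemma abs_continuous_C1:
  assumes der: "\<And>x. a \<le> x \<Longrightarrow> x \<le> b \<Longrightarrow> (p has_real_derivative p' x) (at x)" and c: "continuous_on {a..b} p'"
  shows "abs_continuous_on_interval a b p"
proof -
  have "bounded (p' ` {a..b})" by (intro compact_imp_bounded compact_continuous_image c) simp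
  then obtain L where L: "L > 0" "\<And>x. x \<in> {a..b} \<Longrightarrow> \<bar>p' x\<bar> \<le> L" by (auto simp: bounded_pos)
  show ?thesis
  proof (rule abs_continuous_Lipschitz)
    show "\<bar>p y - p x\<bar> \<le> L * (y - x)" if "a \<le> x" "x \<le> y" "y \<le> b" for x y
    proof (cases "x = y")
      case False
      then have "x < y" using that by simp
      have "(p has_real_derivative p' w) (at w)" if "x \<le> w" "w \<le> y" for w
        using that \<open>a \<le> x\<close> \<open>y \<le> b\<close> by (intro der) auto
      then obtain z where "z > x" "z < y" "p y - p x = (y - x) * p' z"
        using MVT2[OF \<open>x < y\<close>, of p p'] by blast
      then show ?thesis using L(2)[of z] that by (simp add: abs_mult mult.commute mult_right_mono)
    qed simp
  qed (use L in simp)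
qed

lemma abs_continuous_diff:
  assumes "abs_continuous_on_interval a b f" "abs_continuous_on_interval a b g"
  shows "abs_continuous_on_interval a b (\<lambda>x. f x - g x)"
  by (rule abs_continuous_dominated[OF assms, of 1]) (auto simp: abs_if)

lemma abs_continuous_imp_continuous:
  assumes "abs_continuous_on_interval a b f"
  shows "continuous_on {a..b} f"
  unfolding continuous_on_iff
proof (intro ballI allI impI)
  fix x e :: real assume x: "x \<in> {a..b}" and "e > 0"
  then obtain d where d: "d > 0" "\<And>D. finite D \<and> (\<forall>(x, y)\<in>D. a \<le> x \<and> x \<le> y \<and> y \<le> b) \<and>
        disjoint_family_on (\<lambda>(x, y). {x<..<y}) D \<and> (\<Sum>(x, y)\<in>D. y - x) < d \<Longrightarrow>
        (\<Sum>(x, y)\<in>D. \<bar>f y - f x\<bar>) < e"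
    using assms unfolding abs_continuous_on_interval_def by blast
  have "\<bar>f v - f u\<bar> < e" if "a \<le> u" "u \<le> v" "v \<le> b" "v - u < d" for u v
    using d(2)[of "{(u, v)}"] that by (simp add: disjoint_family_on_def)
  then have "\<bar>f y - f x\<bar> < e" if "y \<in> {a..b}" "\<bar>y - x\<bar> < d" for y
    using that x by (cases "y \<le> x") (fastforce simp: abs_minus_commute)+
  with d(1) show "\<exists>d>0. \<forall>x'\<in>{a..b}. dist x' x < d \<longrightarrow> dist (f x') (f x) < e"
    by (auto simp: dist_real_def)
qed

lemma sum_lengths_le_measure:
  assumes "finite D" "disjoint_family_on (\<lambda>(x, y). {x<..<y}) D" "\<And>x y. (x, y) \<in> D \<Longrightarrow> x \<le> y \<and> {x<..<y} \<subseteq> U"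
    and U: "U \<in> lmeasurable"
  shows "(\<Sum>(x, y)\<in>D. y - x) \<le> measure lebesgue (U :: real set)"
proof -
  have fin: "emeasure lborel {u<..<v} \<noteq> \<infinity>" for u v :: real
    using emeasure_bounded_finite[OF bounded_subset[OF bounded_closed_interval[of u v]], of "{u<..<v}"]
    by (auto simp: greaterThanLessThan_subseteq_atLeastAtMost_iff)
  have "(\<Sum>(x, y)\<in>D. y - x) = (\<Sum>p\<in>D. measure lebesgue ((\<lambda>(x, y). {x<..<y}) p))"
    using assms(3) by (intro sum.cong) (auto simp: measure_def)
  also have "\<dots> = measure lebesgue (\<Union>p\<in>D. (\<lambda>(x, y). {x<..<y}) p)"
    using assms(1,2) fin by (intro measure_finite_Union[symmetric]) auto
  also have "\<dots> \<le> measure lebesgue U"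
    using assms(3) U by (intro measure_mono_fmeasurable) (auto simp: fmeasurableD intro!: sets.finite_UN assms(1))
  finally show ?thesis .
qed

text \<open>By Bolzano's covering argument, the increment of \<open>f\<close> splits into a part controlled by the
  derivative and a part carried by a small open neighbourhood of the exceptional null set.\<close>

lemma abs_continuous_antimono:
  fixes f :: "real \<Rightarrow> real"
  assumes ac: "abs_continuous_on_interval a b f" and ab: "a \<le> b"
    and der: "AE x in lebesgue. x \<in> {a<..<b} \<longrightarrow> (\<exists>d\<le>0. (f has_real_derivative d) (at x))"
  shows "f b \<le> f a"
proof -
  obtain N where N: "N \<in> null_sets lebesgue" "\<And>x. x \<notin> N \<Longrightarrow> x \<in> {a<..<b} \<Longrightarrow> \<exists>d\<le>0. (f has_real_derivative d) (at x)"
    using der unfolding completion.AE_iff_null_sets by auto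
  \<comment> \<open>Nothing is assumed about the derivative at the end points, so they join the
    exceptional set.\<close>
  define N' where "N' = N \<union> {a, b}"
  have N': "N' \<in> null_sets lebesgue"
    unfolding N'_def using N(1) by (simp add: negligible_iff_null_sets[symmetric])
  have le: "f b - f a \<le> e * (b - a) + e" if e: "e > 0" for e
  proof -
    obtain d where d: "d > 0" "\<And>D. finite D \<and> (\<forall>(x, y)\<in>D. a \<le> x \<and> x \<le> y \<and> y \<le> b) \<and>
        disjoint_family_on (\<lambda>(x, y). {x<..<y}) D \<and> (\<Sum>(x, y)\<in>D. y - x) < d \<Longrightarrow>
        (\<Sum>(x, y)\<in>D. \<bar>f y - f x\<bar>) < e"
      using ac e unfolding abs_continuous_on_interval_def by blast
    obtain U where U: "open U" "N' \<subseteq> U" "U \<in> lmeasurable" "measure lebesgue U < d"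
    proof -
      have "N' \<in> sets lebesgue" using N' by blast
      then obtain T where T: "open T" "N' \<subseteq> T" "emeasure lebesgue (T - N') < ennreal d"
        using sets_lebesgue_outer_open d(1) by metis
      have Ts: "T \<in> sets lebesgue" using T(1) by (rule open_sets_lebesgue)
      have em: "emeasure lebesgue T < ennreal d" using T(3) emeasure_Diff_null_set[OF N' Ts] by simp
      then have "T \<in> lmeasurable" using Ts by (intro fmeasurableI) (auto simp: less_top[symmetric] intro: less_trans)
      moreover from this em have "measure lebesgue T < d"
        using d(1) by (simp add: emeasure_eq_measure2 ennreal_less_iff)
      ultimately show thesis using that T(1,2) by blast
    qed
    \<comment> \<open>Bolzano's argument also presents intervals that stick out of [a, b]; the
      premise makes \<open>P\<close> vacuous there. The strict inequality \<open>x < y\<close> keeps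
      the families of adjacent intervals from sharing a degenerate interval.\<close>
    define P where "P u v \<longleftrightarrow> (a \<le> u \<and> v \<le> b \<longrightarrow> (\<exists>D. finite D \<and> (\<forall>(x, y)\<in>D. u \<le> x \<and> x < y \<and> y \<le> v \<and> {x<..<y} \<subseteq> U) \<and>
        disjoint_family_on (\<lambda>(x, y). {x<..<y}) D \<and> f v - f u \<le> e * (v - u) + (\<Sum>(x, y)\<in>D. \<bar>f y - f x\<bar>)))" for u v
    have "P a b"
      using ab
    proof (induction rule: Bolzano)
      case (trans u v w)
      show ?case
        unfolding P_def
      proof (intro impI)
        assume uw: "a \<le> u \<and> w \<le> b"
        obtain D1 where D1: "finite D1" "\<forall>(x, y)\<in>D1. u \<le> x \<and> x < y \<and> y \<le> v \<and> {x<..<y} \<subseteq> U"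
          "disjoint_family_on (\<lambda>(x, y). {x<..<y}) D1" "f v - f u \<le> e * (v - u) + (\<Sum>(x, y)\<in>D1. \<bar>f y - f x\<bar>)"
          using trans uw unfolding P_def by auto
        obtain D2 where D2: "finite D2" "\<forall>(x, y)\<in>D2. v \<le> x \<and> x < y \<and> y \<le> w \<and> {x<..<y} \<subseteq> U"
          "disjoint_family_on (\<lambda>(x, y). {x<..<y}) D2" "f w - f v \<le> e * (w - v) + (\<Sum>(x, y)\<in>D2. \<bar>f y - f x\<bar>)"
          using trans uw unfolding P_def by auto
        have disj: "D1 \<inter> D2 = {}"
        proof (rule equals0I)
          fix p assume "p \<in> D1 \<inter> D2"
          then show False using D1(2) D2(2) by (cases p) force
        qed
        show "\<exists>D. finite D \<and> (\<forall>(x, y)\<in>D. u \<le> x \<and> x < y \<and> y \<le> w \<and> {x<..<y} \<subseteq> U) \<and>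
          disjoint_family_on (\<lambda>(x, y). {x<..<y}) D \<and> f w - f u \<le> e * (w - u) + (\<Sum>(x, y)\<in>D. \<bar>f y - f x\<bar>)"
        proof (intro exI[of _ "D1 \<union> D2"] conjI)
          show "\<forall>(x, y)\<in>D1 \<union> D2. u \<le> x \<and> x < y \<and> y \<le> w \<and> {x<..<y} \<subseteq> U"
            using D1(2) D2(2) trans(3,4) by fastforce
          show "disjoint_family_on (\<lambda>(x, y). {x<..<y}) (D1 \<union> D2)"
            unfolding disjoint_family_on_def
          proof (intro ballI impI)
            fix p q assume pq: "p \<in> D1 \<union> D2" "q \<in> D1 \<union> D2" "p \<noteq> q"
            have *: "(case r of (x, y) \<Rightarrow> {x<..<y}) \<inter> (case s of (x, y) \<Rightarrow> {x<..<y}) = {}" if "r \<in> D1" "s \<in> D2" for r s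
              using D1(2) D2(2) that by (cases r, cases s) force
            show "(case p of (x, y) \<Rightarrow> {x<..<y}) \<inter> (case q of (x, y) \<Rightarrow> {x<..<y}) = {}"
              using pq D1(3) D2(3) *[of p q] *[of q p] unfolding disjoint_family_on_def by blast
          qed
          show "f w - f u \<le> e * (w - u) + (\<Sum>(x, y)\<in>D1 \<union> D2. \<bar>f y - f x\<bar>)"
            using D1(1,4) D2(1,4) disj by (simp add: sum.union_disjoint algebra_simps)
        qed (use D1(1) D2(1) in simp)
      qed
    next
      case (local x)
      show ?case
      proof (cases "x \<in> N'")
        case True
        then obtain r where r: "r > 0" "ball x r \<subseteq> U" using U(1,2) open_contains_ball by blast
        have "P u v" if uv: "u \<le> x \<and> x \<le> v \<and> v - u < r" for u v
          unfolding P_def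
        proof (intro impI)
          have sub: "{u<..<v} \<subseteq> U" using r(2) uv by (force simp: dist_real_def)
          show "\<exists>D. finite D \<and> (\<forall>(x, y)\<in>D. u \<le> x \<and> x < y \<and> y \<le> v \<and> {x<..<y} \<subseteq> U) \<and>
            disjoint_family_on (\<lambda>(x, y). {x<..<y}) D \<and> f v - f u \<le> e * (v - u) + (\<Sum>(x, y)\<in>D. \<bar>f y - f x\<bar>)"
          proof (cases "u = v")
            case True
            then show ?thesis by (intro exI[of _ "{}"]) (simp add: disjoint_family_on_def)
          next
            case False
            then have "0 \<le> e * (v - u)" using uv e by simp
            then show ?thesis using False sub uv
              by (intro exI[of _ "{(u, v)}"]) (auto simp: disjoint_family_on_def)
          qed
        qed
        with r(1) show ?thesis by blast
      next
        case False
        then have "x \<in> {a<..<b}" "x \<notin> N" using local unfolding N'_def by auto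
        then obtain d where d: "d \<le> 0" "(f has_real_derivative d) (at x)" using N(2) by blast
        then have "((\<lambda>h. (f (x + h) - f x) / h) \<longlongrightarrow> d) (at 0)" by (simp add: DERIV_def)
        then obtain r where r: "r > 0" "\<And>h. h \<noteq> 0 \<Longrightarrow> \<bar>h\<bar> < r \<Longrightarrow> \<bar>(f (x + h) - f x) / h - d\<bar> < e"
          using e unfolding LIM_eq by (auto simp: dist_real_def)
        \<comment> \<open>The increment is split at x, since the difference quotient controls only
          increments that start or end at x.\<close>
        have right: "f v - f x \<le> e * (v - x)" if "x \<le> v" "v - x < r" for v
        proof (cases "v = x")
          case False
          then have "\<bar>(f v - f x) / (v - x) - d\<bar> < e" using r(2)[of "v - x"] that by simp
          then have "(f v - f x) / (v - x) \<le> e" using d(1) by linarith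
          then show ?thesis using False that by (simp add: pos_divide_le_eq)
        qed simp
        have left: "f x - f u \<le> e * (x - u)" if "u \<le> x" "x - u < r" for u
        proof (cases "u = x")
          case False
          then have "\<bar>(f u - f x) / (u - x) - d\<bar> < e" using r(2)[of "u - x"] that by simp
          moreover have "(f u - f x) / (u - x) = (f x - f u) / (x - u)" by (simp add: minus_divide_divide[symmetric, of "f u - f x"])
          ultimately have "(f x - f u) / (x - u) \<le> e" using d(1) by linarith
          then show ?thesis using False that by (simp add: pos_divide_le_eq)
        qed simp
        have "P u v" if uv: "u \<le> x \<and> x \<le> v \<and> v - u < r" for u v
          unfolding P_def
        proof (intro impI exI[of _ "{}"] conjI)
          show "f v - f u \<le> e * (v - u) + (\<Sum>(x, y)\<in>{}. \<bar>f y - f x\<bar>)"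
            using left[of u] right[of v] uv by (simp add: algebra_simps)
        qed (auto simp: disjoint_family_on_def)
        with r(1) show ?thesis by blast
      qed
    qed
    then obtain D where D: "finite D" "\<forall>(x, y)\<in>D. a \<le> x \<and> x < y \<and> y \<le> b \<and> {x<..<y} \<subseteq> U"
        "disjoint_family_on (\<lambda>(x, y). {x<..<y}) D" "f b - f a \<le> e * (b - a) + (\<Sum>(x, y)\<in>D. \<bar>f y - f x\<bar>)"
      unfolding P_def by auto
    have "(\<Sum>(x, y)\<in>D. y - x) \<le> measure lebesgue U"
      using D by (intro sum_lengths_le_measure U(3)) auto
    with U(4) have "(\<Sum>(x, y)\<in>D. y - x) < d" by linarith
    then have "(\<Sum>(x, y)\<in>D. \<bar>f y - f x\<bar>) < e" using D by (intro d(2)) auto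
    with D(4) show ?thesis by linarith
  qed
  show ?thesis
  proof (rule ccontr)
    assume "\<not> f b \<le> f a"
    then have p: "f b - f a > 0" by simp
    define e where "e = (f b - f a) / (2 * (b - a + 1))"
    have "e > 0" using p ab by (simp add: e_def)
    from le[OF this] have "f b - f a \<le> e * (b - a + 1)" by (simp add: algebra_simps)
    also have "\<dots> = (f b - f a) / 2" using ab by (simp add: e_def field_simps)
    finally show False using p by simp
  qed
qed

text \<open>After the last point where f \<le> y the difference stays positive up to the end, so the
  inequality between the derivatives, assumed only where f > y, makes the difference nonincreasing
  there.\<close>

lemma abs_continuous_comparison:
  fixes f y :: "real \<Rightarrow> real"
  assumes f: "abs_continuous_on_interval a b f" and y: "abs_continuous_on_interval a b y" and ab: "a \<le> b"
    and init: "f a \<le> y a"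
    and der: "AE x in lebesgue. x \<in> {a<..<b} \<longrightarrow> f x > y x \<longrightarrow>
       (\<exists>d e. (f has_real_derivative d) (at x) \<and> (y has_real_derivative e) (at x) \<and> d \<le> e)"
  shows "f b \<le> y b"
proof (rule ccontr)
  assume nle: "\<not> f b \<le> y b"
  define g where "g x = f x - y x" for x
  have g: "abs_continuous_on_interval a b g" unfolding g_def by (rule abs_continuous_diff[OF f y])
  note cg = abs_continuous_imp_continuous[OF g]
  define S where "S = {x \<in> {a..b}. g x \<le> 0}"
  have S: "compact S"
  proof -
    have "closed S" unfolding S_def by (rule continuous_on_closed_Collect_le[OF cg continuous_on_const]) simp
    moreover have "bounded S" unfolding S_def by (rule bounded_subset[of "{a..b}"]) auto
    ultimately show ?thesis by (simp add: compact_eq_bounded_closed)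
  qed
  have "a \<in> S" using init ab by (simp add: S_def g_def)
  then obtain s where s: "s \<in> S" "\<And>x. x \<in> S \<Longrightarrow> x \<le> s" using compact_attains_sup[OF S] by blast
  have sb: "a \<le> s" "s \<le> b" "g s \<le> 0" using s(1) by (auto simp: S_def)
  have pos: "g x > 0" if "x \<in> {s<..<b}" for x
    using s(2)[of x] that sb by (force simp: S_def)
  have "g b \<le> g s"
  proof (rule abs_continuous_antimono[OF abs_continuous_subinterval[OF g sb(1) order.refl] sb(2)])
    show "AE x in lebesgue. x \<in> {s<..<b} \<longrightarrow> (\<exists>d\<le>0. (g has_real_derivative d) (at x))"
      using der
    proof eventually_elim
      case (elim x)
      show ?case
      proof
        assume x: "x \<in> {s<..<b}"
        then obtain d e where "(f has_real_derivative d) (at x)" "(y has_real_derivative e) (at x)" "d \<le> e"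
          using elim pos[OF x] sb(1) by (auto simp: g_def)
        then show "\<exists>d\<le>0. (g has_real_derivative d) (at x)"
          unfolding g_def[abs_def] by (intro exI[of _ "d - e"]) (auto intro: DERIV_diff)
      qed
    qed
  qed
  then show False using nle sb(3) by (simp add: g_def)
qed

section \<open>The differential inequality for the modified energy\<close>

text \<open>A case distinction at y = \<eta> x, with \<eta>^b = \<delta>, takes the place of
  convexity: in each region one variable is replaced by its bound in terms of the other.\<close>

lemma young_powr:
  fixes a b \<delta> :: real
  assumes "a > 0" "b > 0" "\<delta> > 0"
  obtains C where "C \<ge> 0" "\<And>x y. 0 \<le> x \<Longrightarrow> 0 \<le> y \<Longrightarrow> x powr a * y powr b \<le> \<delta> * x powr (a + b) + C * y powr (a + b)"
proof
  define \<eta> where "\<eta> = \<delta> powr (1 / b)"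
  have \<eta>: "\<eta> > 0" "\<eta> powr b = \<delta>" using assms by (auto simp: \<eta>_def powr_powr)
  show "0 \<le> \<eta> powr (- a)" by simp
  fix x y :: real assume xy: "0 \<le> x" "0 \<le> y"
  show "x powr a * y powr b \<le> \<delta> * x powr (a + b) + \<eta> powr (- a) * y powr (a + b)"
  proof (cases "y \<le> \<eta> * x")
    case True
    have "x powr a * y powr b \<le> x powr a * (\<eta> * x) powr b"
      using xy True assms by (intro mult_left_mono powr_mono2) auto
    also have "\<dots> = \<delta> * x powr (a + b)"
      using xy \<eta> by (simp add: powr_mult powr_add)
    finally show ?thesis by (simp add: add_increasing2)
  next
    case False
    have "x powr a * y powr b \<le> (y / \<eta>) powr a * y powr b"
      using xy False assms \<eta> by (intro mult_right_mono powr_mono2) (auto simp: pos_le_divide_eq mult.commute)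
    also have "\<dots> = \<eta> powr (- a) * y powr (a + b)"
      using xy \<eta> by (simp add: powr_divide powr_add powr_minus field_simps)
    finally show ?thesis using assms by (simp add: add_increasing)
  qed
qed

lemma young_powr_1:
  fixes a b \<delta> :: real
  assumes "a > 0" "b > 0" "\<delta> > 0"
  obtains C where "C \<ge> 0" "\<And>x. 0 \<le> x \<Longrightarrow> x powr a \<le> \<delta> * x powr (a + b) + C"
proof -
  obtain C where "C \<ge> 0" "\<And>x y. 0 \<le> x \<Longrightarrow> 0 \<le> y \<Longrightarrow> x powr a * y powr b \<le> \<delta> * x powr (a + b) + C * y powr (a + b)"
    using young_powr[OF assms] by blast
  from that[OF this(1)] this(2)[of _ 1] show thesis by simp
qed

lemma square_le_powr:
  fixes b \<delta> :: real
  assumes "b > 0" "\<delta> > 0"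
  obtains C where "C \<ge> 0" "\<And>x. 0 \<le> x \<Longrightarrow> x\<^sup>2 \<le> \<delta> * x powr (b + 2) + C"
proof -
  obtain C where "C \<ge> 0" "\<And>x. 0 \<le> x \<Longrightarrow> x powr 2 \<le> \<delta> * x powr (2 + b) + C"
    using young_powr_1[of 2 b \<delta>] assms by auto
  then show thesis using that[of C] by (simp add: powr_two_eq_square add.commute)
qed

lemma le_powr:
  fixes b \<delta> :: real
  assumes "b > - 1" "\<delta> > 0"
  obtains C where "C \<ge> 0" "\<And>x. 0 \<le> x \<Longrightarrow> x \<le> \<delta> * x powr (b + 2) + C"
proof -
  obtain C where "C \<ge> 0" "\<And>x. 0 \<le> x \<Longrightarrow> x powr 1 \<le> \<delta> * x powr (1 + (b + 1)) + C"
    using young_powr_1[of 1 "b + 1" \<delta>] assms by auto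
  then show thesis using that[of C] by (simp add: powr_one' add.commute)
qed

text \<open>From here on a solution is seen only through the real numbers V, A, U and z, which stand
  for the norms of u_t, of the gradient of u and of u, and for (u_t, u). \<open>P\<close> is a
  Poincare constant.\<close>

locale kirchhoff_parameters =
  fixes b c \<alpha> \<beta> lam mu P :: real
  assumes b: "b > 0" and c: "c > 0" and \<alpha>: "0 < \<alpha>" and \<beta>: "\<alpha> < \<beta>" and P: "P > 0"
begin

definition en :: "real \<Rightarrow> real \<Rightarrow> real \<Rightarrow> real" where
  "en V A U = V\<^sup>2 / 2 + A\<^sup>2 / 2 + b / (\<beta> + 2) * A powr (\<beta> + 2) - lam / 2 * U\<^sup>2"

text \<open>The energy identity, with r in place of (h, u_t).\<close>

definition en' :: "real \<Rightarrow> real \<Rightarrow> real" where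
  "en' V r = - c * V powr (\<alpha> + 2) + mu * V\<^sup>2 + r"

text \<open>The formal derivative of (u_t, u): the square of V plus the equation tested with u, with
  r in place of (h, u).\<close>

definition cross' :: "real \<Rightarrow> real \<Rightarrow> real \<Rightarrow> real \<Rightarrow> real \<Rightarrow> real" where
  "cross' V A U z r = V\<^sup>2 - A\<^sup>2 - b * A powr (\<beta> + 2) - c * V powr \<alpha> * z + lam * U\<^sup>2 + mu * z + r"

definition \<gamma> :: real where
  "\<gamma> = min (\<alpha> / 2) ((\<beta> - \<alpha>) / ((\<alpha> + 1) * (\<beta> + 2)))"

definition admissible :: "real \<Rightarrow> real \<Rightarrow> real \<Rightarrow> real \<Rightarrow> bool" where
  "admissible V A U z \<longleftrightarrow> 0 \<le> V \<and> 0 \<le> A \<and> 0 \<le> U \<and> U \<le> P * A \<and> \<bar>z\<bar> \<le> V * U"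

lemma \<beta>_pos: "\<beta> > 0" using \<alpha> \<beta> by simp

lemma \<gamma>_pos: "\<gamma> > 0"
  unfolding \<gamma>_def using \<alpha> \<beta> \<beta>_pos by auto

text \<open>The first bound is for e^\<gamma> V^2, the second for the damping tested with u, the
  third for the corrector, which must stay below a multiple of e. The third follows from the second
  term of the minimum if \<beta> - 2\<alpha> \<le> \<alpha>\<beta>, and from \<gamma> \<le>
  \<alpha>/2 otherwise.\<close>

lemma \<gamma>_le: "2 * \<gamma> \<le> \<alpha>" "(\<gamma> + 1 / (\<beta> + 2)) * (\<alpha> + 2) \<le> 1 + \<gamma>" "\<gamma> + 1 / 2 + 1 / (\<beta> + 2) \<le> 1"
proof -
  have \<gamma>2: "\<gamma> \<le> \<alpha> / 2" unfolding \<gamma>_def by (rule min.cobounded1)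
  then show "2 * \<gamma> \<le> \<alpha>" by linarith
  have "\<gamma> \<le> (\<beta> - \<alpha>) / ((\<alpha> + 1) * (\<beta> + 2))" unfolding \<gamma>_def by simp
  then have le: "\<gamma> * ((\<alpha> + 1) * (\<beta> + 2)) \<le> \<beta> - \<alpha>" using \<alpha> \<beta>_pos by (simp add: pos_le_divide_eq)
  have "((\<gamma> + 1 / (\<beta> + 2)) * (\<alpha> + 2)) * (\<beta> + 2) = (\<gamma> * (\<beta> + 2) + 1) * (\<alpha> + 2)"
    using \<beta>_pos by (simp add: field_simps)
  also have "\<dots> \<le> (1 + \<gamma>) * (\<beta> + 2)" using le by (simp add: algebra_simps)
  finally show "(\<gamma> + 1 / (\<beta> + 2)) * (\<alpha> + 2) \<le> 1 + \<gamma>" using \<beta>_pos by simp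
  have "\<gamma> * (2 * (\<beta> + 2)) \<le> \<beta>"
  proof (cases "\<beta> - 2 * \<alpha> \<le> \<alpha> * \<beta>")
    case True
    have "\<gamma> * (2 * (\<beta> + 2)) * (\<alpha> + 1) = 2 * (\<gamma> * ((\<alpha> + 1) * (\<beta> + 2)))" by simp
    also have "\<dots> \<le> 2 * (\<beta> - \<alpha>)" using le by simp
    also have "\<dots> \<le> \<beta> * (\<alpha> + 1)" using True by (simp add: algebra_simps)
    finally show ?thesis using \<alpha> by simp
  next
    case False
    have "\<gamma> * (2 * (\<beta> + 2)) \<le> \<alpha> / 2 * (2 * (\<beta> + 2))"
      using \<beta>_pos \<gamma>2 by (intro mult_right_mono) auto
    also have "\<dots> \<le> \<beta>" using False by (simp add: algebra_simps)
    finally show ?thesis .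
  qed
  then have "\<gamma> \<le> \<beta> / (2 * (\<beta> + 2))" using \<beta>_pos by (simp add: pos_le_divide_eq)
  also have "\<dots> = 1 / 2 - 1 / (\<beta> + 2)" using \<beta>_pos by (simp add: field_simps)
  finally show "\<gamma> + 1 / 2 + 1 / (\<beta> + 2) \<le> 1" by simp
qed

section \<open>Estimates of the energy and of the two derivatives for fixed values of V, A, U and
  z\<close>

lemma lam_U_le:
  assumes "admissible V A U z"
  shows "\<bar>lam * U\<^sup>2\<bar> \<le> \<bar>lam\<bar> * P\<^sup>2 * A\<^sup>2"
proof -
  have "U\<^sup>2 \<le> (P * A)\<^sup>2" using assms by (intro power_mono) (auto simp: admissible_def)
  then have "\<bar>lam\<bar> * U\<^sup>2 \<le> \<bar>lam\<bar> * (P * A)\<^sup>2" by (intro mult_left_mono) auto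
  then show ?thesis by (simp add: abs_mult power_mult_distrib)
qed

lemma abs_z_le:
  assumes "admissible V A U z"
  shows "\<bar>z\<bar> \<le> P * (V * A)"
proof -
  have "V * U \<le> V * (P * A)" using assms by (intro mult_left_mono) (auto simp: admissible_def)
  then show ?thesis using assms by (simp add: admissible_def algebra_simps)
qed

text \<open>The term with \<open>lam\<close> has arbitrary sign and size, and A^(\<beta>+2) absorbs
  it at the price of the constant \<open>K\<close>. The normalization
  \<open>1 \<le> en V A U + K\<close> lets powers of the shifted energy be compared by their
  exponents.\<close>

lemma energy_bounds:
  obtains K B C where "K \<ge> 0" "B > 0" "C \<ge> 0"
    "\<And>V A U z. admissible V A U z \<Longrightarrow> 1 \<le> en V A U + K \<and> V\<^sup>2 + A powr (\<beta> + 2) \<le> B * (en V A U + K) \<and>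
        en V A U + K \<le> V\<^sup>2 / 2 + B * A powr (\<beta> + 2) + C"
proof -
  define L where "L = \<bar>lam\<bar> * P\<^sup>2 / 2 + 1"
  have L: "L > 0" unfolding L_def by (simp add: add_nonneg_pos)
  \<comment> \<open>Half of the coefficient of A^(\<beta>+2): one half absorbs the quadratic terms,
    the other remains in the lower bound.\<close>
  define q where "q = b / (2 * (\<beta> + 2))"
  have q: "q > 0" "b / (\<beta> + 2) = 2 * q" "2 * (\<beta> + 2) / b = 1 / q"
    using b \<beta>_pos by (auto simp: q_def field_simps)
  define \<delta> where "\<delta> = q / L"
  have \<delta>: "\<delta> > 0" "L * \<delta> = q" using q L unfolding \<delta>_def by auto
  obtain C0 where C0: "C0 \<ge> 0" "\<And>x. 0 \<le> x \<Longrightarrow> x\<^sup>2 \<le> \<delta> * x powr (\<beta> + 2) + C0"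
    using square_le_powr[OF \<beta>_pos \<delta>(1)] by blast
  define K where "K = L * C0 + 1"
  \<comment> \<open>\<open>2 + 1 / q\<close> is for bounding V and A by the energy,
    \<open>4 * q\<close> for the converse.\<close>
  define B where "B = 2 + 1 / q + 4 * q"
  have B: "2 \<le> B" "2 + 1 / q \<le> B" "4 * q \<le> B"
    using q(1) by (auto simp: B_def)
  show thesis
  proof (rule that[of K B "K + L * C0"])
    show K0: "K \<ge> 0" "B > 0" "K + L * C0 \<ge> 0" using L C0(1) B(1) by (auto simp: K_def)
    fix V A U z assume a: "admissible V A U z"
    then have n: "0 \<le> V" "0 \<le> A" by (auto simp: admissible_def)
    define Q where "Q = A powr (\<beta> + 2)"
    have Q: "0 \<le> Q" by (simp add: Q_def)
    have A2: "L * A\<^sup>2 \<le> q * Q + L * C0"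
    proof -
      have "L * A\<^sup>2 \<le> L * (\<delta> * Q + C0)" using C0(2)[OF n(2)] L unfolding Q_def by (intro mult_left_mono) auto
      also have "\<dots> = L * \<delta> * Q + L * C0" by (simp only: distrib_left mult.assoc)
      finally show ?thesis unfolding \<delta>(2) .
    qed
    have lU: "\<bar>lam / 2 * U\<^sup>2\<bar> \<le> (L - 1) * A\<^sup>2" using lam_U_le[OF a] by (simp add: L_def)
    have half: "b / (\<beta> + 2) * Q = 2 * (q * Q)" by (simp add: q(2))
    have lower: "V\<^sup>2 / 2 + q * Q + 1 \<le> en V A U + K"
    proof -
      have "lam / 2 * U\<^sup>2 \<le> L * A\<^sup>2" using lU zero_le_power2[of A] unfolding left_diff_distrib abs_le_iff by linarith
      then show ?thesis using A2 zero_le_power2[of A] unfolding en_def K_def Q_def[symmetric] half by linarith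
    qed
    have bQ: "0 \<le> q * Q" using q(1) Q by simp
    have e1: "1 \<le> en V A U + K" using lower bQ zero_le_power2[of V] by linarith
    moreover have "V\<^sup>2 + Q \<le> B * (en V A U + K)"
    proof -
      have "V\<^sup>2 + Q \<le> (2 + 1 / q) * (V\<^sup>2 / 2 + q * Q + 1)"
      proof -
        have "(2 + 1 / q) * (V\<^sup>2 / 2 + q * Q + 1) = V\<^sup>2 + Q + (2 * (q * Q + 1) + 1 / q * (V\<^sup>2 / 2 + 1))"
          using q(1) by (simp add: field_simps)
        moreover have "0 \<le> 2 * (q * Q + 1) + 1 / q * (V\<^sup>2 / 2 + 1)"
          using Q q(1) by (intro add_nonneg_nonneg mult_nonneg_nonneg) auto
        ultimately show ?thesis by linarith
      qed
      also have "\<dots> \<le> B * (en V A U + K)"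
        using lower bQ q(1) B(1,2) by (intro mult_mono) auto
      finally show ?thesis .
    qed
    moreover have "en V A U + K \<le> V\<^sup>2 / 2 + B * Q + (K + L * C0)"
    proof -
      have "- (lam / 2 * U\<^sup>2) \<le> (L - 1) * A\<^sup>2" using lU unfolding abs_le_iff by linarith
      then have "A\<^sup>2 / 2 - lam / 2 * U\<^sup>2 \<le> L * A\<^sup>2" using zero_le_power2[of A] unfolding left_diff_distrib by linarith
      moreover have "4 * q * Q \<le> B * Q" using B(3) Q by (rule mult_right_mono)
      moreover have "4 * q * Q = 4 * (q * Q)" by simp
      ultimately show ?thesis using A2 bQ unfolding en_def Q_def[symmetric] half by linarith
    qed
    ultimately show "1 \<le> en V A U + K \<and> V\<^sup>2 + A powr (\<beta> + 2) \<le> B * (en V A U + K) \<and>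
        en V A U + K \<le> V\<^sup>2 / 2 + B * A powr (\<beta> + 2) + (K + L * C0)"
      unfolding Q_def by blast
  qed
qed

text \<open>The damping is of higher order than the term with \<open>mu\<close> and than the force,
  and a quarter of it absorbs each of them up to a constant. The additions of 1 keep the divisors
  positive.\<close>

lemma en'_le:
  assumes H: "H \<ge> 0"
  obtains C where "C \<ge> 0" "\<And>V r. 0 \<le> V \<Longrightarrow> \<bar>r\<bar> \<le> H * V \<Longrightarrow> en' V r \<le> - (c / 2) * V powr (\<alpha> + 2) + C"
proof -
  obtain C1 where C1: "C1 \<ge> 0" "\<And>x. 0 \<le> x \<Longrightarrow> x\<^sup>2 \<le> c / 4 / (\<bar>mu\<bar> + 1) * x powr (\<alpha> + 2) + C1"
    using square_le_powr[OF \<alpha>, of "c / 4 / (\<bar>mu\<bar> + 1)"] c by (auto simp: add_nonneg_pos)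
  obtain C2 where C2: "C2 \<ge> 0" "\<And>x. 0 \<le> x \<Longrightarrow> x \<le> c / 4 / (H + 1) * x powr (\<alpha> + 2) + C2"
    using le_powr[of \<alpha> "c / 4 / (H + 1)"] c H \<alpha> by auto
  show thesis
  proof (rule that[of "(\<bar>mu\<bar> + 1) * C1 + (H + 1) * C2"])
    show "0 \<le> (\<bar>mu\<bar> + 1) * C1 + (H + 1) * C2" using C1(1) C2(1) H by simp
    fix V r :: real assume V: "0 \<le> V" and r: "\<bar>r\<bar> \<le> H * V"
    define W where "W = V powr (\<alpha> + 2)"
    have "mu * V\<^sup>2 \<le> (\<bar>mu\<bar> + 1) * V\<^sup>2" by (intro mult_right_mono) auto
    also have "\<dots> \<le> (\<bar>mu\<bar> + 1) * (c / 4 / (\<bar>mu\<bar> + 1) * W + C1)"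
      using C1(2)[OF V] unfolding W_def by (intro mult_left_mono) auto
    also have "\<dots> = c / 4 * W + (\<bar>mu\<bar> + 1) * C1"
    proof -
      have "m * (c / 4 / m) = c / 4" if "m > 0" for m using that by simp
      from this[of "\<bar>mu\<bar> + 1"] have "(\<bar>mu\<bar> + 1) * (c / 4 / (\<bar>mu\<bar> + 1)) = c / 4" by linarith
      then show ?thesis by (simp only: distrib_left mult.assoc[symmetric])
    qed
    finally have 1: "mu * V\<^sup>2 \<le> c / 4 * W + (\<bar>mu\<bar> + 1) * C1" .
    have "r \<le> (H + 1) * V" using r V by (simp add: distrib_right abs_le_iff)
    also have "\<dots> \<le> (H + 1) * (c / 4 / (H + 1) * W + C2)"
      using C2(2)[OF V] H unfolding W_def by (intro mult_left_mono) auto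
    also have "\<dots> = c / 4 * W + (H + 1) * C2"
    proof -
      have "m * (c / 4 / m) = c / 4" if "m > 0" for m using that by simp
      from this[of "H + 1"] have "(H + 1) * (c / 4 / (H + 1)) = c / 4" using H by linarith
      then show ?thesis by (simp only: distrib_left mult.assoc[symmetric])
    qed
    finally have 2: "r \<le> c / 4 * W + (H + 1) * C2" .
    have "c * W = c / 4 * W + c / 4 * W + c / 2 * W" by simp
    then show "en' V r \<le> - (c / 2) * V powr (\<alpha> + 2) + ((\<bar>mu\<bar> + 1) * C1 + (H + 1) * C2)"
      using 1 2 unfolding en'_def W_def[symmetric] by simp
  qed
qed

lemma damping_cross_le:
  assumes "admissible V A U z"
  shows "- c * V powr \<alpha> * z \<le> c * P * (V powr (\<alpha> + 1) * A)"
proof -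
  have n: "0 \<le> V" "0 \<le> A" using assms by (auto simp: admissible_def)
  have "- c * V powr \<alpha> * z \<le> c * V powr \<alpha> * \<bar>z\<bar>"
    using c by (simp add: mult_left_mono abs_le_iff minus_le_iff)
      (metis abs_ge_minus_self mult_left_mono mult_minus_right mult_nonneg_nonneg less_imp_le powr_ge_zero mult.assoc)
  also have "\<dots> \<le> c * V powr \<alpha> * (P * (V * A))"
    using abs_z_le[OF assms] c by (intro mult_left_mono) auto
  also have "\<dots> = c * P * (V powr (\<alpha> + 1) * A)"
    using n by (simp add: powr_add)
  finally show ?thesis .
qed

text \<open>A quarter of b A^(\<beta>+2) absorbs the quadratic terms in A, another quarter the
  force. The terms with V^2 and V^(\<alpha>+1) A are kept, to be set against the damping of the
  energy.\<close>

lemma cross'_le: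
  assumes H: "H \<ge> 0"
  obtains C D k where "C \<ge> 0" "D \<ge> 0" "k > 0"
    "\<And>V A U z r. admissible V A U z \<Longrightarrow> \<bar>r\<bar> \<le> H * U \<Longrightarrow>
      cross' V A U z r \<le> D * V\<^sup>2 - k * A powr (\<beta> + 2) + c * P * (V powr (\<alpha> + 1) * A) + C"
proof -
  define L where "L = \<bar>lam\<bar> * P\<^sup>2 + \<bar>mu\<bar> * P + 1"
  have L: "L > 0" unfolding L_def using P by (intro add_nonneg_pos add_nonneg_nonneg) auto
  obtain C1 where C1: "C1 \<ge> 0" "\<And>x. 0 \<le> x \<Longrightarrow> x\<^sup>2 \<le> b / 4 / L * x powr (\<beta> + 2) + C1"
    using square_le_powr[OF \<beta>_pos, of "b / 4 / L"] b L by auto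
  define HP where "HP = H * P + 1"
  have HP: "HP > 0" unfolding HP_def using H P by (simp add: add_nonneg_pos)
  obtain C2 where C2: "C2 \<ge> 0" "\<And>x. 0 \<le> x \<Longrightarrow> x \<le> b / 4 / HP * x powr (\<beta> + 2) + C2"
    using le_powr[of \<beta> "b / 4 / HP"] b HP \<beta>_pos by auto
  show thesis
  proof (rule that[of "L * C1 + HP * C2" "1 + \<bar>mu\<bar> * P" "b / 2"])
    show "0 \<le> L * C1 + HP * C2" "0 \<le> 1 + \<bar>mu\<bar> * P" "0 < b / 2" using C1(1) C2(1) L HP P b by auto
    fix V A U z r assume a: "admissible V A U z" and r: "\<bar>r\<bar> \<le> H * U"
    then have n: "0 \<le> V" "0 \<le> A" "U \<le> P * A" by (auto simp: admissible_def)
    define Q where "Q = A powr (\<beta> + 2)"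
    have "L * A\<^sup>2 \<le> L * (b / 4 / L * Q + C1)" using C1(2)[OF n(2)] L unfolding Q_def by (intro mult_left_mono) auto
    also have "\<dots> = b / 4 * Q + L * C1" using L by (simp add: distrib_left)
    finally have 1: "L * A\<^sup>2 \<le> b / 4 * Q + L * C1" .
    have "HP * A \<le> HP * (b / 4 / HP * Q + C2)" using C2(2)[OF n(2)] HP unfolding Q_def by (intro mult_left_mono) auto
    also have "\<dots> = b / 4 * Q + HP * C2" using HP by (simp add: distrib_left)
    finally have 2: "HP * A \<le> b / 4 * Q + HP * C2" .
    have "r \<le> H * (P * A)" using r mult_left_mono[OF n(3) H] by linarith
    also have "\<dots> \<le> HP * A" using n(2) by (simp add: HP_def distrib_right)
    finally have 3: "r \<le> HP * A" .
    have 4: "lam * U\<^sup>2 \<le> \<bar>lam\<bar> * P\<^sup>2 * A\<^sup>2" using lam_U_le[OF a] by linarith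
    have 5: "mu * z \<le> \<bar>mu\<bar> * P * V\<^sup>2 + \<bar>mu\<bar> * P * A\<^sup>2"
    proof -
      have "mu * z \<le> \<bar>mu\<bar> * \<bar>z\<bar>" by (metis abs_ge_self abs_mult)
      also have "\<dots> \<le> \<bar>mu\<bar> * (P * (V * A))" using abs_z_le[OF a] by (intro mult_left_mono) auto
      also have "\<dots> \<le> \<bar>mu\<bar> * (P * (V\<^sup>2 + A\<^sup>2))"
      proof -
        have "0 \<le> V * A" using n by simp
        then have "V * A \<le> V\<^sup>2 + A\<^sup>2" using sum_squares_bound[of V A] by linarith
        then show ?thesis using P by (intro mult_left_mono) auto
      qed
      finally show ?thesis by (simp add: algebra_simps)
    qed
    have "\<bar>lam\<bar> * P\<^sup>2 * A\<^sup>2 + \<bar>mu\<bar> * P * A\<^sup>2 \<le> L * A\<^sup>2" by (simp add: L_def algebra_simps)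
    moreover have "b * Q = b / 4 * Q + b / 4 * Q + b / 2 * Q" by simp
    ultimately show "cross' V A U z r \<le> (1 + \<bar>mu\<bar> * P) * V\<^sup>2 - b / 2 * A powr (\<beta> + 2) + c * P * (V powr (\<alpha> + 1) * A) + (L * C1 + HP * C2)"
      using 1 2 3 4 5 damping_cross_le[OF a] zero_le_power2[of A]
      unfolding cross'_def Q_def[symmetric] distrib_right by linarith
  qed
qed


lemma le_powr_of_powr_le:
  fixes x p B e :: real
  assumes "0 \<le> x" "p > 0" "x powr p \<le> B * e" "0 \<le> B" "0 \<le> e"
  shows "x \<le> B powr (1 / p) * e powr (1 / p)"
proof -
  have "p * (1 / p) = 1" using assms(2) by simp
  then have "x = (x powr p) powr (1 / p)" using assms(1) unfolding powr_powr by simp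
  also have "\<dots> \<le> (B * e) powr (1 / p)" using assms by (intro powr_mono2) auto
  finally show ?thesis using assms by (simp add: powr_mult)
qed

text \<open>The upper energy bound trades - A^(\<beta>+2) for a negative multiple of e, at the price
  of V^2 and a constant. Of the gain \<kappa> e^(1+\<gamma>) the three bad terms take a sixth each,
  and half remains.\<close>

lemma powr_cross'_le:
  assumes H: "H \<ge> 0"
  obtains K B \<kappa> C4 C5 C6 where "B > 0" "\<kappa> > 0" "C4 \<ge> 0" "C5 \<ge> 0" "C6 \<ge> 0"
    "\<And>V A U z r e. admissible V A U z \<Longrightarrow> \<bar>r\<bar> \<le> H * U \<Longrightarrow> e = en V A U + K \<Longrightarrow>
       1 \<le> e \<and> V\<^sup>2 + A powr (\<beta> + 2) \<le> B * e \<and> e powr \<gamma> * \<bar>z\<bar> \<le> C4 * e \<and>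
       e powr \<gamma> * cross' V A U z r \<le> - (\<kappa> / 2) * e powr (1 + \<gamma>) + C5 * V powr (\<alpha> + 2) + C6"
proof -
  let ?q = "\<beta> + 2"
  have q: "?q > 0" using \<beta>_pos by simp
  obtain K B C0 where K: "B > 0" "C0 \<ge> 0" and
    en: "\<And>V A U z. admissible V A U z \<Longrightarrow> 1 \<le> en V A U + K \<and> V\<^sup>2 + A powr ?q \<le> B * (en V A U + K) \<and>
        en V A U + K \<le> V\<^sup>2 / 2 + B * A powr ?q + C0"
    using energy_bounds by metis
  obtain C2 D k0 where C2: "C2 \<ge> 0" "D \<ge> 0" "k0 > 0" and
    cr: "\<And>V A U z r. admissible V A U z \<Longrightarrow> \<bar>r\<bar> \<le> H * U \<Longrightarrow>
      cross' V A U z r \<le> D * V\<^sup>2 - k0 * A powr ?q + c * P * (V powr (\<alpha> + 1) * A) + C2"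
    using cross'_le[OF H] by metis
  \<comment> \<open>\<open>B\<close> is the coefficient of A^(\<beta>+2) in the upper energy bound,
    so \<kappa> e is paid for by \<open>k0\<close> times that power.\<close>
  define \<kappa> where "\<kappa> = k0 / B"
  have \<kappa>: "\<kappa> > 0" "\<kappa> * B = k0" using C2(3) K(1) by (auto simp: \<kappa>_def)
  define D' where "D' = D + \<kappa> / 2"
  define C3 where "C3 = C2 + \<kappa> * C0"
  define a1 where "a1 = B powr (1 / ?q)"
  define F where "F = c * P * a1"
  have pos: "D' \<ge> 0" "C3 \<ge> 0" "a1 > 0" "F \<ge> 0" using C2 \<kappa> K c P by (auto simp: D'_def C3_def a1_def F_def)
  \<comment> \<open>The Young parameters below are divided by m + 1 rather than m, as the
    coefficient m may be 0.\<close>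
  have div: "m * (\<kappa> / 6 / (m + 1)) \<le> \<kappa> / 6" if "m \<ge> 0" for m
  proof -
    have "m * (\<kappa> / 6 / (m + 1)) \<le> (m + 1) * (\<kappa> / 6 / (m + 1))" using that \<kappa>(1) by (intro mult_right_mono) auto
    also have "\<dots> = \<kappa> / 6"
    proof -
      have "t * (\<kappa> / 6 / t) = \<kappa> / 6" if "t > 0" for t using that by simp
      then show ?thesis using that by (metis add_nonneg_pos zero_less_one)
    qed
    finally show ?thesis .
  qed
  \<comment> \<open>To be used with x = e^(1/2), for which x^(2\<gamma>) = e^\<gamma> and
    x^(2\<gamma>+2) = e^(1+\<gamma>).\<close>
  obtain Y1 where Y1: "Y1 \<ge> 0" "\<And>x y. 0 \<le> x \<Longrightarrow> 0 \<le> y \<Longrightarrow>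
      x powr (2 * \<gamma>) * y powr 2 \<le> \<kappa> / 6 / (D' + 1) * x powr (2 * \<gamma> + 2) + Y1 * y powr (2 * \<gamma> + 2)"
    using young_powr[of "2 * \<gamma>" 2 "\<kappa> / 6 / (D' + 1)"] \<gamma>_pos \<kappa> pos by auto
  obtain Y2 where Y2: "Y2 \<ge> 0" "\<And>x y. 0 \<le> x \<Longrightarrow> 0 \<le> y \<Longrightarrow>
      x powr 1 * y powr (\<alpha> + 1) \<le> \<kappa> / 6 / (F + 1) * x powr (1 + (\<alpha> + 1)) + Y2 * y powr (1 + (\<alpha> + 1))"
    using young_powr[of 1 "\<alpha> + 1" "\<kappa> / 6 / (F + 1)"] \<alpha> \<kappa> pos by auto
  obtain Y3 where Y3: "Y3 \<ge> 0" "\<And>x. 0 \<le> x \<Longrightarrow> x powr \<gamma> \<le> \<kappa> / 6 / (C3 + 1) * x powr (\<gamma> + 1) + Y3"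
    using young_powr_1[of \<gamma> 1 "\<kappa> / 6 / (C3 + 1)"] \<gamma>_pos \<kappa> pos by auto
  define C4 where "C4 = P * (B powr (1 / 2) * a1)"
  show thesis
  proof (rule that[of B \<kappa> C4 "D' * Y1 + F * Y2" "D' * Y1 + C3 * Y3" K])
    show "B > 0" "\<kappa> > 0" "C4 \<ge> 0" "D' * Y1 + F * Y2 \<ge> 0" "D' * Y1 + C3 * Y3 \<ge> 0"
      using K \<kappa> pos P Y1 Y2 Y3 by (auto simp: C4_def)
    fix V A U z r e assume a: "admissible V A U z" and r: "\<bar>r\<bar> \<le> H * U" and e: "e = en V A U + K"
    have n: "0 \<le> V" "0 \<le> A" using a by (auto simp: admissible_def)
    note E = en[OF a, folded e]
    then have e1: "1 \<le> e" by blast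
    define Q where "Q = A powr ?q"
    define X where "X = e powr (1 + \<gamma>)"
    define W where "W = V powr (\<alpha> + 2)"
    define g where "g = e powr \<gamma>"
    have g: "g > 0" using e1 by (simp add: g_def)
    have gX: "g * e = X" using e1 by (simp add: g_def X_def powr_add)
    have Vle: "V \<le> B powr (1 / 2) * e powr (1 / 2)"
      using E e1 K(1) n by (intro le_powr_of_powr_le) (auto simp: powr_two_eq_square intro: order.trans[rotated])
    have Ale: "A \<le> a1 * e powr (1 / ?q)"
      unfolding a1_def using E e1 K(1) n q by (intro le_powr_of_powr_le) (auto intro: order.trans[rotated])
    have zle: "\<bar>z\<bar> \<le> C4 * e powr (1 / 2 + 1 / ?q)"
    proof -
      have "\<bar>z\<bar> \<le> P * (V * A)" by (rule abs_z_le[OF a])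
      also have "\<dots> \<le> P * ((B powr (1 / 2) * e powr (1 / 2)) * (a1 * e powr (1 / ?q)))"
        using Vle Ale n P by (intro mult_left_mono mult_mono) auto
      also have "\<dots> = C4 * e powr (1 / 2 + 1 / ?q)" by (simp add: C4_def powr_add)
      finally show ?thesis .
    qed
    have gz: "g * \<bar>z\<bar> \<le> C4 * e"
    proof -
      have "g * \<bar>z\<bar> \<le> g * (C4 * e powr (1 / 2 + 1 / ?q))" using zle g by (intro mult_left_mono) auto
      also have "\<dots> = C4 * e powr (\<gamma> + 1 / 2 + 1 / ?q)" by (simp add: g_def powr_add)
      also have "\<dots> \<le> C4 * e powr 1"
        using \<gamma>_le(3) e1 pos P K(1) by (intro mult_left_mono powr_mono) (auto simp: C4_def)
      finally show ?thesis using e1 by simp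
    qed
    have 1: "g * V\<^sup>2 \<le> \<kappa> / 6 / (D' + 1) * X + Y1 * (W + 1)"
    proof -
      have "(e powr (1 / 2)) powr (2 * \<gamma>) * V powr 2
        \<le> \<kappa> / 6 / (D' + 1) * (e powr (1 / 2)) powr (2 * \<gamma> + 2) + Y1 * V powr (2 * \<gamma> + 2)"
        by (rule Y1(2)) (use n in auto)
      \<comment> \<open>This is where \<gamma> \<le> \<alpha>/2 enters; the 1 pays for small
        V.\<close>
      moreover have "V powr (2 * \<gamma> + 2) \<le> W + 1"
      proof (cases "V \<le> 1")
        case True
        then have "V powr (2 * \<gamma> + 2) \<le> 1" using n \<gamma>_pos by (intro powr_le1) auto
        then show ?thesis by (simp add: W_def add_increasing)
      next
        case False
        then have "V powr (2 * \<gamma> + 2) \<le> W" unfolding W_def using \<gamma>_le(1) by (intro powr_mono) auto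
        then show ?thesis by simp
      qed
      then have "Y1 * V powr (2 * \<gamma> + 2) \<le> Y1 * (W + 1)" using Y1(1) by (rule mult_left_mono)
      moreover have "(e powr (1 / 2)) powr (2 * \<gamma> + 2) = X" "(e powr (1 / 2)) powr (2 * \<gamma>) = g"
        unfolding X_def g_def powr_powr by (auto intro!: arg_cong[where f="(powr) e"] simp: field_simps)
      ultimately show ?thesis
        using n(1) by (simp add: powr_two_eq_square mult.commute)
    qed
    have 2: "g * (V powr (\<alpha> + 1) * A) \<le> a1 * (\<kappa> / 6 / (F + 1) * X + Y2 * W)"
    proof -
      \<comment> \<open>The factor A costs e^(1/(\<beta>+2)). Young's inequality raises x to the
        power \<alpha>+2, and the second bound in \<open>\<gamma>_le\<close> keeps the result below
        e^(1+\<gamma>).\<close>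
      define x where "x = e powr (\<gamma> + 1 / ?q)"
      have "g * (V powr (\<alpha> + 1) * A) \<le> g * (V powr (\<alpha> + 1) * (a1 * e powr (1 / ?q)))"
        using Ale g by (intro mult_left_mono) auto
      also have "\<dots> = a1 * (x powr 1 * V powr (\<alpha> + 1))" by (simp add: x_def g_def powr_add)
      also have "\<dots> \<le> a1 * (\<kappa> / 6 / (F + 1) * x powr (1 + (\<alpha> + 1)) + Y2 * V powr (1 + (\<alpha> + 1)))"
        using pos(3) n by (intro mult_left_mono Y2(2)) (auto simp: x_def)
      also have "\<dots> \<le> a1 * (\<kappa> / 6 / (F + 1) * X + Y2 * W)"
      proof -
        have "x powr (1 + (\<alpha> + 1)) = e powr ((\<gamma> + 1 / ?q) * (\<alpha> + 2))" by (simp add: x_def powr_powr add.commute)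
        also have "\<dots> \<le> X" unfolding X_def using e1 \<gamma>_le(2) by (intro powr_mono) auto
        finally have "\<kappa> / 6 / (F + 1) * x powr (1 + (\<alpha> + 1)) \<le> \<kappa> / 6 / (F + 1) * X"
          using \<kappa> pos by (intro mult_left_mono) auto
        moreover have "V powr (1 + (\<alpha> + 1)) = W" by (simp add: W_def add.commute)
        ultimately show ?thesis using pos(3) by (intro mult_left_mono) auto
      qed
      finally show ?thesis .
    qed
    have 3: "g \<le> \<kappa> / 6 / (C3 + 1) * X + Y3"
      using Y3(2)[of e] e1 by (simp add: g_def X_def add.commute)
    have "cross' V A U z r \<le> D' * V\<^sup>2 - \<kappa> * e + c * P * (V powr (\<alpha> + 1) * A) + C3"
    proof -
      have "\<kappa> * e \<le> \<kappa> * (V\<^sup>2 / 2 + B * Q + C0)" using E \<kappa>(1) unfolding Q_def by (intro mult_left_mono) auto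
      also have "\<dots> = \<kappa> / 2 * V\<^sup>2 + k0 * Q + \<kappa> * C0" by (simp add: distrib_left \<kappa>(2) mult.assoc[symmetric])
      finally show ?thesis using cr[OF a r] unfolding D'_def C3_def Q_def[symmetric] distrib_right by linarith
    qed
    then have "g * cross' V A U z r \<le> g * (D' * V\<^sup>2 - \<kappa> * e + c * P * (V powr (\<alpha> + 1) * A) + C3)"
      using g by (intro mult_left_mono) auto
    also have "\<dots> = D' * (g * V\<^sup>2) - \<kappa> * X + c * P * (g * (V powr (\<alpha> + 1) * A)) + C3 * g"
      by (simp add: gX[symmetric] algebra_simps)
    also have "\<dots> \<le> - (\<kappa> / 2) * X + (D' * Y1 + F * Y2) * W + (D' * Y1 + C3 * Y3)"
    proof -
      have X0: "0 \<le> X" by (simp add: X_def)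
      have "D' * (g * V\<^sup>2) \<le> D' * (\<kappa> / 6 / (D' + 1) * X + Y1 * (W + 1))" using 1 pos(1) by (rule mult_left_mono)
      also have "\<dots> = (D' * (\<kappa> / 6 / (D' + 1))) * X + D' * Y1 * W + D' * Y1" by (simp only: distrib_left mult.assoc mult_1_right add.assoc)
      also have "\<dots> \<le> \<kappa> / 6 * X + D' * Y1 * W + D' * Y1" using div[OF pos(1)] X0 by (intro add_right_mono mult_right_mono)
      finally have i: "D' * (g * V\<^sup>2) \<le> \<kappa> / 6 * X + D' * Y1 * W + D' * Y1" .
      have "c * P * (g * (V powr (\<alpha> + 1) * A)) \<le> c * P * (a1 * (\<kappa> / 6 / (F + 1) * X + Y2 * W))"
        using 2 c P by (intro mult_left_mono) auto
      also have "\<dots> = (F * (\<kappa> / 6 / (F + 1))) * X + F * Y2 * W" by (simp only: F_def distrib_left mult.assoc)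
      also have "\<dots> \<le> \<kappa> / 6 * X + F * Y2 * W" using div[OF pos(4)] X0 by (intro add_right_mono mult_right_mono)
      finally have ii: "c * P * (g * (V powr (\<alpha> + 1) * A)) \<le> \<kappa> / 6 * X + F * Y2 * W" .
      have "C3 * g \<le> C3 * (\<kappa> / 6 / (C3 + 1) * X + Y3)" using 3 pos(2) by (rule mult_left_mono)
      also have "\<dots> = (C3 * (\<kappa> / 6 / (C3 + 1))) * X + C3 * Y3" by (simp only: distrib_left mult.assoc)
      also have "\<dots> \<le> \<kappa> / 6 * X + C3 * Y3" using div[OF pos(2)] X0 by (intro add_right_mono mult_right_mono)
      finally have iii: "C3 * g \<le> \<kappa> / 6 * X + C3 * Y3" .
      have "\<kappa> * X = 3 * (\<kappa> / 6 * X) + \<kappa> / 2 * X" by simp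
      then show ?thesis using i ii iii unfolding distrib_right by simp
    qed
    finally show "1 \<le> e \<and> V\<^sup>2 + A powr (\<beta> + 2) \<le> B * e \<and> e powr \<gamma> * \<bar>z\<bar> \<le> C4 * e \<and>
       e powr \<gamma> * cross' V A U z r \<le> - (\<kappa> / 2) * e powr (1 + \<gamma>) + (D' * Y1 + F * Y2) * V powr (\<alpha> + 2) + (D' * Y1 + C3 * Y3)"
      using E gz unfolding g_def X_def W_def by blast
  qed
qed

text \<open>The weight \<open>\<epsilon>\<close> of the corrector is so small that the corrector perturbs the energy by at most a
  factor, and its growth in \<open>V\<close> is absorbed by the damping.\<close>

lemma modified_energy_inequality:
  fixes e W C1 C4 C5 C6 \<kappa> \<epsilon> p z X Z R :: real
  assumes e: "e > 0" and p: "0 < p" "\<epsilon> * p * C4 \<le> 1 / 2" and \<epsilon>: "0 < \<epsilon>" "\<epsilon> * C4 \<le> 1 / 2" "\<epsilon> * C5 \<le> c / 4"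
    and z: "e powr p * \<bar>z\<bar> \<le> C4 * e" and W: "W \<ge> 0" and C1: "C1 \<ge> 0" and \<kappa>: "\<kappa> > 0"
    and R: "R \<le> - (c / 2) * W + C1"
    and Z: "e powr p * Z \<le> - (\<kappa> / 2) * e powr (1 + p) + C5 * W + C6"
  shows "R * (1 + \<epsilon> * (p * e powr (p - 1) * z)) + \<epsilon> * (e powr p * Z)
      \<le> - (\<epsilon> * \<kappa> / 2 / (3 / 2) powr (1 + p)) * (e + \<epsilon> * (e powr p * z)) powr (1 + p) + (3 / 2 * C1 + \<epsilon> * C6)"
    "\<bar>\<epsilon> * (e powr p * z)\<bar> \<le> e / 2"
proof -
  \<comment> \<open>The relative change of the energy derivative caused by differentiating e^p in
    the corrector. It is at most 1/2 in absolute value, so at least half of the damping survives and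
    \<open>C1\<close> grows at most to 3/2 of itself.\<close>
  define th where "th = \<epsilon> * (p * e powr (p - 1) * z)"
  have "e powr (p - 1) * \<bar>z\<bar> \<le> C4"
  proof -
    have "e powr (p - 1) * \<bar>z\<bar> * e = e powr p * \<bar>z\<bar>" using e by (simp add: powr_diff)
    then show ?thesis using z e by (metis mult_le_cancel_right_pos)
  qed
  then have "\<epsilon> * p * (e powr (p - 1) * \<bar>z\<bar>) \<le> \<epsilon> * p * C4" using \<epsilon> p by (intro mult_left_mono) auto
  moreover have "\<bar>th\<bar> = \<epsilon> * p * (e powr (p - 1) * \<bar>z\<bar>)"
    using \<epsilon> p by (simp add: th_def abs_mult)
  ultimately have th: "\<bar>th\<bar> \<le> 1 / 2" using p(2) by linarith
  have "\<epsilon> * (e powr p * \<bar>z\<bar>) \<le> \<epsilon> * (C4 * e)" using z \<epsilon> by (intro mult_left_mono) auto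
  also have "\<dots> \<le> 1 / 2 * e" using \<epsilon>(2) e unfolding mult.assoc[symmetric] by (intro mult_right_mono) auto
  finally show cor: "\<bar>\<epsilon> * (e powr p * z)\<bar> \<le> e / 2" using \<epsilon> by (simp add: abs_mult)
  have cW: "0 \<le> c / 2 * W" using c W by simp
  have "R * (1 + th) \<le> (- (c / 2) * W + C1) * (1 + th)" using R th by (intro mult_right_mono) (auto simp: abs_le_iff)
  also have "\<dots> = - (c / 2 * W * (1 + th)) + C1 * (1 + th)" by (simp add: algebra_simps)
  also have "\<dots> \<le> - (c / 2 * W * (1 / 2)) + C1 * (3 / 2)"
    using th cW C1 by (intro add_mono le_imp_neg_le mult_left_mono) (auto simp: abs_le_iff)
  finally have 1: "R * (1 + th) \<le> - (c / 4 * W) + 3 / 2 * C1" by simp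
  have "\<epsilon> * (e powr p * Z) \<le> \<epsilon> * (- (\<kappa> / 2) * e powr (1 + p) + C5 * W + C6)"
    using Z \<epsilon> by (intro mult_left_mono) auto
  also have "\<dots> = - (\<epsilon> * \<kappa> / 2) * e powr (1 + p) + (\<epsilon> * C5) * W + \<epsilon> * C6" by (simp add: algebra_simps)
  also have "\<dots> \<le> - (\<epsilon> * \<kappa> / 2) * e powr (1 + p) + c / 4 * W + \<epsilon> * C6"
    using \<epsilon>(3) W by (intro add_mono order.refl mult_right_mono)
  finally have 2: "\<epsilon> * (e powr p * Z) \<le> - (\<epsilon> * \<kappa> / 2) * e powr (1 + p) + c / 4 * W + \<epsilon> * C6" .
  have 3: "- (\<epsilon> * \<kappa> / 2) * e powr (1 + p) \<le> - (\<epsilon> * \<kappa> / 2 / (3 / 2) powr (1 + p)) * (e + \<epsilon> * (e powr p * z)) powr (1 + p)"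
  proof -
    \<comment> \<open>The modified energy is at most 3/2 of e; hence the factor (3/2)^(1+p) in the
      rate.\<close>
    have "(e + \<epsilon> * (e powr p * z)) powr (1 + p) \<le> (3 / 2 * e) powr (1 + p)"
      using cor e p(1) by (intro powr_mono2) (auto simp: abs_le_iff)
    also have "\<dots> = (3 / 2) powr (1 + p) * e powr (1 + p)" using e by (intro powr_mult)
    finally have "(e + \<epsilon> * (e powr p * z)) powr (1 + p) / (3 / 2) powr (1 + p) \<le> e powr (1 + p)"
      by (simp add: pos_divide_le_eq mult.commute)
    then have "(\<epsilon> * \<kappa> / 2) * ((e + \<epsilon> * (e powr p * z)) powr (1 + p) / (3 / 2) powr (1 + p)) \<le> (\<epsilon> * \<kappa> / 2) * e powr (1 + p)"
      using \<epsilon>(1) \<kappa> by (intro mult_left_mono) auto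
    then show ?thesis by simp
  qed
  show "R * (1 + \<epsilon> * (p * e powr (p - 1) * z)) + \<epsilon> * (e powr p * Z)
      \<le> - (\<epsilon> * \<kappa> / 2 / (3 / 2) powr (1 + p)) * (e + \<epsilon> * (e powr p * z)) powr (1 + p) + (3 / 2 * C1 + \<epsilon> * C6)"
    using 1 2 3 unfolding th_def[symmetric] by linarith
qed

end

section \<open>Universal bounds for trajectories\<close>

lemma powr_Lipschitz_on_interval:
  fixes p m M :: real
  assumes "0 < m"
  obtains L where "L \<ge> 0" "\<And>x y. m \<le> x \<Longrightarrow> x \<le> M \<Longrightarrow> m \<le> y \<Longrightarrow> y \<le> M \<Longrightarrow> \<bar>y powr p - x powr p\<bar> \<le> L * \<bar>y - x\<bar>"
proof -
  have "continuous_on {m..M} (\<lambda>x. p * x powr (p - 1))" using assms by (intro continuous_intros) auto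
  then have "bounded ((\<lambda>x. p * x powr (p - 1)) ` {m..M})"
    by (intro compact_imp_bounded compact_continuous_image) auto
  then obtain L where L: "L > 0" "\<And>x. x \<in> {m..M} \<Longrightarrow> \<bar>p * x powr (p - 1)\<bar> \<le> L" by (auto simp: bounded_pos)
  have "\<bar>y powr p - x powr p\<bar> \<le> L * \<bar>y - x\<bar>" if "m \<le> x" "x \<le> M" "m \<le> y" "y \<le> M" for x y
  proof -
    have "norm (y powr p - x powr p) \<le> L * norm (y - x)"
    proof (rule field_differentiable_bound[of "{m..M}" "\<lambda>x. x powr p" "\<lambda>x. p * x powr (p - 1)"])
      show "((\<lambda>x. x powr p) has_field_derivative p * z powr (p - 1)) (at z within {m..M})" if "z \<in> {m..M}" for z
        using that assms by (auto intro!: has_field_derivative_at_within[OF has_real_derivative_powr])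
    qed (use L that in auto)
    then show ?thesis by simp
  qed
  with L(1) show thesis using that[of L] by simp
qed

text \<open>The map x -> x^p need not be Lipschitz near 0, which is why e is kept above m. On the
  compact range of e it is Lipschitz, and the product is split as usual for increments.\<close>

lemma abs_continuous_corrector:
  fixes e z :: "real \<Rightarrow> real"
  assumes e: "abs_continuous_on_interval a b e" and z: "abs_continuous_on_interval a b z"
    and m: "m > 0" "\<And>t. a \<le> t \<Longrightarrow> t \<le> b \<Longrightarrow> m \<le> e t"
  shows "abs_continuous_on_interval a b (\<lambda>t. e t + \<epsilon> * (e t powr p * z t))"
proof -
  have "bounded (e ` {a..b})" "bounded (z ` {a..b})"
    using abs_continuous_imp_continuous[OF e] abs_continuous_imp_continuous[OF z]
    by (auto intro!: compact_imp_bounded compact_continuous_image)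
  then obtain M Z where M: "\<And>t. a \<le> t \<Longrightarrow> t \<le> b \<Longrightarrow> \<bar>e t\<bar> \<le> M" and Z: "Z > 0" "\<And>t. a \<le> t \<Longrightarrow> t \<le> b \<Longrightarrow> \<bar>z t\<bar> \<le> Z"
    unfolding bounded_pos by fastforce
  have eM: "e t \<le> M" if "a \<le> t" "t \<le> b" for t using M[OF that] by linarith
  obtain L where L: "L \<ge> 0" "\<And>x y. m \<le> x \<Longrightarrow> x \<le> M \<Longrightarrow> m \<le> y \<Longrightarrow> y \<le> M \<Longrightarrow> \<bar>y powr p - x powr p\<bar> \<le> L * \<bar>y - x\<bar>"
    using powr_Lipschitz_on_interval[OF m(1)] by metis
  \<comment> \<open>A bound for e^p taken from the Lipschitz constant, whatever the sign of
    p.\<close>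
  define N where "N = m powr p + L * \<bar>M - m\<bar>"
  have N: "e t powr p \<le> N" if "a \<le> t" "t \<le> b" for t
  proof -
    have b: "m \<le> e t" "e t \<le> M" using m(2) eM that by auto
    then have "\<bar>e t powr p - m powr p\<bar> \<le> L * \<bar>e t - m\<bar>" by (intro L(2)) auto
    also have "\<dots> \<le> L * \<bar>M - m\<bar>" using b L(1) by (intro mult_left_mono) auto
    finally show ?thesis unfolding N_def by linarith
  qed
  have N0: "N \<ge> 0" unfolding N_def using L(1) by simp
  define C where "C = 1 + \<bar>\<epsilon>\<bar> * (L * Z) + \<bar>\<epsilon>\<bar> * N"
  show ?thesis
  proof (rule abs_continuous_dominated[OF e z, of C])
    show "C \<ge> 0" unfolding C_def using L(1) Z N0 by simp
    fix x y assume xy: "a \<le> x" "x \<le> y" "y \<le> b"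
    have "e y powr p * z y - e x powr p * z x = (e y powr p - e x powr p) * z y + e x powr p * (z y - z x)"
      by (simp add: algebra_simps)
    also have "\<bar>\<dots>\<bar> \<le> \<bar>e y powr p - e x powr p\<bar> * \<bar>z y\<bar> + e x powr p * \<bar>z y - z x\<bar>"
      by (rule order.trans[OF abs_triangle_ineq]) (simp add: abs_mult)
    also have "\<dots> \<le> (L * \<bar>e y - e x\<bar>) * Z + N * \<bar>z y - z x\<bar>"
      using xy m(2) eM L(1) Z(1) N0 by (intro add_mono mult_mono L(2) Z(2) N) auto
    finally have "\<bar>\<epsilon>\<bar> * \<bar>e y powr p * z y - e x powr p * z x\<bar> \<le> \<bar>\<epsilon>\<bar> * ((L * \<bar>e y - e x\<bar>) * Z + N * \<bar>z y - z x\<bar>)"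
      by (rule mult_left_mono) simp
    then have "\<bar>\<epsilon> * (e y powr p * z y) - \<epsilon> * (e x powr p * z x)\<bar> \<le> \<bar>\<epsilon>\<bar> * (L * Z) * \<bar>e y - e x\<bar> + \<bar>\<epsilon>\<bar> * N * \<bar>z y - z x\<bar>"
      unfolding right_diff_distrib[symmetric] abs_mult by (simp add: algebra_simps)
    moreover have "\<bar>(a + a') - (d + d')\<bar> \<le> 1 * \<bar>a - d\<bar> + \<bar>a' - d'\<bar>" for a a' d d' :: real
      using abs_triangle_ineq[of "a - d" "a' - d'"] by (simp add: algebra_simps)
    ultimately have "\<bar>(e y + \<epsilon> * (e y powr p * z y)) - (e x + \<epsilon> * (e x powr p * z x))\<bar>
      \<le> 1 * \<bar>e y - e x\<bar> + (\<bar>\<epsilon>\<bar> * (L * Z) * \<bar>e y - e x\<bar> + \<bar>\<epsilon>\<bar> * N * \<bar>z y - z x\<bar>)"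
      using order.trans add_left_mono by blast
    also have "\<dots> \<le> C * \<bar>e y - e x\<bar> + C * \<bar>z y - z x\<bar>"
    proof -
      have "(1 + \<bar>\<epsilon>\<bar> * (L * Z)) * \<bar>e y - e x\<bar> \<le> C * \<bar>e y - e x\<bar>" "\<bar>\<epsilon>\<bar> * N * \<bar>z y - z x\<bar> \<le> C * \<bar>z y - z x\<bar>"
        unfolding C_def using L(1) Z N0 by (intro mult_right_mono; simp)+
      then show ?thesis by (simp add: algebra_simps)
    qed
    also have "\<dots> \<le> C * (\<bar>e y - e x\<bar> + \<bar>z y - z x\<bar> + (y - x))"
      using \<open>C \<ge> 0\<close> xy by (simp add: distrib_left)
    finally show "\<bar>(e y + \<epsilon> * (e y powr p * z y)) - (e x + \<epsilon> * (e x powr p * z x))\<bar> \<le> C * (\<bar>e y - e x\<bar> + \<bar>z y - z x\<bar> + (y - x))" .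
  qed
qed

lemma corrector_has_derivative:
  assumes "(e has_real_derivative e') (at t)" "(z has_real_derivative z') (at t)" "e t > 0"
  shows "((\<lambda>t. e t + \<epsilon> * (e t powr p * z t)) has_real_derivative
    e' * (1 + \<epsilon> * (p * e t powr (p - 1) * z t)) + \<epsilon> * (e t powr p * z')) (at t)"
proof -
  have "((\<lambda>t. e t powr p) has_real_derivative p * e t powr (p - 1) * e') (at t)"
    using DERIV_fun_powr[OF assms(1,3), of p] by simp
  from DERIV_add[OF assms(1) DERIV_cmult[OF DERIV_mult[OF this assms(2)], of \<epsilon>]]
  show ?thesis by (rule DERIV_cong) (simp add: algebra_simps)
qed

lemma powr_barrier_has_derivative:
  fixes p G C :: real
  assumes "t > 0"
  shows "((\<lambda>t. G * t powr (- 1 / p) + C) has_real_derivative - (G / p * t powr (- 1 / p - 1))) (at t)"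
  using DERIV_add[OF DERIV_cmult[OF has_real_derivative_powr[OF assms, of "- 1 / p"], of G] DERIV_const[of C]]
  by (rule DERIV_cong) simp

lemma powr_barrier_abs_continuous:
  fixes p G C :: real
  assumes "s > 0" "p > 0"
  shows "abs_continuous_on_interval s t (\<lambda>t. G * t powr (- 1 / p) + C)"
  by (rule abs_continuous_C1[OF powr_barrier_has_derivative])
    (use assms in \<open>auto intro!: continuous_intros\<close>)

context kirchhoff_parameters
begin

text \<open>What is remembered of a weak solution. The bound on V and A is not uniform: it may
  depend on the trajectory and only serves to find a starting time for the comparison. In the last
  clause r and s stand for (h, u_t) and (h, u), of which only the Cauchy-Schwarz bounds are
  kept.\<close>

definition trajectory :: "real \<Rightarrow> real \<Rightarrow> (real \<Rightarrow> real) \<Rightarrow> (real \<Rightarrow> real) \<Rightarrow> (real \<Rightarrow> real) \<Rightarrow> (real \<Rightarrow> real) \<Rightarrow> bool" where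
  "trajectory H T V A U z \<longleftrightarrow>
     (\<forall>t\<in>{0<..<T}. admissible (V t) (A t) (U t) (z t)) \<and>
     (\<exists>B. \<forall>t\<in>{0<..<T}. V t \<le> B \<and> A t \<le> B) \<and>
     (\<forall>s t. 0 < s \<longrightarrow> t < T \<longrightarrow> abs_continuous_on_interval s t (\<lambda>t. en (V t) (A t) (U t))) \<and>
     (\<forall>s t. 0 < s \<longrightarrow> t < T \<longrightarrow> abs_continuous_on_interval s t z) \<and>
     (AE t in lebesgue. t \<in> {0<..<T} \<longrightarrow> (\<exists>r s. \<bar>r\<bar> \<le> H * V t \<and> \<bar>s\<bar> \<le> H * U t \<and>
        ((\<lambda>t. en (V t) (A t) (U t)) has_real_derivative en' (V t) r) (at t) \<and>
        (z has_real_derivative cross' (V t) (A t) (U t) (z t) s) (at t)))"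

lemma en_bounded:
  obtains M where "M \<ge> 0" "\<And>V A U z. admissible V A U z \<Longrightarrow> V \<le> B \<Longrightarrow> A \<le> B \<Longrightarrow> en V A U \<le> M"
proof
  let ?M = "B\<^sup>2 / 2 + B\<^sup>2 / 2 + b / (\<beta> + 2) * B powr (\<beta> + 2) + \<bar>lam\<bar> * P\<^sup>2 * B\<^sup>2 / 2"
  show "0 \<le> ?M" using b \<beta>_pos by (intro add_nonneg_nonneg) auto
  fix V A U z assume a: "admissible V A U z" and B: "V \<le> B" "A \<le> B"
  then have n: "0 \<le> V" "0 \<le> A" by (auto simp: admissible_def)
  have 1: "V\<^sup>2 \<le> B\<^sup>2" "A\<^sup>2 \<le> B\<^sup>2" using n B by (auto intro: power_mono)
  have 2: "b / (\<beta> + 2) * A powr (\<beta> + 2) \<le> b / (\<beta> + 2) * B powr (\<beta> + 2)"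
    using n B b \<beta>_pos by (intro mult_left_mono powr_mono2) auto
  have "- (lam * U\<^sup>2) \<le> \<bar>lam\<bar> * P\<^sup>2 * A\<^sup>2" using lam_U_le[OF a] by linarith
  also have "\<dots> \<le> \<bar>lam\<bar> * P\<^sup>2 * B\<^sup>2" using 1(2) by (intro mult_left_mono) auto
  finally have 3: "- (lam / 2 * U\<^sup>2) \<le> \<bar>lam\<bar> * P\<^sup>2 * B\<^sup>2 / 2" by simp
  show "en V A U \<le> ?M" using 1 2 3 unfolding en_def by linarith
qed

text \<open>All constants are chosen before T and the trajectory. The individual size of a
  trajectory enters only in the starting time of the comparison, which does not appear in the
  result.\<close>

lemma trajectory_universal_bound:
  assumes H: "H \<ge> 0"
  shows "\<exists>\<Gamma> \<Gamma>\<^sub>s. \<forall>T V A U z. trajectory H T V A U z \<longrightarrow>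
    (\<forall>t\<in>{0<..<T}. (V t)\<^sup>2 + A t powr (\<beta> + 2) \<le> \<Gamma> * t powr (- 1 / \<gamma>) + \<Gamma>\<^sub>s)"
proof -
  obtain K B \<kappa> C4 C5 C6 where K: "B > 0" "\<kappa> > 0" "C4 \<ge> 0" "C5 \<ge> 0" "C6 \<ge> 0" and
    en: "\<And>V A U z r e. admissible V A U z \<Longrightarrow> \<bar>r\<bar> \<le> H * U \<Longrightarrow> e = en V A U + K \<Longrightarrow>
       1 \<le> e \<and> V\<^sup>2 + A powr (\<beta> + 2) \<le> B * e \<and> e powr \<gamma> * \<bar>z\<bar> \<le> C4 * e \<and>
       e powr \<gamma> * cross' V A U z r \<le> - (\<kappa> / 2) * e powr (1 + \<gamma>) + C5 * V powr (\<alpha> + 2) + C6"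
    using powr_cross'_le[OF H] by metis
  obtain C1 where C1: "C1 \<ge> 0" "\<And>V r. 0 \<le> V \<Longrightarrow> \<bar>r\<bar> \<le> H * V \<Longrightarrow> en' V r \<le> - (c / 2) * V powr (\<alpha> + 2) + C1"
    using en'_le[OF H] by metis
  \<comment> \<open>Small enough for the corrector against the energy and for its growth in V
    against the damping; the additions of 1 keep the divisors positive.\<close>
  define \<epsilon> where "\<epsilon> = min (1 / (2 * (C4 + 1))) (c / (4 * (C5 + 1)))"
  have \<epsilon>: "\<epsilon> > 0" "\<epsilon> \<le> 1 / (2 * (C4 + 1))" "\<epsilon> \<le> c / (4 * (C5 + 1))" using K c by (auto simp: \<epsilon>_def)
  have \<epsilon>4: "\<epsilon> * C4 \<le> 1 / 2"
  proof -
    have "\<epsilon> * (C4 + 1) \<le> 1 / 2" using \<epsilon>(2) K(3) by (simp add: field_simps)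
    then show ?thesis using \<epsilon>(1) by (simp add: distrib_left)
  qed
  have \<epsilon>5: "\<epsilon> * C5 \<le> c / 4"
  proof -
    have "\<epsilon> * (C5 + 1) \<le> c / 4" using \<epsilon>(3) K(4) by (simp add: field_simps)
    then show ?thesis using \<epsilon>(1) by (simp add: distrib_left)
  qed
  have g1: "\<gamma> \<le> 1" using \<gamma>_le(3) \<beta>_pos divide_pos_pos[of 1 "\<beta> + 2"] by linarith
  have \<epsilon>p: "\<epsilon> * \<gamma> * C4 \<le> 1 / 2"
  proof -
    have "\<gamma> * (\<epsilon> * C4) \<le> 1 * (\<epsilon> * C4)" using g1 \<epsilon> K by (intro mult_right_mono) auto
    then show ?thesis using \<epsilon>4 by (simp add: mult_ac)
  qed
  define k where "k = \<epsilon> * \<kappa> / 2 / (3 / 2) powr (1 + \<gamma>)"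
  define C where "C = 3 / 2 * C1 + \<epsilon> * C6"
  have k: "k > 0" using \<epsilon> K by (simp add: k_def)
  have C: "C \<ge> 0" using C1 \<epsilon> K by (simp add: C_def)
  \<comment> \<open>Half of the rate k is spent on each summand of the barrier: G makes (k/2) (G
    t^(-1/\<gamma>))^(1+\<gamma>) equal to minus the derivative of G t^(-1/\<gamma>), and S makes
    (k/2) S^(1+\<gamma>) equal to C. The power of the sum is at least the mean of the two
    powers.\<close>
  define G where "G = (2 / (k * \<gamma>)) powr (1 / \<gamma>)"
  define S where "S = (2 * C / k) powr (1 / (1 + \<gamma>))"
  have G: "G > 0" "G powr \<gamma> = 2 / (k * \<gamma>)" using k \<gamma>_pos by (auto simp: G_def powr_powr)
  have S: "S \<ge> 0" "S powr (1 + \<gamma>) = 2 * C / k" using k C \<gamma>_pos by (auto simp: S_def powr_powr)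
  define y where "y t = G * t powr (- 1 / \<gamma>) + S" for t
  define y' where "y' t = - (G / \<gamma> * t powr (- 1 / \<gamma> - 1))" for t
  have y': "(y has_real_derivative y' t) (at t)" if "t > 0" for t
    unfolding y_def[abs_def] y'_def by (rule powr_barrier_has_derivative[OF that])
  have barrier: "- k * y t powr (1 + \<gamma>) + C \<le> y' t" if t: "t > 0" for t
  proof -
    define u where "u = G * t powr (- 1 / \<gamma>)"
    have u: "u \<ge> 0" using G t by (simp add: u_def)
    have "u powr (1 + \<gamma>) \<le> y t powr (1 + \<gamma>)" "S powr (1 + \<gamma>) \<le> y t powr (1 + \<gamma>)"
      using u S(1) \<gamma>_pos unfolding y_def u_def[symmetric] by (auto intro!: powr_mono2)
    then have "k * (u powr (1 + \<gamma>) + S powr (1 + \<gamma>)) \<le> k * (2 * y t powr (1 + \<gamma>))"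
      using k by (intro mult_left_mono) auto
    moreover have "k * S powr (1 + \<gamma>) = 2 * C" using S(2) k by simp
    moreover have "k * u powr (1 + \<gamma>) = 2 * (G / \<gamma> * t powr (- 1 / \<gamma> - 1))"
    proof -
      have "u powr (1 + \<gamma>) = G powr (1 + \<gamma>) * (t powr (- 1 / \<gamma>)) powr (1 + \<gamma>)"
        unfolding u_def by (rule powr_mult)
      also have "(t powr (- 1 / \<gamma>)) powr (1 + \<gamma>) = t powr (- 1 / \<gamma> - 1)"
        unfolding powr_powr using \<gamma>_pos by (intro arg_cong[where f="(powr) t"]) (simp add: field_simps)
      also have "G powr (1 + \<gamma>) = G * (2 / (k * \<gamma>))" using G by (simp add: powr_add)
      finally show ?thesis using k \<gamma>_pos by (simp add: field_simps)
    qed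
    ultimately show ?thesis unfolding y'_def by (simp add: distrib_left)
  qed
  have main: "(V t1)\<^sup>2 + A t1 powr (\<beta> + 2) \<le> 2 * B * y t1"
    if tr: "trajectory H T V A U z" and t1: "t1 \<in> {0<..<T}" for T V A U z t1
  proof -
    define e where "e t = en (V t) (A t) (U t) + K" for t
    define \<Phi> where "\<Phi> t = e t + \<epsilon> * (e t powr \<gamma> * z t)" for t
    have adm: "admissible (V t) (A t) (U t) (z t)" if "t \<in> {0<..<T}" for t
      using tr that by (simp add: trajectory_def)
    have eb: "1 \<le> e t" "(V t)\<^sup>2 + A t powr (\<beta> + 2) \<le> B * e t" "e t powr \<gamma> * \<bar>z t\<bar> \<le> C4 * e t" if "t \<in> {0<..<T}" for t
      using en[OF adm[OF that], of 0 "e t"] H adm[OF that] by (auto simp: e_def admissible_def)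
    have \<Phi>b: "\<bar>\<epsilon> * (e t powr \<gamma> * z t)\<bar> \<le> e t / 2" if t: "t \<in> {0<..<T}" for t
    proof -
      have "\<epsilon> * (e t powr \<gamma> * \<bar>z t\<bar>) \<le> \<epsilon> * (C4 * e t)" using eb(3)[OF t] \<epsilon> by (intro mult_left_mono) auto
      also have "\<dots> \<le> 1 / 2 * e t" using \<epsilon>4 eb(1)[OF t] unfolding mult.assoc[symmetric] by (intro mult_right_mono) auto
      finally show ?thesis using \<epsilon> by (simp add: abs_mult)
    qed
    obtain Bd where Bd: "\<And>t. t \<in> {0<..<T} \<Longrightarrow> V t \<le> Bd \<and> A t \<le> Bd" using tr unfolding trajectory_def by blast
    obtain M where M: "M \<ge> 0" "\<And>V A U z. admissible V A U z \<Longrightarrow> V \<le> Bd \<Longrightarrow> A \<le> Bd \<Longrightarrow> en V A U \<le> M"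
      using en_bounded by metis
    define M' where "M' = 3 / 2 * (M + \<bar>K\<bar>) + 1"
    have M': "M' > 0" using M(1) by (simp add: M'_def add_nonneg_pos)
    have \<Phi>M: "\<Phi> t \<le> M'" if t: "t \<in> {0<..<T}" for t
    proof -
      have "e t \<le> M + \<bar>K\<bar>" using M(2)[OF adm[OF t]] Bd[OF t] by (simp add: e_def)
      moreover have "\<epsilon> * (e t powr \<gamma> * z t) \<le> e t / 2" using \<Phi>b[OF t] by linarith
      ultimately show ?thesis unfolding \<Phi>_def M'_def by argo
    qed
    \<comment> \<open>A time before \<open>t1\<close> at which the barrier exceeds
      \<open>M'\<close>, the bound for this particular trajectory, so that the comparison can start
      there.\<close>
    define s where "s = min (t1 / 2) ((G / M') powr \<gamma>)"
    have s: "0 < s" "s < t1" "s \<le> (G / M') powr \<gamma>" using t1 G M' by (auto simp: s_def)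
    have ys: "\<Phi> s \<le> y s"
    proof -
      have "((G / M') powr \<gamma>) powr (- 1 / \<gamma>) \<le> s powr (- 1 / \<gamma>)"
        using s \<gamma>_pos by (intro powr_mono2') auto
      moreover have "((G / M') powr \<gamma>) powr (- 1 / \<gamma>) = M' / G"
        unfolding powr_powr using \<gamma>_pos G M' by (simp add: powr_minus)
      ultimately have "G * (M' / G) \<le> G * s powr (- 1 / \<gamma>)" using G by (intro mult_left_mono) auto
      then have "M' \<le> y s" using G S(1) by (simp add: y_def)
      moreover have "s \<in> {0<..<T}" using s t1 by auto
      ultimately show ?thesis using \<Phi>M by fastforce
    qed
    have "\<Phi> t1 \<le> y t1"
    proof (rule abs_continuous_comparison[of s t1])
      have "abs_continuous_on_interval s t1 (\<lambda>t. en (V t) (A t) (U t))" and z: "abs_continuous_on_interval s t1 z"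
        using tr s t1 unfolding trajectory_def by auto
      then have e: "abs_continuous_on_interval s t1 e"
        unfolding e_def[abs_def] using abs_continuous_diff[OF _ abs_continuous_const[of s t1 "- K"]] by simp
      show "abs_continuous_on_interval s t1 \<Phi>"
        unfolding \<Phi>_def[abs_def]
        by (rule abs_continuous_corrector[OF e z, of 1]) (use eb(1) s t1 in auto)
      show "abs_continuous_on_interval s t1 y"
        unfolding y_def[abs_def] by (rule powr_barrier_abs_continuous[OF s(1) \<gamma>_pos])
      show "s \<le> t1" using s by simp
      show "\<Phi> s \<le> y s" by (rule ys)
      have "AE t in lebesgue. t \<in> {0<..<T} \<longrightarrow> (\<exists>r s. \<bar>r\<bar> \<le> H * V t \<and> \<bar>s\<bar> \<le> H * U t \<and>
        ((\<lambda>t. en (V t) (A t) (U t)) has_real_derivative en' (V t) r) (at t) \<and>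
        (z has_real_derivative cross' (V t) (A t) (U t) (z t) s) (at t))"
        using tr by (simp add: trajectory_def)
      then show "AE t in lebesgue. t \<in> {s<..<t1} \<longrightarrow> y t < \<Phi> t \<longrightarrow>
        (\<exists>d e. (\<Phi> has_real_derivative d) (at t) \<and> (y has_real_derivative e) (at t) \<and> d \<le> e)"
      proof eventually_elim
        case (elim t)
        show ?case
        proof (intro impI)
          assume t: "t \<in> {s<..<t1}" and less: "y t < \<Phi> t"
          have tT: "t \<in> {0<..<T}" using t s t1 by auto
          then obtain r q where rq: "\<bar>r\<bar> \<le> H * V t" "\<bar>q\<bar> \<le> H * U t"
            "((\<lambda>t. en (V t) (A t) (U t)) has_real_derivative en' (V t) r) (at t)"
            "(z has_real_derivative cross' (V t) (A t) (U t) (z t) q) (at t)" using elim by blast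
          have e': "(e has_real_derivative en' (V t) r) (at t)"
            using DERIV_add[OF rq(3) DERIV_const[of K]] by (simp add: e_def[abs_def])
          have e0: "e t > 0" using eb(1)[OF tT] by simp
          let ?d = "en' (V t) r * (1 + \<epsilon> * (\<gamma> * e t powr (\<gamma> - 1) * z t)) + \<epsilon> * (e t powr \<gamma> * cross' (V t) (A t) (U t) (z t) q)"
          have d: "(\<Phi> has_real_derivative ?d) (at t)"
            unfolding \<Phi>_def[abs_def] by (rule corrector_has_derivative[OF e' rq(4) e0])
          have V0: "0 \<le> V t" using adm[OF tT] by (simp add: admissible_def)
          have "?d \<le> - k * \<Phi> t powr (1 + \<gamma>) + C"
            unfolding k_def C_def \<Phi>_def
            by (rule modified_energy_inequality(1)[OF e0 \<gamma>_pos \<epsilon>p \<epsilon>(1) \<epsilon>4 \<epsilon>5 eb(3)[OF tT] _ C1(1) K(2) C1(2)[OF V0 rq(1)]])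
              (use en[OF adm[OF tT] rq(2), of "e t"] in \<open>auto simp: e_def\<close>)
          also have "\<dots> \<le> - k * y t powr (1 + \<gamma>) + C"
          proof -
            have "0 \<le> y t" using G S(1) t s by (simp add: y_def)
            then have "y t powr (1 + \<gamma>) \<le> \<Phi> t powr (1 + \<gamma>)" using less \<gamma>_pos by (intro powr_mono2) auto
            then show ?thesis using k by simp
          qed
          also have "\<dots> \<le> y' t" using t s by (intro barrier) auto
          finally have "?d \<le> y' t" .
          moreover have "(y has_real_derivative y' t) (at t)" using t s by (intro y') auto
          ultimately show "\<exists>d e. (\<Phi> has_real_derivative d) (at t) \<and> (y has_real_derivative e) (at t) \<and> d \<le> e"
            using d by blast
        qed
      qed
    qed
    moreover have "e t1 / 2 \<le> \<Phi> t1" using \<Phi>b[OF t1] unfolding \<Phi>_def by (simp add: abs_le_iff)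
    ultimately have "e t1 \<le> 2 * y t1" by linarith
    then have "B * e t1 \<le> B * (2 * y t1)" using K(1) by (intro mult_left_mono) auto
    then show ?thesis using eb(2)[OF t1] by simp
  qed
  show ?thesis
  proof (intro exI allI impI ballI)
    fix T V A U z t assume "trajectory H T V A U z" "t \<in> {0<..<T}"
    from main[OF this]
    show "(V t)\<^sup>2 + A t powr (\<beta> + 2) \<le> (2 * B * G) * t powr (- 1 / \<gamma>) + 2 * B * S"
      unfolding y_def by (simp add: algebra_simps)
  qed
qed

text \<open>As e may tend to 0, additive constants are not allowed and powers of e cannot be
  compared through e \<ge> 1; instead e \<le> M bounds the surplus powers. The trailing
  \<open>+ 0\<close> is the place of \<open>C6\<close> in
  \<open>modified_energy_inequality\<close>.\<close>

lemma powr_cross'_le_unforced: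
  assumes mu: "mu = 0" and kp: "kp > 0" and M: "M > 0"
  obtains B C4 C5 where "B > 0" "C4 \<ge> 0" "C5 \<ge> 0"
    "\<And>V A U z e. admissible V A U z \<Longrightarrow> kp * A\<^sup>2 \<le> A\<^sup>2 - lam * U\<^sup>2 \<Longrightarrow> e = en V A U \<Longrightarrow>
       0 \<le> e \<and> V\<^sup>2 + A\<^sup>2 \<le> B * e \<and> (e \<le> M \<longrightarrow> e powr (\<alpha> / 2) * \<bar>z\<bar> \<le> C4 * e \<and>
       (0 < e \<longrightarrow> e powr (\<alpha> / 2) * cross' V A U z 0 \<le> - (1 / 2) * e powr (1 + \<alpha> / 2) + C5 * V powr (\<alpha> + 2) + 0))"
proof -
  define B where "B = 2 + 2 / kp"
  have B: "B > 0" using kp by (simp add: B_def add_pos_pos)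
  define C4 where "C4 = M powr (\<alpha> / 2) * (P * B)"
  define a2 where "a2 = B powr (1 / 2)"
  \<comment> \<open>After Young's inequality the exponent of e exceeds 1 + \<alpha>/2 by (1 +
    \<alpha>/2) \<alpha>; m bounds the surplus power.\<close>
  define m where "m = M powr ((1 + \<alpha> / 2) * \<alpha>)"
  define F where "F = c * P * a2"
  have pos: "C4 \<ge> 0" "a2 > 0" "F > 0" "m > 0" using B P c M by (auto simp: C4_def a2_def F_def m_def)
  obtain Y1 where Y1: "Y1 \<ge> 0" "\<And>x y. 0 \<le> x \<Longrightarrow> 0 \<le> y \<Longrightarrow>
      x powr \<alpha> * y powr 2 \<le> 1 / 6 * x powr (\<alpha> + 2) + Y1 * y powr (\<alpha> + 2)"
    using young_powr[of \<alpha> 2 "1 / 6"] \<alpha> by auto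
  \<comment> \<open>The term with V^(\<alpha>+1) A takes a quarter of e^(1+\<alpha>/2), the term
    with V^2 takes 3/2 times 1/6, and one half remains.\<close>
  obtain Y2 where Y2: "Y2 \<ge> 0" "\<And>x y. 0 \<le> x \<Longrightarrow> 0 \<le> y \<Longrightarrow>
      x powr 1 * y powr (\<alpha> + 1) \<le> 1 / 4 / (F * m) * x powr (1 + (\<alpha> + 1)) + Y2 * y powr (1 + (\<alpha> + 1))"
    using young_powr[of 1 "\<alpha> + 1" "1 / 4 / (F * m)"] \<alpha> pos by auto
  show thesis
  proof (rule that[of B C4 "3 / 2 * Y1 + F * Y2"])
    show "B > 0" "C4 \<ge> 0" "3 / 2 * Y1 + F * Y2 \<ge> 0" using B pos Y1(1) Y2(1) by auto
    fix V A U z e assume a: "admissible V A U z" and l: "kp * A\<^sup>2 \<le> A\<^sup>2 - lam * U\<^sup>2" and e: "e = en V A U"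
    have n: "0 \<le> V" "0 \<le> A" using a by (auto simp: admissible_def)
    define Q where "Q = A powr (\<beta> + 2)"
    have bQ: "0 \<le> b / (\<beta> + 2) * Q" using b \<beta>_pos by (simp add: Q_def)
    have elow: "V\<^sup>2 / 2 + kp / 2 * A\<^sup>2 \<le> e"
      using l bQ unfolding e en_def Q_def[symmetric] by linarith
    have kA: "0 \<le> kp * A\<^sup>2" using kp by simp
    have "0 \<le> kp / 2 * A\<^sup>2" using kp by simp
    then have e0: "0 \<le> e" using elow zero_le_power2[of V] by linarith
    have VA: "V\<^sup>2 + A\<^sup>2 \<le> B * e"
    proof -
      have "B * (V\<^sup>2 / 2 + kp / 2 * A\<^sup>2) = V\<^sup>2 + A\<^sup>2 + (kp * A\<^sup>2 + 1 / kp * V\<^sup>2)"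
        using kp by (simp add: B_def field_simps)
      moreover have "0 \<le> 1 / kp * V\<^sup>2" using kp by simp
      ultimately show ?thesis using mult_left_mono[OF elow, of B] B kA by linarith
    qed
    have "e powr (\<alpha> / 2) * \<bar>z\<bar> \<le> C4 * e \<and>
       (0 < e \<longrightarrow> e powr (\<alpha> / 2) * cross' V A U z 0 \<le> - (1 / 2) * e powr (1 + \<alpha> / 2) + (3 / 2 * Y1 + F * Y2) * V powr (\<alpha> + 2) + 0)"
      if eM: "e \<le> M"
    proof (intro conjI impI)
      have "0 \<le> V * A" using n by simp
      then have "V * A \<le> B * e" using VA sum_squares_bound[of V A] by linarith
      then have "\<bar>z\<bar> \<le> P * (B * e)" using order.trans[OF abs_z_le[OF a] mult_left_mono[of _ _ P]] P by simp
      then have "e powr (\<alpha> / 2) * \<bar>z\<bar> \<le> M powr (\<alpha> / 2) * (P * (B * e))"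
        using e0 eM \<alpha> by (intro mult_mono powr_mono2) auto
      then show "e powr (\<alpha> / 2) * \<bar>z\<bar> \<le> C4 * e" by (simp add: C4_def mult_ac)
      assume ep: "0 < e"
      define X where "X = e powr (1 + \<alpha> / 2)"
      define W where "W = V powr (\<alpha> + 2)"
      define g where "g = e powr (\<alpha> / 2)"
      have g: "g > 0" using ep by (simp add: g_def)
      have gX: "g * e = X" using ep by (simp add: g_def X_def powr_add)
      have A2: "A\<^sup>2 \<le> B * e" using VA zero_le_power2[of V] by linarith
      have Ale: "A \<le> a2 * e powr (1 / 2)"
        unfolding a2_def
        using n B e0 A2 by (intro le_powr_of_powr_le) (auto simp: powr_two_eq_square)
      have 1: "g * V\<^sup>2 \<le> 1 / 6 * X + Y1 * W"
      proof -
        have "(e powr (1 / 2)) powr \<alpha> * V powr 2 \<le> 1 / 6 * (e powr (1 / 2)) powr (\<alpha> + 2) + Y1 * V powr (\<alpha> + 2)"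
          by (rule Y1(2)) (use n in auto)
        moreover have "(e powr (1 / 2)) powr (\<alpha> + 2) = X" "(e powr (1 / 2)) powr \<alpha> = g"
          unfolding X_def g_def powr_powr by (auto intro!: arg_cong[where f="(powr) e"] simp: field_simps)
        ultimately show ?thesis using n(1) by (simp add: powr_two_eq_square W_def)
      qed
      have 2: "g * (V powr (\<alpha> + 1) * A) \<le> a2 * (1 / 4 / (F * m) * (X * m) + Y2 * W)"
      proof -
        define x where "x = e powr (\<alpha> / 2 + 1 / 2)"
        have "g * (V powr (\<alpha> + 1) * A) \<le> g * (V powr (\<alpha> + 1) * (a2 * e powr (1 / 2)))"
          using Ale g by (intro mult_left_mono) auto
        also have "\<dots> = a2 * (x powr 1 * V powr (\<alpha> + 1))" by (simp add: x_def g_def powr_add)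
        also have "\<dots> \<le> a2 * (1 / 4 / (F * m) * x powr (1 + (\<alpha> + 1)) + Y2 * V powr (1 + (\<alpha> + 1)))"
          using pos n by (intro mult_left_mono Y2(2)) (auto simp: x_def)
        also have "\<dots> \<le> a2 * (1 / 4 / (F * m) * (X * m) + Y2 * W)"
        proof -
          have "x powr (1 + (\<alpha> + 1)) = X * e powr ((1 + \<alpha> / 2) * \<alpha>)"
            unfolding x_def X_def powr_powr powr_add[symmetric]
            by (intro arg_cong[where f="(powr) e"]) (simp add: field_simps)
          also have "\<dots> \<le> X * m"
            unfolding m_def X_def using e0 eM \<alpha> by (intro mult_left_mono powr_mono2) auto
          finally have "1 / 4 / (F * m) * x powr (1 + (\<alpha> + 1)) \<le> 1 / 4 / (F * m) * (X * m)"
            using pos by (intro mult_left_mono) auto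
          moreover have "V powr (1 + (\<alpha> + 1)) = W" by (simp add: W_def add.commute)
          ultimately show ?thesis using pos(2) by (intro mult_left_mono) auto
        qed
        finally show ?thesis .
      qed
      have "cross' V A U z 0 \<le> 3 / 2 * V\<^sup>2 - e + c * P * (V powr (\<alpha> + 1) * A)"
      proof -
        have "b / (\<beta> + 2) * Q \<le> b * Q"
          using b \<beta>_pos by (intro mult_right_mono) (auto simp: Q_def pos_divide_le_eq)
        then have "e - V\<^sup>2 / 2 \<le> (A\<^sup>2 - lam * U\<^sup>2) + b * Q"
          using l kA unfolding e en_def Q_def[symmetric] by simp
        then show ?thesis using damping_cross_le[OF a] unfolding cross'_def Q_def[symmetric] using mu by simp
      qed
      then have "g * cross' V A U z 0 \<le> g * (3 / 2 * V\<^sup>2 - e + c * P * (V powr (\<alpha> + 1) * A))"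
        using g by (intro mult_left_mono) auto
      also have "\<dots> = 3 / 2 * (g * V\<^sup>2) - X + c * P * (g * (V powr (\<alpha> + 1) * A))"
        by (simp add: gX[symmetric] algebra_simps)
      also have "\<dots> \<le> 3 / 2 * (1 / 6 * X + Y1 * W) - X + c * P * (a2 * (1 / 4 / (F * m) * (X * m) + Y2 * W))"
        using 1 2 c P by (intro add_mono diff_mono mult_left_mono) auto
      also have "c * P * (a2 * (1 / 4 / (F * m) * (X * m) + Y2 * W)) = 1 / 4 * X + F * Y2 * W"
      proof -
        have "c * P * (a2 * (1 / 4 / (F * m) * (X * m) + Y2 * W)) = F * (1 / 4 / (F * m) * (X * m) + Y2 * W)"
          by (simp add: F_def)
        also have "\<dots> = 1 / 4 * X + F * Y2 * W" using pos by (simp add: distrib_left)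
        finally show ?thesis .
      qed
      also have "3 / 2 * (1 / 6 * X + Y1 * W) - X + (1 / 4 * X + F * Y2 * W) = - (1 / 2) * X + (3 / 2 * Y1 + F * Y2) * W + 0"
        by (simp add: algebra_simps)
      finally show "e powr (\<alpha> / 2) * cross' V A U z 0 \<le> - (1 / 2) * e powr (1 + \<alpha> / 2) + (3 / 2 * Y1 + F * Y2) * V powr (\<alpha> + 2) + 0"
        unfolding g_def X_def W_def .
    qed
    with e0 VA show "0 \<le> e \<and> V\<^sup>2 + A\<^sup>2 \<le> B * e \<and> (e \<le> M \<longrightarrow> e powr (\<alpha> / 2) * \<bar>z\<bar> \<le> C4 * e \<and>
       (0 < e \<longrightarrow> e powr (\<alpha> / 2) * cross' V A U z 0 \<le> - (1 / 2) * e powr (1 + \<alpha> / 2) + (3 / 2 * Y1 + F * Y2) * V powr (\<alpha> + 2) + 0))"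
      by blast
  qed
qed


text \<open>Without force and without the term in \<open>mu\<close> the differential inequality has
  no constant, so the barrier is a pure power. The exponent \<alpha>/2 is available because the
  bound e \<le> M replaces the second restriction on \<gamma>.\<close>

lemma trajectory_decay:
  assumes mu: "mu = 0" and kp: "kp > 0"
  shows "\<exists>D. \<forall>V A U z. (\<forall>T>0. trajectory 0 T V A U z) \<longrightarrow> (\<forall>t>0. kp * (A t)\<^sup>2 \<le> (A t)\<^sup>2 - lam * (U t)\<^sup>2) \<longrightarrow>
    (\<forall>t\<ge>1. (V t)\<^sup>2 + (A t)\<^sup>2 \<le> D * t powr (- 2 / \<alpha>))"
proof -
  obtain \<Gamma> \<Gamma>\<^sub>s where "\<forall>T V A U z. trajectory 0 T V A U z \<longrightarrow>
    (\<forall>t\<in>{0<..<T}. (V t)\<^sup>2 + A t powr (\<beta> + 2) \<le> \<Gamma> * t powr (- 1 / \<gamma>) + \<Gamma>\<^sub>s)"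
    using trajectory_universal_bound[OF order.refl] by blast
  then have \<Gamma>: "\<And>T V A U z t. trajectory 0 T V A U z \<Longrightarrow> t \<in> {0<..<T} \<Longrightarrow>
      (V t)\<^sup>2 + A t powr (\<beta> + 2) \<le> \<Gamma> * t powr (- 1 / \<gamma>) + \<Gamma>\<^sub>s"
    by blast
  \<comment> \<open>By V \<le> 1 + V^2 and A \<le> 1 + A^(\<beta>+2), the universal bound at time 1
    gives V \<le> N and A \<le> N there.\<close>
  define N where "N = \<bar>\<Gamma>\<bar> + \<bar>\<Gamma>\<^sub>s\<bar> + 1"
  obtain M0 where M0: "M0 \<ge> 0" "\<And>V A U z. admissible V A U z \<Longrightarrow> V \<le> N \<Longrightarrow> A \<le> N \<Longrightarrow> en V A U \<le> M0"
    using en_bounded by metis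
  define M where "M = M0 + 1"
  have M: "M > 0" using M0(1) by (simp add: M_def)
  obtain B C4 C5 where K: "B > 0" "C4 \<ge> 0" "C5 \<ge> 0" and
    en: "\<And>V A U z e. admissible V A U z \<Longrightarrow> kp * A\<^sup>2 \<le> A\<^sup>2 - lam * U\<^sup>2 \<Longrightarrow> e = en V A U \<Longrightarrow>
       0 \<le> e \<and> V\<^sup>2 + A\<^sup>2 \<le> B * e \<and> (e \<le> M \<longrightarrow> e powr (\<alpha> / 2) * \<bar>z\<bar> \<le> C4 * e \<and>
       (0 < e \<longrightarrow> e powr (\<alpha> / 2) * cross' V A U z 0 \<le> - (1 / 2) * e powr (1 + \<alpha> / 2) + C5 * V powr (\<alpha> + 2) + 0))"
    using powr_cross'_le_unforced[OF mu kp M] by metis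
  define p where "p = \<alpha> / 2"
  have p: "p > 0" using \<alpha> by (simp add: p_def)
  \<comment> \<open>The factor \<open>1 + p\<close> makes both \<open>\<epsilon> * C4\<close> and
    \<open>\<epsilon> * p * C4\<close> at most 1/2, as p may exceed 1.\<close>
  define \<epsilon> where "\<epsilon> = min (1 / (2 * ((C4 + 1) * (1 + p)))) (c / (4 * (C5 + 1)))"
  have \<epsilon>: "\<epsilon> > 0" "\<epsilon> \<le> 1 / (2 * ((C4 + 1) * (1 + p)))" "\<epsilon> \<le> c / (4 * (C5 + 1))" using K c p by (auto simp: \<epsilon>_def)
  have "\<epsilon> * ((C4 + 1) * (1 + p)) \<le> 1 / 2"
  proof -
    have "\<epsilon> * (2 * ((C4 + 1) * (1 + p))) \<le> 1" using \<epsilon>(2) K(2) p by (subst (asm) pos_le_divide_eq) auto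
    then show ?thesis by linarith
  qed
  moreover have "\<epsilon> * ((C4 + 1) * (1 + p)) = \<epsilon> * C4 + \<epsilon> * p * C4 + (\<epsilon> + \<epsilon> * p)" by (simp add: algebra_simps)
  moreover have "0 \<le> \<epsilon> * C4" "0 \<le> \<epsilon> * p * C4" "0 \<le> \<epsilon> + \<epsilon> * p" using \<epsilon> K p by auto
  ultimately have \<epsilon>4: "\<epsilon> * C4 \<le> 1 / 2" and \<epsilon>p: "\<epsilon> * p * C4 \<le> 1 / 2" by linarith+
  have \<epsilon>5: "\<epsilon> * C5 \<le> c / 4"
  proof -
    have "\<epsilon> * (C5 + 1) \<le> c / 4" using \<epsilon>(3) K(3) by (simp add: field_simps)
    then show ?thesis using \<epsilon>(1) by (simp add: distrib_left)
  qed
  define k where "k = \<epsilon> * 1 / 2 / (3 / 2) powr (1 + p)"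
  have k: "k > 0" using \<epsilon> by (simp add: k_def)
  \<comment> \<open>The first entry puts the barrier above the modified energy at time 1, the second
    makes it a supersolution.\<close>
  define D where "D = max (3 / 2 * M) ((1 / (k * p)) powr (1 / p))"
  have D: "D > 0" "3 / 2 * M \<le> D" using M by (auto simp: D_def)
  have Dk: "1 / p \<le> k * D powr p"
  proof -
    have "((1 / (k * p)) powr (1 / p)) powr p \<le> D powr p" using p by (intro powr_mono2) (auto simp: D_def)
    moreover have "((1 / (k * p)) powr (1 / p)) powr p = 1 / (k * p)" using p k by (simp add: powr_powr)
    ultimately have "k * (1 / (k * p)) \<le> k * D powr p" using k by (intro mult_left_mono) auto
    then show ?thesis using k by simp
  qed
  \<comment> \<open>The \<open>+ 0\<close> matches the form of the barrier lemmas.\<close>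
  define y where "y t = D * t powr (- 1 / p) + 0" for t
  define y' where "y' t = - (D / p * t powr (- 1 / p - 1))" for t
  have barrier: "- k * y t powr (1 + p) \<le> y' t" if t: "t > 0" for t
  proof -
    have "y t powr (1 + p) = D powr (1 + p) * (t powr (- 1 / p)) powr (1 + p)"
      unfolding y_def using D(1) t by (simp add: powr_mult)
    also have "(t powr (- 1 / p)) powr (1 + p) = t powr (- 1 / p - 1)"
      unfolding powr_powr using p by (intro arg_cong[where f="(powr) t"]) (simp add: field_simps)
    also have "D powr (1 + p) = D * D powr p" using D(1) by (simp add: powr_add)
    finally have eq: "k * y t powr (1 + p) = (k * D powr p) * (D * t powr (- 1 / p - 1))" by simp
    have "1 / p * (D * t powr (- 1 / p - 1)) \<le> (k * D powr p) * (D * t powr (- 1 / p - 1))"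
      using Dk D(1) by (intro mult_right_mono) auto
    moreover have "1 / p * (D * t powr (- 1 / p - 1)) = D / p * t powr (- 1 / p - 1)" by simp
    ultimately show ?thesis unfolding y'_def using eq by linarith
  qed
  have main: "(V t1)\<^sup>2 + (A t1)\<^sup>2 \<le> 2 * B * y t1"
    if tr: "\<And>T. T > 0 \<Longrightarrow> trajectory 0 T V A U z" and l: "\<And>t. t > 0 \<Longrightarrow> kp * (A t)\<^sup>2 \<le> (A t)\<^sup>2 - lam * (U t)\<^sup>2"
      and t1: "t1 \<ge> 1" for V A U z t1
  proof -
    define e where "e t = en (V t) (A t) (U t)" for t
    define \<Phi> where "\<Phi> t = e t + \<epsilon> * (e t powr p * z t)" for t
    have adm: "admissible (V t) (A t) (U t) (z t)" if "t > 0" for t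
      using tr[of "t + 1"] that by (simp add: trajectory_def)
    have tr1: "trajectory 0 (t1 + 1) V A U z" using tr t1 by simp
    have ace: "abs_continuous_on_interval s t e" and acz: "abs_continuous_on_interval s t z" if "0 < s" "t < t1 + 1" for s t
      using tr1 that unfolding trajectory_def e_def[abs_def] by auto
    have eb: "0 \<le> e t" "(V t)\<^sup>2 + (A t)\<^sup>2 \<le> B * e t" if "t > 0" for t
      using en[OF adm[OF that] l[OF that], of "e t"] by (auto simp: e_def)
    have ae: "AE t in lebesgue. t \<in> {0<..<t1 + 1} \<longrightarrow>
        (e has_real_derivative en' (V t) 0) (at t) \<and>
        (z has_real_derivative cross' (V t) (A t) (U t) (z t) 0) (at t)"
      using tr1 unfolding trajectory_def e_def[abs_def] by auto
    have e1: "e 1 \<le> M"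
    proof -
      have "(V 1)\<^sup>2 + A 1 powr (\<beta> + 2) \<le> \<Gamma> * 1 powr (- 1 / \<gamma>) + \<Gamma>\<^sub>s"
        by (rule \<Gamma>[OF tr[of 2]]) auto
      then have N1: "(V 1)\<^sup>2 + A 1 powr (\<beta> + 2) \<le> N - 1" by (simp add: N_def)
      have n: "0 \<le> V 1" "0 \<le> A 1" using adm[of 1] by (auto simp: admissible_def)
      have "V 1 \<le> 1 + (V 1)\<^sup>2" using sum_squares_bound[of 1 "V 1"] n unfolding power_one by linarith
      moreover have "A 1 \<le> 1 + A 1 powr (\<beta> + 2)"
      proof (cases "A 1 \<le> 1")
        case False
        then have "A 1 powr 1 \<le> A 1 powr (\<beta> + 2)" using \<beta>_pos by (intro powr_mono) auto
        then show ?thesis using n by simp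
      qed (simp add: add_increasing2)
      moreover have "0 \<le> A 1 powr (\<beta> + 2)" "0 \<le> (V 1)\<^sup>2" by auto
      ultimately have "V 1 \<le> N" "A 1 \<le> N" using N1 by linarith+
      then have "e 1 \<le> M0" unfolding e_def by (intro M0(2)[OF adm]) auto
      then show ?thesis by (simp add: M_def)
    qed
    have mono: "e t \<le> e s" if st: "1 \<le> s" "s \<le> t" "t \<le> t1" for s t
    proof (rule abs_continuous_antimono[of s t e])
      show "abs_continuous_on_interval s t e" using st by (intro ace) auto
      show "AE x in lebesgue. x \<in> {s<..<t} \<longrightarrow> (\<exists>d\<le>0. (e has_real_derivative d) (at x))"
        using ae
      proof eventually_elim
        case (elim x)
        have "en' (V x) 0 \<le> 0" unfolding en'_def using c mu by simp
        then show ?case using elim st by force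
      qed
    qed (use st in simp)
    have eM: "e t \<le> M" if "1 \<le> t" "t \<le> t1" for t using mono[of 1 t] e1 that by simp
    have \<Phi>b: "\<bar>\<epsilon> * (e t powr p * z t)\<bar> \<le> e t / 2" if t: "1 \<le> t" "t \<le> t1" for t
    proof -
      have t0: "t > 0" using t by simp
      have "e t powr p * \<bar>z t\<bar> \<le> C4 * e t"
        using en[OF adm[OF t0] l[OF t0], of "e t"] eM[OF t] by (auto simp: e_def p_def)
      then have "\<epsilon> * (e t powr p * \<bar>z t\<bar>) \<le> \<epsilon> * (C4 * e t)" using \<epsilon> by (intro mult_left_mono) auto
      also have "\<dots> \<le> 1 / 2 * e t" using \<epsilon>4 eb(1)[OF t0] unfolding mult.assoc[symmetric] by (intro mult_right_mono) auto
      finally show ?thesis using \<epsilon> by (simp add: abs_mult)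
    qed
    have "e t1 \<le> 2 * y t1"
    \<comment> \<open>If the energy vanishes at \<open>t1\<close> the bound is trivial. Otherwise
      monotonicity keeps e above \<open>e t1 > 0\<close> on [1, t1], the lower bound that the
      corrector requires.\<close>
    proof (cases "e t1 = 0")
      case True
      then show ?thesis using D(1) by (simp add: y_def)
    next
      case False
      then have pos: "e t1 > 0" using eb(1)[of t1] t1 by simp
      have epos: "e t1 \<le> e t" if "1 \<le> t" "t \<le> t1" for t using mono[of t t1] that by simp
      have "\<Phi> t1 \<le> y t1"
      proof (rule abs_continuous_comparison[of 1 t1])
        show "abs_continuous_on_interval 1 t1 \<Phi>"
          unfolding \<Phi>_def[abs_def]
          by (rule abs_continuous_corrector[OF ace acz pos epos]) auto
        show "abs_continuous_on_interval 1 t1 y"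
          unfolding y_def[abs_def] by (rule powr_barrier_abs_continuous[OF _ p]) simp
        show "1 \<le> t1" by (rule t1)
        have "\<Phi> 1 \<le> 3 / 2 * M" using \<Phi>b[of 1] e1 t1 unfolding \<Phi>_def by (simp add: abs_le_iff)
        then show "\<Phi> 1 \<le> y 1" using D(2) by (simp add: y_def)
        show "AE t in lebesgue. t \<in> {1<..<t1} \<longrightarrow> y t < \<Phi> t \<longrightarrow>
          (\<exists>d e. (\<Phi> has_real_derivative d) (at t) \<and> (y has_real_derivative e) (at t) \<and> d \<le> e)"
          using ae
        proof eventually_elim
          case (elim t)
          show ?case
          proof (intro impI)
            assume t: "t \<in> {1<..<t1}" and less: "y t < \<Phi> t"
            then have t0: "t > 0" and tt: "1 \<le> t" "t \<le> t1" by auto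
            have der: "(e has_real_derivative en' (V t) 0) (at t)"
              "(z has_real_derivative cross' (V t) (A t) (U t) (z t) 0) (at t)"
              using elim t by auto
            have e0: "e t > 0" using epos[OF tt] pos by linarith
            note E = en[OF adm[OF t0] l[OF t0], of "e t"]
            let ?d = "en' (V t) 0 * (1 + \<epsilon> * (p * e t powr (p - 1) * z t)) + \<epsilon> * (e t powr p * cross' (V t) (A t) (U t) (z t) 0)"
            have d: "(\<Phi> has_real_derivative ?d) (at t)"
              unfolding \<Phi>_def[abs_def] by (rule corrector_has_derivative[OF der e0])
            have W: "0 \<le> V t powr (\<alpha> + 2)" by simp
            have cW: "0 \<le> c / 2 * V t powr (\<alpha> + 2)" using c by simp
            have R: "en' (V t) 0 \<le> - (c / 2) * V t powr (\<alpha> + 2) + 0"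
              unfolding en'_def using cW mu by simp
            have "?d \<le> - k * \<Phi> t powr (1 + p) + (3 / 2 * 0 + \<epsilon> * 0)"
              unfolding k_def \<Phi>_def
              by (rule modified_energy_inequality(1)[OF e0 p \<epsilon>p \<epsilon>(1) \<epsilon>4 \<epsilon>5 _ W order.refl _ R])
                (use E e0 eM[OF tt] in \<open>auto simp: e_def p_def\<close>)
            also have "\<dots> \<le> - k * y t powr (1 + p)"
            proof -
              have "0 \<le> y t" using D(1) by (simp add: y_def)
              then have "y t powr (1 + p) \<le> \<Phi> t powr (1 + p)" using less p by (intro powr_mono2) auto
              then show ?thesis using k by simp
            qed
            also have "\<dots> \<le> y' t" using t0 by (rule barrier)
            finally have "?d \<le> y' t" .
            moreover have "(y has_real_derivative y' t) (at t)"
              unfolding y_def[abs_def] y'_def by (rule powr_barrier_has_derivative[OF t0])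
            ultimately show "\<exists>d e. (\<Phi> has_real_derivative d) (at t) \<and> (y has_real_derivative e) (at t) \<and> d \<le> e"
              using d by blast
          qed
        qed
      qed
      moreover have "e t1 / 2 \<le> \<Phi> t1" using \<Phi>b[of t1] t1 unfolding \<Phi>_def by (simp add: abs_le_iff)
      ultimately show ?thesis by linarith
    qed
    then have "B * e t1 \<le> B * (2 * y t1)" using K(1) by (intro mult_left_mono) auto
    then show ?thesis using eb(2)[of t1] t1 by simp
  qed
  show ?thesis
  proof (intro exI allI impI)
    fix V A U z t assume "\<forall>T>0. trajectory 0 T V A U z" "\<forall>t>0. kp * (A t)\<^sup>2 \<le> (A t)\<^sup>2 - lam * (U t)\<^sup>2" "(1::real) \<le> t"
    then have "(V t)\<^sup>2 + (A t)\<^sup>2 \<le> 2 * B * y t" by (intro main[where U=U and z=z]) auto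
    moreover have "- 1 / p = - 2 / \<alpha>" using \<alpha> by (simp add: p_def field_simps)
    ultimately show "(V t)\<^sup>2 + (A t)\<^sup>2 \<le> (2 * B * D) * t powr (- 2 / \<alpha>)"
      by (simp add: y_def)
  qed
qed

end

section \<open>Functions of time\<close>

text \<open>A smooth step from 0 to 1 on [s, s + h] whose derivative \<rho> has mass 1. Differences
  of two steps are test functions that approximate indicators of intervals, while their derivatives
  approximate differences of point evaluations.\<close>

definition smooth_step :: "real \<Rightarrow> real \<Rightarrow> (real \<Rightarrow> real) \<Rightarrow> (real \<Rightarrow> real) \<Rightarrow> bool" where
  "smooth_step s h \<Phi> \<rho> \<longleftrightarrow> (\<forall>k. Ck k \<Phi>) \<and> (\<forall>x. (\<Phi> has_real_derivative \<rho> x) (at x)) \<and>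
     (\<forall>x\<le>s. \<Phi> x = 0) \<and> (\<forall>x\<ge>s + h. \<Phi> x = 1) \<and> (\<forall>x. 0 \<le> \<Phi> x \<and> \<Phi> x \<le> 1) \<and>
     continuous_on UNIV \<rho> \<and> (\<forall>x. 0 \<le> \<rho> x) \<and> (\<forall>x. x \<notin> {s..s + h} \<longrightarrow> \<rho> x = 0) \<and> integral {s..s + h} \<rho> = 1"

text \<open>The indefinite integral of a normalized bump on (s, s + h).\<close>

lemma ex_smooth_step:
  assumes s: "0 < s" and h: "0 < h"
  shows "\<exists>\<Phi> \<rho>. smooth_step s h \<Phi> \<rho>"
proof -
  let ?B = "bump 1 s (s + h) :: real \<Rightarrow> real"
  have cB: "continuous_on S ?B" for S
    using Ck_bump[of 1 0 s "s + h"] by (auto intro: continuous_on_subset)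
  define m where "m = integral {s..s + h} ?B"
  have "m \<noteq> 0"
  proof
    assume "m = 0"
    then have "\<forall>x\<in>{s..s + h}. ?B x = 0"
      unfolding m_def using h cB bump_nonneg[of 1 s "s + h"] by (subst (asm) integral_eq_0_iff) auto
    moreover have "s + h / 2 \<in> {s..s + h}" "s + h / 2 \<in> box s (s + h)" using h by (auto simp: box_real)
    ultimately show False using bump_pos[of 1 "s + h / 2" s "s + h"] by force
  qed
  moreover have "m \<ge> 0" unfolding m_def using bump_nonneg[of 1 s "s + h"]
    by (intro integral_nonneg integrable_continuous_real cB) auto
  ultimately have m: "m > 0" by simp
  define \<rho> where "\<rho> x = inverse m * ?B x" for x
  have Ck: "Ck k \<rho>" for k unfolding \<rho>_def[abs_def] by (intro Ck_cmult Ck_bump) simp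
  have c: "continuous_on S \<rho>" for S using Ck[of 0] by (auto intro: continuous_on_subset)
  have nonneg: "0 \<le> \<rho> x" for x unfolding \<rho>_def using m bump_nonneg[of 1 s "s + h" x] by simp
  have out: "\<rho> x = 0" if "x \<notin> {s<..<s + h}" for x
    unfolding \<rho>_def using that by (simp add: bump_outside box_real)
  have one: "integral {s..s + h} \<rho> = 1" unfolding \<rho>_def using m by (simp add: m_def[symmetric])
  define \<Phi> where "\<Phi> x = integral {0..x} \<rho>" for x
  have i: "\<rho> integrable_on {a..b}" for a b by (rule integrable_continuous_real[OF c])
  have left: "\<Phi> x = 0" if "x \<le> s" for x
  proof -
    have "integral {0..x} \<rho> = integral {0..x} (\<lambda>x. 0)" by (intro integral_cong out) (use that in auto)
    then show ?thesis by (simp add: \<Phi>_def)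
  qed
  have right: "\<Phi> x = 1" if "s + h \<le> x" for x
  proof -
    have "\<Phi> x = \<Phi> s + (integral {s..s + h} \<rho> + integral {s + h..x} \<rho>)"
      unfolding \<Phi>_def using Henstock_Kurzweil_Integration.integral_combine[of 0 s x \<rho>] Henstock_Kurzweil_Integration.integral_combine[of s "s + h" x \<rho>] s h that i by simp
    also have "integral {s + h..x} \<rho> = integral {s + h..x} (\<lambda>x. 0)" by (intro integral_cong out) auto
    finally show ?thesis using left[of s] one by simp
  qed
  have bounds: "0 \<le> \<Phi> x" "\<Phi> x \<le> 1" for x
  proof -
    show "0 \<le> \<Phi> x" unfolding \<Phi>_def by (intro integral_nonneg i nonneg)
    have "\<Phi> x \<le> \<Phi> (max x (s + h))" unfolding \<Phi>_def by (intro integral_subset_le i) (auto simp: nonneg)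
    then show "\<Phi> x \<le> 1" using right[of "max x (s + h)"] by simp
  qed
  have der: "(\<Phi> has_real_derivative \<rho> x) (at x)" for x
  proof (cases "x < s")
    case True
    have "((\<lambda>x. 0) has_real_derivative 0) (at x)" by simp
    then have "(\<Phi> has_real_derivative 0) (at x)"
      by (rule has_field_derivative_transform_within_open[of _ _ _ "{..<s}"]) (use True left in auto)
    then show ?thesis using out[of x] True by simp
  next
    case False
    have "(\<Phi> has_real_derivative \<rho> x) (at x within {0..x + 1})"
      unfolding \<Phi>_def[abs_def] using False s by (intro integral_has_real_derivative c) auto
    moreover have "x \<in> interior {0..x + 1}" using False s by simp
    ultimately show ?thesis using at_within_interior[of x "{0..x + 1}"] by metis
  qed
  have Ck\<Phi>: "Ck k \<Phi>" for k
  proof (cases k)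
    case 0
    have "continuous_on UNIV \<Phi>" by (rule DERIV_continuous_on[of _ _ \<rho>]) (rule has_field_derivative_at_within[OF der])
    then show ?thesis using 0 by simp
  next
    case (Suc j)
    have "Ck (Suc j) \<Phi>"
    proof (rule Ck_SucI)
      show "(\<Phi> has_derivative (\<lambda>h. \<rho> x * h)) (at x)" for x using der[of x] by (simp add: has_field_derivative_def)
      show "Ck j (\<lambda>x. \<rho> x * i)" for i by (intro Ck_mult Ck Ck_const)
    qed
    then show ?thesis using Suc by simp
  qed
  have out': "\<rho> x = 0" if "x \<notin> {s..s + h}" for x by (rule out) (use that in auto)
  show ?thesis
  proof (intro exI)
    show "smooth_step s h \<Phi> \<rho>"
      unfolding smooth_step_def
      by (intro conjI allI impI Ck\<Phi> der left right bounds c nonneg out' one)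
  qed
qed

lemma smooth_step_test_function:
  assumes "smooth_step s h \<Phi> \<rho>" "smooth_step t h' \<Phi>' \<rho>'" "0 < s" "s \<le> t" "s + h \<le> t + h'" "t + h' < T"
  shows "test_function {0<..<T} (\<lambda>x. \<Phi> x - \<Phi>' x)" "deriv (\<lambda>x. \<Phi> x - \<Phi>' x) x = \<rho> x - \<rho>' x"
proof -
  show "test_function {0<..<T} (\<lambda>x. \<Phi> x - \<Phi>' x)"
    unfolding test_function_def
  proof (intro conjI exI[of _ "{s..t + h'}"])
    show "\<forall>k. Ck k (\<lambda>x. \<Phi> x - \<Phi>' x)" using assms(1,2) by (auto simp: smooth_step_def intro: Ck_diff)
    show "\<forall>x. x \<notin> {s..t + h'} \<longrightarrow> \<Phi> x - \<Phi>' x = 0"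
    proof (intro allI impI)
      fix x assume "x \<notin> {s..t + h'}"
      then consider "x \<le> s" | "t + h' \<le> x" by force
      then show "\<Phi> x - \<Phi>' x = 0" using assms by cases (auto simp: smooth_step_def)
    qed
  qed (use assms in auto)
  have "((\<lambda>x. \<Phi> x - \<Phi>' x) has_real_derivative \<rho> x - \<rho>' x) (at x)"
    using assms(1,2) by (intro DERIV_diff) (auto simp: smooth_step_def)
  then show "deriv (\<lambda>x. \<Phi> x - \<Phi>' x) x = \<rho> x - \<rho>' x" by (rule DERIV_imp_deriv)
qed

lemma smooth_step_mult_integral:
  assumes st: "smooth_step s h \<Phi> \<rho>" and w: "continuous_on {0<..<T} w" and s: "0 < s" "s + h < T"
  shows "integrable (lebesgue_on {0<..<T}) (\<lambda>x. \<rho> x * w x)"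
    "(LINT x|lebesgue_on {0<..<T}. \<rho> x * w x) = integral {s..s + h} (\<lambda>x. \<rho> x * w x)"
proof -
  have sub: "{s..s + h} \<subseteq> {0<..<T}" using s by auto
  have c: "continuous_on {s..s + h} (\<lambda>x. \<rho> x * w x)"
    using st w sub by (intro continuous_on_mult) (auto simp: smooth_step_def intro: continuous_on_subset)
  have i: "integrable (lebesgue_on {s..s + h}) (\<lambda>x. \<rho> x * w x)" by (rule continuous_imp_integrable_real[OF c])
  have z: "\<rho> x * w x = 0" if "x \<notin> {s..s + h}" for x using st that by (simp add: smooth_step_def)
  show "integrable (lebesgue_on {0<..<T}) (\<lambda>x. \<rho> x * w x)"
    by (subst integrable_lebesgue_on_superset[OF _ _ sub z]) (auto simp: i)
  have "(LINT x|lebesgue_on {0<..<T}. \<rho> x * w x) = (LINT x|lebesgue_on {s..s + h}. \<rho> x * w x)"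
    by (rule integral_lebesgue_on_superset[OF _ _ sub z]) auto
  also have "\<dots> = integral {s..s + h} (\<lambda>x. \<rho> x * w x)" by (rule lebesgue_integral_eq_integral[OF i]) simp
  finally show "(LINT x|lebesgue_on {0<..<T}. \<rho> x * w x) = integral {s..s + h} (\<lambda>x. \<rho> x * w x)" .
qed

text \<open>The derivatives of the steps form an approximate identity that concentrates at s from
  the right.\<close>

lemma smooth_step_tendsto:
  assumes st: "\<And>n::nat. smooth_step s (h n) (\<Phi> n) (\<rho> n)" and w: "continuous_on {0<..<T} w"
    and s: "0 < s" "\<And>n. s + h n < T" and h: "\<And>n. 0 < h n" "h \<longlonglongrightarrow> 0"
  shows "(\<lambda>n. LINT x|lebesgue_on {0<..<T}. \<rho> n x * w x) \<longlonglongrightarrow> w s"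
proof (rule LIMSEQ_I)
  fix e :: real assume e: "e > 0"
  have sT: "s \<in> {0<..<T}" using s(1) s(2)[of 0] h(1)[of 0] by auto
  obtain d where d: "d > 0" "\<And>x. x \<in> {0<..<T} \<Longrightarrow> dist x s < d \<Longrightarrow> dist (w x) (w s) < e / 2"
    using w sT e unfolding continuous_on_iff by (metis half_gt_zero)
  obtain N where N: "\<And>n. n \<ge> N \<Longrightarrow> h n < d"
    using order_tendstoD(2)[OF h(2) d(1)] unfolding eventually_sequentially by blast
  have "norm ((LINT x|lebesgue_on {0<..<T}. \<rho> n x * w x) - w s) < e" if n: "n \<ge> N" for n
  proof -
    let ?I = "{s..s + h n}"
    have r: "continuous_on ?I (\<rho> n)" "\<And>x. 0 \<le> \<rho> n x" "integral ?I (\<rho> n) = 1"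
      using st[of n] by (auto simp: smooth_step_def intro: continuous_on_subset)
    have wI: "continuous_on ?I w" using w by (rule continuous_on_subset) (use s(1) s(2)[of n] in auto)
    have i: "(\<lambda>x. \<rho> n x * w x) integrable_on ?I" "(\<lambda>x. \<rho> n x * w s) integrable_on ?I" "(\<lambda>x. \<rho> n x * (e / 2)) integrable_on ?I"
      using r wI by (auto intro!: integrable_continuous_real continuous_intros)
    have "(LINT x|lebesgue_on {0<..<T}. \<rho> n x * w x) - w s = integral ?I (\<lambda>x. \<rho> n x * w x) - integral ?I (\<lambda>x. \<rho> n x * w s)"
      using smooth_step_mult_integral(2)[OF st w s(1) s(2)] r(3) by simp
    also have "\<dots> = integral ?I (\<lambda>x. \<rho> n x * w x - \<rho> n x * w s)" by (rule integral_diff[OF i(1,2), symmetric])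
    also have "norm \<dots> \<le> integral ?I (\<lambda>x. \<rho> n x * (e / 2))"
    proof (rule integral_norm_bound_integral)
      show "(\<lambda>x. \<rho> n x * w x - \<rho> n x * w s) integrable_on ?I" by (rule integrable_diff[OF i(1,2)])
      show "norm (\<rho> n x * w x - \<rho> n x * w s) \<le> \<rho> n x * (e / 2)" if "x \<in> ?I" for x
      proof -
        have "x \<in> {0<..<T}" "dist x s < d" using that s(1) s(2)[of n] N[OF n] by (auto simp: dist_real_def)
        then have "\<bar>w x - w s\<bar> \<le> e / 2" using d(2) by (force simp: dist_real_def)
        then have "\<rho> n x * \<bar>w x - w s\<bar> \<le> \<rho> n x * (e / 2)" using r(2) by (rule mult_left_mono)
        then show ?thesis using r(2)[of x] by (simp add: right_diff_distrib[symmetric] abs_mult)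
      qed
    qed (rule i(3))
    also have "\<dots> = e / 2" using r(3) by simp
    finally show ?thesis using e by simp
  qed
  then show "\<exists>N. \<forall>n\<ge>N. norm ((LINT x|lebesgue_on {0<..<T}. \<rho> n x * w x) - w s) < e" by blast
qed

text \<open>Testing with smooth approximations of the indicator of \<open>(s,t]\<close>.\<close>

lemma weak_derivative_imp_increment:
  assumes w: "continuous_on {0<..<T} w" and F: "integrable (lebesgue_on {0<..<T}) F"
    and weak: "\<And>\<phi>. test_function {0<..<T} \<phi> \<Longrightarrow>
      (LINT t|lebesgue_on {0<..<T}. deriv \<phi> t * w t) = - (LINT t|lebesgue_on {0<..<T}. \<phi> t * F t)"
    and st: "0 < s" "s \<le> t" "t < T"
  shows "w t - w s = integral {s..t} F"
proof -
  let ?M = "lebesgue_on {0<..<T}"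
  \<comment> \<open>The widths tend to 0 and keep \<open>t + h n\<close> below T.\<close>
  define h where "h n = (T - t) / 2 * (1 / real (Suc n))" for n
  have h: "0 < h n" "h n \<le> (T - t) / 2" for n
    using st mult_left_le[of "1 / real (Suc n)" "(T - t) / 2"] by (auto simp: h_def)
  have hT: "t + h n < T" "s + h n < T" for n
  proof -
    have "t + h n \<le> t + (T - t) / 2" using h(2) by simp
    also have "\<dots> < T" using st by (simp add: field_simps)
    finally show "t + h n < T" .
    then show "s + h n < T" using st by simp
  qed
  have h0: "h \<longlonglongrightarrow> 0"
    unfolding h_def[abs_def] using tendsto_mult[OF tendsto_const LIMSEQ_inverse_real_of_nat, of "(T - t) / 2"]
    by (simp only: inverse_eq_divide mult_zero_right)
  have "\<forall>n. \<exists>\<Phi> \<rho>. smooth_step s (h n) \<Phi> \<rho>" by (intro allI ex_smooth_step h(1) st(1))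
  then obtain \<Phi> \<rho> where 1: "\<And>n. smooth_step s (h n) (\<Phi> n) (\<rho> n)" by metis
  have "\<forall>n. \<exists>\<Phi> \<rho>. smooth_step t (h n) \<Phi> \<rho>"
    using less_le_trans[OF st(1,2)] by (intro allI ex_smooth_step h(1))
  then obtain \<Phi>' \<rho>' where 2: "\<And>n. smooth_step t (h n) (\<Phi>' n) (\<rho>' n)" by metis
  note T = smooth_step_test_function[OF 1 2 st(1,2) add_right_mono[OF st(2)] hT(1)]
  have l: "(\<lambda>n. (LINT x|?M. \<rho> n x * w x) - (LINT x|?M. \<rho>' n x * w x)) \<longlonglongrightarrow> w s - w t"
    by (intro tendsto_diff smooth_step_tendsto[OF 1 w] smooth_step_tendsto[OF 2 w] h h0 hT) (use st in auto)
  have eq: "(LINT x|?M. \<rho> n x * w x) - (LINT x|?M. \<rho>' n x * w x) = - (LINT x|?M. (\<Phi> n x - \<Phi>' n x) * F x)" for n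
  proof -
    have "(LINT x|?M. \<rho> n x * w x) - (LINT x|?M. \<rho>' n x * w x) = (LINT x|?M. \<rho> n x * w x - \<rho>' n x * w x)"
      using smooth_step_mult_integral(1)[OF 1 w st(1) hT(2)] smooth_step_mult_integral(1)[OF 2 w _ hT(1)] st
      by (intro Bochner_Integration.integral_diff[symmetric]) auto
    also have "\<dots> = (LINT x|?M. deriv (\<lambda>x. \<Phi> n x - \<Phi>' n x) x * w x)"
      by (simp add: T(2) left_diff_distrib)
    also have "\<dots> = - (LINT x|?M. (\<Phi> n x - \<Phi>' n x) * F x)" by (rule weak[OF T(1)])
    finally show ?thesis .
  qed
  \<comment> \<open>The limit is the indicator of an interval open at s and closed at t, because
    every step is still 0 at its starting point.\<close>
  have r: "(\<lambda>n. LINT x|?M. (\<Phi> n x - \<Phi>' n x) * F x) \<longlonglongrightarrow> (LINT x|?M. indicator {s<..t} x * F x)"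
  proof (rule integral_dominated_convergence[where w="\<lambda>x. \<bar>F x\<bar>"])
    show "integrable ?M (\<lambda>x. \<bar>F x\<bar>)" using F by auto
    show "(\<lambda>x. indicator {s<..t} x * F x) \<in> borel_measurable ?M"
      using F by (intro borel_measurable_times borel_measurable_imp_lebesgue_on[of "indicator {s<..t}"]) auto
    show "(\<lambda>x. (\<Phi> n x - \<Phi>' n x) * F x) \<in> borel_measurable ?M" for n
      by (rule borel_measurable_times[OF borel_measurable_imp_lebesgue_on[OF borel_measurable_test[OF T(1)]]
            borel_measurable_integrable[OF F]])
    show "AE x in ?M. norm ((\<Phi> n x - \<Phi>' n x) * F x) \<le> \<bar>F x\<bar>" for n
    proof (intro AE_I2)
      fix x
      have "0 \<le> \<Phi> n x" "\<Phi> n x \<le> 1" "0 \<le> \<Phi>' n x" "\<Phi>' n x \<le> 1" using 1[of n] 2[of n] by (auto simp: smooth_step_def)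
      then have "\<bar>\<Phi> n x - \<Phi>' n x\<bar> \<le> 1" by linarith
      then have "\<bar>\<Phi> n x - \<Phi>' n x\<bar> * \<bar>F x\<bar> \<le> 1 * \<bar>F x\<bar>" by (rule mult_right_mono) simp
      then show "norm ((\<Phi> n x - \<Phi>' n x) * F x) \<le> \<bar>F x\<bar>" by (simp add: abs_mult)
    qed
    have step: "(\<lambda>n. \<Psi> n x) \<longlonglongrightarrow> (if x \<le> a then 0 else 1)" if "\<And>n. smooth_step a (h n) (\<Psi> n) (\<sigma> n)" for \<Psi> \<sigma> a and x :: real
    proof (cases "x \<le> a")
      case True
      then have "\<Psi> n x = 0" for n using that[of n] by (simp add: smooth_step_def)
      then show ?thesis using True by simp
    next
      case False
      then have "\<forall>\<^sub>F n in sequentially. h n < x - a" by (intro order_tendstoD(2)[OF h0]) simp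
      then have "\<forall>\<^sub>F n in sequentially. \<Psi> n x = 1"
        by eventually_elim (use that in \<open>auto simp: smooth_step_def\<close>)
      then show ?thesis using False by (simp add: tendsto_eventually)
    qed
    show "AE x in ?M. (\<lambda>n. (\<Phi> n x - \<Phi>' n x) * F x) \<longlonglongrightarrow> indicator {s<..t} x * F x"
    proof (intro AE_I2 tendsto_mult tendsto_const)
      fix x
      have "(\<lambda>n. \<Phi> n x - \<Phi>' n x) \<longlonglongrightarrow> (if x \<le> s then 0 else 1) - (if x \<le> t then 0 else 1)"
        by (intro tendsto_diff step[OF 1] step[OF 2])
      then show "(\<lambda>n. \<Phi> n x - \<Phi>' n x) \<longlonglongrightarrow> indicator {s<..t} x"
        using st by (auto simp: indicator_def split: if_splits)
    qed
  qed
  have "(\<lambda>n. - (LINT x|?M. (\<Phi> n x - \<Phi>' n x) * F x)) \<longlonglongrightarrow> w s - w t" using l unfolding eq .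
  then have "w s - w t = - (LINT x|?M. indicator {s<..t} x * F x)"
    using LIMSEQ_unique tendsto_minus[OF r] by blast
  also have "(LINT x|?M. indicator {s<..t} x * F x) = (LINT x|lebesgue_on {s<..t}. F x)"
  proof -
    have "{s<..t} \<subseteq> {0<..<T}" using st by auto
    from Lebesgue_Measure.integral_restrict[OF this, of F] show ?thesis
      by (simp add: indicator_def of_bool_def if_distrib[of "\<lambda>y. y * _"] cong: if_cong)
  qed
  also have "\<dots> = integral {s<..t} F"
    by (intro lebesgue_integral_eq_integral integrable_lebesgue_on_subset[OF F]) (use st in auto)
  also have "\<dots> = integral {s..t} F"
    by (rule integral_spike_set) (auto intro: negligible_subset[of "{s}"])
  finally show ?thesis by simp
qed

section \<open>Differentiation of integrals and measurability of pairings\<close>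

lemma indefinite_integral_right_derivative_AE:
  fixes f :: "real \<Rightarrow> real"
  assumes "\<And>a b. f integrable_on {a..b}"
  obtains N where "negligible N" "\<And>x e. x \<notin> N \<Longrightarrow> 0 < e \<Longrightarrow>
      \<exists>d>0. \<forall>h. 0 < h \<and> h < d \<longrightarrow> \<bar>integral {x..x + h} f / h - f x\<bar> < e"
proof -
  have "f integrable_on cbox a b" for a b using assms by simp
  from integrable_ccontinuous_explicit[OF this] obtain N where "negligible N"
    "\<And>x e. x \<notin> N \<Longrightarrow> 0 < e \<Longrightarrow> \<exists>d>0. \<forall>h. 0 < h \<and> h < d \<longrightarrow>
      norm (integral (cbox x (x + h *\<^sub>R One)) f /\<^sub>R h ^ DIM(real) - f x) < e" by blast
  then show thesis using that by (simp add: divide_inverse mult.commute)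
qed

text \<open>The statement on right derivatives, applied to f and to its reflection x -> f(-x), gives
  both one-sided derivatives; the exceptional set of the reflection is reflected back.\<close>

lemma indefinite_integral_has_derivative_AE:
  fixes f :: "real \<Rightarrow> real"
  assumes f: "f integrable_on {a..b}"
  shows "AE x in lebesgue. x \<in> {a<..<b} \<longrightarrow> ((\<lambda>x. integral {a..x} f) has_real_derivative f x) (at x)"
proof -
  \<comment> \<open>Extension by zero makes f and its reflection integrable on every
    interval.\<close>
  define g where "g x = (if x \<in> {a..b} then f x else 0)" for x
  have "g integrable_on UNIV" unfolding g_def using f by (simp add: Henstock_Kurzweil_Integration.integrable_restrict_UNIV del: atLeastAtMost_iff)
  then have g: "g integrable_on {c..d}" for c d by (rule integrable_on_subinterval) simp
  have g': "(\<lambda>x. g (- x)) integrable_on {c..d}" for c d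
    using g[of "-d" "-c"] Henstock_Kurzweil_Integration.integrable_reflect_real[of g "-c" "-d"] by simp
  obtain N1 where N1: "negligible N1" "\<And>x e. x \<notin> N1 \<Longrightarrow> 0 < e \<Longrightarrow>
      \<exists>d>0. \<forall>h. 0 < h \<and> h < d \<longrightarrow> \<bar>integral {x..x + h} g / h - g x\<bar> < e"
    using indefinite_integral_right_derivative_AE[OF g] by metis
  obtain N2 where N2: "negligible N2" "\<And>x e. x \<notin> N2 \<Longrightarrow> 0 < e \<Longrightarrow>
      \<exists>d>0. \<forall>h. 0 < h \<and> h < d \<longrightarrow> \<bar>integral {x..x + h} (\<lambda>x. g (- x)) / h - g (- x)\<bar> < e"
    using indefinite_integral_right_derivative_AE[OF g'] by metis
  have "negligible (uminus ` N2)"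
    by (rule negligible_differentiable_image_negligible[OF order.refl N2(1)]) (auto intro!: derivative_intros)
  with N1(1) have N: "negligible (N1 \<union> uminus ` N2)" by simp
  have "((\<lambda>x. integral {a..x} f) has_real_derivative f x) (at x)" if x: "x \<in> {a<..<b}" "x \<notin> N1 \<union> uminus ` N2" for x
    unfolding DERIV_def
  proof (rule LIM_I)
    fix e :: real assume e: "e > 0"
    have "x \<notin> N1" "- x \<notin> N2" using x(2) by (auto simp: image_iff)
    then obtain d1 d2 where d1: "d1 > 0" "\<And>h. 0 < h \<Longrightarrow> h < d1 \<Longrightarrow> \<bar>integral {x..x + h} g / h - g x\<bar> < e"
      and d2: "d2 > 0" "\<And>h. 0 < h \<Longrightarrow> h < d2 \<Longrightarrow> \<bar>integral {- x..- x + h} (\<lambda>x. g (- x)) / h - g (- (- x))\<bar> < e"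
      using N1(2)[of x e] N2(2)[of "- x" e] e by metis
    define r where "r = min (min d1 d2) (min (x - a) (b - x))"
    have gx: "g x = f x" using x(1) by (simp add: g_def)
    have "\<bar>(integral {a..x + h} f - integral {a..x} f) / h - f x\<bar> < e" if h: "h \<noteq> 0" "\<bar>h\<bar> < r" for h
    proof (cases "h > 0")
      case True
      have i: "f integrable_on {a..x + h}" by (rule integrable_on_subinterval[OF f]) (use h True r_def in auto)
      have "integral {a..x + h} f - integral {a..x} f = integral {x..x + h} f"
        using Henstock_Kurzweil_Integration.integral_combine[OF _ _ i, of x] x(1) True by simp
      also have "\<dots> = integral {x..x + h} g" by (intro integral_cong) (use x(1) h True r_def in \<open>auto simp: g_def\<close>)
      finally show ?thesis using d1(2)[of h] True h gx by (simp add: r_def)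
    next
      case False
      then have h': "h < 0" using h by simp
      have i: "f integrable_on {a..x}" by (rule integrable_on_subinterval[OF f]) (use x(1) in auto)
      have "integral {a..x} f - integral {a..x + h} f = integral {x + h..x} f"
        using Henstock_Kurzweil_Integration.integral_combine[OF _ _ i, of "x + h"] x(1) h h' by (simp add: r_def)
      also have "\<dots> = integral {x + h..x} g" by (intro integral_cong) (use x(1) h h' r_def in \<open>auto simp: g_def\<close>)
      also have "\<dots> = integral {- x..- x + (- h)} (\<lambda>x. g (- x))"
        using Henstock_Kurzweil_Integration.integral_reflect_real[of x "x + h" g] by simp
      finally have "(integral {a..x + h} f - integral {a..x} f) / h = integral {- x..- x + (- h)} (\<lambda>x. g (- x)) / (- h)"
        by (simp add: field_simps)
      then show ?thesis using d2(2)[of "- h"] h h' gx by (simp add: r_def)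
    qed
    moreover have "r > 0" using d1(1) d2(1) x(1) by (simp add: r_def)
    ultimately show "\<exists>s>0. \<forall>h. h \<noteq> 0 \<and> norm (h - 0) < s \<longrightarrow>
      norm ((integral {a..x + h} f - integral {a..x} f) / h - f x) < e" by auto
  qed
  then have "{x. \<not> (x \<in> {a<..<b} \<longrightarrow> ((\<lambda>x. integral {a..x} f) has_real_derivative f x) (at x))} \<subseteq> N1 \<union> uminus ` N2"
    by blast
  then show ?thesis using N unfolding negligible_iff_null_sets by (intro AE_I'[of "N1 \<union> uminus ` N2"]) auto
qed

text \<open>For simple h the pairing is a finite sum of indicators times functions t -> (y, v t),
  which are continuous because v is. The pairing with a strongly measurable h is a limit of such
  sums almost everywhere.\<close>

lemma bochner_measurable_ip:
  fixes h v :: "real \<Rightarrow> 'a::euclidean_space \<Rightarrow> real"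
  assumes h: "bochner_measurable (lebesgue_on I) (L2s M) (l2 M) h" and I: "I \<in> sets lebesgue"
    and v: "\<And>t. t \<in> I \<Longrightarrow> v t \<in> L2s M" "\<And>t. t \<in> I \<Longrightarrow> ((\<lambda>s. l2 M (\<lambda>x. v s x - v t x)) \<longlongrightarrow> 0) (at t within I)"
  shows "(\<lambda>t. ip M (h t) (v t)) \<in> borel_measurable (lebesgue_on I)"
proof -
  obtain s where s: "\<And>n::nat. simple_function (lebesgue_on I) (s n)" "\<And>n. s n ` I \<subseteq> L2s M"
    and lim: "AE t in lebesgue_on I. (\<lambda>n. l2 M (\<lambda>x. s n t x - h t x)) \<longlonglongrightarrow> 0"
    and hL: "AE t in lebesgue_on I. h t \<in> L2s M"
    using h unfolding bochner_measurable_def space_lebesgue_on by blast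
  define f where "f n t = (\<Sum>y\<in>s n ` I. indicator (s n -` {y} \<inter> I) t * ip M y (v t))" for n t
  have fin: "finite (s n ` I)" for n using simple_functionD(1)[OF s(1)] by simp
  have f_eq: "f n t = ip M (s n t) (v t)" if "t \<in> I" for n t
  proof -
    have "f n t = (\<Sum>y\<in>s n ` I. if s n t = y then ip M y (v t) else 0)"
      unfolding f_def using that by (intro sum.cong) (auto simp: indicator_def)
    also have "\<dots> = ip M (s n t) (v t)" using fin that by (simp add: sum.delta)
    finally show ?thesis .
  qed
  have fm: "f n \<in> borel_measurable (lebesgue_on I)" for n
    unfolding f_def[abs_def]
  proof (intro borel_measurable_sum borel_measurable_times borel_measurable_indicator)
    fix y assume y: "y \<in> s n ` I"
    show "s n -` {y} \<inter> I \<in> sets (lebesgue_on I)" using simple_functionD(2)[OF s(1)[of n], of "{y}"] by simp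
    have "continuous_on I (\<lambda>t. ip M y (v t))"
      unfolding continuous_on_def
    proof
      fix t assume t: "t \<in> I"
      have yL: "y \<in> L2s M" using y s(2) by blast
      have ev: "\<forall>\<^sub>F s in at t within I. v s \<in> L2s M"
        using v(1) by (auto simp: eventually_at_filter)
      show "((\<lambda>t. ip M y (v t)) \<longlongrightarrow> ip M y (v t)) (at t within I)"
        by (rule tendsto_ip_eventually[OF _ _ yL v(2)[OF t] ev v(1)[OF t]]) (use yL in simp_all)
    qed
    then show "(\<lambda>t. ip M y (v t)) \<in> borel_measurable (lebesgue_on I)"
      using I by (rule continuous_imp_measurable_on_sets_lebesgue)
  qed
  have "(\<lambda>t. lim (\<lambda>n. f n t)) \<in> borel_measurable (lebesgue_on I)"
    using fm by (intro borel_measurable_lim_metric) auto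
  moreover have "AE t in lebesgue_on I. lim (\<lambda>n. f n t) = ip M (h t) (v t)"
    using lim hL AE_space
  proof eventually_elim
    case (elim t)
    then have t: "t \<in> I" by simp
    have "(\<lambda>n. ip M (s n t) (v t)) \<longlonglongrightarrow> ip M (h t) (v t)"
      by (rule tendsto_ip[OF elim(1) _ elim(2) _ v(1)[OF t] v(1)[OF t]]) (use s(2) t in auto)
    then show ?case using f_eq[OF t] by (simp add: limI)
  qed
  ultimately show ?thesis using I by (rule borel_measurable_lebesgue_on_AE)
qed

section \<open>Weak solutions as trajectories\<close>

lemma AE_lebesgue_on_iff:
  "S \<in> sets lebesgue \<Longrightarrow> (AE t in lebesgue_on S. Q t) \<longleftrightarrow> (AE t in lebesgue. t \<in> S \<longrightarrow> Q t)"
  by (simp add: AE_restrict_space_iff)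

lemma integral_increment_le:
  fixes f :: "real \<Rightarrow> real"
  assumes "x \<le> y" "f integrable_on {x..y}" "\<And>r. r \<in> {x..y} \<Longrightarrow> \<bar>f r\<bar> \<le> C"
  shows "\<bar>integral {x..y} f\<bar> \<le> C * (y - x)"
proof -
  have "norm (integral {x..y} f) \<le> integral {x..y} (\<lambda>r. C)"
    by (rule integral_norm_bound_integral) (use assms in auto)
  then show ?thesis using assms(1) by (simp add: mult.commute)
qed

lemma integral_difference:
  fixes f :: "real \<Rightarrow> real"
  assumes "f integrable_on {a..b}" "a \<le> x" "x \<le> y" "y \<le> b"
  shows "integral {a..y} f - integral {a..x} f = integral {x..y} f"
proof -
  have "f integrable_on {a..y}" by (rule integrable_on_subinterval[OF assms(1)]) (use assms in auto)
  from Henstock_Kurzweil_Integration.integral_combine[OF assms(2,3) this] show ?thesis by simp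
qed

text \<open>The corrector \<open>(u\<^sub>t, u)\<close> is differentiated at the Lebesgue points of \<open>t \<mapsto> (h(t), u(t))\<close>: near
  such a point \<open>t\<close> the second factor is frozen at \<open>u(t)\<close>, so that only the weak equation tested with a
  fixed function is used.\<close>

lemma weak_solution_trajectory:
  fixes \<Omega> :: "'a::euclidean_space set"
  assumes \<Omega>: "open \<Omega>"
    and Poincare: "P > 0" "\<And>v. v \<in> H10 \<Omega> \<Longrightarrow> l2 (lebesgue_on \<Omega>) v \<le> P * l2 (lebesgue_on \<Omega>) (weak_grad \<Omega> v)"
    and par: "b > 0" "c > 0" "0 < \<alpha>" "\<alpha> < \<beta>" and T: "T > 0"
    and h: "bochner_measurable (lebesgue_on {0<..<T}) (L2s (lebesgue_on \<Omega>)) (l2 (lebesgue_on \<Omega>)) h"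
      "AE t in lebesgue_on {0<..<T}. l2 (lebesgue_on \<Omega>) (h t) \<le> H" and H: "H \<ge> 0"
    and sol: "weak_solution \<Omega> b c \<alpha> \<beta> lam mu h T u ut"
  shows "kirchhoff_parameters.trajectory b c \<alpha> \<beta> lam mu P H T (\<lambda>t. l2 (lebesgue_on \<Omega>) (ut t))
    (\<lambda>t. l2 (lebesgue_on \<Omega>) (weak_grad \<Omega> (u t))) (\<lambda>t. l2 (lebesgue_on \<Omega>) (u t))
    (\<lambda>t. ip (lebesgue_on \<Omega>) (ut t) (u t))"
proof -
  interpret kirchhoff_parameters b c \<alpha> \<beta> lam mu P using par Poincare(1) by unfold_locales
  define M where "M = lebesgue_on \<Omega>"
  define I where "I = {0<..<T}"
  define J where "J = {0..T}"
  define G where "G t = weak_grad \<Omega> (u t)" for t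
  define V where "V t = l2 M (ut t)" for t
  define A where "A t = l2 M (G t)" for t
  define U where "U t = l2 M (u t)" for t
  define z where "z t = ip M (ut t) (u t)" for t
  have IJ: "I \<subseteq> J" "I \<in> sets lebesgue" by (auto simp: I_def J_def)
  \<comment> \<open>Continuity and derivatives are defined within [0, T]; at interior times these
    are the two-sided notions.\<close>
  have atJ: "at t within J = at t" if "t \<in> I" for t
    using that by (intro at_within_interior) (simp add: I_def J_def)
  have evI: "\<forall>\<^sub>F s in at t. s \<in> I" if "t \<in> I" for t
    using that unfolding I_def by (intro eventually_at_in_open') auto
  have evJ: "\<forall>\<^sub>F s in at t within J. Q s" if "\<And>s. s \<in> J \<Longrightarrow> Q s" for Q and t :: real
    by (simp add: eventually_at_filter that)

  \<comment> \<open>Values and continuity in time of the solution\<close>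
  have uH: "u t \<in> H10 \<Omega>" if "t \<in> J" for t
    using sol that unfolding weak_solution_def continuous_into_def J_def by blast
  have utL: "ut t \<in> L2s M" if "t \<in> J" for t
    using sol that unfolding weak_solution_def continuous_into_def J_def M_def Lp_2_eq_L2s by blast
  have uH1: "u t \<in> H1 \<Omega>" if "t \<in> J" for t using uH[OF that] by (simp add: H10_def)
  have uL: "u t \<in> L2s M" if "t \<in> J" for t unfolding M_def by (rule W1p_2_D(1)[OF \<Omega> uH1[OF that]])
  have GL: "G t \<in> L2s M" if "t \<in> J" for t unfolding M_def G_def by (rule W1p_2_D(3)[OF \<Omega> uH1[OF that]])
  have cH: "((\<lambda>s. H1_norm \<Omega> (\<lambda>x. u s x - u t x)) \<longlongrightarrow> 0) (at t within J)" if "t \<in> J" for t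
    using sol that unfolding weak_solution_def continuous_into_def J_def by blast
  have cu: "((\<lambda>s. l2 M (\<lambda>x. u s x - u t x)) \<longlongrightarrow> 0) (at t within J)" if "t \<in> J" for t
    by (rule tendsto_0_le[OF cH[OF that], of _ 1]) (simp add: M_def H1_norm_ge H1_norm_nonneg)
  have cG: "((\<lambda>s. l2 M (\<lambda>x. G s x - G t x)) \<longlongrightarrow> 0) (at t within J)" if t: "t \<in> J" for t
  proof (rule tendsto_0_le[OF cH[OF t], of _ 1], rule evJ)
    fix s assume s: "s \<in> J"
    show "norm (l2 M (\<lambda>x. G s x - G t x)) \<le> norm (H1_norm \<Omega> (\<lambda>x. u s x - u t x)) * 1"
      using H1_norm_ge(2)[of \<Omega> "\<lambda>x. u s x - u t x"]
      unfolding l2_weak_grad_diff[OF \<Omega> uH1[OF s] uH1[OF t]] G_def M_def by (simp add: H1_norm_nonneg)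
  qed
  have ct: "((\<lambda>s. l2 M (\<lambda>x. ut s x - ut t x)) \<longlongrightarrow> 0) (at t within J)" if "t \<in> J" for t
    using sol that unfolding weak_solution_def continuous_into_def J_def M_def Lp_norm_2_eq_l2 by blast
  have du: "((\<lambda>s. l2 M (\<lambda>x. (u s x - u t x) / (s - t) - ut t x)) \<longlongrightarrow> 0) (at t within J)" if "t \<in> J" for t
    using sol that unfolding weak_solution_def has_derivative_into_def J_def M_def Lp_norm_2_eq_l2 by blast

  have cont: "continuous_on J V" "continuous_on J A" "continuous_on J U"
    unfolding continuous_on_def V_def[abs_def] A_def[abs_def] U_def[abs_def]
    by (auto intro!: tendsto_l2_eventually ct cG cu evJ utL GL uL)
  have cip: "continuous_on J (\<lambda>t. ip M (ut t) v)" "continuous_on J (\<lambda>t. ip M (u t) v)" if v: "v \<in> L2s M" for v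
    unfolding continuous_on_def using v
    by (auto intro!: tendsto_ip_eventually ct cu evJ utL uL)
  have cipG: "continuous_on J (\<lambda>t. ip M (G t) v)" if v: "v \<in> L2s M" for v
    unfolding continuous_on_def using v by (auto intro!: tendsto_ip_eventually cG evJ GL)
  obtain B where B: "B > 0" "\<And>t. t \<in> J \<Longrightarrow> V t \<le> B \<and> A t \<le> B \<and> U t \<le> B"
  proof -
    have "compact (V ` J)" "compact (A ` J)" "compact (U ` J)"
      using cont by (auto intro!: compact_continuous_image simp: J_def)
    then have "bounded (V ` J \<union> A ` J \<union> U ` J)" by (auto intro: compact_imp_bounded)
    then obtain B where "B > 0" "\<forall>x\<in>V ` J \<union> A ` J \<union> U ` J. norm x \<le> B" unfolding bounded_pos by blast
    then show thesis by (intro that[of B]) force+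
  qed

  \<comment> \<open>A modification of h, equal to it almost everywhere, for which membership in L2
    and the bound H hold at every time.\<close>
  define h' where "h' t = (if h t \<in> L2s M \<and> l2 M (h t) \<le> H then h t else (\<lambda>x. 0))" for t
  have h'L: "h' t \<in> L2s M" "l2 M (h' t) \<le> H" for t using H by (auto simp: h'_def L2s_zero)
  have h'ae: "AE t in lebesgue_on I. h' t = h t"
    using h unfolding bochner_measurable_def M_def[symmetric] I_def[symmetric] by (auto simp: h'_def)
  have hm: "(\<lambda>t. ip M (h' t) (v t)) \<in> borel_measurable (lebesgue_on I)"
    if "\<And>t. t \<in> I \<Longrightarrow> v t \<in> L2s M" "\<And>t. t \<in> I \<Longrightarrow> ((\<lambda>s. l2 M (\<lambda>x. v s x - v t x)) \<longlongrightarrow> 0) (at t within I)" for v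
  proof (rule borel_measurable_lebesgue_on_AE[OF bochner_measurable_ip[OF _ IJ(2) that]])
    show "bochner_measurable (lebesgue_on I) (L2s M) (l2 M) h" using h(1) by (simp add: I_def M_def)
    show "AE t in lebesgue_on I. ip M (h t) (v t) = ip M (h' t) (v t)" using h'ae by eventually_elim simp
  qed (use IJ in auto)
  have h'ip: "\<bar>ip M (h' t) v\<bar> \<le> H * l2 M v" if "v \<in> L2s M" for t v
    by (rule order.trans[OF ip_Cauchy_Schwarz[OF h'L(1) that]]) (intro mult_right_mono h'L, simp)
  interpret fin: finite_measure "lebesgue_on I"
    by (rule finite_measure_lebesgue_on) (simp add: I_def)

  \<comment> \<open>The equation tested with a fixed function\<close>
  define N where "N v r = - (1 + b * A r powr \<beta>) * ip M (G r) (weak_grad \<Omega> v) - c * V r powr \<alpha> * ip M (ut r) v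
      + lam * ip M (u r) v + mu * ip M (ut r) v" for v r
  \<comment> \<open>\<open>F v\<close> represents u_tt applied to v. Its part \<open>N v\<close> is
    continuous up to the end points of the time interval; only the force is merely measurable in
    time.\<close>
  define F where "F v r = N v r + ip M (h' r) v" for v r
  have HD: "v \<in> L2s M" "weak_grad \<Omega> v \<in> L2s M" if "v \<in> H10 \<Omega>" for v
    using that W1p_2_D[OF \<Omega>, of v] by (auto simp: H10_def M_def)
  have cN: "continuous_on J (N v)" if v: "v \<in> H10 \<Omega>" for v
  proof -
    have "continuous_on J (\<lambda>r. A r powr \<beta>)" "continuous_on J (\<lambda>r. V r powr \<alpha>)"
      using cont \<alpha> \<beta>_pos by (auto intro!: continuous_on_powr' continuous_on_const simp: A_def V_def)
    then show ?thesis
      unfolding N_def[abs_def] using HD[OF v]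
      by (intro continuous_on_add continuous_on_diff continuous_on_mult continuous_on_minus continuous_on_const cip cipG)
  qed
  have iN: "integrable (lebesgue_on I) (N v)" if v: "v \<in> H10 \<Omega>" for v
  proof (rule integrable_lebesgue_on_subset[OF _ IJ(1) _ IJ(2)])
    show "integrable (lebesgue_on J) (N v)" using cN[OF v] unfolding J_def by (rule continuous_imp_integrable_real)
  qed (simp add: J_def)
  have ihv: "integrable (lebesgue_on I) (\<lambda>t. ip M (h' t) v)" if v: "v \<in> H10 \<Omega>" for v
  proof (rule fin.integrable_const_bound[where B="H * l2 M v"])
    show "(\<lambda>t. ip M (h' t) v) \<in> borel_measurable (lebesgue_on I)"
      by (rule hm) (use HD[OF v] in auto)
  qed (use h'ip[OF HD(1)[OF v]] in auto)
  have iF: "integrable (lebesgue_on I) (F v)" if v: "v \<in> H10 \<Omega>" for v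
    unfolding F_def[abs_def] by (intro Bochner_Integration.integrable_add iN ihv v)
  have HK: "f integrable_on {0..T}" if "integrable (lebesgue_on I) f" for f :: "real \<Rightarrow> real"
    using integrable_on_lebesgue_on[OF that IJ(2)] by (simp add: I_def integrable_on_open_interval_real)

  obtain utt where dist: "distributional_derivative_Hm1 \<Omega> T ut utt"
    and eq: "AE t in lebesgue_on I. \<forall>v\<in>H10 \<Omega>.
           utt t v + neg_laplacian \<Omega> (u t) v
           + b * (LINT x|lebesgue_on \<Omega>. norm (weak_grad \<Omega> (u t) x) ^ 2) powr (\<beta> / 2) * neg_laplacian \<Omega> (u t) v
           + c * (LINT x|lebesgue_on \<Omega>. \<bar>ut t x\<bar> ^ 2) powr (\<alpha> / 2) * L2_pair \<Omega> (ut t) v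
           - lam * L2_pair \<Omega> (u t) v - mu * L2_pair \<Omega> (ut t) v = L2_pair \<Omega> (h t) v"
    using sol unfolding weak_solution_def I_def by blast
  have uttF: "AE t in lebesgue_on I. F v t = utt t v" if v: "v \<in> H10 \<Omega>" for v
    using eq h'ae
  proof eventually_elim
    case (elim t)
    have sq: "(x\<^sup>2) powr (p / 2) = x powr p" if "0 \<le> x" for x p :: real
      unfolding powr_two_eq_square[OF that, symmetric] powr_powr by simp
    have "(LINT x|lebesgue_on \<Omega>. norm (weak_grad \<Omega> (u t) x) ^ 2) powr (\<beta> / 2) = A t powr \<beta>"
      "(LINT x|lebesgue_on \<Omega>. \<bar>ut t x\<bar> ^ 2) powr (\<alpha> / 2) = V t powr \<alpha>"
    proof -
      have "(LINT x|lebesgue_on \<Omega>. norm (weak_grad \<Omega> (u t) x) ^ 2) = (A t)\<^sup>2"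
        unfolding A_def l2_power2 M_def G_def ..
      moreover have "(LINT x|lebesgue_on \<Omega>. \<bar>ut t x\<bar> ^ 2) = (V t)\<^sup>2"
        unfolding V_def l2_power2 M_def by simp
      moreover have "0 \<le> A t" "0 \<le> V t" by (simp_all add: A_def V_def)
      ultimately show "(LINT x|lebesgue_on \<Omega>. norm (weak_grad \<Omega> (u t) x) ^ 2) powr (\<beta> / 2) = A t powr \<beta>"
        "(LINT x|lebesgue_on \<Omega>. \<bar>ut t x\<bar> ^ 2) powr (\<alpha> / 2) = V t powr \<alpha>"
        by (simp_all only: sq)
    qed
    note 1 = this
    have 2: "neg_laplacian \<Omega> (u t) v = ip M (G t) (weak_grad \<Omega> v)"
      by (simp add: neg_laplacian_def ip_def M_def G_def)
    have "utt t v + ip M (G t) (weak_grad \<Omega> v) + b * A t powr \<beta> * ip M (G t) (weak_grad \<Omega> v)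
        + c * V t powr \<alpha> * ip M (ut t) v - lam * ip M (u t) v - mu * ip M (ut t) v = ip M (h' t) v"
      using bspec[OF elim(1) v] unfolding 1 2 elim(2) unfolding L2_pair_eq_ip M_def[symmetric] .
    moreover have "- (1 + b * A t powr \<beta>) * ip M (G t) (weak_grad \<Omega> v)
        = - ip M (G t) (weak_grad \<Omega> v) - b * A t powr \<beta> * ip M (G t) (weak_grad \<Omega> v)"
      by (simp add: left_diff_distrib)
    ultimately show ?case unfolding F_def N_def by linarith
  qed
  \<comment> \<open>The identity holds at all times of the open interval, not only almost
    everywhere, and takes the place of u_tt from here on.\<close>
  have incr: "ip M (ut t) v - ip M (ut s) v = integral {s..t} (F v)"
    if v: "v \<in> H10 \<Omega>" and st: "0 < s" "s \<le> t" "t < T" for v s t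
  proof (rule weak_derivative_imp_increment[OF _ _ _ st])
    show "continuous_on {0<..<T} (\<lambda>t. ip M (ut t) v)"
      using cip(1)[OF HD(1)[OF v]] IJ(1) unfolding I_def by (rule continuous_on_subset)
    show "integrable (lebesgue_on {0<..<T}) (F v)" using iF[OF v] by (simp add: I_def)
    fix \<phi> :: "real \<Rightarrow> real" assume \<phi>: "test_function {0<..<T} \<phi>"
    have m: "(\<lambda>t. \<phi> t * F v t) \<in> borel_measurable (lebesgue_on I)"
      by (rule borel_measurable_times[OF borel_measurable_imp_lebesgue_on[OF borel_measurable_test[OF \<phi>]]
            borel_measurable_integrable[OF iF[OF v]]])
    have ae: "AE t in lebesgue_on I. \<phi> t * F v t = \<phi> t * utt t v"
      using uttF[OF v] by eventually_elim simp
    have "(LINT t|lebesgue_on I. deriv \<phi> t * ip M (ut t) v) = - (LINT t|lebesgue_on I. \<phi> t * utt t v)"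
      using dist \<phi> v unfolding distributional_derivative_Hm1_def L2_pair_eq_ip M_def[symmetric] I_def by blast
    also have "(LINT t|lebesgue_on I. \<phi> t * utt t v) = (LINT t|lebesgue_on I. \<phi> t * F v t)"
      using ae by (intro integral_cong_AE[OF borel_measurable_lebesgue_on_AE[OF m ae IJ(2)] m]) auto
    finally show "(LINT t|lebesgue_on {0<..<T}. deriv \<phi> t * ip M (ut t) v) = - (LINT t|lebesgue_on {0<..<T}. \<phi> t * F v t)"
      unfolding I_def .
  qed

  \<comment> \<open>Lipschitz continuity of u and of (u_t, u)\<close>
  have dip: "((\<lambda>r. ip M (u r) v) has_real_derivative ip M (ut t) v) (at t)" if t: "t \<in> I" and v: "v \<in> L2s M" for t v
    unfolding has_field_derivative_iff
  proof (rule Lim_transform_eventually)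
    have tJ: "t \<in> J" using t IJ by blast
    have q: "\<forall>\<^sub>F s in at t within J. (\<lambda>x. (u s x - u t x) / (s - t)) \<in> L2s M"
      by (rule evJ) (intro L2s_divide L2s_diff uL tJ)
    show "((\<lambda>s. ip M (\<lambda>x. (u s x - u t x) / (s - t)) v) \<longlongrightarrow> ip M (ut t) v) (at t)"
      unfolding atJ[OF t, symmetric]
      by (rule tendsto_ip_eventually[OF du[OF tJ] q utL[OF tJ]]) (use v in auto)
    show "\<forall>\<^sub>F s in at t. ip M (\<lambda>x. (u s x - u t x) / (s - t)) v = (ip M (u s) v - ip M (u t) v) / (s - t)"
      using evI[OF t]
    proof eventually_elim
      case (elim s)
      then have "s \<in> J" using IJ by blast
      then show ?case
        using ip_divide_right[of M v "\<lambda>x. u s x - u t x" "s - t"] ip_diff_left[OF uL[of s] uL[OF tJ] v]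
        by (simp add: ip_commute)
    qed
  qed
  \<comment> \<open>A mean value inequality for values in L2: the scalar function r -> (u(r), v) is
    used with v the increment u(t) - u(s) itself.\<close>
  have lip: "l2 M (\<lambda>x. u t x - u s x) \<le> B * (t - s)" if st: "s \<in> I" "t \<in> I" "s \<le> t" for s t
  proof (cases "s = t")
    case False
    then have less: "s < t" using st by simp
    have sub: "r \<in> I" if "s \<le> r" "r \<le> t" for r using that st by (auto simp: I_def)
    define v where "v = (\<lambda>x. u t x - u s x)"
    have J: "s \<in> J" "t \<in> J" using st IJ by auto
    have v: "v \<in> L2s M" unfolding v_def by (intro L2s_diff uL J)
    obtain r where r: "s < r" "r < t" "ip M (u t) v - ip M (u s) v = (t - s) * ip M (ut r) v"
      using MVT2[OF less, of "\<lambda>r. ip M (u r) v" "\<lambda>r. ip M (ut r) v"] dip[OF sub v] by blast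
    have rJ: "r \<in> J" using r sub[of r] IJ by auto
    have "(l2 M v)\<^sup>2 = ip M (u t) v - ip M (u s) v"
      unfolding l2_power2_eq_ip using ip_diff_left[OF uL[OF J(2)] uL[OF J(1)] v] by (simp add: v_def[symmetric])
    also have "\<dots> \<le> (t - s) * (B * l2 M v)"
    proof -
      have "ip M (ut r) v \<le> V r * l2 M v" using ip_Cauchy_Schwarz[OF utL[OF rJ] v] by (simp add: V_def)
      also have "\<dots> \<le> B * l2 M v" using B(2)[OF rJ] by (intro mult_right_mono) auto
      finally show ?thesis unfolding r(3) using less by (intro mult_left_mono) auto
    qed
    finally have "l2 M v * l2 M v \<le> (B * (t - s)) * l2 M v" by (simp add: power2_eq_square mult_ac)
    then have "l2 M v \<le> B * (t - s)"
    proof (cases "l2 M v = 0")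
      case False
      then have "l2 M v > 0" using l2_nonneg[of M v] by linarith
      then show ?thesis using \<open>l2 M v * l2 M v \<le> _\<close> by simp
    qed (use B less in simp)
    then show ?thesis by (simp add: v_def)
  qed simp
  have lip': "l2 M (\<lambda>x. u t x - u s x) \<le> B * \<bar>t - s\<bar>" if "s \<in> I" "t \<in> I" for s t
    using lip[OF that] lip[OF that(2,1)] by (cases "s \<le> t") (simp_all add: l2_minus_commute[of M "u t"])

  \<comment> \<open>Bounds \<open>F (u x) r\<close> term by term, for all times x and r at
    once.\<close>
  define C where "C = (1 + b * B powr \<beta>) * (B * B) + c * B powr \<alpha> * (B * B) + \<bar>lam\<bar> * (B * B) + \<bar>mu\<bar> * (B * B) + H * B"
  have C0: "C \<ge> 0" unfolding C_def using par B(1) H by (intro add_nonneg_nonneg mult_nonneg_nonneg) auto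
  have FB: "\<bar>F (u x) r\<bar> \<le> C" if x: "x \<in> J" and r: "r \<in> J" for x r
  proof -
    have n: "0 \<le> A t" "0 \<le> V t" "0 \<le> U t" for t by (auto simp: A_def V_def U_def)
    have i1: "\<bar>ip M (G r) (weak_grad \<Omega> (u x))\<bar> \<le> B * B"
      using ip_Cauchy_Schwarz[OF GL[OF r] GL[OF x]] mult_mono[of "A r" B "A x" B] B n r x
      by (auto simp: A_def G_def intro: order.trans)
    have i2: "\<bar>ip M (ut r) (u x)\<bar> \<le> B * B"
      using ip_Cauchy_Schwarz[OF utL[OF r] uL[OF x]] mult_mono[of "V r" B "U x" B] B n r x
      by (auto simp: V_def U_def intro: order.trans)
    have i3: "\<bar>ip M (u r) (u x)\<bar> \<le> B * B"
      using ip_Cauchy_Schwarz[OF uL[OF r] uL[OF x]] mult_mono[of "U r" B "U x" B] B n r x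
      by (auto simp: U_def intro: order.trans)
    have i4: "\<bar>ip M (h' r) (u x)\<bar> \<le> H * B"
      using h'ip[OF uL[OF x], of r] mult_left_mono[of "U x" B H] B(2)[OF x] H by (auto simp: U_def)
    have a: "A r powr \<beta> \<le> B powr \<beta>" "V r powr \<alpha> \<le> B powr \<alpha>"
      using B(2)[OF r] n \<alpha> \<beta>_pos by (auto intro!: powr_mono2)
    have j1: "\<bar>- (1 + b * A r powr \<beta>) * ip M (G r) (weak_grad \<Omega> (u x))\<bar> \<le> (1 + b * B powr \<beta>) * (B * B)"
    proof -
      have "0 \<le> b * A r powr \<beta>" "b * A r powr \<beta> \<le> b * B powr \<beta>" using a(1) par by auto
      then have "\<bar>- (1 + b * A r powr \<beta>)\<bar> \<le> 1 + b * B powr \<beta>" by linarith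
      then show ?thesis unfolding abs_mult using i1 by (intro mult_mono) auto
    qed
    have j2: "\<bar>c * V r powr \<alpha> * ip M (ut r) (u x)\<bar> \<le> c * B powr \<alpha> * (B * B)"
      unfolding abs_mult using i2 a(2) par by (intro mult_mono) auto
    have j3: "\<bar>lam * ip M (u r) (u x)\<bar> \<le> \<bar>lam\<bar> * (B * B)" "\<bar>mu * ip M (ut r) (u x)\<bar> \<le> \<bar>mu\<bar> * (B * B)"
      unfolding abs_mult using i2 i3 by (auto intro: mult_left_mono)
    show ?thesis unfolding F_def N_def C_def using j1 j2 j3 i4 by linarith
  qed
  have zac: "abs_continuous_on_interval s t z" if st: "0 < s" "t < T" for s t
  proof (rule abs_continuous_Lipschitz)
    show "C + B * B \<ge> 0" using C0 B(1) by simp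
    fix x y assume xy: "s \<le> x" "x \<le> y" "y \<le> t"
    have I: "x \<in> I" "y \<in> I" and J: "x \<in> J" "y \<in> J" using xy st by (auto simp: I_def J_def)
    \<comment> \<open>In the bracket only u_t changes while u(x) is fixed, so \<open>incr\<close>
      applies; the rest is controlled by the Lipschitz continuity of u.\<close>
    have "z y - z x = (ip M (ut y) (u x) - ip M (ut x) (u x)) + ip M (ut y) (\<lambda>r. u y r - u x r)"
      unfolding z_def using ip_diff_right[OF uL[OF J(2)] uL[OF J(1)] utL[OF J(2)]] by simp
    also have "ip M (ut y) (u x) - ip M (ut x) (u x) = integral {x..y} (F (u x))"
      by (rule incr[OF uH[OF J(1)]]) (use xy st in auto)
    finally have e: "z y - z x = integral {x..y} (F (u x)) + ip M (ut y) (\<lambda>r. u y r - u x r)" .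
    have "\<bar>integral {x..y} (F (u x))\<bar> \<le> C * (y - x)"
    proof (rule integral_increment_le[OF xy(2)])
      show "F (u x) integrable_on {x..y}"
        by (rule integrable_on_subinterval[OF HK[OF iF[OF uH[OF J(1)]]]]) (use xy st in auto)
      show "\<bar>F (u x) r\<bar> \<le> C" if "r \<in> {x..y}" for r
        using that xy st by (intro FB J) (auto simp: J_def)
    qed
    moreover have "\<bar>ip M (ut y) (\<lambda>r. u y r - u x r)\<bar> \<le> B * (B * (y - x))"
    proof (rule order.trans[OF ip_Cauchy_Schwarz[OF utL[OF J(2)] L2s_diff[OF uL[OF J(2)] uL[OF J(1)]]]])
      show "l2 M (ut y) * l2 M (\<lambda>r. u y r - u x r) \<le> B * (B * (y - x))"
        using lip[OF I xy(2)] B(1) B(2)[OF J(2)] by (intro mult_mono) (auto simp: V_def)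
    qed
    ultimately show "\<bar>z y - z x\<bar> \<le> (C + B * B) * (y - x)" unfolding e by (simp add: algebra_simps)
  qed

  \<comment> \<open>The Lebesgue points of r -> (h(r), v) depend on v, and v is going to be u(t).
    The single function \<zeta> provides one null set for all t.\<close>
  define \<zeta> where "\<zeta> r = ip M (h' r) (u r)" for r
  have i\<zeta>: "integrable (lebesgue_on I) \<zeta>"
  proof (rule fin.integrable_const_bound[where B="H * B"])
    show "\<zeta> \<in> borel_measurable (lebesgue_on I)"
      unfolding \<zeta>_def[abs_def]
    proof (rule hm)
      fix t assume t: "t \<in> I"
      then have tJ: "t \<in> J" using IJ by blast
      show "u t \<in> L2s M" by (rule uL[OF tJ])
      show "((\<lambda>s. l2 M (\<lambda>x. u s x - u t x)) \<longlongrightarrow> 0) (at t within I)"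
        by (rule tendsto_within_subset[OF cu[OF tJ] IJ(1)])
    qed
    have "\<bar>\<zeta> t\<bar> \<le> H * B" if "t \<in> I" for t
    proof -
      have tJ: "t \<in> J" using that IJ by blast
      show ?thesis unfolding \<zeta>_def using h'ip[OF uL[OF tJ], of t] mult_left_mono[of "U t" B H] B(2)[OF tJ] H by (auto simp: U_def)
    qed
    then show "AE t in lebesgue_on I. norm (\<zeta> t) \<le> H * B" by (intro AE_I2) simp
  qed

  \<comment> \<open>The derivative of (u_t, u) at a Lebesgue point\<close>
  have dz: "(z has_real_derivative cross' (V t) (A t) (U t) (z t) (\<zeta> t)) (at t)"
    if t: "t \<in> I" and L: "((\<lambda>x. integral {0..x} \<zeta>) has_real_derivative \<zeta> t) (at t)" for t
  proof -
    have tJ: "t \<in> J" using t IJ by blast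
    define v where "v = u t"
    have v: "v \<in> H10 \<Omega>" "v \<in> L2s M" unfolding v_def by (intro uH uL tJ)+
    \<comment> \<open>The error made by freezing u at time t in the force term. It is of order |r -
      t| by the Lipschitz continuity of u, so its integral has derivative 0 at t.\<close>
    define k where "k r = ip M (h' r) v - \<zeta> r" for r
    have ik: "k integrable_on {0..T}"
      unfolding k_def[abs_def] by (intro HK Bochner_Integration.integrable_diff ihv i\<zeta> v)
    have kB: "\<bar>k r\<bar> \<le> H * (B * \<bar>r - t\<bar>)" if r: "r \<in> I" for r
    proof -
      have rJ: "r \<in> J" using r IJ by blast
      have "k r = ip M (h' r) (\<lambda>x. v x - u r x)"
        unfolding k_def \<zeta>_def using ip_diff_right[OF v(2) uL[OF rJ] h'L(1)] by simp
      also have "\<bar>\<dots>\<bar> \<le> H * l2 M (\<lambda>x. v x - u r x)" by (intro h'ip L2s_diff v uL rJ)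
      also have "\<dots> \<le> H * (B * \<bar>r - t\<bar>)"
        using lip'[OF r t] H unfolding v_def by (intro mult_left_mono) (auto simp: abs_minus_commute)
      finally show ?thesis .
    qed
    have dk: "((\<lambda>x. integral {0..x} k) has_real_derivative 0) (at t)"
      unfolding has_field_derivative_iff
    proof (rule tendsto_0_le[where f="\<lambda>x. x - t" and K="H * B"])
      show "((\<lambda>x. x - t) \<longlongrightarrow> 0) (at t)" by (rule LIM_zero) (rule tendsto_ident_at)
      show "\<forall>\<^sub>F x in at t. norm ((integral {0..x} k - integral {0..t} k) / (x - t)) \<le> norm (x - t) * (H * B)"
        using evI[OF t]
      proof eventually_elim
        case (elim x)
        have inc: "\<bar>integral {0..q} k - integral {0..p} k\<bar> \<le> H * (B * (q - p)) * (q - p)"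
          if pq: "p \<in> I" "q \<in> I" "p \<le> q" "t = p \<or> t = q" for p q
        proof -
          have "integral {0..q} k - integral {0..p} k = integral {p..q} k"
            by (rule integral_difference[OF ik]) (use pq in \<open>auto simp: I_def\<close>)
          also have "\<bar>\<dots>\<bar> \<le> H * (B * (q - p)) * (q - p)"
          proof (rule integral_increment_le[OF pq(3)])
            show "k integrable_on {p..q}" by (rule integrable_on_subinterval[OF ik]) (use pq in \<open>auto simp: I_def\<close>)
            fix r assume r: "r \<in> {p..q}"
            then have "r \<in> I" using pq by (auto simp: I_def)
            moreover have "H * (B * \<bar>r - t\<bar>) \<le> H * (B * (q - p))"
              using r pq(4) H B(1) by (intro mult_left_mono) auto
            ultimately show "\<bar>k r\<bar> \<le> H * (B * (q - p))" using kB[of r] by linarith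
          qed
          finally show ?thesis .
        qed
        have "\<bar>integral {0..x} k - integral {0..t} k\<bar> \<le> H * (B * \<bar>x - t\<bar>) * \<bar>x - t\<bar>"
        proof (cases "t \<le> x")
          case True
          then show ?thesis using inc[OF t elim] by simp
        next
          case False
          then show ?thesis using inc[OF elim t] by (simp add: abs_minus_commute)
        qed
        then show ?case
          by (cases "x = t") (auto simp: abs_divide pos_divide_le_eq mult_ac)
      qed
    qed
    have dN: "((\<lambda>x. integral {0..x} (N v)) has_real_derivative N v t) (at t)"
      using integral_has_real_derivative[OF cN[OF v(1), unfolded J_def], of t] tJ atJ[OF t] by (simp add: J_def)
    define w where "w r = ip M (ut r) v" for r
    have Fsum: "integral {0..x} (F v) = integral {0..x} (N v) + integral {0..x} \<zeta> + integral {0..x} k" if x: "x \<in> I" for x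
    proof -
      have sub: "{0..x} \<subseteq> {0..T}" using x by (auto simp: I_def)
      note i = integrable_on_subinterval[OF HK[OF iN[OF v(1)]] sub] integrable_on_subinterval[OF HK[OF i\<zeta>] sub]
        integrable_on_subinterval[OF ik sub]
      have "integral {0..x} (F v) = integral {0..x} (\<lambda>r. N v r + \<zeta> r + k r)" by (simp add: F_def[abs_def] k_def)
      also have "\<dots> = integral {0..x} (N v) + integral {0..x} \<zeta> + integral {0..x} k"
        using i by (simp add: Henstock_Kurzweil_Integration.integral_add integrable_add)
      finally show ?thesis .
    qed
    have wF: "w x = w t + (integral {0..x} (F v) - integral {0..t} (F v))" if x: "x \<in> I" for x
    proof (cases "t \<le> x")
      case True
      then have "w x - w t = integral {t..x} (F v)" unfolding w_def using t x by (intro incr[OF v(1)]) (auto simp: I_def)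
      also have "\<dots> = integral {0..x} (F v) - integral {0..t} (F v)"
        by (rule integral_difference[OF HK[OF iF[OF v(1)]], symmetric]) (use True t x in \<open>auto simp: I_def\<close>)
      finally show ?thesis by simp
    next
      case False
      then have "w t - w x = integral {x..t} (F v)" unfolding w_def using t x by (intro incr[OF v(1)]) (auto simp: I_def)
      also have "\<dots> = integral {0..t} (F v) - integral {0..x} (F v)"
        by (rule integral_difference[OF HK[OF iF[OF v(1)]], symmetric]) (use False t x in \<open>auto simp: I_def\<close>)
      finally show ?thesis by simp
    qed
    have dw: "(w has_real_derivative N v t + \<zeta> t) (at t)"
    proof (rule has_field_derivative_transform_within_open[where S=I])
      show "((\<lambda>x. w t + ((integral {0..x} (N v) + integral {0..x} \<zeta> + integral {0..x} k) - integral {0..t} (F v)))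
        has_real_derivative N v t + \<zeta> t) (at t)"
        by (rule derivative_eq_intros dN L dk refl)+ simp
      show "w t + ((integral {0..x} (N v) + integral {0..x} \<zeta> + integral {0..x} k) - integral {0..t} (F v)) = w x" if "x \<in> I" for x
        using wF[OF that] Fsum[OF that] by simp
    qed (use t in \<open>auto simp: I_def\<close>)
    \<comment> \<open>The part of (u_t, u) left over by freezing u. Its second factor vanishes at t,
      so continuity of u_t and the derivative of u suffice; u_t is not differentiated.\<close>
    define y where "y r = ip M (ut r) (\<lambda>x. u r x - u t x)" for r
    have dy: "(y has_real_derivative (V t)\<^sup>2) (at t)"
      unfolding has_field_derivative_iff
    proof (rule Lim_transform_eventually)
      have q: "\<forall>\<^sub>F s in at t within J. (\<lambda>x. (u s x - u t x) / (s - t)) \<in> L2s M"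
        by (rule evJ) (intro L2s_divide L2s_diff uL tJ)
      have "((\<lambda>s. ip M (ut s) (\<lambda>x. (u s x - u t x) / (s - t))) \<longlongrightarrow> ip M (ut t) (ut t)) (at t within J)"
        by (rule tendsto_ip_eventually[OF ct[OF tJ] evJ[OF utL] utL[OF tJ] du[OF tJ] q utL[OF tJ]])
      then show "((\<lambda>s. ip M (ut s) (\<lambda>x. (u s x - u t x) / (s - t))) \<longlongrightarrow> (V t)\<^sup>2) (at t)"
        unfolding atJ[OF t] V_def l2_power2_eq_ip .
      show "\<forall>\<^sub>F s in at t. ip M (ut s) (\<lambda>x. (u s x - u t x) / (s - t)) = (y s - y t) / (s - t)"
        by (intro always_eventually allI) (simp add: ip_divide_right y_def, simp add: ip_def)
    qed
    have "((\<lambda>r. w r + y r) has_real_derivative (N v t + \<zeta> t) + (V t)\<^sup>2) (at t)"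
      by (rule DERIV_add[OF dw dy])
    then have "(z has_real_derivative (N v t + \<zeta> t) + (V t)\<^sup>2) (at t)"
    proof (rule has_field_derivative_transform_within_open[where S=I])
      show "w r + y r = z r" if "r \<in> I" for r
      proof -
        have rJ: "r \<in> J" using that IJ by blast
        show ?thesis unfolding w_def y_def z_def v_def
          using ip_diff_right[OF uL[OF rJ] uL[OF tJ] utL[OF rJ]] by simp
      qed
    qed (use t in \<open>auto simp: I_def\<close>)
    moreover have "(N v t + \<zeta> t) + (V t)\<^sup>2 = cross' (V t) (A t) (U t) (z t) (\<zeta> t)"
    proof -
      have "ip M (G t) (weak_grad \<Omega> v) = (A t)\<^sup>2" "ip M (u t) v = (U t)\<^sup>2" "ip M (ut t) v = z t"
        by (simp_all add: v_def A_def U_def z_def l2_power2_eq_ip G_def)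
      moreover have "A t powr (\<beta> + 2) = A t powr \<beta> * (A t)\<^sup>2"
        by (simp add: powr_add powr_two_eq_square A_def)
      ultimately show ?thesis unfolding N_def cross'_def by (simp add: algebra_simps)
    qed
    ultimately show ?thesis by simp
  qed

  \<comment> \<open>Verification of the conditions on a trajectory\<close>
  have en_eq: "energy0 \<Omega> b \<beta> lam u ut = (\<lambda>t. en (V t) (A t) (U t))"
    unfolding energy0_def[abs_def] en_def Lp_norm_2_eq_l2 by (simp add: V_def A_def U_def M_def G_def)
  have adm: "admissible (V t) (A t) (U t) (z t)" if "t \<in> J" for t
    unfolding admissible_def
    using Poincare(2)[OF uH[OF that]] ip_Cauchy_Schwarz[OF utL[OF that] uL[OF that]]
    by (simp add: V_def A_def U_def z_def M_def G_def)
  have de: "AE t in lebesgue_on I. ((\<lambda>t. en (V t) (A t) (U t)) has_real_derivative en' (V t) (ip M (h t) (ut t))) (at t)"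
  proof -
    have "AE t in lebesgue_on I. (energy0 \<Omega> b \<beta> lam u ut has_real_derivative
           - c * L2_norm_on \<Omega> (ut t) powr (\<alpha> + 2) + mu * L2_norm_on \<Omega> (ut t) ^ 2
           + (LINT x|lebesgue_on \<Omega>. h t x * ut t x)) (at t)"
      using sol unfolding weak_solution_def I_def by blast
    then show ?thesis
      unfolding en_eq en'_def Lp_norm_2_eq_l2 by (simp add: V_def M_def ip_def)
  qed
  have "trajectory H T V A U z"
    unfolding trajectory_def
  proof (intro conjI ballI allI impI)
    show "admissible (V t) (A t) (U t) (z t)" if "t \<in> {0<..<T}" for t
      using that by (intro adm) (simp add: J_def)
    show "\<exists>B. \<forall>t\<in>{0<..<T}. V t \<le> B \<and> A t \<le> B"
      using B(2) IJ(1) unfolding I_def by blast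
    fix s t :: real assume st: "0 < s" "t < T"
    have "abs_continuous_on_interval 0 T (\<lambda>t. en (V t) (A t) (U t))"
      using sol unfolding weak_solution_def en_eq by blast
    then show "abs_continuous_on_interval s t (\<lambda>t. en (V t) (A t) (U t))"
      by (rule abs_continuous_subinterval) (use st in auto)
    show "abs_continuous_on_interval s t z" by (rule zac[OF st])
  next
    have "AE t in lebesgue. t \<in> I \<longrightarrow> ((\<lambda>t. en (V t) (A t) (U t)) has_real_derivative en' (V t) (ip M (h t) (ut t))) (at t)"
      "AE t in lebesgue. t \<in> I \<longrightarrow> h' t = h t"
      "AE t in lebesgue. t \<in> I \<longrightarrow> ((\<lambda>x. integral {0..x} \<zeta>) has_real_derivative \<zeta> t) (at t)"
      using de h'ae indefinite_integral_has_derivative_AE[OF HK[OF i\<zeta>]]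
      by (simp_all add: AE_lebesgue_on_iff[OF IJ(2)] I_def)
    then show "AE t in lebesgue. t \<in> {0<..<T} \<longrightarrow> (\<exists>r s. \<bar>r\<bar> \<le> H * V t \<and> \<bar>s\<bar> \<le> H * U t \<and>
        ((\<lambda>t. en (V t) (A t) (U t)) has_real_derivative en' (V t) r) (at t) \<and>
        (z has_real_derivative cross' (V t) (A t) (U t) (z t) s) (at t))"
    proof eventually_elim
      case (elim t)
      show ?case
      proof (intro impI exI conjI)
        assume t: "t \<in> {0<..<T}"
        then have tI: "t \<in> I" and tJ: "t \<in> J" by (auto simp: I_def J_def)
        show "\<bar>ip M (h' t) (ut t)\<bar> \<le> H * V t" unfolding V_def by (rule h'ip[OF utL[OF tJ]])
        show "\<bar>\<zeta> t\<bar> \<le> H * U t" unfolding U_def \<zeta>_def by (rule h'ip[OF uL[OF tJ]])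
        show "((\<lambda>t. en (V t) (A t) (U t)) has_real_derivative en' (V t) (ip M (h' t) (ut t))) (at t)"
          using elim tI by simp
        show "(z has_real_derivative cross' (V t) (A t) (U t) (z t) (\<zeta> t)) (at t)"
          using elim tI by (intro dz) auto
      qed
    qed
  qed
  then show ?thesis unfolding V_def A_def U_def z_def G_def M_def .
qed

theorem proposition4p4:
  fixes \<Omega> :: "(real ^ 'n) set"
    and h :: "real \<Rightarrow> real ^ 'n \<Rightarrow> real"
    and T b c lam mu \<alpha> \<beta> :: real
  assumes "open \<Omega>" and "bounded \<Omega>" and "smooth_boundary \<Omega>"
    and "T > 0"
    and "bochner_Linf (lebesgue_on {0<..<T}) (Lp \<Omega> 2) (Lp_norm \<Omega> 2) h"
    and "b > 0" and "c > 0"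
    and "0 < \<alpha>" and "\<alpha> < \<beta>"
  shows "(\<exists>\<Gamma> \<Gamma>\<^sub>s :: real. \<forall>u ut. weak_solution \<Omega> b c \<alpha> \<beta> lam mu h T u ut \<longrightarrow>
            (\<forall>t\<in>{0<..<T}.
               L2_norm_on \<Omega> (ut t) ^ 2 + L2_norm_on \<Omega> (weak_grad \<Omega> (u t)) powr (\<beta> + 2)
               \<le> \<Gamma> * t powr (- 1 / min (\<alpha> / 2) ((\<beta> - \<alpha>) / ((\<alpha> + 1) * (\<beta> + 2)))) + \<Gamma>\<^sub>s))
       \<and> (mu = 0 \<and> lam < first_dirichlet_eigenvalue \<Omega> \<longrightarrow>
            (\<exists>D :: real. \<forall>u ut. global_weak_solution \<Omega> b c \<alpha> \<beta> lam mu (\<lambda>t x. 0) u ut \<longrightarrow>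
               (\<forall>t\<ge>1.
                  L2_norm_on \<Omega> (ut t) ^ 2 + L2_norm_on \<Omega> (weak_grad \<Omega> (u t)) ^ 2
                  \<le> D * t powr (- 2 / \<alpha>))))"
proof -
  let ?M = "lebesgue_on \<Omega>"
  obtain P where Poincare: "P > 0" "\<And>v. v \<in> H10 \<Omega> \<Longrightarrow> l2 ?M v \<le> P * l2 ?M (weak_grad \<Omega> v)"
    using Poincare_H10[OF assms(1,2)] by metis
  interpret kirchhoff_parameters b c \<alpha> \<beta> lam mu P using assms Poincare(1) by unfold_locales
  have traj: "trajectory H T' (\<lambda>t. l2 ?M (ut t)) (\<lambda>t. l2 ?M (weak_grad \<Omega> (u t))) (\<lambda>t. l2 ?M (u t)) (\<lambda>t. ip ?M (ut t) (u t))"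
    if "T' > 0" "bochner_measurable (lebesgue_on {0<..<T'}) (L2s ?M) (l2 ?M) g" "AE t in lebesgue_on {0<..<T'}. l2 ?M (g t) \<le> H"
      "H \<ge> 0" "weak_solution \<Omega> b c \<alpha> \<beta> lam mu g T' u ut" for H T' g u ut
    by (rule weak_solution_trajectory[OF assms(1) Poincare(1) _ assms(6-9) that]) (rule Poincare(2))
  show ?thesis
    unfolding Lp_norm_2_eq_l2
  proof (intro conjI impI)
    obtain C where C: "AE t in lebesgue_on {0<..<T}. l2 ?M (h t) \<le> C"
      using assms(5) unfolding bochner_Linf_def Lp_norm_2_eq_l2 by blast
    have hm: "bochner_measurable (lebesgue_on {0<..<T}) (L2s ?M) (l2 ?M) h"
      using assms(5) unfolding bochner_Linf_def Lp_2_eq_L2s Lp_norm_2_eq_l2[abs_def] by blast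
    \<comment> \<open>The absolute value supplies the sign condition on H without an argument about
      the measure of (0, T).\<close>
    have hC: "AE t in lebesgue_on {0<..<T}. l2 ?M (h t) \<le> \<bar>C\<bar>" using C by eventually_elim simp
    obtain \<Gamma> \<Gamma>\<^sub>s where \<Gamma>: "\<forall>T V A U z. trajectory \<bar>C\<bar> T V A U z \<longrightarrow>
        (\<forall>t\<in>{0<..<T}. (V t)\<^sup>2 + A t powr (\<beta> + 2) \<le> \<Gamma> * t powr (- 1 / \<gamma>) + \<Gamma>\<^sub>s)"
      using trajectory_universal_bound[of "\<bar>C\<bar>"] by auto
    show "\<exists>\<Gamma> \<Gamma>\<^sub>s :: real. \<forall>u ut. weak_solution \<Omega> b c \<alpha> \<beta> lam mu h T u ut \<longrightarrow>
            (\<forall>t\<in>{0<..<T}. l2 ?M (ut t) ^ 2 + l2 ?M (weak_grad \<Omega> (u t)) powr (\<beta> + 2)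
               \<le> \<Gamma> * t powr (- 1 / min (\<alpha> / 2) ((\<beta> - \<alpha>) / ((\<alpha> + 1) * (\<beta> + 2)))) + \<Gamma>\<^sub>s)"
      unfolding \<gamma>_def[symmetric] using \<Gamma> traj[OF assms(4) hm hC abs_ge_zero] by blast
  next
    assume a: "mu = 0 \<and> lam < first_dirichlet_eigenvalue \<Omega>"
    let ?k = "first_dirichlet_eigenvalue \<Omega>"
    \<comment> \<open>For lam \<le> 0 the quadratic form dominates the squared gradient as it
      stands. Otherwise \<open>?k > lam > 0\<close>, and by the Rayleigh bound the term with lam
      takes at most the share \<open>lam / ?k\<close> of the squared gradient.\<close>
    define kp where "kp = (if lam \<le> 0 then 1 else 1 - lam / ?k)"
    have kp: "kp > 0" using a by (auto simp: kp_def)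
    have coercive: "kp * (l2 ?M (weak_grad \<Omega> v))\<^sup>2 \<le> (l2 ?M (weak_grad \<Omega> v))\<^sup>2 - lam * (l2 ?M v)\<^sup>2" if "v \<in> H10 \<Omega>" for v
    proof (cases "lam \<le> 0")
      case True
      then show ?thesis by (simp add: kp_def mult_nonpos_nonneg)
    next
      case False
      then have k: "?k > 0" "lam > 0" using a by auto
      have "lam / ?k * (?k * (l2 ?M v)\<^sup>2) \<le> lam / ?k * (l2 ?M (weak_grad \<Omega> v))\<^sup>2"
        using first_dirichlet_eigenvalue_le_Rayleigh[OF assms(1,2) that] k by (intro mult_left_mono) auto
      then show ?thesis using False k by (simp add: kp_def algebra_simps)
    qed
    obtain D where D: "\<forall>V A U z. (\<forall>T>0. trajectory 0 T V A U z) \<longrightarrow> (\<forall>t>0. kp * (A t)\<^sup>2 \<le> (A t)\<^sup>2 - lam * (U t)\<^sup>2) \<longrightarrow>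
        (\<forall>t\<ge>1. (V t)\<^sup>2 + (A t)\<^sup>2 \<le> D * t powr (- 2 / \<alpha>))"
      using trajectory_decay[OF conjunct1[OF a] kp] by blast
    have zero: "bochner_measurable (lebesgue_on {0<..<T'}) (L2s ?M) (l2 ?M) (\<lambda>t x. 0)" for T'
      unfolding bochner_measurable_def by (auto intro!: exI[of _ "\<lambda>n t x. 0"] simp: L2s_zero)
    have "\<forall>t\<ge>1. (l2 ?M (ut t))\<^sup>2 + (l2 ?M (weak_grad \<Omega> (u t)))\<^sup>2 \<le> D * t powr (- 2 / \<alpha>)"
      if g: "global_weak_solution \<Omega> b c \<alpha> \<beta> lam mu (\<lambda>t x. 0) u ut" for u ut
    proof -
      have s: "weak_solution \<Omega> b c \<alpha> \<beta> lam mu (\<lambda>t x. 0) T' u ut" if "T' > 0" for T'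
        using g that by (simp add: global_weak_solution_def)
      have "trajectory 0 T' (\<lambda>t. l2 ?M (ut t)) (\<lambda>t. l2 ?M (weak_grad \<Omega> (u t))) (\<lambda>t. l2 ?M (u t)) (\<lambda>t. ip ?M (ut t) (u t))"
        if "T' > 0" for T'
        by (rule traj[OF that zero _ _ s[OF that]]) auto
      moreover have "u t \<in> H10 \<Omega>" if "t > 0" for t
        using s[of t] that unfolding weak_solution_def continuous_into_def by auto
      ultimately show ?thesis using D coercive by blast
    qed
    then show "\<exists>D. \<forall>u ut. global_weak_solution \<Omega> b c \<alpha> \<beta> lam mu (\<lambda>t x. 0) u ut \<longrightarrow>
               (\<forall>t\<ge>1. l2 ?M (ut t) ^ 2 + l2 ?M (weak_grad \<Omega> (u t)) ^ 2 \<le> D * t powr (- 2 / \<alpha>))" by blast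
  qed
qed

end
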